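(* Let $W$, $G$ be as in the context, let $W^\vee$ and $G^\vee$ be the dual potential and dual group, and let $\hat c=d-2\sum_{j=1}^dq_j$. Then for all $z\in\mathbb C$ and all $\tau$ in the upper half plane, $$Ell(W/G,z,\tau)=(-1)^{\hat c}\,Ell(W^\vee/G^\vee,z,\tau).$$
   Context: Let $W(x_1,\dots,x_d)=\sum_{i=1}^d\prod_{j=1}^d x_j^{a_{ij}}$ be a polynomial with non-negative integer exponents such that $A=(a_{ij})$ is invertible, there are positive rational $q_1,\dots,q_d$ with $\sum_j a_{ij}q_j=1$ for all $i$, and $W$ is non-degenerate: the hypersurface $W=0$ in $\mathbb C^d$ is smooth away from the origin. Assume $\sum_j q_j\in\mathbb Z_{>0}$. Let $\mathrm{Aut}(W)$ be the group of diagonal automorphisms $x_j\mapsto \gamma_jx_j$ preserving $W$ (i.e. $\prod_j\gamma_j^{a_{ij}}=1$ for all $i$), $J_W=(e^{2\pi i q_j})_j\in \mathrm{Aut}(W)$, $SL_W=\{\gamma\in\mathrm{Aut}(W):\prod_j\gamma_j=1\}$, and let $G$ be a subgroup with $\langle J_W\rangle\subset G\subset SL_W$. **Dual data.** The dual potential is $W^\vee=\sum_{i=1}^d\prod_{j=1}^dx_j^{a_{ji}}$ (transposed exponent matrix); it is again non-degenerate (by the Kreuzer–Skarke classification), with positive rational degrees $q_i^\vee$ determined by $\sum_i q_i^\vee a_{ij}=1$ for all $j$. Let $M_0,N_0$ be free abelian groups with bases $(u_i)_{i=1}^d$, $(v_j)_{j=1}^d$ and pairing $u_i\cdot v_j=a_{ij}$;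 then $M_0\subset N_0^\vee$, $N_0\subset M_0^\vee$ (dual lattices, inside the rational spans). The map $(e^{2\pi ip_j})_j\mapsto\sum_jp_jv_j$ identifies $\mathrm{Aut}(W)$ with $M_0^\vee/N_0$, and similarly $(e^{2\pi i p_i})_i\mapsto\sum_i p_iu_i$ identifies $\mathrm{Aut}(W^\vee)$ with $N_0^\vee/M_0$. Let $N\supset N_0$ be the lattice with $N/N_0=G$ and let $M\supset M_0$ be the dual lattice of $N$. The dual group is $G^\vee=M/M_0\subset\mathrm{Aut}(W^\vee)$; it satisfies $\langle J_{W^\vee}\rangle\subset G^\vee\subset SL_{W^\vee}$. Put $\mathrm{deg}^\vee=\sum_jq_jv_j\in N$, $\mathrm{deg}=\sum_iq_i^\vee u_i\in M$; then $\sum_jq_j=\sum_iq_i^\vee=\mathrm{deg}\cdot\mathrm{deg}^\vee$. **Elliptic genus.** For $n\in G$ let $\theta_j(n)$ be the $v_j$-coordinate of a representative of $n$ in $N$ (so $n$ acts by $x_j\mapsto e^{2\pi i\theta_j(n)}x_j$), and define $$Ell(W/G,z,\tau)=\frac1{|G|}\sum_{n,n_1\in G}\ \prod_{j=1}^d e^{-2\pi i z\,\theta_j(n)}\,\frac{\Theta\big((1-q_j)z-\theta_j(n)\tau-\theta_j(n_1),\tau\big)}{\Theta\big(q_jz+\theta_j(n)\tau+\theta_j(n_1),\tau\big)},$$ where the summands do not depend on the chosen representatives, and removable singularities are removed ($Ell$ is holomorphic on $\mathbb C$ times the upper half plane). $Ell(W^\vee/G^\vee,z,\tau)$ is defined by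 the same formula with $(G,q_j,\theta_j)$ replaced by $(G^\vee,q_j^\vee,\theta_j^\vee)$, where $\theta_j^\vee(m)$ is the $u_j$-coordinate of a representative in $M$ of $m\in G^\vee$. Here, for $\nu\in\mathbb C$, $\tau$ in the upper half plane, $q=e^{2\pi i\tau}$: $$\Theta(\nu,\tau)=iq^{1/8}e^{-i\pi\nu}(1-e^{2\pi i\nu})\prod_{n=1}^\infty(1-q^n)(1-q^ne^{2\pi i\nu})(1-q^ne^{-2\pi i\nu}),\qquad q^{1/8}=e^{2\pi i\tau/8}.$$
   Formalization: Positivity of the dual degrees q_i^∨ is assumed rather than derived from non-degeneracy of W: it can fail, e.g. W = x_1x_2 + x_2^a (a ≥ 3) has q^∨ = (1, 0), and then Ell(W^∨/G^∨) has a denominator Θ(0) = 0 and is undefined. *)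

theory Defs
  imports
    "HOL-Complex_Analysis.Complex_Analysis"
    "HOL-Algebra.Generated_Groups"
begin

text \<open>
  The exponent matrix is A, with A $ i $ j the exponent of x_j in the i-th monomial, so
  the dual potential is the potential of the transposed matrix.
\<close>

definition potential :: "nat^'d^'d \<Rightarrow> complex^'d \<Rightarrow> complex" where
  "potential A x = (\<Sum>i\<in>UNIV. \<Prod>j\<in>UNIV. (x $ j) ^ (A $ i $ j))"

definition partial_deriv :: "'d \<Rightarrow> (complex^'d \<Rightarrow> complex) \<Rightarrow> complex^'d \<Rightarrow> complex" where
  "partial_deriv j f x = deriv (\<lambda>t. f (\<chi> k. if k = j then t else x $ k)) (x $ j)"

text \<open>Smoothness of the hypersurface away from the origin is the Jacobian criterion.\<close>

definition nondegenerate :: "nat^'d^'d \<Rightarrow> bool" where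
  "nondegenerate A \<longleftrightarrow>
     (\<forall>x. potential A x = 0 \<and> x \<noteq> 0 \<longrightarrow> (\<exists>j. partial_deriv j (potential A) x \<noteq> 0))"

definition is_degrees :: "nat^'d^'d \<Rightarrow> rat^'d \<Rightarrow> bool" where
  "is_degrees A q \<longleftrightarrow>
     (\<forall>j. 0 < q $ j) \<and> (\<forall>i. (\<Sum>j\<in>UNIV. of_nat (A $ i $ j) * q $ j) = 1)"

text \<open>
  A diagonal automorphism is the vector of its entries. Multiplication and the unit of vectors
  are componentwise.
\<close>

definition Aut :: "nat^'d^'d \<Rightarrow> (complex^'d) monoid" where
  "Aut A = \<lparr>carrier = {\<gamma>. (\<forall>j. \<gamma> $ j \<noteq> 0) \<and> (\<forall>i. (\<Prod>j\<in>UNIV. (\<gamma> $ j) ^ (A $ i $ j)) = 1)},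
            mult = (*), one = 1\<rparr>"

definition SL :: "nat^'d^'d \<Rightarrow> (complex^'d) set" where
  "SL A = {\<gamma> \<in> carrier (Aut A). (\<Prod>j\<in>UNIV. \<gamma> $ j) = 1}"

definition expvec :: "rat^'d \<Rightarrow> complex^'d" where
  "expvec p = (\<chi> j. exp (2 * of_real pi * \<i> * of_rat (p $ j)))"

text \<open>
  Elements of the rational spans of N_0 and M_0 are given by their coordinates with respect to
  the bases v_j and u_i. Thus a lattice N containing N_0 with N / N_0 = G is the preimage of G
  under expvec, and the group M / M_0 is the image of M under expvec.
\<close>

definition cover_lattice :: "(complex^'d) set \<Rightarrow> (rat^'d) set" where
  "cover_lattice G = {p. expvec p \<in> G}"

definition pairing :: "nat^'d^'d \<Rightarrow> rat^'d \<Rightarrow> rat^'d \<Rightarrow> rat" where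
  "pairing A m n = (\<Sum>i\<in>UNIV. \<Sum>j\<in>UNIV. m $ i * of_nat (A $ i $ j) * n $ j)"

definition dual_lattice :: "nat^'d^'d \<Rightarrow> (rat^'d) set \<Rightarrow> (rat^'d) set" where
  "dual_lattice A N = {m. \<forall>n\<in>N. pairing A m n \<in> \<int>}"

definition dual_group :: "nat^'d^'d \<Rightarrow> (complex^'d) set \<Rightarrow> (complex^'d) set" where
  "dual_group A G = expvec ` dual_lattice A (cover_lattice G)"

definition Theta :: "complex \<Rightarrow> complex \<Rightarrow> complex" where
  "Theta \<nu> \<tau> =
     (let q = exp (2 * of_real pi * \<i> * \<tau>); y = exp (2 * of_real pi * \<i> * \<nu>)
      in \<i> * exp (2 * of_real pi * \<i> * \<tau> / 8) * exp (- (\<i> * of_real pi * \<nu>)) * (1 - y) *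
         prodinf (\<lambda>n. (1 - q ^ Suc n) * (1 - q ^ Suc n * y) * (1 - q ^ Suc n * inverse y)))"

text \<open>The choice of the representative of a group element does not matter in the sum below.\<close>

definition theta_rep :: "complex^'d \<Rightarrow> rat^'d" where
  "theta_rep \<gamma> = (SOME p. expvec p = \<gamma>)"

definition Ell_raw :: "rat^'d \<Rightarrow> (complex^'d) set \<Rightarrow> complex \<Rightarrow> complex \<Rightarrow> complex" where
  "Ell_raw q G z \<tau> =
     1 / of_nat (card G) *
     (\<Sum>n\<in>G. \<Sum>n1\<in>G. \<Prod>j\<in>UNIV.
        exp (- 2 * of_real pi * \<i> * z * of_rat (theta_rep n $ j)) *
        (Theta ((1 - of_rat (q $ j)) * z - of_rat (theta_rep n $ j) * \<tau>
                  - of_rat (theta_rep n1 $ j)) \<tau> /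
         Theta (of_rat (q $ j) * z + of_rat (theta_rep n $ j) * \<tau>
                  + of_rat (theta_rep n1 $ j)) \<tau>))"

text \<open>
  For fixed \<tau> in the upper half plane and positive q the denominators are not identically
  zero in z, so removing the singularities of the whole sum in the variable z gives the
  restriction to this \<tau> of the holomorphic extension in both variables.
\<close>

definition Ell :: "rat^'d \<Rightarrow> (complex^'d) set \<Rightarrow> complex \<Rightarrow> complex \<Rightarrow> complex" where
  "Ell q G z \<tau> = remove_sings (\<lambda>w. Ell_raw q G w \<tau>) z"

end

theory Submission
  imports Defs
begin

text \<open>
  Kronecker's expansion of Theta(z - u) / Theta(u) turns the elliptic genus of W / G, for z in a
  strip, into a series over pairs (k, n), where n runs through N and k through the dual of N
  inside the integral vectors. The summand is a product of signs, one for each variable, times an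
  exponential. For the dual pair the exponentials are the same after the substitution
  (k, n) = (m a, n), and only the basis changes in which signs are compared: the unit vectors are
  replaced by the rows of the exponent matrix.

  When W is a sum of chains and loops, the rows are exchanged into the basis one at a time. Each
  exchange is a linear relation between the products of signs, coming from the three-term Fay
  identity, and its superfluous terms vanish because a reflection of the lattice of pairs
  reverses their sign. Summability needs distinct generic values of z at the variables; the
  diagonal is reached by continuity.

  The remaining potentials contain a monomial x y with x different from y. A counting argument based
  on nondegeneracy provides one for which x occurs in exactly one further monomial. The two
  variables and the two monomials then cancel on both sides, and induction applies. Finally, an
  identity of meromorphic functions on a strip holds everywhere.
\<close>

text \<open>The obstacle is convergence between the two extreme bases. If all variables carry the
  same z, an intermediate dual vector whose coordinates sum to 0 may pair to 0 with infinitely many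
  k, and there the exponential does not decay. Generic values cure this, but the perturbation has to
  respect the reflections: these exchange a coordinate of k with the value of a row on n, so both
  must carry the same shift. This forces the dual value of a row to be the value at the variable to
  which the row points, or z if it points to none. The arguments of the denominators are then
  determined by the inverse matrix, and on the diagonal they become z times the degrees.

  The sign (-1)^d arises because exchanging the roles of k and n requires negating both, which
  reverses each of the d sign factors.

  A monomial x y whose variable x occurs in one further monomial x M contributes x (y + M).
  Eliminating x replaces y by -M elsewhere, and this substitution produces the reduced exponent
  matrix. Monomials that consist of a single variable make both sides vanish.\<close>

section \<open>Kronecker's expansion\<close>

text \<open>This kernel unites the two expansions of 1/(1 - x). It is 1 or -1 on pairs of equal
  nonzero signs and 0 on opposite signs; hence, for 0 < c < 1, the sum of
  \<open>sg (k + c) t\<close> times x^k over all integers k is the geometric series in x if t > 0,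
  and minus the series of the negative powers of x if t < 0.\<close>

definition sg :: "real \<Rightarrow> real \<Rightarrow> real" where "sg s t = (sgn s + sgn t) / 2"

lemma summable_on_int_split:
  fixes f :: "int \<Rightarrow> real"
  assumes "summable (\<lambda>n. f (int n))" "summable (\<lambda>n. f (- int (Suc n)))" "\<And>p. f p \<ge> 0"
  shows "f summable_on UNIV"
proof -
  have 1: "f summable_on (range int)"
    using assms by (subst summable_on_reindex) (auto simp: o_def intro!: norm_summable_imp_summable_on)
  have inj: "inj (\<lambda>n. - int (Suc n))" by (auto simp: inj_on_def)
  have 2: "f summable_on (range (\<lambda>n. - int (Suc n)))"
    using assms by (subst summable_on_reindex[OF inj]) (auto simp: o_def intro!: norm_summable_imp_summable_on)
  have "range int \<union> range (\<lambda>n. - int (Suc n)) = UNIV"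
  proof -
    have "k \<in> range int \<or> k \<in> range (\<lambda>n. - int (Suc n))" for k
    proof (cases "k \<ge> 0")
      case True then have "k = int (nat k)" by simp then show ?thesis by blast
    next
      case False then have "k = - int (Suc (nat (-k) - 1))" by auto then show ?thesis by blast
    qed
    then show ?thesis by auto
  qed
  moreover have "range int \<inter> range (\<lambda>n. - int (Suc n)) = {}" by auto
  ultimately show ?thesis using summable_on_Un_disjoint[OF 1 2] by simp
qed

text \<open>As a function of x the product is rational with simple poles at the points 1 /
  \<open>\<alpha> p\<close>. Its value at infinity is \<open>b ^ card K\<close>, and the coefficient
  at a pole is 1 - b times the other factors evaluated there.\<close>

lemma partial_fraction_prod:
  fixes \<alpha> :: "'k \<Rightarrow> complex"
  assumes "finite K" "inj_on \<alpha> K" "\<And>k. k \<in> K \<Longrightarrow> \<alpha> k \<noteq> 0" "\<And>k. k \<in> K \<Longrightarrow> x * \<alpha> k \<noteq> 1"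
  shows "(\<Prod>k\<in>K. (1 - b * x * \<alpha> k) / (1 - x * \<alpha> k)) =
    b ^ card K + (1 - b) * (\<Sum>p\<in>K. (\<Prod>k\<in>K - {p}. (1 - b * (\<alpha> k / \<alpha> p)) / (1 - \<alpha> k / \<alpha> p)) / (1 - x * \<alpha> p))"
  using assms
proof (induction K arbitrary: x rule: finite_induct)
  case empty
  then show ?case by simp
next
  case (insert m K)
  define C where "C p = (\<Prod>k\<in>K - {p}. (1 - b * (\<alpha> k / \<alpha> p)) / (1 - \<alpha> k / \<alpha> p))" for p
  define F where "F y = (\<Prod>k\<in>K. (1 - b * y * \<alpha> k) / (1 - y * \<alpha> k))" for y
  have ne: "\<alpha> k \<noteq> \<alpha> m" "\<alpha> k \<noteq> 0" if "k \<in> K" for k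
    using insert.prems insert.hyps that by (auto simp: inj_on_def)
  have m0: "\<alpha> m \<noteq> 0" and xm: "x * \<alpha> m \<noteq> 1" using insert.prems by auto
  have IH: "F y = b ^ card K + (1 - b) * (\<Sum>p\<in>K. C p / (1 - y * \<alpha> p))"
    if "\<And>k. k \<in> K \<Longrightarrow> y * \<alpha> k \<noteq> 1" for y
    unfolding F_def C_def using insert.prems that by (intro insert.IH) (auto simp: inj_on_def)
  have Fx: "F x = b ^ card K + (1 - b) * (\<Sum>p\<in>K. C p / (1 - x * \<alpha> p))"
    using insert.prems by (intro IH) auto
  \<comment> \<open>The coefficient at the new pole is the old product at that point, so the
    induction hypothesis is used a second time, at 1 / \<open>\<alpha> m\<close>.\<close>
  have Fm: "F (1 / \<alpha> m) = b ^ card K + (1 - b) * (\<Sum>p\<in>K. C p / (1 - \<alpha> p / \<alpha> m))"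
    using ne m0 by (subst IH) (auto simp: field_simps)
  have key: "C p / (1 - x * \<alpha> p) / (1 - x * \<alpha> m) =
      C p / (1 - \<alpha> m / \<alpha> p) / (1 - x * \<alpha> p) + C p / (1 - \<alpha> p / \<alpha> m) / (1 - x * \<alpha> m)" if "p \<in> K" for p
  proof -
    have "x * \<alpha> p \<noteq> 1" using insert.prems that by auto
    then have *: "1 - x * \<alpha> p \<noteq> 0" "1 - x * \<alpha> m \<noteq> 0" "\<alpha> p - \<alpha> m \<noteq> 0" "\<alpha> m - \<alpha> p \<noteq> 0"
      using xm ne[OF that] by auto
    have "1 / (1 - x * \<alpha> p) / (1 - x * \<alpha> m) =
      1 / (1 - \<alpha> m / \<alpha> p) / (1 - x * \<alpha> p) + 1 / (1 - \<alpha> p / \<alpha> m) / (1 - x * \<alpha> m)"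
    proof -
      have e1: "1 / (1 - \<alpha> m / \<alpha> p) = \<alpha> p / (\<alpha> p - \<alpha> m)" using ne[OF that] * by (simp add: field_simps)
      have e2: "1 / (1 - \<alpha> p / \<alpha> m) = - (\<alpha> m / (\<alpha> p - \<alpha> m))" using m0 * by (simp add: divide_simps) (simp add: algebra_simps)
      have "\<alpha> p / (\<alpha> p - \<alpha> m) / (1 - x * \<alpha> p) - \<alpha> m / (\<alpha> p - \<alpha> m) / (1 - x * \<alpha> m)
         = (\<alpha> p * (1 - x * \<alpha> m) - \<alpha> m * (1 - x * \<alpha> p)) / ((\<alpha> p - \<alpha> m) * (1 - x * \<alpha> p) * (1 - x * \<alpha> m))"
        using * by (simp add: divide_simps)
      also have "\<alpha> p * (1 - x * \<alpha> m) - \<alpha> m * (1 - x * \<alpha> p) = \<alpha> p - \<alpha> m" by (simp add: algebra_simps)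
      also have "(\<alpha> p - \<alpha> m) / ((\<alpha> p - \<alpha> m) * (1 - x * \<alpha> p) * (1 - x * \<alpha> m)) = 1 / (1 - x * \<alpha> p) / (1 - x * \<alpha> m)"
        using * by simp
      finally show ?thesis unfolding e1 e2 by simp
    qed
    then have "C p * (1 / (1 - x * \<alpha> p) / (1 - x * \<alpha> m)) =
      C p * (1 / (1 - \<alpha> m / \<alpha> p) / (1 - x * \<alpha> p) + 1 / (1 - \<alpha> p / \<alpha> m) / (1 - x * \<alpha> m))" by simp
    then show ?thesis by (simp add: distrib_left)
  qed
  have lin: "(1 - b * x * \<alpha> m) / (1 - x * \<alpha> m) = b + (1 - b) / (1 - x * \<alpha> m)"
    using xm by (simp add: field_simps)
  have CI: "(\<Prod>k\<in>insert m K - {p}. (1 - b * (\<alpha> k / \<alpha> p)) / (1 - \<alpha> k / \<alpha> p)) =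
     C p * ((1 - b * (\<alpha> m / \<alpha> p)) / (1 - \<alpha> m / \<alpha> p))" if "p \<in> K" for p
  proof -
    have "insert m K - {p} = insert m (K - {p})" using that insert.hyps by auto
    then show ?thesis using insert.hyps by (simp add: C_def)
  qed
  have lin2: "(1 - b * (\<alpha> m / \<alpha> p)) / (1 - \<alpha> m / \<alpha> p) = b + (1 - b) / (1 - \<alpha> m / \<alpha> p)" if "p \<in> K" for p
    using ne[OF that] by (simp add: field_simps)
  have CM: "(\<Prod>k\<in>insert m K - {m}. (1 - b * (\<alpha> k / \<alpha> m)) / (1 - \<alpha> k / \<alpha> m)) = F (1 / \<alpha> m)"
  proof -
    have "insert m K - {m} = K" using insert.hyps by auto
    then show ?thesis by (simp add: F_def)
  qed
  have "(\<Prod>k\<in>insert m K. (1 - b * x * \<alpha> k) / (1 - x * \<alpha> k)) = F x * (b + (1 - b) / (1 - x * \<alpha> m))"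
    using insert.hyps by (simp add: F_def flip: lin)
  also have "\<dots> = b * F x + (1 - b) * (F x / (1 - x * \<alpha> m))" by (simp add: algebra_simps)
  also have "F x / (1 - x * \<alpha> m) = b ^ card K / (1 - x * \<alpha> m) + (1 - b) * (\<Sum>p\<in>K. C p / (1 - x * \<alpha> p) / (1 - x * \<alpha> m))"
    unfolding Fx add_divide_distrib by (simp only: sum_divide_distrib[symmetric] times_divide_eq_right)
  also have "(\<Sum>p\<in>K. C p / (1 - x * \<alpha> p) / (1 - x * \<alpha> m)) =
     (\<Sum>p\<in>K. C p / (1 - \<alpha> m / \<alpha> p) / (1 - x * \<alpha> p)) + (\<Sum>p\<in>K. C p / (1 - \<alpha> p / \<alpha> m)) / (1 - x * \<alpha> m)"
    unfolding sum_divide_distrib sum.distrib[symmetric] by (intro sum.cong refl key)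
  also have "b * F x + (1 - b) * (b ^ card K / (1 - x * \<alpha> m) + (1 - b) * \<dots>) =
     b ^ Suc (card K) + (1 - b) * (\<Sum>p\<in>K. C p * (b + (1 - b) / (1 - \<alpha> m / \<alpha> p)) / (1 - x * \<alpha> p))
     + (1 - b) * (F (1 / \<alpha> m) / (1 - x * \<alpha> m))"
    unfolding Fx Fm
    by (simp add: algebra_simps sum.distrib sum_distrib_left add_divide_distrib sum_divide_distrib)
  also have "\<dots> = b ^ card (insert m K) + (1 - b) * (\<Sum>p\<in>insert m K.
      (\<Prod>k\<in>insert m K - {p}. (1 - b * (\<alpha> k / \<alpha> p)) / (1 - \<alpha> k / \<alpha> p)) / (1 - x * \<alpha> p))"
  proof -
    have "(\<Sum>p\<in>K. C p * (b + (1 - b) / (1 - \<alpha> m / \<alpha> p)) / (1 - x * \<alpha> p)) =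
      (\<Sum>p\<in>K. (\<Prod>k\<in>insert m K - {p}. (1 - b * (\<alpha> k / \<alpha> p)) / (1 - \<alpha> k / \<alpha> p)) / (1 - x * \<alpha> p))"
      by (intro sum.cong refl) (simp only: CI lin2)
    then have *: "(\<Sum>p\<in>insert m K. (\<Prod>k\<in>insert m K - {p}. (1 - b * (\<alpha> k / \<alpha> p)) / (1 - \<alpha> k / \<alpha> p)) / (1 - x * \<alpha> p)) =
       F (1 / \<alpha> m) / (1 - x * \<alpha> m) + (\<Sum>p\<in>K. C p * (b + (1 - b) / (1 - \<alpha> m / \<alpha> p)) / (1 - x * \<alpha> p))"
      unfolding sum.insert[OF insert.hyps] by (simp only: CM)
    show ?thesis unfolding * card_insert_disjoint[OF insert.hyps] by (simp only: distrib_left add_ac)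
  qed
  finally show ?case .
qed

text \<open>In the usual notation this is (q x; q)_infinity. The product starts at the first power
  of q, so \<open>qpoch q 1\<close> is Euler's product, and the factor 1 - x of a theta function
  stands apart in \<open>theta_prod\<close>.\<close>

definition qpoch :: "complex \<Rightarrow> complex \<Rightarrow> complex" where
  "qpoch q x = prodinf (\<lambda>n. 1 - q ^ Suc n * x)"

lemma convergent_prod_qpoch:
  assumes "norm q < 1"
  shows "convergent_prod (\<lambda>n. 1 - q ^ Suc n * x :: complex)"
proof -
  have "summable (\<lambda>n. norm x * norm q ^ Suc n)"
    using assms summable_Suc_iff[of "\<lambda>n. norm q ^ n"] by (intro summable_mult) (simp add: summable_geometric)
  then have "summable (\<lambda>n. norm ((1 - q ^ Suc n * x) - 1))"
    by (simp add: norm_mult norm_power mult_ac)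
  then show ?thesis
    by (metis abs_convergent_prod_conv_summable abs_convergent_prod_imp_convergent_prod)
qed

lemma qpoch_limit:
  assumes "norm q < 1"
  shows "(\<lambda>N. \<Prod>n<N. 1 - q ^ Suc n * x) \<longlonglongrightarrow> qpoch q x"
proof -
  have "(\<lambda>N. \<Prod>n\<le>N. 1 - q ^ Suc n * x) \<longlonglongrightarrow> qpoch q x"
    unfolding qpoch_def by (intro convergent_prod_LIMSEQ convergent_prod_qpoch assms)
  then show ?thesis by (simp only: LIMSEQ_lessThan_iff_atMost)
qed

lemma qpoch_nonzero:
  assumes "norm q < 1" "\<And>n. q ^ Suc n * x \<noteq> 1"
  shows "qpoch q x \<noteq> 0"
  unfolding qpoch_def using assms by (intro prodinf_nonzero convergent_prod_qpoch) auto

lemma qpoch_eq_0: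
  assumes "norm q < 1" "q ^ Suc n * x = 1"
  shows "qpoch q x = 0"
proof -
  have "eventually (\<lambda>N. (\<Prod>n<N. 1 - q ^ Suc n * x) = 0) sequentially"
    using eventually_gt_at_top[of n]
  proof eventually_elim
    case (elim N)
    have "1 - q ^ Suc n * x = 0" using assms(2) by (simp add: algebra_simps)
    then show ?case using elim by (intro prod_zero) (auto intro!: bexI[of _ n])
  qed
  then have "(\<lambda>N. \<Prod>n<N. 1 - q ^ Suc n * x) \<longlonglongrightarrow> 0" by (rule tendsto_eventually)
  then show ?thesis using qpoch_limit[OF assms(1), of x] LIMSEQ_unique by blast
qed

lemma qpoch_holomorphic:
  assumes q: "norm q < 1"
  shows "qpoch q holomorphic_on UNIV"
proof (rule holomorphic_uniform_sequence[OF open_UNIV])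
  show "(\<lambda>x. \<Prod>n<N. 1 - q ^ Suc n * x) holomorphic_on UNIV" for N
    by (intro holomorphic_intros)
  fix z :: complex
  have "uniform_limit (cball z 1) (\<lambda>N x. \<Prod>n<N. 1 - q ^ Suc n * x) (qpoch q) sequentially"
  proof -
    have "uniformly_convergent_on (cball z 1) (\<lambda>N x. \<Prod>n<N. 1 + - (q ^ Suc n * x))"
    proof (rule Infinite_Products.uniformly_convergent_on_prod)
      show "uniformly_convergent_on (cball z 1) (\<lambda>N x. \<Sum>n<N. norm (- (q ^ Suc n * x)))"
      proof (rule Weierstrass_m_test'[where M = "\<lambda>n. (norm z + 1) * norm q ^ Suc n"])
        fix n and x :: complex assume "x \<in> cball z 1"
        then have "norm x \<le> norm z + 1"
          by (metis add.commute dist_commute dist_norm mem_cball norm_triangle_sub order_trans add_left_mono diff_le_eq norm_triangle_ineq2)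
        then show "norm (norm (- (q ^ Suc n * x))) \<le> (norm z + 1) * norm q ^ Suc n"
          by (simp add: norm_mult norm_power mult.commute mult_right_mono del: power_Suc)
      qed (use q summable_Suc_iff[of "\<lambda>n. norm q ^ n"] in \<open>auto intro!: summable_mult simp: summable_geometric simp del: power_Suc\<close>)
    qed (auto intro!: continuous_intros)
    then obtain l where l: "uniform_limit (cball z 1) (\<lambda>N x. \<Prod>n<N. 1 - q ^ Suc n * x) l sequentially"
      by (auto simp: uniformly_convergent_on_def)
    have "l x = qpoch q x" if "x \<in> cball z 1" for x
      using tendsto_uniform_limitI[OF l that] qpoch_limit[OF q, of x] LIMSEQ_unique by blast
    then show ?thesis using l uniform_limit_cong'[of "cball z 1" _ _ l "qpoch q"] by (metis (no_types, lifting))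
  qed
  then show "\<exists>d>0. cball z d \<subseteq> UNIV \<and>
      uniform_limit (cball z d) (\<lambda>N x. \<Prod>n<N. 1 - q ^ Suc n * x) (qpoch q) sequentially"
    by (intro exI[of _ 1]) auto
qed

section \<open>Partial fractions of truncated theta quotients\<close>

lemma prod_int_split:
  fixes g :: "int \<Rightarrow> complex"
  shows "(\<Prod>k\<in>{- int a..int b} - {0}. g k) = (\<Prod>j<b. g (int (Suc j))) * (\<Prod>j<a. g (- int (Suc j)))"
proof -
  have "{- int a..int b} - {0} = (\<lambda>j. int (Suc j)) ` {..<b} \<union> (\<lambda>j. - int (Suc j)) ` {..<a}" (is "?L = ?P \<union> ?N")
  proof (intro Set.set_eqI iffI)
    fix k assume k: "k \<in> ?L"
    show "k \<in> ?P \<union> ?N"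
    proof (cases "k > 0")
      case True then have "k = int (Suc (nat k - 1))" "nat k - 1 < b" using k by auto
      then show ?thesis by blast
    next
      case False then have "k = - int (Suc (nat (-k) - 1))" "nat (-k) - 1 < a" using k by auto
      then show ?thesis by blast
    qed
  qed auto
  moreover have "prod g (?P \<union> ?N) = prod g ?P * prod g ?N"
    by (intro prod.union_disjoint) auto
  moreover have "prod g ?P = (\<Prod>j<b. g (int (Suc j)))" "prod g ?N = (\<Prod>j<a. g (- int (Suc j)))"
    by (subst prod.reindex; simp add: inj_on_def)+
  ultimately show ?thesis by simp
qed

lemma prod_int_split':
  fixes g :: "int \<Rightarrow> complex"
  assumes "p \<in> {- int N..int N}"
  shows "(\<Prod>k\<in>{- int N..int N} - {p}. g (k - p)) =
    (\<Prod>j<nat (int N - p). g (int (Suc j))) * (\<Prod>j<nat (int N + p). g (- int (Suc j)))"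
proof -
  have "(\<Prod>k\<in>{- int N..int N} - {p}. g (k - p)) = (\<Prod>k\<in>{- int (nat (int N + p))..int (nat (int N - p))} - {0}. g k)"
    using assms by (intro prod.reindex_bij_witness[where i = "\<lambda>k. k + p" and j = "\<lambda>k. k - p"]) auto
  then show ?thesis by (simp only: prod_int_split)
qed

lemma bounded_below_of_limit:
  fixes f :: "nat \<Rightarrow> complex"
  assumes "f \<longlonglongrightarrow> l" "l \<noteq> 0" "\<And>n. f n \<noteq> 0"
  obtains c where "c > 0" "\<And>n. norm (f n) \<ge> c"
proof -
  have "(\<lambda>n. inverse (f n)) \<longlonglongrightarrow> inverse l" using assms by (intro tendsto_intros)
  then have "Bseq (\<lambda>n. inverse (f n))" using convergentI convergent_imp_Bseq by blast
  then obtain B where B: "B > 0" "\<And>n. norm (inverse (f n)) \<le> B" using BseqE by blast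
  have "norm (f n) \<ge> 1 / B" for n
    using B(1) B(2)[of n] assms(3)[of n] by (simp add: norm_inverse norm_divide field_simps)
  then show thesis using B(1) by (intro that[of "1 / B"]) auto
qed

text \<open>For p tending to +infinity the summand is of the order of b^p; for p tending to
  -infinity the denominator grows like q^p and leaves (q/b)^|p|. The annulus |q| < |b| < 1 makes
  both halves geometric.\<close>

lemma lerch_abs_summable:
  fixes q b x :: complex
  assumes "q \<noteq> 0" "norm q < norm b" "norm b < 1" "x \<noteq> 0" "\<And>p. x * q powi p \<noteq> 1"
  shows "(\<lambda>p::int. norm (b powi p / (1 - x * q powi p))) summable_on UNIV"
proof (rule summable_on_int_split)
  have q1: "norm q < 1" using assms by simp
  then have ql: "(\<lambda>n. q ^ n) \<longlonglongrightarrow> 0" by (rule LIMSEQ_power_zero)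
  have b0: "b \<noteq> 0" using assms by auto
  have "(\<lambda>n. 1 - x * q ^ n) \<longlonglongrightarrow> 1 - x * 0" by (intro tendsto_diff tendsto_const tendsto_mult ql)
  then obtain c where c: "c > 0" "\<And>n. norm (1 - x * q ^ n) \<ge> c"
  proof (rule bounded_below_of_limit)
    show "1 - x * q ^ n \<noteq> 0" for n using assms(5)[of "int n"] by simp
  qed auto
  show "summable (\<lambda>n. norm (b powi int n / (1 - x * q powi int n)))"
  proof (rule summable_comparison_test'[where g = "\<lambda>n. (1 / c) * norm b ^ n" and N = 0])
    show "summable (\<lambda>n. (1 / c) * norm b ^ n)" using assms by (intro summable_mult summable_geometric) auto
    fix n
    have "norm b ^ n / norm (1 - x * q ^ n) \<le> norm b ^ n / c" using c by (intro divide_left_mono) (auto intro: mult_pos_pos less_le_trans)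
    then show "norm (norm (b powi int n / (1 - x * q powi int n))) \<le> 1 / c * norm b ^ n"
      by (simp add: norm_divide norm_power)
  qed
  have "(\<lambda>n. q ^ Suc n - x) \<longlonglongrightarrow> 0 - x" using LIMSEQ_Suc[OF ql] by (intro tendsto_intros)
  then obtain c where c: "c > 0" "\<And>n. norm (q ^ Suc n - x) \<ge> c"
  proof (rule bounded_below_of_limit)
    show "q ^ Suc n - x \<noteq> 0" for n
      using assms(5)[of "- int (Suc n)"] assms(1)
      by (simp only: power_int_minus power_int_of_nat) (simp add: field_simps)
  qed (use assms in auto)
  show "summable (\<lambda>n. norm (b powi (- int (Suc n)) / (1 - x * q powi (- int (Suc n)))))"
  proof (rule summable_comparison_test'[where g = "\<lambda>n. (1 / c) * norm (q / b) ^ Suc n" and N = 0])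
    have "norm (q / b) < 1" using assms b0 by (simp add: norm_divide)
    then show "summable (\<lambda>n. (1 / c) * norm (q / b) ^ Suc n)"
      using summable_Suc_iff[of "\<lambda>n. norm (q / b) ^ n"] by (intro summable_mult) (simp add: summable_geometric)
    fix n
    have qx: "q ^ Suc n - x \<noteq> 0" using c(1) c(2)[of n] by auto
    have "b powi (- int (Suc n)) / (1 - x * q powi (- int (Suc n))) = (q / b) ^ Suc n / (q ^ Suc n - x)"
      using assms(1) b0 qx by (simp add: power_int_minus power_int_def field_simps del: power_Suc of_nat_Suc)
    then have "norm (b powi (- int (Suc n)) / (1 - x * q powi (- int (Suc n)))) = norm (q / b) ^ Suc n / norm (q ^ Suc n - x)"
      by (simp only: norm_divide norm_power)
    also have "\<dots> \<le> norm (q / b) ^ Suc n / c" using c by (intro divide_left_mono) (auto intro: mult_pos_pos less_le_trans)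
    finally show "norm (norm (b powi (- int (Suc n)) / (1 - x * q powi (- int (Suc n))))) \<le> 1 / c * norm (q / b) ^ Suc n"
      by simp
  qed
qed auto

text \<open>The factors 1 - x q^k with |k| <= N, where those with negative k are normalised to 1 -
  q^|k| / x so that the limit exists.\<close>

definition theta_part :: "complex \<Rightarrow> nat \<Rightarrow> complex \<Rightarrow> complex" where
  "theta_part q N x = (1 - x) * (\<Prod>n<N. 1 - q ^ Suc n * x) * (\<Prod>n<N. 1 - q ^ Suc n / x)"

definition theta_prod :: "complex \<Rightarrow> complex \<Rightarrow> complex" where
  "theta_prod q x = (1 - x) * qpoch q x * qpoch q (inverse x)"

lemma theta_part_limit:
  assumes "norm q < 1"
  shows "(\<lambda>N. theta_part q N x) \<longlonglongrightarrow> theta_prod q x"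
  unfolding theta_part_def theta_prod_def divide_inverse
  by (intro tendsto_intros qpoch_limit assms)

lemma theta_prod_nonzero:
  assumes "norm q < 1" "q \<noteq> 0" "x \<noteq> 0" "\<And>p::int. x * q powi p \<noteq> 1"
  shows "theta_prod q x \<noteq> 0"
proof -
  have "q ^ Suc n * x \<noteq> 1" for n using assms(4)[of "int (Suc n)"] by (simp only: power_int_of_nat mult.commute not_False_eq_True)
  moreover have "q ^ Suc n * inverse x \<noteq> 1" for n
    using assms(4)[of "- int (Suc n)"] assms(2,3)
    by (simp only: power_int_minus power_int_of_nat) (simp add: field_simps)
  moreover have "x \<noteq> 1" using assms(4)[of 0] by simp
  ultimately show ?thesis unfolding theta_prod_def by (simp add: qpoch_nonzero[OF assms(1)] del: power_Suc)
qed

lemma theta_prod_eq_0: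
  assumes "norm q < 1" "q \<noteq> 0" "x = q powi p"
  shows "theta_prod q x = 0"
proof (cases "p = 0")
  case True then show ?thesis using assms by (simp add: theta_prod_def)
next
  case False
  show ?thesis
  proof (cases "p > 0")
    case True
    then have "q ^ Suc (nat p - 1) * inverse x = 1"
      using assms by (simp add: power_int_def Suc_diff_1 del: power_Suc)
    then show ?thesis unfolding theta_prod_def using qpoch_eq_0[OF assms(1)] by simp
  next
    case False
    then have "q ^ Suc (nat (-p) - 1) * x = 1"
      using assms \<open>p \<noteq> 0\<close> by (simp add: power_int_def Suc_diff_1 del: power_Suc flip: power_mult_distrib)
    then show ?thesis unfolding theta_prod_def using qpoch_eq_0[OF assms(1)] by simp
  qed
qed

text \<open>\<open>partial_fraction_prod\<close> for the points q^k with |k| <= N. Normalising the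
  factors of negative index costs one factor b each: b^N on the left, b^(N + p) in the coefficient
  of the p-th pole. After division by b^N the coefficient keeps \<open>b powi p\<close>, and the
  constant b^(2 N + 1) becomes \<open>b ^ Suc N\<close>, which tends to 0 when |b| < 1.\<close>

lemma theta_part_quotient:
  assumes q: "q \<noteq> 0" "norm q < 1" and b: "b \<noteq> 0" and x: "x \<noteq> 0" "\<And>p::int. x * q powi p \<noteq> 1"
  defines "A \<equiv> \<lambda>n. \<Prod>j<n. (1 - b * q ^ Suc j) / (1 - q ^ Suc j)"
  defines "B \<equiv> \<lambda>n. \<Prod>j<n. (1 - q ^ Suc j / b) / (1 - q ^ Suc j)"
  shows "theta_part q N (b * x) / theta_part q N x = b ^ Suc N + (1 - b) *
      (\<Sum>p\<in>{- int N..int N}. b powi p * A (nat (int N - p)) * B (nat (int N + p)) / (1 - x * q powi p))"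
proof -
  let ?K = "{- int N..int N}"
  have qpow: "q ^ Suc j \<noteq> 1" for j
  proof
    assume "q ^ Suc j = 1"
    then have "norm q ^ Suc j = 1" by (metis norm_power norm_one)
    then show False using power_Suc_less_one[of "norm q" j] q by simp
  qed
  have qinj: "q powi k \<noteq> q powi l" if "k \<noteq> l" for k l
  proof
    assume eq: "q powi k = q powi l"
    have *: False if "k < l" "q powi k = q powi l" for k l
    proof -
      have "q powi (l - k) = 1" using that q by (simp add: power_int_diff)
      moreover have "q powi (l - k) = q ^ Suc (nat (l - k) - 1)" using that by (simp add: power_int_def del: power_Suc)
      ultimately show False using qpow by simp
    qed
    show False using *[of k l] *[of l k] eq that by force
  qed
  have shift: "(1 - b * q powi (- int (Suc j))) / (1 - q powi (- int (Suc j))) = b * ((1 - q ^ Suc j / b) / (1 - q ^ Suc j))" for j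
  proof -
    have "1 - q ^ Suc j \<noteq> 0" "q ^ Suc j - 1 \<noteq> 0" "q ^ Suc j \<noteq> 0" using qpow[of j] q by auto
    then have "(1 - b / q ^ Suc j) / (1 - 1 / q ^ Suc j) = (q ^ Suc j - b) / (q ^ Suc j - 1)"
      by (simp add: field_simps del: power_Suc)
    also have "\<dots> = b * ((1 - q ^ Suc j / b) / (1 - q ^ Suc j))"
      using b \<open>1 - q ^ Suc j \<noteq> 0\<close> \<open>q ^ Suc j - 1 \<noteq> 0\<close> by (simp add: divide_simps del: power_Suc) (simp add: algebra_simps)
    finally show ?thesis by (simp only: power_int_minus power_int_of_nat divide_inverse mult_1_left)
  qed
  have xshift: "(1 - b * x * q powi (- int (Suc j))) / (1 - x * q powi (- int (Suc j))) =
      b * ((1 - q ^ Suc j / (b * x)) / (1 - q ^ Suc j / x))" for j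
  proof -
    have q0: "q ^ Suc j \<noteq> 0" using q by auto
    have "q ^ Suc j - x \<noteq> 0" 
      using x(2)[of "- int (Suc j)"] q(1) by (simp only: power_int_minus power_int_of_nat) (simp add: field_simps)
    then have ne: "q ^ Suc j - x \<noteq> 0" "x - q ^ Suc j \<noteq> 0" by auto
    then have "(1 - b * x / q ^ Suc j) / (1 - x / q ^ Suc j) = (q ^ Suc j - b * x) / (q ^ Suc j - x)"
      using q0 by (simp add: field_simps del: power_Suc)
    also have "\<dots> = b * ((1 - q ^ Suc j / (b * x)) / (1 - q ^ Suc j / x))"
      using b x(1) ne by (simp add: divide_simps del: power_Suc) (simp add: algebra_simps)
    finally show ?thesis by (simp only: power_int_minus power_int_of_nat divide_inverse)
  qed
  have "(\<Prod>k\<in>?K. (1 - b * x * q powi k) / (1 - x * q powi k)) =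
     (1 - b * x) / (1 - x) * (\<Prod>k\<in>?K - {0}. (1 - b * x * q powi k) / (1 - x * q powi k))"
    by (subst prod.remove[of _ 0]) auto
  also have "(\<Prod>k\<in>?K - {0}. (1 - b * x * q powi k) / (1 - x * q powi k)) =
     (\<Prod>j<N. (1 - b * x * q ^ Suc j) / (1 - x * q ^ Suc j)) * (\<Prod>j<N. b * ((1 - q ^ Suc j / (b * x)) / (1 - q ^ Suc j / x)))"
    by (simp only: prod_int_split xshift power_int_of_nat)
  also have "(1 - b * x) / (1 - x) * \<dots> = b ^ N * (theta_part q N (b * x) / theta_part q N x)"
  proof -
    have "(1 - b * x) / (1 - x) * (P1 / P2 * (c * (P3 / P4))) = c * ((1 - b * x) * P1 * P3 / ((1 - x) * P2 * P4))" for P1 P2 P3 P4 c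
      by (simp add: mult_ac)
    moreover have "q ^ Suc j * (b * x) = b * x * q ^ Suc j" "q ^ Suc j * x = x * q ^ Suc j" for j by (simp_all only: mult.commute)
    ultimately show ?thesis unfolding theta_part_def prod.distrib prod_dividef prod_constant card_lessThan by (simp only:)
  qed
  finally have lhs: "(\<Prod>k\<in>?K. (1 - b * x * q powi k) / (1 - x * q powi k)) = b ^ N * (theta_part q N (b * x) / theta_part q N x)" .
  have rem: "(\<Prod>k\<in>?K - {p}. (1 - b * (q powi k / q powi p)) / (1 - q powi k / q powi p)) =
      b ^ N * (b powi p * A (nat (int N - p)) * B (nat (int N + p)))" if p: "p \<in> ?K" for p
  proof -
    have "q powi k / q powi p = q powi (k - p)" for k
      using q by (simp add: power_int_diff)
    then have "(\<Prod>k\<in>?K - {p}. (1 - b * (q powi k / q powi p)) / (1 - q powi k / q powi p)) =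
       (\<Prod>k\<in>?K - {p}. (1 - b * q powi (k - p)) / (1 - q powi (k - p)))"
      by (simp only:)
    also have "\<dots> = (\<Prod>j<nat (int N - p). (1 - b * q ^ Suc j) / (1 - q ^ Suc j)) *
      (\<Prod>j<nat (int N + p). b * ((1 - q ^ Suc j / b) / (1 - q ^ Suc j)))"
      by (subst prod_int_split'[OF p, of "\<lambda>k. (1 - b * q powi k) / (1 - q powi k)"])
         (simp only: shift power_int_of_nat)
    also have "\<dots> = A (nat (int N - p)) * (b ^ nat (int N + p) * B (nat (int N + p)))"
      by (simp only: A_def B_def prod.distrib prod_constant card_lessThan)
    also have "b ^ nat (int N + p) = b ^ N * b powi p"
    proof -
      have "b ^ nat (int N + p) = b powi (int N + p)" using p by (simp add: power_int_def)
      then show ?thesis using b by (simp add: power_int_add)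
    qed
    finally show ?thesis by (simp only: mult_ac)
  qed
  have "b ^ N * (theta_part q N (b * x) / theta_part q N x) = b ^ card ?K + (1 - b) *
     (\<Sum>p\<in>?K. (\<Prod>k\<in>?K - {p}. (1 - b * (q powi k / q powi p)) / (1 - q powi k / q powi p)) / (1 - x * q powi p))"
    unfolding lhs[symmetric]
    by (intro partial_fraction_prod) (use q x qinj in \<open>auto simp: inj_on_def\<close>)
  also have "b ^ card ?K = b ^ N * b ^ Suc N"
  proof -
    have "card ?K = N + Suc N" by simp
    then show ?thesis by (simp only: power_add)
  qed
  also have "(\<Sum>p\<in>?K. (\<Prod>k\<in>?K - {p}. (1 - b * (q powi k / q powi p)) / (1 - q powi k / q powi p)) / (1 - x * q powi p)) =
    b ^ N * (\<Sum>p\<in>?K. b powi p * A (nat (int N - p)) * B (nat (int N + p)) / (1 - x * q powi p))"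
    unfolding sum_distrib_left by (intro sum.cong refl, subst rem, assumption, rule times_divide_eq_right[symmetric])
  finally have "b ^ N * (theta_part q N (b * x) / theta_part q N x) = b ^ N * (b ^ Suc N + (1 - b) *
     (\<Sum>p\<in>?K. b powi p * A (nat (int N - p)) * B (nat (int N + p)) / (1 - x * q powi p)))"
    by (simp only: distrib_left mult_ac)
  then show ?thesis using b unfolding mult_cancel_left by auto
qed

text \<open>Kronecker's expansion, as the limit of the partial fractions of the finite products.\<close>

lemma theta_prod_quotient:
  assumes q: "q \<noteq> 0" and b: "norm q < norm b" "norm b < 1" and x: "x \<noteq> 0" "\<And>p::int. x * q powi p \<noteq> 1"
  shows "theta_prod q (b * x) / theta_prod q x =
    theta_prod q b / qpoch q 1 ^ 2 * (\<Sum>\<^sub>\<infinity>p. b powi p / (1 - x * q powi p))"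
proof -
  have q1: "norm q < 1" and b0: "b \<noteq> 0" using b by auto
  define A where "A n = (\<Prod>j<n. (1 - b * q ^ Suc j) / (1 - q ^ Suc j))" for n
  define B where "B n = (\<Prod>j<n. (1 - q ^ Suc j / b) / (1 - q ^ Suc j))" for n
  define g where "g p = b powi p / (1 - x * q powi p)" for p :: int
  have qpow: "q ^ Suc j \<noteq> 1" for j
  proof
    assume "q ^ Suc j = 1"
    then have "norm q ^ Suc j = 1" by (metis norm_power norm_one)
    then show False using power_Suc_less_one[of "norm q" j] q q1 by simp
  qed
  have E0: "qpoch q 1 \<noteq> 0" using qpow by (intro qpoch_nonzero q1) (simp del: power_Suc)
  have A: "A \<longlonglongrightarrow> qpoch q b / qpoch q 1"
  proof -
    have "A = (\<lambda>n. (\<Prod>j<n. 1 - q ^ Suc j * b) / (\<Prod>j<n. 1 - q ^ Suc j * 1))"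
      by (simp add: A_def fun_eq_iff prod_dividef mult.commute)
    then show ?thesis by (simp only:) (intro tendsto_divide qpoch_limit q1 E0)
  qed
  have B: "B \<longlonglongrightarrow> qpoch q (inverse b) / qpoch q 1"
  proof -
    have "B = (\<lambda>n. (\<Prod>j<n. 1 - q ^ Suc j * inverse b) / (\<Prod>j<n. 1 - q ^ Suc j * 1))"
      by (simp add: B_def fun_eq_iff prod_dividef field_simps)
    then show ?thesis by (simp only:) (intro tendsto_divide qpoch_limit q1 E0)
  qed
  have "Bseq A" using A by (intro convergent_imp_Bseq convergentI)
  then obtain MA where MA: "\<And>n. norm (A n) \<le> MA" by (auto simp: Bseq_def)
  have "Bseq B" using B by (intro convergent_imp_Bseq convergentI)
  then obtain MB where MB: "\<And>n. norm (B n) \<le> MB" by (auto simp: Bseq_def)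
  have M0: "MA \<ge> 0" "MB \<ge> 0" using MA[of 0] MB[of 0] by (meson norm_ge_zero order_trans)+
  \<comment> \<open>Terms outside the finite range are set to 0, so that all N share one index
    set.\<close>
  define f where "f N p = (if p \<in> {- int N..int N} then g p * (A (nat (int N - p)) * B (nat (int N + p))) else 0)" for N p
  define AB where "AB = qpoch q b / qpoch q 1 * (qpoch q (inverse b) / qpoch q 1)"
  have gs: "(\<lambda>p. norm (g p)) summable_on UNIV" unfolding g_def by (rule lerch_abs_summable) (use q b x in auto)
  have lim: "(\<lambda>N. f N p) \<longlonglongrightarrow> g p * AB" for p
  proof -
    have ev: "eventually (\<lambda>N. g p * (A (nat (int N - p)) * B (nat (int N + p))) = f N p) sequentially"
      using eventually_ge_at_top[of "nat \<bar>p\<bar>"] by eventually_elim (auto simp: f_def)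
    have t1: "filterlim (\<lambda>N. nat (int N - p)) sequentially sequentially"
      unfolding filterlim_at_top
    proof
      fix Z show "eventually (\<lambda>N. Z \<le> nat (int N - p)) sequentially"
        using eventually_ge_at_top[of "nat (int Z + \<bar>p\<bar>)"] by eventually_elim linarith
    qed
    have t2: "filterlim (\<lambda>N. nat (int N + p)) sequentially sequentially"
      unfolding filterlim_at_top
    proof
      fix Z show "eventually (\<lambda>N. Z \<le> nat (int N + p)) sequentially"
        using eventually_ge_at_top[of "nat (int Z + \<bar>p\<bar>)"] by eventually_elim linarith
    qed
    have "(\<lambda>N. g p * (A (nat (int N - p)) * B (nat (int N + p)))) \<longlonglongrightarrow> g p * AB"
      unfolding AB_def by (intro tendsto_mult tendsto_const filterlim_compose[OF A t1] filterlim_compose[OF B t2])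
    then show ?thesis using ev by (rule Lim_transform_eventually)
  qed
  \<comment> \<open>Tannery's theorem is about series over the naturals, hence the enumeration of
    the integers. The majorant is the Lerch series times bounds for the convergent sequences A and
    B.\<close>
  have bij: "bij_betw int_decode UNIV UNIV" by (rule bij_int_decode)
  have gd: "(\<lambda>k. norm (g (int_decode k))) summable_on UNIV"
    using summable_on_reindex_bij_betw[OF bij, of "\<lambda>p. norm (g p)"] gs by simp
  have sumM: "summable (\<lambda>k. norm (g (int_decode k)) * (MA * MB))"
    by (intro summable_mult2) (use gd summable_on_UNIV_nonneg_real_iff[of "\<lambda>k. norm (g (int_decode k))"] in auto)
  have bound: "norm (f N p) \<le> norm (g p) * (MA * MB)" for N p
    using MA MB M0 by (auto simp: f_def norm_mult intro!: mult_left_mono mult_mono)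
  have "(\<lambda>N. \<Sum>k. f N (int_decode k)) \<longlonglongrightarrow> (\<Sum>k. g (int_decode k) * AB)"
    by (rule conjunct2[OF conjunct2[OF tannerys_theorem[where M = "\<lambda>k. norm (g (int_decode k)) * (MA * MB)"]]])
       (use lim bound sumM in \<open>auto intro!: always_eventually\<close>)
  moreover have "(\<Sum>k. f N (int_decode k)) = (\<Sum>p\<in>{- int N..int N}. g p * (A (nat (int N - p)) * B (nat (int N + p))))" for N
  proof -
    have "(\<Sum>k. f N (int_decode k)) = (\<Sum>k\<in>int_encode ` {- int N..int N}. f N (int_decode k))"
    proof (intro suminf_finite)
      fix k assume "k \<notin> int_encode ` {- int N..int N}"
      then have "int_decode k \<notin> {- int N..int N}" using int_decode_inverse[of k] by (metis imageI)
      then show "f N (int_decode k) = 0" unfolding f_def by (simp only: if_False)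
    qed simp
    also have "\<dots> = (\<Sum>p\<in>{- int N..int N}. f N p)"
      by (subst sum.reindex) (auto simp: inj_on_def o_def int_encode_eq)
    finally show ?thesis by (simp add: f_def)
  qed
  moreover have "(\<Sum>k. g (int_decode k) * AB) = infsum g UNIV * AB"
  proof -
    have "(\<lambda>k. g (int_decode k)) summable_on UNIV"
      by (rule Infinite_Sum.abs_summable_summable[OF gd])
    then have "(\<lambda>k. g (int_decode k)) sums infsum (\<lambda>k. g (int_decode k)) UNIV"
      by (intro has_sum_imp_sums has_sum_infsum)
    moreover have "infsum (\<lambda>k. g (int_decode k)) UNIV = infsum g UNIV"
      by (rule infsum_reindex_bij_betw[OF bij])
    ultimately have "(\<lambda>k. g (int_decode k) * AB) sums (infsum g UNIV * AB)"
      by (intro sums_mult2) simp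
    then show ?thesis by (simp add: sums_iff)
  qed
  ultimately have "(\<lambda>N. b ^ Suc N + (1 - b) * (\<Sum>p\<in>{- int N..int N}. g p * (A (nat (int N - p)) * B (nat (int N + p))))) 
      \<longlonglongrightarrow> 0 + (1 - b) * (infsum g UNIV * AB)"
    using b by (intro tendsto_intros LIMSEQ_Suc[OF LIMSEQ_power_zero]) simp_all
  moreover have "b ^ Suc N + (1 - b) * (\<Sum>p\<in>{- int N..int N}. g p * (A (nat (int N - p)) * B (nat (int N + p)))) 
     = theta_part q N (b * x) / theta_part q N x" for N
    by (subst theta_part_quotient[OF q q1 b0 x]) (simp_all add: A_def B_def g_def mult_ac)
  ultimately have "(\<lambda>N. theta_part q N (b * x) / theta_part q N x) \<longlonglongrightarrow> (1 - b) * (infsum g UNIV * AB)"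
    by simp
  moreover have "(\<lambda>N. theta_part q N (b * x) / theta_part q N x) \<longlonglongrightarrow> theta_prod q (b * x) / theta_prod q x"
    using q q1 x by (intro tendsto_divide theta_part_limit theta_prod_nonzero) auto
  ultimately have "theta_prod q (b * x) / theta_prod q x = (1 - b) * (infsum g UNIV * AB)"
    using LIMSEQ_unique by blast
  also have "\<dots> = theta_prod q b / qpoch q 1 ^ 2 * infsum g UNIV"
    by (simp add: AB_def theta_prod_def power2_eq_square)
  finally show ?thesis by (simp add: g_def[abs_def])
qed

section \<open>Exchange of bases in signed lattice sums\<close>

lemma sg_uminus: "sg (- s) (- t) = - sg s t" by (simp add: sg_def sgn_minus field_simps)
lemma sg_commute: "sg s t = sg t s" by (simp add: sg_def add.commute)
lemma abs_sg_le_1: "\<bar>sg s t\<bar> \<le> 1" by (auto simp: sg_def sgn_if)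
lemma sg_nonzero_imp: "sg s t \<noteq> 0 \<Longrightarrow> s * t \<ge> 0" by (auto simp: sg_def sgn_if mult_nonneg_nonneg mult_nonpos_nonpos split: if_splits)

lemma sg_mult_left:
  assumes "r \<noteq> 0"
  shows "sg (r * s) t = sgn r * sg s (r * t)"
proof -
  have "sgn r * sgn r = (1::real)" using assms by (simp add: sgn_if)
  then have "sgn r * sgn (r * t) = sgn t" by (simp add: sgn_mult mult.assoc[symmetric])
  then show ?thesis by (simp add: sg_def sgn_mult algebra_simps)
qed

text \<open>The sign shadow of the three-term Fay identity of the Kronecker function.\<close>

lemma sg_fay:
  assumes "a \<noteq> 0" "b \<noteq> 0" "a \<noteq> b" "y \<noteq> 0"
  shows "sg a x * sg b y = sg a (x + y) * sg (b - a) y + sg (a - b) x * sg b (x + y)"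
proof -
  consider "x > 0" | "x = 0" | "x < 0" by linarith
  then show ?thesis
  proof cases
    case 1 then show ?thesis using assms by (auto simp: sg_def sgn_if)
  next
    case 2 then show ?thesis using assms by (auto simp: sg_def sgn_if)
  next
    case 3 then show ?thesis using assms by (auto simp: sg_def sgn_if)
  qed
qed

text \<open>Iteration of the Fay identity. In the induction step it is applied, for every i, to the
  slot that holds the sum over S and to the new slot m. The terms that pair
  \<open>\<gamma> m\<close> with the full sum are collected by a second use of the induction
  hypothesis, for the shifted family \<open>\<gamma> s - \<gamma> m\<close>.\<close>

lemma sg_circuit_aux:
  assumes "finite S" "S \<noteq> {}" "inj_on \<gamma> S" "\<And>s. s \<in> S \<Longrightarrow> \<gamma> s \<noteq> 0" "\<And>s. s \<in> S \<Longrightarrow> \<rho> s \<noteq> 0"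
  shows "(\<Prod>s\<in>S. sg (\<gamma> s) (\<rho> s)) =
    (\<Sum>i\<in>S. sg (\<gamma> i) (\<Sum>s\<in>S. \<rho> s) * (\<Prod>s\<in>S - {i}. sg (\<gamma> s - \<gamma> i) (\<rho> s)))"
  using assms
proof (induction S arbitrary: \<gamma> rule: finite_ne_induct)
  case (singleton x)
  then show ?case by simp
next
  case (insert m S)
  let ?U = "\<Sum>s\<in>S. \<rho> s"
  have ne: "\<gamma> i \<noteq> \<gamma> m" if "i \<in> S" for i using insert.prems(1) insert.hyps that by (auto simp: inj_on_def)
  have injS: "inj_on \<gamma> S" using insert.prems(1) by (auto simp: inj_on_def)
  have IH1: "(\<Prod>s\<in>S. sg (\<gamma> s) (\<rho> s)) = (\<Sum>i\<in>S. sg (\<gamma> i) ?U * (\<Prod>s\<in>S - {i}. sg (\<gamma> s - \<gamma> i) (\<rho> s)))"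
    using insert.prems injS by (intro insert.IH) auto
  have IH2: "(\<Prod>s\<in>S. sg (\<gamma> s - \<gamma> m) (\<rho> s)) =
     (\<Sum>i\<in>S. sg (\<gamma> i - \<gamma> m) ?U * (\<Prod>s\<in>S - {i}. sg (\<gamma> s - \<gamma> i) (\<rho> s)))"
    using insert.IH[of "\<lambda>s. \<gamma> s - \<gamma> m"] insert.prems injS ne by (simp add: inj_on_def)
  have fay: "sg (\<gamma> i) ?U * sg (\<gamma> m) (\<rho> m) =
      sg (\<gamma> i) (?U + \<rho> m) * sg (\<gamma> m - \<gamma> i) (\<rho> m) + sg (\<gamma> i - \<gamma> m) ?U * sg (\<gamma> m) (?U + \<rho> m)" if "i \<in> S" for i
    using that insert.prems ne by (intro sg_fay) auto
  have U: "(\<Sum>s\<in>insert m S. \<rho> s) = ?U + \<rho> m" using insert.hyps by simp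
  have PI: "(\<Prod>s\<in>insert m S - {i}. sg (\<gamma> s - \<gamma> i) (\<rho> s)) = sg (\<gamma> m - \<gamma> i) (\<rho> m) * (\<Prod>s\<in>S - {i}. sg (\<gamma> s - \<gamma> i) (\<rho> s))"
    if "i \<in> S" for i
  proof -
    have "insert m S - {i} = insert m (S - {i})" using that insert.hyps by auto
    then show ?thesis using insert.hyps by simp
  qed
  have PM: "insert m S - {m} = S" using insert.hyps by auto
  have "(\<Prod>s\<in>insert m S. sg (\<gamma> s) (\<rho> s)) = (\<Prod>s\<in>S. sg (\<gamma> s) (\<rho> s)) * sg (\<gamma> m) (\<rho> m)"
    using insert.hyps by simp
  also have "\<dots> = (\<Sum>i\<in>S. (sg (\<gamma> i) ?U * sg (\<gamma> m) (\<rho> m)) * (\<Prod>s\<in>S - {i}. sg (\<gamma> s - \<gamma> i) (\<rho> s)))"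
    unfolding IH1 sum_distrib_right by (intro sum.cong refl) simp
  also have "\<dots> = (\<Sum>i\<in>S. sg (\<gamma> i) (?U + \<rho> m) * (sg (\<gamma> m - \<gamma> i) (\<rho> m) * (\<Prod>s\<in>S - {i}. sg (\<gamma> s - \<gamma> i) (\<rho> s))) +
      sg (\<gamma> m) (?U + \<rho> m) * (sg (\<gamma> i - \<gamma> m) ?U * (\<Prod>s\<in>S - {i}. sg (\<gamma> s - \<gamma> i) (\<rho> s))))"
    by (intro sum.cong refl, subst fay, assumption) (simp add: algebra_simps)
  also have "\<dots> = (\<Sum>i\<in>S. sg (\<gamma> i) (?U + \<rho> m) * (\<Prod>s\<in>insert m S - {i}. sg (\<gamma> s - \<gamma> i) (\<rho> s))) +
      sg (\<gamma> m) (?U + \<rho> m) * (\<Prod>s\<in>S. sg (\<gamma> s - \<gamma> m) (\<rho> s))"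
    unfolding sum.distrib IH2 sum_distrib_left[symmetric]
    by (intro arg_cong2[of _ _ _ _ "(+)"] sum.cong refl) (simp only: PI)
  also have "\<dots> = (\<Sum>i\<in>insert m S. sg (\<gamma> i) (\<Sum>s\<in>insert m S. \<rho> s) * (\<Prod>s\<in>insert m S - {i}. sg (\<gamma> s - \<gamma> i) (\<rho> s)))"
    unfolding U sum.insert[OF insert.hyps(1,3)] PM by (simp only: add.commute)
  finally show ?case .
qed

text \<open>X stands for the values of the forms of a basis and C for the coordinates with respect
  to the dual basis. If the form i is replaced by the combination with coefficients r, the dual
  coordinates become \<open>C i / r i\<close> and \<open>C s - r s / r i * C i\<close>; so every
  summand is a sign product of the same kind for an exchanged basis. Moving the factor
  \<open>r s\<close> from one argument of a slot to the other costs \<open>sgn (r s)\<close> and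
  reduces the claim to \<open>sg_circuit_aux\<close>; slots with \<open>r s = 0\<close> agree on
  both sides.\<close>

lemma sg_circuit:
  fixes r C X :: "'s \<Rightarrow> real"
  assumes J: "finite J" and i0: "i0 \<in> J" "r i0 \<noteq> 0"
    and C: "\<And>s. s \<in> J \<Longrightarrow> C s \<noteq> 0" and X: "\<And>s. s \<in> J \<Longrightarrow> X s \<noteq> 0"
    and C': "\<And>i s. i \<in> J \<Longrightarrow> s \<in> J \<Longrightarrow> r i \<noteq> 0 \<Longrightarrow> s \<noteq> i \<Longrightarrow> C s - r s / r i * C i \<noteq> 0"
  shows "(\<Prod>s\<in>J. sg (C s) (X s)) = (\<Sum>i\<in>{i\<in>J. r i \<noteq> 0}. sgn (r i) *
    (\<Prod>s\<in>J. if s = i then sg (C i / r i) (\<Sum>s\<in>J. r s * X s) else sg (C s - r s / r i * C i) (X s)))"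
proof -
  let ?S = "{i\<in>J. r i \<noteq> 0}"
  let ?U = "\<Sum>s\<in>J. r s * X s"
  define \<gamma> where "\<gamma> s = C s / r s" for s
  define \<rho> where "\<rho> s = r s * X s" for s
  define Q where "Q = (\<Prod>s\<in>J - ?S. sg (C s) (X s))"
  define \<epsilon> where "\<epsilon> = (\<Prod>s\<in>?S. sgn (r s))"
  have fS: "finite ?S" using J by simp
  have U: "?U = (\<Sum>s\<in>?S. \<rho> s)" unfolding \<rho>_def by (intro sum.mono_neutral_right J) auto
  have split: "(\<Prod>s\<in>J. f s) = (\<Prod>s\<in>?S. f s) * (\<Prod>s\<in>J - ?S. f s)" for f :: "'s \<Rightarrow> real"
    using prod.subset_diff[of ?S J f] J by (simp add: mult.commute)
  have circ: "(\<Prod>s\<in>?S. sg (\<gamma> s) (\<rho> s)) =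
    (\<Sum>i\<in>?S. sg (\<gamma> i) (\<Sum>s\<in>?S. \<rho> s) * (\<Prod>s\<in>?S - {i}. sg (\<gamma> s - \<gamma> i) (\<rho> s)))"
  proof (rule sg_circuit_aux[OF fS])
    show "inj_on \<gamma> ?S"
    proof (rule inj_onI, rule ccontr)
      fix s i assume "s \<in> ?S" "i \<in> ?S" "\<gamma> s = \<gamma> i" "s \<noteq> i"
      then show False using C'[of i s] by (simp add: \<gamma>_def field_simps)
    qed
  qed (use i0 C X in \<open>auto simp: \<gamma>_def \<rho>_def\<close>)
  have e1: "sg (C s) (X s) = sgn (r s) * sg (\<gamma> s) (\<rho> s)" if "s \<in> ?S" for s
    using sg_mult_left[of "r s" "\<gamma> s" "X s"] that by (simp add: \<gamma>_def \<rho>_def)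
  have e2: "sg (C s - r s / r i * C i) (X s) = sgn (r s) * sg (\<gamma> s - \<gamma> i) (\<rho> s)" if "s \<in> ?S" "i \<in> ?S" for s i
    using sg_mult_left[of "r s" "\<gamma> s - \<gamma> i" "X s"] that by (simp add: \<gamma>_def \<rho>_def algebra_simps)
  have lhs: "(\<Prod>s\<in>J. sg (C s) (X s)) = \<epsilon> * (\<Prod>s\<in>?S. sg (\<gamma> s) (\<rho> s)) * Q"
    unfolding split[of "\<lambda>s. sg (C s) (X s)"] Q_def \<epsilon>_def prod.distrib[symmetric]
    by (intro arg_cong2[of _ _ _ _ "(*)"] prod.cong refl e1)
  have rhs: "sgn (r i) * (\<Prod>s\<in>J. if s = i then sg (C i / r i) ?U else sg (C s - r s / r i * C i) (X s)) =
     \<epsilon> * (sg (\<gamma> i) (\<Sum>s\<in>?S. \<rho> s) * (\<Prod>s\<in>?S - {i}. sg (\<gamma> s - \<gamma> i) (\<rho> s))) * Q" if i: "i \<in> ?S" for i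
  proof -
    have "(\<Prod>s\<in>J - ?S. if s = i then sg (C i / r i) ?U else sg (C s - r s / r i * C i) (X s)) = Q"
      unfolding Q_def using i by (intro prod.cong refl) auto
    moreover have "(\<Prod>s\<in>?S. if s = i then sg (C i / r i) ?U else sg (C s - r s / r i * C i) (X s)) =
       sg (\<gamma> i) (\<Sum>s\<in>?S. \<rho> s) * (\<Prod>s\<in>?S - {i}. sgn (r s) * sg (\<gamma> s - \<gamma> i) (\<rho> s))"
      unfolding prod.remove[OF fS i] using i e2
      by (intro arg_cong2[of _ _ _ _ "(*)"] prod.cong refl) (auto simp: U \<gamma>_def)
    moreover have "\<epsilon> = sgn (r i) * (\<Prod>s\<in>?S - {i}. sgn (r s))"
      unfolding \<epsilon>_def by (rule prod.remove[OF fS i])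
    ultimately show ?thesis unfolding split by (simp add: prod.distrib mult_ac)
  qed
  have "(\<Sum>i\<in>?S. sgn (r i) * (\<Prod>s\<in>J. if s = i then sg (C i / r i) ?U else sg (C s - r s / r i * C i) (X s))) =
     \<epsilon> * (\<Prod>s\<in>?S. sg (\<gamma> s) (\<rho> s)) * Q"
    unfolding circ by (simp only: rhs sum_distrib_left sum_distrib_right cong: sum.cong)
  then show ?thesis using lhs by simp
qed

lemma has_sum_finite_sum:
  fixes f :: "'a \<Rightarrow> 'b \<Rightarrow> complex"
  assumes "finite A" "\<And>a. a \<in> A \<Longrightarrow> (f a has_sum s a) B"
  shows "((\<lambda>x. \<Sum>a\<in>A. f a x) has_sum (\<Sum>a\<in>A. s a)) B"
  using assms by (induction A rule: finite_induct) (auto intro: has_sum_add)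

text \<open>Vectors are functions summed over an index set J, not elements of a finite vector type,
  because the elimination of quadratic monomials removes elements from J.\<close>

definition dot :: "'j set \<Rightarrow> ('j \<Rightarrow> rat) \<Rightarrow> ('j \<Rightarrow> rat) \<Rightarrow> rat" where
  "dot J x y = (\<Sum>j\<in>J. x j * y j)"

definition rdot :: "'j set \<Rightarrow> ('j \<Rightarrow> real) \<Rightarrow> ('j \<Rightarrow> rat) \<Rightarrow> real" where
  "rdot J x y = (\<Sum>j\<in>J. x j * of_rat (y j))"

definition dual_bases :: "'j set \<Rightarrow> ('j \<Rightarrow> 'j \<Rightarrow> rat) \<Rightarrow> ('j \<Rightarrow> 'j \<Rightarrow> rat) \<Rightarrow> bool" where
  "dual_bases J F G \<longleftrightarrow> (\<forall>s\<in>J. \<forall>t\<in>J. dot J (F s) (G t) = (if s = t then 1 else 0)) \<and>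
     (\<forall>i\<in>J. \<forall>j\<in>J. (\<Sum>s\<in>J. G s i * F s j) = (if i = j then 1 else 0))"

lemma of_rat_dot: "of_rat (dot J x y) = rdot J (\<lambda>j. of_rat (x j)) y"
  by (simp add: dot_def rdot_def of_rat_sum of_rat_mult)

lemma dot_commute: "dot J x y = dot J y x" by (simp add: dot_def mult.commute)

lemma dot_add_right: "dot J x (\<lambda>j. y j + z j) = dot J x y + dot J x z" by (simp add: dot_def sum.distrib algebra_simps)
lemma dot_diff_right: "dot J x (\<lambda>j. y j - z j) = dot J x y - dot J x z" by (simp add: dot_def sum_subtractf algebra_simps)
lemma dot_diff_left: "dot J (\<lambda>j. y j - z j) x = dot J y x - dot J z x" by (simp add: dot_def sum_subtractf algebra_simps)
lemma dot_scale_right: "dot J x (\<lambda>j. c * y j) = c * dot J x y" by (simp add: dot_def sum_distrib_left mult_ac)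
lemma dot_scale_left: "dot J (\<lambda>j. c * y j) x = c * dot J y x" by (simp add: dot_def sum_distrib_left mult_ac)
lemma rdot_diff_right: "rdot J x (\<lambda>j. y j - z j) = rdot J x y - rdot J x z"
  by (simp add: rdot_def sum_subtractf algebra_simps of_rat_diff)
lemma rdot_scale_right: "rdot J x (\<lambda>j. c * y j) = of_rat c * rdot J x y"
  by (simp add: rdot_def sum_distrib_left mult_ac of_rat_mult)
lemma rdot_sum_right: "finite S \<Longrightarrow> rdot J x (\<lambda>j. \<Sum>s\<in>S. y s j) = (\<Sum>s\<in>S. rdot J x (y s))"
  unfolding rdot_def of_rat_sum sum_distrib_left by (rule sum.swap)

lemma dot_unit: "finite J \<Longrightarrow> i \<in> J \<Longrightarrow> dot J x (\<lambda>j. if j = i then c else 0) = x i * c"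
  by (simp add: dot_def if_distrib cong: if_cong)

lemma dual_bases_expand:
  assumes "dual_bases J F G" "finite J" "j \<in> J"
  shows "x j = (\<Sum>s\<in>J. dot J x (G s) * F s j)" and "x j = (\<Sum>s\<in>J. dot J (F s) x * G s j)"
proof -
  have "(\<Sum>s\<in>J. dot J x (G s) * F s j) = (\<Sum>i\<in>J. x i * (\<Sum>s\<in>J. G s i * F s j))"
    unfolding dot_def sum_distrib_left sum_distrib_right by (subst sum.swap) (simp add: mult_ac)
  also have "\<dots> = (\<Sum>i\<in>J. x i * (if i = j then 1 else 0))"
    using assms unfolding dual_bases_def by (intro sum.cong refl) simp
  finally show "x j = (\<Sum>s\<in>J. dot J x (G s) * F s j)" using assms by (simp add: if_distrib cong: if_cong)
  have "(\<Sum>s\<in>J. dot J (F s) x * G s j) = (\<Sum>i\<in>J. x i * (\<Sum>s\<in>J. G s j * F s i))"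
    unfolding dot_def sum_distrib_left sum_distrib_right by (subst sum.swap) (simp add: mult_ac)
  also have "\<dots> = (\<Sum>i\<in>J. x i * (if j = i then 1 else 0))"
    using assms unfolding dual_bases_def by (intro sum.cong refl) simp
  finally show "x j = (\<Sum>s\<in>J. dot J (F s) x * G s j)" using assms by (simp add: if_distrib cong: if_cong)
qed

text \<open>This lets one and the same exponential weight be estimated in the coordinates of
  whichever basis is used to compare signs.\<close>

lemma dual_bases_pairing:
  assumes "dual_bases J F G" "finite J"
  shows "(\<Sum>j\<in>J. x j * y j) = (\<Sum>s\<in>J. rdot J x (G s) * rdot J y (F s))"
proof -
  have "(\<Sum>s\<in>J. rdot J x (G s) * rdot J y (F s)) = (\<Sum>s\<in>J. \<Sum>i\<in>J. \<Sum>j\<in>J. x i * y j * of_rat (G s i * F s j))"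
    unfolding rdot_def sum_product by (simp add: of_rat_mult mult_ac)
  also have "\<dots> = (\<Sum>i\<in>J. \<Sum>s\<in>J. \<Sum>j\<in>J. x i * y j * of_rat (G s i * F s j))" by (rule sum.swap)
  also have "\<dots> = (\<Sum>i\<in>J. \<Sum>j\<in>J. \<Sum>s\<in>J. x i * y j * of_rat (G s i * F s j))"
    by (intro sum.cong refl sum.swap)
  also have "\<dots> = (\<Sum>i\<in>J. \<Sum>j\<in>J. x i * y j * of_rat (\<Sum>s\<in>J. G s i * F s j))"
    by (simp add: sum_distrib_left of_rat_sum)
  also have "\<dots> = (\<Sum>i\<in>J. \<Sum>j\<in>J. x i * y j * of_rat (if i = j then 1 else 0))"
    using assms unfolding dual_bases_def by (intro sum.cong refl) simp
  also have "\<dots> = (\<Sum>i\<in>J. x i * y i)"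
    using assms by (intro sum.cong refl) (simp add: if_distrib cong: if_cong)
  finally show ?thesis ..
qed

text \<open>The dual basis after the form with index i has given way to the form whose coefficients
  in the old basis are r.\<close>

definition exch :: "'j \<Rightarrow> ('j \<Rightarrow> rat) \<Rightarrow> ('j \<Rightarrow> 'j \<Rightarrow> rat) \<Rightarrow> 'j \<Rightarrow> 'j \<Rightarrow> rat" where
  "exch i r G s = (if s = i then (\<lambda>j. (1 / r i) * G i j) else (\<lambda>j. G s j - (r s / r i) * G i j))"

lemma dot_exch: "dot J x (exch i r G t) = (if t = i then dot J x (G i) / r i else dot J x (G t) - r t / r i * dot J x (G i))"
proof (cases "t = i")
  case True
  then have "exch i r G t = (\<lambda>j. (1 / r i) * G i j)" by (simp only: exch_def simp_thms if_True)
  then have "dot J x (exch i r G t) = (1 / r i) * dot J x (G i)" by (simp only: dot_scale_right)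
  then show ?thesis using True by simp
next
  case False
  then show ?thesis by (simp only: exch_def simp_thms if_False dot_diff_right dot_scale_right)
qed

lemma rdot_exch: "rdot J x (exch i r G t) =
    (if t = i then rdot J x (G i) / of_rat (r i) else rdot J x (G t) - of_rat (r t) / of_rat (r i) * rdot J x (G i))"
proof (cases "t = i")
  case True
  then have "exch i r G t = (\<lambda>j. (1 / r i) * G i j)" by (simp only: exch_def simp_thms if_True)
  then have "rdot J x (exch i r G t) = of_rat (1 / r i) * rdot J x (G i)" by (simp only: rdot_scale_right)
  then show ?thesis using True by (simp add: of_rat_divide)
next
  case False
  then show ?thesis by (simp only: exch_def simp_thms if_False rdot_diff_right rdot_scale_right of_rat_divide)
qed

lemma dual_bases_exchange:
  assumes db: "dual_bases J F G" and J: "finite J" and i: "i \<in> J" and ri: "dot J u (G i) \<noteq> 0"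
  shows "dual_bases J (F(i := u)) (exch i (\<lambda>s. dot J u (G s)) G)"
proof -
  define r where "r s = dot J u (G s)" for s
  have r: "r = (\<lambda>s. dot J u (G s))" by (simp add: r_def fun_eq_iff)
  have ri': "r i \<noteq> 0" using ri by (simp add: r_def)
  have FG: "dot J (F s) (G t) = (if s = t then 1 else 0)" if "s \<in> J" "t \<in> J" for s t
    using db that unfolding dual_bases_def by blast
  have GF: "(\<Sum>s\<in>J. G s a * F s b) = (if a = b then 1 else 0)" if "a \<in> J" "b \<in> J" for a b
    using db that unfolding dual_bases_def by blast
  show ?thesis
    unfolding dual_bases_def r[symmetric]
  proof (intro conjI ballI)
    fix s t assume st: "s \<in> J" "t \<in> J"
    show "dot J ((F(i := u)) s) (exch i r G t) = (if s = t then 1 else 0)"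
      using FG[OF st] FG[OF st(1) i] ri'
      by (auto simp: dot_exch r_def[symmetric])
  next
    fix a b assume ab: "a \<in> J" "b \<in> J"
    have "(\<Sum>s\<in>J. exch i r G s a * (F(i := u)) s b) =
       (1 / r i) * G i a * u b + (\<Sum>s\<in>J - {i}. (G s a - r s / r i * G i a) * F s b)"
      using J i by (subst sum.remove[of _ i]) (auto simp: exch_def intro!: sum.cong)
    also have "(\<Sum>s\<in>J - {i}. (G s a - r s / r i * G i a) * F s b) =
       (\<Sum>s\<in>J. (G s a - r s / r i * G i a) * F s b)"
      using J i ri' by (subst (2) sum.remove[of _ i]) auto
    also have "\<dots> = (\<Sum>s\<in>J. G s a * F s b) - (1 / r i) * G i a * (\<Sum>s\<in>J. r s * F s b)"
      by (simp add: sum_subtractf sum_distrib_left algebra_simps)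
    also have "(\<Sum>s\<in>J. r s * F s b) = u b"
      unfolding r_def by (rule dual_bases_expand(1)[OF db J ab(2), symmetric])
    finally show "(\<Sum>s\<in>J. exch i r G s a * (F(i := u)) s b) = (if a = b then 1 else 0)"
      using GF[OF ab] by simp
  qed
qed

section \<open>Distance from the integers and summation over lattices\<close>

lemma dist_int_pos:
  fixes y :: real
  assumes "y \<notin> \<int>"
  shows "\<exists>\<delta>>0. \<forall>x\<in>\<int>. \<delta> \<le> \<bar>x + y\<bar>"
proof -
  have f: "0 < frac y" using assms frac_ge_0[of y] by (simp add: frac_eq_0_iff order_less_le)
  have "min (frac y) (1 - frac y) \<le> \<bar>x + y\<bar>" if x: "x \<in> \<int>" for x
  proof -
    obtain m where m: "x = of_int m" using x by (elim Ints_cases)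
    have y: "x + y = of_int (m + \<lfloor>y\<rfloor>) + frac y" by (simp add: m frac_def)
    show ?thesis
    proof (cases "m + \<lfloor>y\<rfloor> \<ge> 0")
      case True
      then have "(of_int (m + \<lfloor>y\<rfloor>)::real) \<ge> 0" by simp
      then show ?thesis unfolding y using f by linarith
    next
      case False
      then have "m + \<lfloor>y\<rfloor> \<le> -1" by simp
      then have "(of_int (m + \<lfloor>y\<rfloor>)::real) \<le> -1" by (metis of_int_le_iff of_int_minus of_int_1)
      then show ?thesis unfolding y using frac_lt_1[of y] by linarith
    qed
  qed
  then show ?thesis using f frac_lt_1[of y] by (intro exI[of _ "min (frac y) (1 - frac y)"]) auto
qed

lemma common_denominator:
  assumes "finite S"
  shows "\<exists>D>0. \<forall>x\<in>S. of_nat D * (x::rat) \<in> \<int>"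
  using assms
proof (induction S rule: finite_induct)
  case empty
  then show ?case by (intro exI[of _ 1]) simp
next
  case (insert x S)
  then obtain D where D: "D > 0" "\<forall>x\<in>S. of_nat D * (x::rat) \<in> \<int>" by blast
  obtain a b where ab: "x = Fract a b" "b > 0" by (cases x) auto
  have x: "of_nat (nat b) * x = of_int a" using ab by (simp add: Fract_of_int_quotient)
  have "of_nat (D * nat b) * y \<in> \<int>" if "y \<in> insert x S" for y
  proof (cases "y = x")
    case True
    have "of_nat (D * nat b) * x = of_nat D * of_int a" by (simp only: of_nat_mult mult.assoc x)
    then show ?thesis unfolding True by (simp only:) (intro Ints_mult Ints_of_nat Ints_of_int)
  next
    case False
    then have "of_nat D * y \<in> \<int>" using that D by simp
    then have "of_nat (nat b) * (of_nat D * y) \<in> \<int>" by (rule Ints_mult[OF Ints_of_nat])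
    then show ?thesis by (simp add: mult_ac)
  qed
  then show ?case using D(1) ab(2) by (intro exI[of _ "D * nat b"]) simp
qed

lemma exp_abs_summable:
  fixes \<beta> :: real
  assumes "\<beta> > 0"
  shows "(\<lambda>(a::int, b::int). exp (- \<beta> * \<bar>of_int a\<bar>) * exp (- \<beta> * \<bar>of_int b\<bar>)) summable_on (UNIV :: (int \<times> int) set)"
proof -
  have g: "summable (\<lambda>n. exp (- \<beta> * real n))"
  proof -
    have "summable (\<lambda>n. exp (- \<beta>) ^ n)" using assms by (intro summable_geometric) simp
    then show ?thesis by (simp add: exp_of_nat_mult[symmetric] mult.commute)
  qed
  have "summable (\<lambda>n. exp (- \<beta> * real (Suc n)))" using g by (subst summable_Suc_iff)
  then have 1: "(\<lambda>a::int. exp (- \<beta> * \<bar>of_int a\<bar>)) summable_on UNIV"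
    using g by (intro summable_on_int_split) (simp_all add: algebra_simps)
  have "Infinite_Set_Sum.abs_summable_on (\<lambda>(a::int, b::int). exp (- \<beta> * \<bar>of_int a\<bar>) * exp (- \<beta> * \<bar>of_int b\<bar>)) (UNIV \<times> UNIV)"
    by (intro Infinite_Set_Sum.abs_summable_on_product) (use 1 in \<open>auto simp: abs_summable_equivalent[symmetric]\<close>)
  then have "Infinite_Sum.abs_summable_on (\<lambda>(a::int, b::int). exp (- \<beta> * \<bar>of_int a\<bar>) * exp (- \<beta> * \<bar>of_int b\<bar>)) (UNIV \<times> UNIV)"
    unfolding abs_summable_equivalent .
  from Infinite_Sum.abs_summable_summable[OF this] show ?thesis by simp
qed

text \<open>The lattice sum of a sum of chains and loops, detached from its theta functions. K and N
  are the two lattices, c and \<open>\<nu>\<close> their shifts, and u the rows, with diagonal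
  exponent \<open>a l\<close> and pointer \<open>p l\<close>. The assumption \<open>gen\<close>
  keeps sign arguments from vanishing, \<open>u_c\<close> equates the two shifts that a reflection
  exchanges, \<open>w_inv\<close> is the invariance of the weight under it, and
  \<open>w_bound\<close> ties the weight to the pairing of k + c and n - \<nu>.\<close>

locale core =
  fixes J :: "'j set" and K N :: "('j \<Rightarrow> rat) set" and c \<nu> :: "'j \<Rightarrow> real"
    and w :: "('j \<Rightarrow> rat) \<times> ('j \<Rightarrow> rat) \<Rightarrow> complex"
    and a :: "'j \<Rightarrow> nat" and p :: "'j \<Rightarrow> 'j option" and u :: "'j \<Rightarrow> 'j \<Rightarrow> rat"
    and D :: nat and \<beta> M :: real
  assumes finJ: "finite J" and D0: "D > 0"
    and K_supp: "k \<in> K \<Longrightarrow> j \<notin> J \<Longrightarrow> k j = 0" and K_int: "k \<in> K \<Longrightarrow> k j \<in> \<int>"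
    and N_supp: "n \<in> N \<Longrightarrow> j \<notin> J \<Longrightarrow> n j = 0" and N_D: "n \<in> N \<Longrightarrow> j \<in> J \<Longrightarrow> of_nat D * n j \<in> \<int>"
    and K_u: "k \<in> K \<Longrightarrow> l \<in> J \<Longrightarrow> t \<in> \<int> \<Longrightarrow> (\<lambda>j. k j - t * u l j) \<in> K"
    and N_e: "n \<in> N \<Longrightarrow> i \<in> J \<Longrightarrow> t \<in> \<int> \<Longrightarrow> n(i := n i - t) \<in> N"
    and u_N: "n \<in> N \<Longrightarrow> l \<in> J \<Longrightarrow> dot J (u l) n \<in> \<int>"
    and gen: "j \<in> J \<Longrightarrow> g j \<noteq> 0 \<Longrightarrow> rdot J c g \<notin> \<rat>"
    and nu_D: "j \<in> J \<Longrightarrow> of_nat D * \<nu> j \<notin> \<int>" and u_nu: "l \<in> J \<Longrightarrow> rdot J \<nu> (u l) \<notin> \<int>"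
    and u_c: "l \<in> J \<Longrightarrow> p l = Some i \<Longrightarrow> rdot J \<nu> (u l) = c i"
    and u_def: "l \<in> J \<Longrightarrow> u l = (\<lambda>j. if j = l then of_nat (a l) else if p l = Some j then 1 else 0)"
    and a2: "l \<in> J \<Longrightarrow> a l \<ge> 2" and p_in: "l \<in> J \<Longrightarrow> p l = Some i \<Longrightarrow> i \<in> J"
    and p_ne: "l \<in> J \<Longrightarrow> p l \<noteq> Some l"
    and p_inj: "l \<in> J \<Longrightarrow> l' \<in> J \<Longrightarrow> p l = Some i \<Longrightarrow> p l' = Some i \<Longrightarrow> l = l'"
    and beta: "\<beta> > 0"
    and w_bound: "k \<in> K \<Longrightarrow> n \<in> N \<Longrightarrow> norm (w (k, n)) \<le> M * exp (- \<beta> * (\<Sum>j\<in>J. (of_rat (k j) + c j) * (of_rat (n j) - \<nu> j)))"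
    and w_inv: "k \<in> K \<Longrightarrow> n \<in> N \<Longrightarrow> l \<in> J \<Longrightarrow> p l = Some i \<Longrightarrow> t = k i + dot J (u l) n \<Longrightarrow>
       w (\<lambda>j. k j - t * u l j, n(i := n i - t)) = w (k, n)"
begin

definition cf :: "('j \<Rightarrow> rat) \<Rightarrow> ('j \<Rightarrow> rat) \<Rightarrow> real" where
  "cf k g = rdot J (\<lambda>j. of_rat (k j) + c j) g"

definition xf :: "('j \<Rightarrow> rat) \<Rightarrow> ('j \<Rightarrow> rat) \<Rightarrow> real" where
  "xf n f = rdot J (\<lambda>j. of_rat (n j) - \<nu> j) f"

lemma cf_eq: "cf k g = of_rat (dot J k g) + rdot J c g"
  by (simp add: cf_def of_rat_dot) (simp add: rdot_def sum.distrib algebra_simps)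

lemma xf_eq: "xf n f = of_rat (dot J f n) - rdot J \<nu> f"
  by (simp add: xf_def dot_commute[of J f] of_rat_dot) (simp add: rdot_def sum_subtractf algebra_simps)

text \<open>
  The forms F s and the dual vectors G s describe a cone; the summand is the signed indicator
  of the pairs whose coordinates with respect to the two bases have equal signs.
\<close>

definition st :: "('j \<Rightarrow> 'j \<Rightarrow> rat) \<Rightarrow> ('j \<Rightarrow> 'j \<Rightarrow> rat) \<Rightarrow> ('j \<Rightarrow> rat) \<times> ('j \<Rightarrow> rat) \<Rightarrow> complex" where
  "st F G = (\<lambda>(k, n). of_real (\<Prod>s\<in>J. sg (cf k (G s)) (xf n (F s))) * w (k, n))"

text \<open>Besides rows only unit vectors occur, each in its own slot. On both kinds of forms the
  values of N lie in a discrete group known in advance: the integers for rows, the multiples of 1/D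
  for unit vectors.\<close>

definition admissible :: "('j \<Rightarrow> 'j \<Rightarrow> rat) \<Rightarrow> bool" where
  "admissible F \<longleftrightarrow> (\<forall>s\<in>J. (\<exists>l\<in>J. F s = u l) \<or> F s = (\<lambda>j. if j = s then 1 else 0))"

text \<open>\<open>cf k g\<close> runs through a translate of a discrete subgroup of the reals, and
  genericity of c keeps the translate off 0. Summability needs this uniform gap and not only the
  absence of zeros.\<close>

lemma cf_away:
  assumes "j \<in> J" "g j \<noteq> 0"
  shows "\<exists>\<delta>>0. \<forall>k\<in>K. \<delta> \<le> \<bar>cf k g\<bar>"
proof -
  obtain D' where D': "D' > 0" "\<forall>x\<in>g ` J. of_nat D' * x \<in> \<int>" using common_denominator[of "g ` J"] finJ by blast
  have irr: "of_nat D' * rdot J c g \<notin> \<int>"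
  proof
    assume "of_nat D' * rdot J c g \<in> \<int>"
    then obtain m where "of_nat D' * rdot J c g = of_int m" by (elim Ints_cases)
    then have "rdot J c g = of_int m / of_nat D'" using D'(1) by (simp add: field_simps)
    then have "rdot J c g \<in> \<rat>" by simp
    then show False using gen[of j g] assms by blast
  qed
  obtain \<delta> where d: "\<delta> > 0" "\<forall>x\<in>\<int>. \<delta> \<le> \<bar>x + of_nat D' * rdot J c g\<bar>" using dist_int_pos[OF irr] by blast
  have "\<delta> / of_nat D' \<le> \<bar>cf k g\<bar>" if k: "k \<in> K" for k
  proof -
    have "of_nat D' * dot J k g \<in> \<int>"
    proof -
      have "of_nat D' * dot J k g = (\<Sum>j\<in>J. k j * (of_nat D' * g j))" by (simp add: dot_def sum_distrib_left mult_ac)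
      also have "\<dots> \<in> \<int>"
      proof (rule Ints_sum)
        fix j assume "j \<in> J"
        then have "of_nat D' * g j \<in> \<int>" using D'(2) by blast
        then show "k j * (of_nat D' * g j) \<in> \<int>" by (rule Ints_mult[OF K_int[OF k]])
      qed
      finally show ?thesis .
    qed
    then obtain m where m: "of_nat D' * dot J k g = of_int m" by (elim Ints_cases)
    have "of_nat D' * of_rat (dot J k g) = (of_int m :: real)"
      using arg_cong[OF m, of "of_rat :: rat \<Rightarrow> real"] by (simp add: of_rat_mult)
    then have "of_nat D' * cf k g = of_int m + of_nat D' * rdot J c g" by (simp add: cf_eq algebra_simps)
    then have "\<delta> \<le> \<bar>of_nat D' * cf k g\<bar>" using d(2) by simp
    then show ?thesis using D'(1) by (simp add: abs_mult field_simps)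
  qed
  then show ?thesis using d(1) D'(1) by (intro exI[of _ "\<delta> / of_nat D'"]) simp
qed

text \<open>As in \<open>cf_away\<close>, but here the gap comes from explicit conditions on the
  shift: \<open>u_nu\<close> for rows and \<open>nu_D\<close> for unit vectors.\<close>

lemma xf_away:
  assumes F: "admissible F" and s: "s \<in> J"
  shows "\<exists>\<delta>>0. \<forall>n\<in>N. \<delta> \<le> \<bar>xf n (F s)\<bar>"
proof -
  consider l where "l \<in> J" "F s = u l" | "F s = (\<lambda>j. if j = s then 1 else 0)"
    using F s unfolding admissible_def by blast
  then show ?thesis
  proof cases
    case 1
    have "- rdot J \<nu> (u l) \<notin> \<int>" using u_nu[OF 1(1)] by simp
    then obtain \<delta> where d: "\<delta> > 0" "\<forall>x\<in>\<int>. \<delta> \<le> \<bar>x + - rdot J \<nu> (u l)\<bar>" using dist_int_pos by blast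
    have "\<delta> \<le> \<bar>xf n (F s)\<bar>" if n: "n \<in> N" for n
    proof -
      obtain m where "dot J (u l) n = of_int m" using u_N[OF n 1(1)] by (elim Ints_cases)
      then have "xf n (F s) = of_int m + - rdot J \<nu> (u l)" by (simp add: xf_eq 1(2))
      then show ?thesis using d(2) by simp
    qed
    then show ?thesis using d(1) by blast
  next
    case 2
    have x: "xf n (F s) = of_rat (n s) - \<nu> s" for n
      using finJ s by (simp add: xf_def rdot_def 2 if_distrib cong: if_cong)
    have "- (of_nat D * \<nu> s) \<notin> \<int>" using nu_D[OF s] by simp
    then obtain \<delta> where d: "\<delta> > 0" "\<forall>x\<in>\<int>. \<delta> \<le> \<bar>x + - (of_nat D * \<nu> s)\<bar>" using dist_int_pos by blast
    have "\<delta> / of_nat D \<le> \<bar>xf n (F s)\<bar>" if n: "n \<in> N" for n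
    proof -
      obtain m where m: "of_nat D * n s = of_int m" using N_D[OF n s] by (elim Ints_cases)
      have "of_nat D * of_rat (n s) = (of_int m :: real)"
        using arg_cong[OF m, of "of_rat :: rat \<Rightarrow> real"] by (simp add: of_rat_mult)
      then have "of_nat D * xf n (F s) = of_int m + - (of_nat D * \<nu> s)" by (simp add: x algebra_simps)
      then have "\<delta> \<le> \<bar>of_nat D * xf n (F s)\<bar>" using d(2) by simp
      then show ?thesis using D0 by (simp add: abs_mult field_simps)
    qed
    then show ?thesis using d(1) D0 by (intro exI[of _ "\<delta> / of_nat D"]) simp
  qed
qed

lemma dual_nonzero:
  assumes "dual_bases J F G" "s \<in> J"
  shows "\<exists>j\<in>J. G s j \<noteq> 0"
proof (rule ccontr)
  assume "\<not> (\<exists>j\<in>J. G s j \<noteq> 0)"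
  then have "dot J (F s) (G s) = 0" by (simp add: dot_def)
  then show False using assms unfolding dual_bases_def by force
qed

lemma st_nonzero:
  assumes db: "dual_bases J F G" and F: "admissible F" and s: "s \<in> J"
  shows "k \<in> K \<Longrightarrow> cf k (G s) \<noteq> 0" and "n \<in> N \<Longrightarrow> xf n (F s) \<noteq> 0"
  using cf_away[of _ "G s"] dual_nonzero[OF db s] xf_away[OF F s] by force+

text \<open>On the support of the sign product each \<open>cf k (G s) * xf n (F s)\<close> is
  nonnegative, and both factors are at least \<delta> in absolute value. Hence the bilinear exponent
  dominates a linear one: the product is at least \<delta>/2 times the sum of the two absolute
  values. As all coordinates lie in lattices, a product of geometric series is a majorant.\<close>

lemma st_summable:
  assumes db: "dual_bases J F G" and F: "admissible F"
  shows "st F G summable_on (K \<times> N)"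
proof -
  have "\<exists>\<delta>>0. \<forall>s\<in>J. (\<forall>k\<in>K. \<delta> \<le> \<bar>cf k (G s)\<bar>) \<and> (\<forall>n\<in>N. \<delta> \<le> \<bar>xf n (F s)\<bar>)"
  proof -
    have "\<forall>s\<in>J. \<exists>\<delta>>0. (\<forall>k\<in>K. \<delta> \<le> \<bar>cf k (G s)\<bar>) \<and> (\<forall>n\<in>N. \<delta> \<le> \<bar>xf n (F s)\<bar>)"
    proof
      fix s assume s: "s \<in> J"
      obtain d1 where d1: "d1 > 0" "\<forall>k\<in>K. d1 \<le> \<bar>cf k (G s)\<bar>" using cf_away dual_nonzero[OF db s] by blast
      obtain d2 where d2: "d2 > 0" "\<forall>n\<in>N. d2 \<le> \<bar>xf n (F s)\<bar>" using xf_away[OF F s] by blast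
      show "\<exists>\<delta>>0. (\<forall>k\<in>K. \<delta> \<le> \<bar>cf k (G s)\<bar>) \<and> (\<forall>n\<in>N. \<delta> \<le> \<bar>xf n (F s)\<bar>)"
        using d1 d2 by (intro exI[of _ "min d1 d2"]) (auto simp: min_le_iff_disj)
    qed
    then obtain d where d: "\<forall>s\<in>J. d s > (0::real) \<and> (\<forall>k\<in>K. d s \<le> \<bar>cf k (G s)\<bar>) \<and> (\<forall>n\<in>N. d s \<le> \<bar>xf n (F s)\<bar>)"
      by (rule bchoice[THEN exE])
    have "Min (insert 1 (d ` J)) > 0" using d finJ by auto
    moreover have "Min (insert 1 (d ` J)) \<le> d s" if "s \<in> J" for s using that finJ by auto
    ultimately show ?thesis using d by (intro exI[of _ "Min (insert 1 (d ` J))"]) (meson order_trans)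
  qed
  then obtain \<delta> where \<delta>: "\<delta> > 0" "\<And>s k. s \<in> J \<Longrightarrow> k \<in> K \<Longrightarrow> \<delta> \<le> \<bar>cf k (G s)\<bar>" "\<And>s n. s \<in> J \<Longrightarrow> n \<in> N \<Longrightarrow> \<delta> \<le> \<bar>xf n (F s)\<bar>"
    by blast
  \<comment> \<open>E clears the denominators of both bases and D those of N, so E * D times any
    coordinate is an integer.\<close>
  let ?S = "(\<Union>s\<in>J. G s ` J) \<union> (\<Union>s\<in>J. F s ` J)"
  have "finite ?S" using finJ by auto
  then obtain E where E: "E > 0" "\<forall>x\<in>?S. of_nat E * x \<in> \<int>" using common_denominator by blast
  define m1 where "m1 k s = \<lfloor>of_nat (E * D) * dot J k (G s)\<rfloor>" for k s
  define m2 where "m2 n s = \<lfloor>of_nat (E * D) * dot J (F s) n\<rfloor>" for n s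
  have m1: "of_int (m1 k s) = of_nat (E * D) * dot J k (G s)" if "k \<in> K" "s \<in> J" for k s
  proof -
    have "of_nat (E * D) * dot J k (G s) = (\<Sum>j\<in>J. of_nat D * (k j * (of_nat E * G s j)))"
      by (simp add: dot_def sum_distrib_left mult_ac)
    also have "\<dots> \<in> \<int>"
    proof (rule Ints_sum)
      fix j assume "j \<in> J"
      then have "of_nat E * G s j \<in> \<int>" using E(2) that(2) by blast
      then show "of_nat D * (k j * (of_nat E * G s j)) \<in> \<int>"
        by (rule Ints_mult[OF Ints_of_nat Ints_mult[OF K_int[OF that(1)]]])
    qed
    finally show ?thesis by (simp add: m1_def)
  qed
  have m2: "of_int (m2 n s) = of_nat (E * D) * dot J (F s) n" if "n \<in> N" "s \<in> J" for n s
  proof -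
    have "of_nat (E * D) * dot J (F s) n = (\<Sum>j\<in>J. (of_nat E * F s j) * (of_nat D * n j))"
      by (simp add: dot_def sum_distrib_left mult_ac)
    also have "\<dots> \<in> \<int>"
    proof (rule Ints_sum)
      fix j assume j: "j \<in> J"
      then have "of_nat E * F s j \<in> \<int>" using E(2) that(2) by blast
      then show "(of_nat E * F s j) * (of_nat D * n j) \<in> \<int>"
        by (rule Ints_mult) (rule N_D[OF that(1) j])
    qed
    finally show ?thesis by (simp add: m2_def)
  qed
  define ED where "ED = real (E * D)"
  have ED: "ED > 0" using E(1) D0 by (simp add: ED_def)
  \<comment> \<open>Decay per integer step: \<beta> \<delta>/2 from the estimate of the bilinear
    form, divided by \<open>ED\<close> because the integers are \<open>ED\<close> times the
    coordinates.\<close>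
  define b where "b = \<beta> * \<delta> / (2 * ED)"
  have b: "b > 0" using beta \<delta>(1) ED by (simp add: b_def)
  define h where "h = (\<lambda>(x::int, y::int). exp (- b * \<bar>of_int x\<bar>) * exp (- b * \<bar>of_int y\<bar>))"
  \<comment> \<open>C absorbs the shifts c and \<nu>, which the integer coordinates leave
    out.\<close>
  define C where "C = \<bar>M\<bar> * (\<Prod>s\<in>J. exp (\<beta> * \<delta> / 2 * (\<bar>rdot J c (G s)\<bar> + \<bar>rdot J \<nu> (F s)\<bar>)))"
  \<comment> \<open>Integer coordinates in the two bases. They determine (k, n), so the sum over
    \<open>K \<times> N\<close> is part of a sum over all families of integer pairs.\<close>
  define \<psi> where "\<psi> = (\<lambda>(k, n). restrict (\<lambda>s. (m1 k s, m2 n s)) J)"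
  have "Infinite_Set_Sum.abs_summable_on (\<lambda>g. \<Prod>s\<in>J. h (g s)) (Pi\<^sub>E J (\<lambda>_. UNIV))"
  proof (intro Infinite_Set_Sum.abs_summable_on_prod_PiE finJ)
    show "Infinite_Set_Sum.abs_summable_on h UNIV"
      unfolding abs_summable_equivalent[symmetric]
      using exp_abs_summable[OF b] unfolding h_def split_def by (simp add: abs_mult)
  qed auto
  then have hs: "(\<lambda>g. norm (\<Prod>s\<in>J. h (g s))) summable_on (Pi\<^sub>E J (\<lambda>_. UNIV))"
    unfolding abs_summable_equivalent[symmetric] .
  have inj: "inj_on \<psi> (K \<times> N)"
  proof (rule inj_onI, clarify)
    fix k n k' n' assume kn: "k \<in> K" "n \<in> N" "k' \<in> K" "n' \<in> N" and eq: "\<psi> (k, n) = \<psi> (k', n')"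
    have eqs: "m1 k s = m1 k' s" "m2 n s = m2 n' s" if "s \<in> J" for s
      using fun_cong[OF eq, of s] that by (auto simp: \<psi>_def)
    have e1: "dot J k (G s) = dot J k' (G s)" if "s \<in> J" for s
      using m1[OF kn(1) that] m1[OF kn(3) that] eqs(1)[OF that] E(1) D0 by simp
    have e2: "dot J (F s) n = dot J (F s) n'" if "s \<in> J" for s
      using m2[OF kn(2) that] m2[OF kn(4) that] eqs(2)[OF that] E(1) D0 by simp
    have "k j = k' j" for j
    proof (cases "j \<in> J")
      case True
      show ?thesis unfolding dual_bases_expand(1)[OF db finJ True, of k] dual_bases_expand(1)[OF db finJ True, of k']
        by (intro sum.cong refl) (simp add: e1)
    next
      case False
      then show ?thesis using K_supp[OF kn(1)] K_supp[OF kn(3)] by simp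
    qed
    moreover have "n j = n' j" for j
    proof (cases "j \<in> J")
      case True
      show ?thesis unfolding dual_bases_expand(2)[OF db finJ True, of n] dual_bases_expand(2)[OF db finJ True, of n']
        by (intro sum.cong refl) (simp add: e2)
    next
      case False
      then show ?thesis using N_supp[OF kn(2)] N_supp[OF kn(4)] by simp
    qed
    ultimately show "k = k' \<and> n = n'" by auto
  qed
  have "\<psi> ` (K \<times> N) \<subseteq> Pi\<^sub>E J (\<lambda>_. UNIV)" by (auto simp: \<psi>_def)
  from summable_on_subset_banach[OF hs this]
  have "(\<lambda>x. norm (\<Prod>s\<in>J. h (\<psi> x s))) summable_on (K \<times> N)"
    by (subst (asm) summable_on_reindex[OF inj]) (simp add: o_def)
  then have maj: "(\<lambda>x. C * norm (\<Prod>s\<in>J. h (\<psi> x s))) summable_on (K \<times> N)"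
    by (rule summable_on_cmult_right)
  have bound: "norm (st F G x) \<le> C * norm (\<Prod>s\<in>J. h (\<psi> x s))" if x: "x \<in> K \<times> N" for x
  proof -
    obtain k n where kn: "x = (k, n)" "k \<in> K" "n \<in> N" using x by auto
    have C0: "C \<ge> 0" unfolding C_def by (intro mult_nonneg_nonneg prod_nonneg) auto
    show ?thesis
    proof (cases "\<forall>s\<in>J. sg (cf k (G s)) (xf n (F s)) \<noteq> 0")
      case False
      then have "(\<Prod>s\<in>J. sg (cf k (G s)) (xf n (F s))) = 0" using finJ by auto
      then have "st F G x = 0" unfolding kn st_def prod.case by (simp only: of_real_0 mult_zero_left)
      then show ?thesis using C0 by simp
    next
      case True
      have le1: "\<bar>\<Prod>s\<in>J. sg (cf k (G s)) (xf n (F s))\<bar> \<le> 1"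
        unfolding abs_prod by (intro prod_le_1) (auto simp: abs_sg_le_1)
      have "norm (st F G x) = \<bar>\<Prod>s\<in>J. sg (cf k (G s)) (xf n (F s))\<bar> * norm (w (k, n))"
        by (simp only: st_def kn prod.case norm_mult norm_of_real)
      also have "\<dots> \<le> 1 * norm (w (k, n))" by (intro mult_right_mono le1) auto
      also have "norm (w (k, n)) \<le> M * exp (- \<beta> * (\<Sum>j\<in>J. (of_rat (k j) + c j) * (of_rat (n j) - \<nu> j)))"
        using w_bound[OF kn(2,3)] .
      also have "\<dots> \<le> \<bar>M\<bar> * exp (- \<beta> * (\<Sum>j\<in>J. (of_rat (k j) + c j) * (of_rat (n j) - \<nu> j)))"
        by (intro mult_right_mono) auto
      also have "(\<Sum>j\<in>J. (of_rat (k j) + c j) * (of_rat (n j) - \<nu> j)) = (\<Sum>s\<in>J. cf k (G s) * xf n (F s))"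
        unfolding cf_def xf_def by (rule dual_bases_pairing[OF db finJ])
      also have "\<bar>M\<bar> * exp (- \<beta> * \<dots>) = \<bar>M\<bar> * (\<Prod>s\<in>J. exp (- \<beta> * (cf k (G s) * xf n (F s))))"
        using finJ by (simp add: exp_sum[symmetric] sum_distrib_left)
      also have "\<dots> \<le> \<bar>M\<bar> * (\<Prod>s\<in>J. exp (\<beta> * \<delta> / 2 * (\<bar>rdot J c (G s)\<bar> + \<bar>rdot J \<nu> (F s)\<bar>)) * h (\<psi> x s))"
      proof (intro mult_left_mono prod_mono conjI)
        fix s assume s: "s \<in> J"
        let ?c = "\<bar>cf k (G s)\<bar>" and ?x = "\<bar>xf n (F s)\<bar>"
        have nn: "cf k (G s) * xf n (F s) = ?c * ?x"
          using sg_nonzero_imp[of "cf k (G s)" "xf n (F s)"] True s by (simp add: abs_mult[symmetric])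
        have "?c * ?x \<ge> \<delta> * ?x" "?c * ?x \<ge> ?c * \<delta>"
          using \<delta>(2)[OF s kn(2)] \<delta>(3)[OF s kn(3)] by (auto intro!: mult_left_mono mult_right_mono)
        then have big: "?c * ?x \<ge> \<delta> / 2 * (?c + ?x)" by (simp add: algebra_simps)
        have a1: "?c \<ge> \<bar>of_int (m1 k s)\<bar> / ED - \<bar>rdot J c (G s)\<bar>"
        proof -
          have "(of_rat (of_int (m1 k s)) :: real) = of_rat (of_nat (E * D) * dot J k (G s))"
            using m1[OF kn(2) s] by simp
          then have "of_int (m1 k s) = ED * of_rat (dot J k (G s))" by (simp add: of_rat_mult ED_def)
          then have "\<bar>of_int (m1 k s)\<bar> / ED = \<bar>of_rat (dot J k (G s)) :: real\<bar>" using ED by (simp add: abs_mult)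
          then show ?thesis unfolding cf_eq by linarith
        qed
        have a2: "?x \<ge> \<bar>of_int (m2 n s)\<bar> / ED - \<bar>rdot J \<nu> (F s)\<bar>"
        proof -
          have "(of_rat (of_int (m2 n s)) :: real) = of_rat (of_nat (E * D) * dot J (F s) n)"
            using m2[OF kn(3) s] by simp
          then have "of_int (m2 n s) = ED * of_rat (dot J (F s) n)" by (simp add: of_rat_mult ED_def)
          then have "\<bar>of_int (m2 n s)\<bar> / ED = \<bar>of_rat (dot J (F s) n) :: real\<bar>" using ED by (simp add: abs_mult)
          then show ?thesis unfolding xf_eq by linarith
        qed
        have "\<beta> * (?c * ?x) \<ge> \<beta> * (\<delta> / 2 * (?c + ?x))" using big beta by (intro mult_left_mono) auto
        moreover have "\<beta> * (\<delta> / 2 * (?c + ?x)) \<ge> \<beta> * (\<delta> / 2 * ((\<bar>of_int (m1 k s)\<bar> / ED - \<bar>rdot J c (G s)\<bar>) + (\<bar>of_int (m2 n s)\<bar> / ED - \<bar>rdot J \<nu> (F s)\<bar>)))"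
          using a1 a2 beta \<delta>(1) by (intro mult_left_mono add_mono) auto
        moreover have "\<beta> * (\<delta> / 2 * ((\<bar>of_int (m1 k s)\<bar> / ED - \<bar>rdot J c (G s)\<bar>) + (\<bar>of_int (m2 n s)\<bar> / ED - \<bar>rdot J \<nu> (F s)\<bar>)))
            = b * \<bar>of_int (m1 k s)\<bar> + b * \<bar>of_int (m2 n s)\<bar> - \<beta> * \<delta> / 2 * (\<bar>rdot J c (G s)\<bar> + \<bar>rdot J \<nu> (F s)\<bar>)"
          using ED by (simp add: b_def field_simps)
        ultimately have "- \<beta> * (cf k (G s) * xf n (F s)) \<le> \<beta> * \<delta> / 2 * (\<bar>rdot J c (G s)\<bar> + \<bar>rdot J \<nu> (F s)\<bar>) + (- b * \<bar>of_int (m1 k s)\<bar> + - b * \<bar>of_int (m2 n s)\<bar>)"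
          unfolding nn by linarith
        then have "exp (- \<beta> * (cf k (G s) * xf n (F s))) \<le> exp (\<beta> * \<delta> / 2 * (\<bar>rdot J c (G s)\<bar> + \<bar>rdot J \<nu> (F s)\<bar>) + (- b * \<bar>of_int (m1 k s)\<bar> + - b * \<bar>of_int (m2 n s)\<bar>))"
          by simp
        also have "\<dots> = exp (\<beta> * \<delta> / 2 * (\<bar>rdot J c (G s)\<bar> + \<bar>rdot J \<nu> (F s)\<bar>)) * h (\<psi> x s)"
          using s by (simp add: \<psi>_def kn h_def exp_add[symmetric])
        finally show "exp (- \<beta> * (cf k (G s) * xf n (F s))) \<le> exp (\<beta> * \<delta> / 2 * (\<bar>rdot J c (G s)\<bar> + \<bar>rdot J \<nu> (F s)\<bar>)) * h (\<psi> x s)" .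
      qed auto
      also have "\<dots> = C * (\<Prod>s\<in>J. h (\<psi> x s))" by (simp add: C_def prod.distrib)
      also have "\<dots> \<le> C * norm (\<Prod>s\<in>J. h (\<psi> x s))" using C0 by (intro mult_left_mono) auto
      finally show ?thesis by simp
    qed
  qed
  have "(\<lambda>x. norm (st F G x)) summable_on (K \<times> N)"
    by (rule summable_on_comparison_test[OF maj]) (use bound in auto)
  then show ?thesis by (rule Infinite_Sum.abs_summable_summable)
qed

text \<open>
  The reflection in (u l, e i) changes only the slot s0, where it exchanges the two arguments of
  the sign function up to sign.
\<close>

lemma st_vanishes:
  assumes db: "dual_bases J F G" and s0: "s0 \<in> J" and l: "l \<in> J" "F s0 = u l" "p l = Some i"
    and Fi: "\<And>s. s \<in> J \<Longrightarrow> F s i = (if s = s0 then 1 else 0)"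
  shows "infsum (st F G) (K \<times> N) = 0"
proof -
  have i: "i \<in> J" using p_in l by blast
  have uli: "u l i = 1" using u_def[OF l(1)] l(3) p_ne[OF l(1)] by auto
  \<comment> \<open>The quadratic form here sends (k, n) to the pairing of k and n. Its value at the
    vector (u l, e_i) is \<open>u l i = 1\<close>, so the reflection in this vector has no
    denominator, and t is an integer on the lattices.\<close>
  define \<phi> where "\<phi> = (\<lambda>(k, n). let t = k i + dot J (u l) n in (\<lambda>j. k j - t * u l j, n(i := n i - t)))"
  have upd: "n(i := n i - t) = (\<lambda>j. n j - t * (if j = i then 1 else 0))" for n :: "'j \<Rightarrow> rat" and t
    by auto
  have dupd: "dot J f (n(i := n i - t)) = dot J f n - t * f i" for f n t
    unfolding upd dot_diff_right dot_scale_right using dot_unit[OF finJ i, of f 1] by simp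
  have mem: "\<phi> x \<in> K \<times> N" if x: "x \<in> K \<times> N" for x
  proof -
    obtain k n where kn: "x = (k, n)" "k \<in> K" "n \<in> N" using x by auto
    have "k i + dot J (u l) n \<in> \<int>" using K_int[OF kn(2)] u_N[OF kn(3) l(1)] by (intro Ints_add)
    then show ?thesis using K_u[OF kn(2) l(1)] N_e[OF kn(3) i] by (simp add: kn(1) \<phi>_def Let_def)
  qed
  have invol: "\<phi> (\<phi> x) = x" for x
  proof -
    obtain k n where kn: "x = (k, n)" by force
    define t where "t = k i + dot J (u l) n"
    have p1: "\<phi> x = (\<lambda>j. k j - t * u l j, n(i := n i - t))" by (simp add: kn \<phi>_def Let_def t_def)
    have "(k i - t * u l i) + dot J (u l) (n(i := n i - t)) = - t" unfolding dupd uli by (simp add: t_def)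
    then have "\<phi> (\<phi> x) = (\<lambda>j. (k j - t * u l j) - - t * u l j, (n(i := n i - t))(i := (n(i := n i - t)) i - - t))"
      unfolding p1 by (simp add: \<phi>_def)
    then show ?thesis by (simp add: kn)
  qed
  \<comment> \<open>Only the form in slot s0 involves the i-th coordinate, so the dual vector of
    that slot is e_i.\<close>
  have G0: "dot J k (G s0) = k i" for k
  proof -
    have "G s0 j = (if j = i then 1 else 0)" if j: "j \<in> J" for j
    proof -
      have "(\<Sum>s\<in>J. G s j * F s i) = (if j = i then 1 else 0)" using db i j unfolding dual_bases_def by blast
      moreover have "(\<Sum>s\<in>J. G s j * F s i) = (\<Sum>s\<in>J. if s = s0 then G s j else 0)"
        by (intro sum.cong refl) (simp add: Fi)
      ultimately show ?thesis using s0 finJ by simp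
    qed
    then have "dot J k (G s0) = dot J k (\<lambda>j. if j = i then 1 else 0)" by (simp add: dot_def)
    then show ?thesis using dot_unit[OF finJ i, of k 1] by simp
  qed
  have Gu: "dot J (u l) (G s) = (if s = s0 then 1 else 0)" if "s \<in> J" for s
    using db s0 that unfolding dual_bases_def l(2)[symmetric] by auto
  have cG0: "rdot J c (G s0) = c i"
  proof -
    have "G s0 j = (if j = i then 1 else 0)" if j: "j \<in> J" for j
      using G0[of "\<lambda>x. if x = j then 1 else 0"] dot_unit[OF finJ j, of "G s0" 1] by (simp add: dot_commute)
    then have "rdot J c (G s0) = rdot J c (\<lambda>j. if j = i then 1 else 0)"
      unfolding rdot_def by (intro sum.cong refl) simp
    then show ?thesis using finJ i by (simp add: rdot_def if_distrib cong: if_cong)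
  qed
  have anti: "st F G (\<phi> x) = - st F G x" if x: "x \<in> K \<times> N" for x
  proof -
    obtain k n where kn: "x = (k, n)" "k \<in> K" "n \<in> N" using x by auto
    define t where "t = k i + dot J (u l) n"
    define k' where "k' = (\<lambda>j. k j - t * u l j)"
    define n' where "n' = n(i := n i - t)"
    have p1: "\<phi> x = (k', n')" by (simp add: kn \<phi>_def Let_def t_def k'_def n'_def)
    have other: "cf k' (G s) = cf k (G s)" "xf n' (F s) = xf n (F s)" if "s \<in> J" "s \<noteq> s0" for s
      using that Gu Fi unfolding cf_eq xf_eq k'_def n'_def dupd dot_diff_left dot_scale_left by auto
    \<comment> \<open>By \<open>u_c\<close> both arguments of slot s0 carry the shift
      \<open>c i\<close>; this is what allows the reflection to exchange them.\<close>
    have c1: "cf k (G s0) = of_rat (k i) + c i" unfolding cf_eq G0 cG0 ..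
    have x1: "xf n (F s0) = of_rat (dot J (u l) n) - c i" unfolding xf_eq l(2) u_c[OF l(1,3)] ..
    have c2: "cf k' (G s0) = - xf n (F s0)"
      unfolding cf_eq cG0 k'_def dot_diff_left dot_scale_left G0 Gu[OF s0] x1 by (simp add: t_def uli of_rat_add of_rat_minus)
    have x2: "xf n' (F s0) = - cf k (G s0)"
      unfolding xf_eq n'_def dupd l(2) uli u_c[OF l(1,3)] c1 by (simp add: t_def of_rat_add of_rat_minus)
    have "(\<Prod>s\<in>J. sg (cf k' (G s)) (xf n' (F s))) = sg (cf k' (G s0)) (xf n' (F s0)) * (\<Prod>s\<in>J - {s0}. sg (cf k' (G s)) (xf n' (F s)))"
      by (rule prod.remove[OF finJ s0])
    also have "(\<Prod>s\<in>J - {s0}. sg (cf k' (G s)) (xf n' (F s))) = (\<Prod>s\<in>J - {s0}. sg (cf k (G s)) (xf n (F s)))"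
      by (intro prod.cong refl) (simp add: other)
    also have "sg (cf k' (G s0)) (xf n' (F s0)) = - sg (cf k (G s0)) (xf n (F s0))"
      unfolding c2 x2 sg_uminus by (simp add: sg_commute)
    finally have "(\<Prod>s\<in>J. sg (cf k' (G s)) (xf n' (F s))) = - (\<Prod>s\<in>J. sg (cf k (G s)) (xf n (F s)))"
      unfolding prod.remove[OF finJ s0, of "\<lambda>s. sg (cf k (G s)) (xf n (F s))"] by simp
    moreover have "w (k', n') = w (k, n)" unfolding k'_def n'_def by (rule w_inv[OF kn(2,3) l(1,3) t_def])
    ultimately show ?thesis unfolding p1 unfolding kn st_def prod.case by (simp only: of_real_minus mult_minus_left)
  qed
  have bij: "bij_betw \<phi> (K \<times> N) (K \<times> N)"
    by (rule bij_betw_byWitness[where f' = \<phi>]) (use invol mem in blast)+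
  have "infsum (st F G) (K \<times> N) = infsum (\<lambda>x. st F G (\<phi> x)) (K \<times> N)"
    by (rule infsum_reindex_bij_betw[OF bij, symmetric])
  also have "\<dots> = infsum (\<lambda>x. - st F G x) (K \<times> N)" by (intro infsum_cong anti)
  also have "\<dots> = - infsum (st F G) (K \<times> N)" by (rule infsum_uminus)
  finally show ?thesis by simp
qed

definition forms :: "'j set \<Rightarrow> 'j \<Rightarrow> 'j \<Rightarrow> rat" where
  "forms R s = (if s \<in> R then u s else (\<lambda>j. if j = s then 1 else 0))"

lemma forms_admissible: "R \<subseteq> J \<Longrightarrow> admissible (forms R)"
  by (auto simp: admissible_def forms_def)

text \<open>Diagonal dominance. In a row the diagonal entry is at least 2 and the only other entry
  is 1, so the dual vector g cannot attain its maximal absolute value, which is at least 1, at an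
  index in R unless that value is 0. Outside R it is a unit vector, hence |g| <= 1 and the
  coefficient is at least 2 - 1. Positivity lets the surviving term of the exchange enter with sign
  +1.\<close>

lemma pivot_coefficient_pos:
  assumes db: "dual_bases J (forms R) G" and R: "R \<subseteq> J" and j0: "j0 \<in> J" "j0 \<notin> R"
  shows "dot J (u j0) (G j0) > 0"
proof -
  define g where "g = G j0"
  have fg: "dot J (forms R s) g = (if s = j0 then 1 else 0)" if "s \<in> J" for s
    using db that j0(1) unfolding dual_bases_def g_def by auto
  have out: "g s = (if s = j0 then 1 else 0)" if "s \<in> J" "s \<notin> R" for s
    using fg[OF that(1)] that dot_unit[OF finJ that(1), of g 1] by (simp add: forms_def dot_commute)
  have du: "dot J (u l) g = of_nat (a l) * g l + (case p l of None \<Rightarrow> 0 | Some i \<Rightarrow> g i)" if l: "l \<in> J" for l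
  proof -
    have "dot J (u l) g = dot J g (\<lambda>j. (if j = l then of_nat (a l) else 0)) + dot J g (\<lambda>j. if p l = Some j then 1 else 0)"
      unfolding dot_add_right[symmetric] dot_commute[of J "u l"] using p_ne[OF l]
      by (intro arg_cong[where f = "dot J g"]) (auto simp: u_def[OF l])
    also have "dot J g (\<lambda>j. if p l = Some j then 1 else 0) = (case p l of None \<Rightarrow> 0 | Some i \<Rightarrow> g i)"
    proof (cases "p l")
      case None then show ?thesis by (simp add: dot_def)
    next
      case (Some i)
      then have "(\<lambda>j. if p l = Some j then 1 else 0) = (\<lambda>j. if j = i then 1 else (0::rat))" by auto
      then show ?thesis using dot_unit[OF finJ p_in[OF l Some], of g 1] Some by simp
    qed
    finally show ?thesis by (simp add: dot_unit[OF finJ l])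
  qed
  have inR: "of_nat (a s) * g s + (case p s of None \<Rightarrow> 0 | Some i \<Rightarrow> g i) = 0" if "s \<in> R" for s
    using fg[of s] du[of s] that R j0(2) by (auto simp: forms_def split: if_splits)
  define m where "m = Max ((\<lambda>s. \<bar>g s\<bar>) ` J)"
  have mle: "\<bar>g s\<bar> \<le> m" if "s \<in> J" for s unfolding m_def using that finJ by auto
  have "m \<in> (\<lambda>s. \<bar>g s\<bar>) ` J" unfolding m_def using finJ j0(1) by (intro Max_in) auto
  then obtain s where s: "s \<in> J" "m = \<bar>g s\<bar>" by blast
  have m1: "m \<ge> 1" using mle[OF j0(1)] out[OF j0] by simp
  have pv: "\<bar>case p l of None \<Rightarrow> 0 | Some i \<Rightarrow> g i\<bar> \<le> m" if "l \<in> J" for l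
    using p_in[OF that] mle m1 by (auto split: option.split)
  have "m \<le> 1"
  proof (cases "s \<in> R")
    case False
    then show ?thesis using out[OF s(1) False] s(2) by (auto split: if_splits)
  next
    case True
    have "of_nat (a s) * \<bar>g s\<bar> = \<bar>case p s of None \<Rightarrow> 0 | Some i \<Rightarrow> g i\<bar>"
      using inR[OF True] by (metis abs_minus_cancel abs_mult abs_of_nat add_eq_0_iff)
    then have "of_nat (a s) * m \<le> m" using pv[OF s(1)] s(2) by simp
    moreover have "of_nat (a s) * m \<ge> 2 * m" using a2[OF s(1)] m1 by (intro mult_right_mono) auto
    ultimately show ?thesis using m1 by linarith
  qed
  then have "(case p j0 of None \<Rightarrow> 0 | Some i \<Rightarrow> g i) \<ge> -1" using pv[OF j0(1)] by linarith
  moreover have "of_nat (a j0) \<ge> (2::rat)" using a2[OF j0(1)] by simp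
  ultimately show ?thesis using du[OF j0(1)] out[OF j0] unfolding g_def[symmetric] by simp
qed

text \<open>\<open>sg_circuit\<close> summed over the lattices, where the coefficients r are those
  of the new row in the basis F. The finite sum may be taken out because every exchanged system is
  summable again, which \<open>F'\<close> secures.\<close>

lemma st_exchange_sum:
  assumes db: "dual_bases J F G" and F: "admissible F" and ul: "l \<in> J"
    and nz: "i0 \<in> J" "dot J (u l) (G i0) \<noteq> 0"
    and F': "\<And>i. i \<in> J \<Longrightarrow> admissible (F(i := u l))"
  shows "infsum (st F G) (K \<times> N) = (\<Sum>i\<in>{i\<in>J. dot J (u l) (G i) \<noteq> 0}. of_rat (sgn (dot J (u l) (G i))) *
      infsum (st (F(i := u l)) (exch i (\<lambda>s. dot J (u l) (G s)) G)) (K \<times> N))"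
proof -
  define r where "r s = dot J (u l) (G s)" for s
  have r: "r = (\<lambda>s. dot J (u l) (G s))" by (simp add: r_def fun_eq_iff)
  let ?S = "{i\<in>J. r i \<noteq> 0}"
  have dbi: "dual_bases J (F(i := u l)) (exch i r G)" if "i \<in> ?S" for i
    unfolding r using that by (intro dual_bases_exchange db finJ) (auto simp: r_def)
  have srat: "of_rat (sgn x) = complex_of_real (sgn (of_rat x))" for x
    by (simp add: sgn_if)
  have pw: "st F G x = (\<Sum>i\<in>?S. of_rat (sgn (r i)) * st (F(i := u l)) (exch i r G) x)" if x: "x \<in> K \<times> N" for x
  proof -
    obtain k n where kn: "x = (k, n)" "k \<in> K" "n \<in> N" using x by auto
    define C where "C s = cf k (G s)" for s
    define X where "X s = xf n (F s)" for s
    have Ci: "cf k (exch i r G s) = (if s = i then C i / of_rat (r i) else C s - of_rat (r s) / of_rat (r i) * C i)" for i s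
      unfolding cf_def rdot_exch C_def ..
    have U: "xf n (u l) = (\<Sum>s\<in>J. of_rat (r s) * X s)"
    proof -
      have "xf n (u l) = rdot J (\<lambda>j. of_rat (n j) - \<nu> j) (\<lambda>j. \<Sum>s\<in>J. r s * F s j)"
        unfolding xf_def rdot_def
      proof (intro sum.cong refl)
        fix j assume j: "j \<in> J"
        show "(of_rat (n j) - \<nu> j) * of_rat (u l j) = (of_rat (n j) - \<nu> j) * of_rat (\<Sum>s\<in>J. r s * F s j)"
          unfolding r_def by (simp only: dual_bases_expand(1)[OF db finJ j, of "u l", symmetric])
      qed
      also have "\<dots> = (\<Sum>s\<in>J. of_rat (r s) * X s)"
        by (simp add: rdot_sum_right[OF finJ] rdot_scale_right X_def xf_def)
      finally show ?thesis .
    qed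
    have circ: "(\<Prod>s\<in>J. sg (C s) (X s)) = (\<Sum>i\<in>{i\<in>J. of_rat (r i) \<noteq> (0::real)}. sgn (of_rat (r i)) *
      (\<Prod>s\<in>J. if s = i then sg (C i / of_rat (r i)) (\<Sum>s\<in>J. of_rat (r s) * X s) else sg (C s - of_rat (r s) / of_rat (r i) * C i) (X s)))"
    proof (rule sg_circuit[OF finJ nz(1)])
      show "of_rat (r i0) \<noteq> (0::real)" using nz(2) by (simp add: r_def)
      show "C s \<noteq> 0" "X s \<noteq> 0" if "s \<in> J" for s
        unfolding C_def X_def using st_nonzero[OF db F that] kn by auto
      show "C s - of_rat (r s) / of_rat (r i) * C i \<noteq> 0" if "i \<in> J" "s \<in> J" "of_rat (r i) \<noteq> (0::real)" "s \<noteq> i" for i s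
      proof -
        have "cf k (exch i r G s) \<noteq> 0"
          by (rule st_nonzero(1)[OF dbi F'[OF that(1)] that(2) kn(2)]) (use that in auto)
        then show ?thesis using that by (simp add: Ci)
      qed
    qed
    have "(\<Prod>s\<in>J. sg (C s) (X s)) = (\<Sum>i\<in>?S. sgn (of_rat (r i)) *
       (\<Prod>s\<in>J. sg (cf k (exch i r G s)) (xf n ((F(i := u l)) s))))"
      unfolding circ
      by (intro sum.cong arg_cong2[of _ _ _ _ "(*)"] prod.cong refl) (auto simp: Ci X_def U)
    then show ?thesis unfolding kn st_def prod.case C_def[symmetric] X_def[symmetric]
      by (simp add: sum_distrib_left sum_distrib_right srat mult_ac)
  qed
  have "infsum (st F G) (K \<times> N) = infsum (\<lambda>x. \<Sum>i\<in>?S. of_rat (sgn (r i)) * st (F(i := u l)) (exch i r G) x) (K \<times> N)"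
    by (intro infsum_cong pw)
  also have "\<dots> = (\<Sum>i\<in>?S. infsum (\<lambda>x. of_rat (sgn (r i)) * st (F(i := u l)) (exch i r G) x) (K \<times> N))"
  proof (rule infsumI, rule has_sum_finite_sum)
    fix i assume i: "i \<in> ?S"
    then show "((\<lambda>x. of_rat (sgn (r i)) * st (F(i := u l)) (exch i r G) x) has_sum
      infsum (\<lambda>x. of_rat (sgn (r i)) * st (F(i := u l)) (exch i r G) x) (K \<times> N)) (K \<times> N)"
      by (intro has_sum_infsum summable_on_cmult_right st_summable dbi F') auto
  qed (use finJ in simp)
  also have "\<dots> = (\<Sum>i\<in>?S. of_rat (sgn (r i)) * infsum (st (F(i := u l)) (exch i r G)) (K \<times> N))"
    by (intro sum.cong refl infsum_cmult_right st_summable dbi F') auto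
  finally show ?thesis unfolding r .
qed

text \<open>Row j0 goes into slot j0. If another slot i has a nonzero coefficient, the i-th
  coordinate of row j0 shows that some exchanged row l, possibly j0 itself, points to i. Once the
  form in slot i is overwritten, l is the only remaining form that involves this coordinate, since
  no two rows point to the same variable. So \<open>st_vanishes\<close> removes the term.\<close>

lemma path:
  assumes "finite R" "R \<subseteq> J"
  shows "\<exists>G. dual_bases J (forms R) G \<and>
     infsum (st (forms {}) (\<lambda>s j. if j = s then 1 else 0)) (K \<times> N) = infsum (st (forms R) G) (K \<times> N)"
  using assms
proof (induction R rule: finite_induct)
  case empty
  have "dual_bases J (forms {}) (\<lambda>s j. if j = s then 1 else 0)"
    unfolding dual_bases_def
  proof (intro conjI ballI)
    fix s t assume "s \<in> J" "t \<in> J"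
    then show "dot J (forms {} s) (\<lambda>j. if j = t then 1 else 0) = (if s = t then 1 else 0)"
      using dot_unit[OF finJ, of t "forms {} s" 1] by (simp add: forms_def eq_commute[of t])
  next
    fix i j assume ij: "i \<in> J" "j \<in> J"
    have "(\<Sum>s\<in>J. (if i = s then 1 else 0) * forms {} s j) = (\<Sum>s\<in>J. if i = s then (if j = i then 1 else 0) else 0)"
      by (intro sum.cong refl) (simp add: forms_def)
    then show "(\<Sum>s\<in>J. (if i = s then 1 else 0) * forms {} s j) = (if i = j then 1 else 0)"
      using finJ ij by (simp add: sum.delta)
  qed
  then show ?case by blast
next
  case (insert j0 R)
  then obtain G where G: "dual_bases J (forms R) G"
    "infsum (st (forms {}) (\<lambda>s j. if j = s then 1 else 0)) (K \<times> N) = infsum (st (forms R) G) (K \<times> N)" by blast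
  have j0: "j0 \<in> J" "j0 \<notin> R" and R: "R \<subseteq> J" using insert.prems insert.hyps by auto
  define r where "r s = dot J (u j0) (G s)" for s
  have r: "r = (\<lambda>s. dot J (u j0) (G s))" by (simp add: r_def fun_eq_iff)
  let ?S = "{i\<in>J. r i \<noteq> 0}"
  have pos: "r j0 > 0" unfolding r_def by (rule pivot_coefficient_pos[OF G(1) R j0])
  have F': "admissible ((forms R)(i := u j0))" if "i \<in> J" for i
    using forms_admissible[OF R] j0(1) by (auto simp: admissible_def)
  have dbi: "dual_bases J ((forms R)(i := u j0)) (exch i r G)" if "i \<in> ?S" for i
    unfolding r using that by (intro dual_bases_exchange G(1) finJ) (auto simp: r_def)
  have fi: "forms R s i = (if s = i then (if i \<in> R then of_nat (a i) else 1) else if s \<in> R \<and> p s = Some i then 1 else 0)"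
    if "s \<in> J" "i \<in> J" for s i
    using that by (auto simp: forms_def u_def)
  have ui: "u j0 i = (if p j0 = Some i then 1 else 0)" if "i \<noteq> j0" for i
    using that u_def[OF j0(1)] by auto
  have zero: "infsum (st ((forms R)(i := u j0)) (exch i r G)) (K \<times> N) = 0" if i: "i \<in> ?S" "i \<noteq> j0" for i
  proof -
    have iJ: "i \<in> J" using i by simp
    have ex: "\<exists>l\<in>insert j0 R. p l = Some i"
    proof (rule ccontr)
      assume n: "\<not> (\<exists>l\<in>insert j0 R. p l = Some i)"
      have "u j0 i = (\<Sum>s\<in>J. r s * forms R s i)"
        unfolding r_def by (rule dual_bases_expand(1)[OF G(1) finJ iJ])
      also have "\<dots> = (\<Sum>s\<in>J. if s = i then r i * (if i \<in> R then of_nat (a i) else 1) else 0)"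
        using n iJ by (intro sum.cong refl) (auto simp: fi)
      also have "\<dots> = r i * (if i \<in> R then of_nat (a i) else 1)" using finJ iJ by simp
      finally have "r i * (if i \<in> R then of_nat (a i) else 1) = 0" using ui[OF i(2)] n by simp
      moreover have "of_nat (a i) \<noteq> (0::rat)" using a2[OF iJ] by simp
      ultimately show False using i by (auto split: if_splits)
    qed
    then obtain l where l: "l \<in> insert j0 R" "p l = Some i" by blast
    have lJ: "l \<in> J" using l R j0 by auto
    have li: "l \<noteq> i" using p_ne[OF lJ] l(2) by auto
    \<comment> \<open>The slot in which row l stands after the exchange: row j0 has just been
      written into slot i, any other row is in its own slot.\<close>
    define s0 where "s0 = (if l = j0 then i else l)"
    show ?thesis
    proof (rule st_vanishes[OF dbi[OF i(1)], of s0 l i])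
      show "s0 \<in> J" using lJ iJ by (simp add: s0_def)
      show "((forms R)(i := u j0)) s0 = u l" using l(1) li by (auto simp: s0_def forms_def)
      fix s assume s: "s \<in> J"
      show "((forms R)(i := u j0)) s i = (if s = s0 then 1 else 0)"
      proof (cases "s = i")
        case True
        have "(p j0 = Some i) = (l = j0)" using p_inj[OF j0(1) lJ _ l(2)] l(2) by auto
        then show ?thesis using True ui[OF i(2)[symmetric, THEN not_sym]] li by (auto simp: s0_def)
      next
        case False
        have "(s \<in> R \<and> p s = Some i) = (s = s0)"
        proof
          assume h: "s \<in> R \<and> p s = Some i"
          then have "s = l" using p_inj[OF s lJ _ l(2)] by blast
          then show "s = s0" using h j0(2) by (auto simp: s0_def)
        next
          assume "s = s0"
          then have "s = l" "l \<noteq> j0" using False by (auto simp: s0_def split: if_splits)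
          then show "s \<in> R \<and> p s = Some i" using l by auto
        qed
        then show ?thesis using False fi[OF s iJ] by simp
      qed
    qed (use lJ l in auto)
  qed
  have Fj0: "(forms R)(j0 := u j0) = forms (insert j0 R)" by (auto simp: forms_def)
  have j0S: "j0 \<in> ?S" using j0(1) pos by simp
  have "infsum (st (forms R) G) (K \<times> N) = (\<Sum>i\<in>?S. of_rat (sgn (r i)) * infsum (st ((forms R)(i := u j0)) (exch i r G)) (K \<times> N))"
    unfolding r using pos unfolding r_def
    by (intro st_exchange_sum[OF G(1) forms_admissible[OF R] j0(1) j0(1)] F') auto
  also have "\<dots> = of_rat (sgn (r j0)) * infsum (st ((forms R)(j0 := u j0)) (exch j0 r G)) (K \<times> N)"
    using zero finJ by (subst sum.remove[OF _ j0S]) (auto intro!: sum.neutral)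
  also have "\<dots> = infsum (st (forms (insert j0 R)) (exch j0 r G)) (K \<times> N)" using pos by (simp add: Fj0)
  finally show ?case using G(2) dbi[OF j0S] unfolding Fj0 by (intro exI[of _ "exch j0 r G"]) simp
qed

end

section \<open>Theta quotients and finite groups\<close>

definition e1 :: "complex \<Rightarrow> complex" where
  "e1 x = exp (2 * of_real pi * \<i> * x)"

lemma e1_0 [simp]: "e1 0 = 1" by (simp add: e1_def)
lemma e1_add: "e1 (x + y) = e1 x * e1 y" by (simp add: e1_def exp_add ring_distribs)
lemma e1_minus: "e1 (- x) = inverse (e1 x)" by (simp add: e1_def exp_minus)
lemma e1_nonzero [simp]: "e1 x \<noteq> 0" by (simp add: e1_def)
lemma e1_sum: "finite A \<Longrightarrow> e1 (sum f A) = prod (\<lambda>x. e1 (f x)) A"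
  by (simp add: e1_def sum_distrib_left exp_sum)
lemma norm_e1: "norm (e1 x) = exp (- 2 * pi * Im x)" by (simp add: e1_def)
lemma e1_of_nat_mult: "e1 (of_nat n * x) = e1 x ^ n"
  by (simp add: e1_def exp_of_nat_mult[symmetric] mult_ac)
lemma e1_of_int_mult: "e1 (of_int n * x) = e1 x powi n"
  by (cases n rule: int_cases2) (simp_all add: e1_of_nat_mult power_int_minus e1_minus)
lemma e1_eq_1_iff: "e1 x = 1 \<longleftrightarrow> x \<in> \<int>"
proof
  assume "e1 x = 1"
  then obtain n :: int where "Re (2 * of_real pi * \<i> * x) = 0" "Im (2 * of_real pi * \<i> * x) = of_int (2 * n) * pi"
    unfolding e1_def exp_eq_1 by blast
  then have "x = of_int n" by (simp add: complex_eq_iff)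
  then show "x \<in> \<int>" by simp
next
  assume "x \<in> \<int>"
  then obtain n where "x = of_int n" by (elim Ints_cases)
  moreover have "e1 1 = 1" by (simp add: e1_def exp_eq_1)
  ultimately show "e1 x = 1" using e1_of_int_mult[of n 1] by simp
qed
lemma e1_of_int [simp]: "e1 (of_int n) = 1" by (simp add: e1_eq_1_iff)
lemma e1_holomorphic [holomorphic_intros]: "f holomorphic_on S \<Longrightarrow> (\<lambda>x. e1 (f x)) holomorphic_on S"
  unfolding e1_def by (intro holomorphic_intros)

lemma norm_nome: "Im \<tau> > 0 \<Longrightarrow> norm (e1 \<tau>) < 1"
  by (simp add: norm_e1)

lemma Theta_eq:
  assumes "Im \<tau> > 0"
  shows "Theta \<nu> \<tau> = \<i> * e1 (\<tau> / 8) * qpoch (e1 \<tau>) 1 * (exp (- (\<i> * of_real pi * \<nu>)) * theta_prod (e1 \<tau>) (e1 \<nu>))"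
proof -
  note c = convergent_prod_qpoch[OF norm_nome[OF assms]]
  have c1: "convergent_prod (\<lambda>n. 1 - e1 \<tau> ^ Suc n)" using c[of 1] by (simp only: mult_1_right)
  have "prodinf (\<lambda>n. (1 - e1 \<tau> ^ Suc n) * (1 - e1 \<tau> ^ Suc n * e1 \<nu>) * (1 - e1 \<tau> ^ Suc n * inverse (e1 \<nu>))) =
     qpoch (e1 \<tau>) 1 * qpoch (e1 \<tau>) (e1 \<nu>) * qpoch (e1 \<tau>) (inverse (e1 \<nu>))"
    unfolding qpoch_def mult_1_right
    by (subst prodinf_mult[OF c1 c], subst prodinf_mult[OF convergent_prod_mult[OF c1 c] c]) (rule refl)
  then show ?thesis
    unfolding Theta_def Let_def theta_prod_def e1_def[symmetric]
    by (simp only: mult_ac) (simp add: e1_def mult_ac)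
qed

lemma Theta_holomorphic [holomorphic_intros]:
  assumes "Im \<tau> > 0" "f holomorphic_on S"
  shows "(\<lambda>x. Theta (f x) \<tau>) holomorphic_on S"
proof -
  have h: "qpoch (e1 \<tau>) holomorphic_on UNIV" by (rule qpoch_holomorphic[OF norm_nome[OF assms(1)]])
  have h2: "(\<lambda>x. qpoch (e1 \<tau>) (g x)) holomorphic_on S" if "g holomorphic_on S" for g
    using holomorphic_on_compose_gen[OF that h] by (simp add: o_def)
  then show ?thesis
    unfolding Theta_eq[OF assms(1)] theta_prod_def by (intro holomorphic_intros h2 assms) auto
qed

lemma qpoch_1_nonzero:
  assumes "norm q < 1"
  shows "qpoch q 1 \<noteq> 0"
proof (rule qpoch_nonzero[OF assms])
  fix n show "q ^ Suc n * 1 \<noteq> 1"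
  proof
    assume "q ^ Suc n * 1 = 1"
    then have "norm q ^ Suc n = 1" by (metis norm_power norm_one mult_1_right)
    then show False using power_Suc_less_one[of "norm q" n] assms by (cases "q = 0") simp_all
  qed
qed

lemma Theta_nonzero:
  assumes "Im \<tau> > 0" "Im \<nu> / Im \<tau> \<notin> \<int>"
  shows "Theta \<nu> \<tau> \<noteq> 0"
proof -
  have "e1 \<nu> * e1 \<tau> powi p \<noteq> 1" for p :: int
  proof
    assume "e1 \<nu> * e1 \<tau> powi p = 1"
    then have "e1 (\<nu> + of_int p * \<tau>) = 1" by (simp add: e1_add e1_of_int_mult)
    then obtain n where "\<nu> + of_int p * \<tau> = of_int n" unfolding e1_eq_1_iff by (elim Ints_cases)
    then have "Im (\<nu> + of_int p * \<tau>) = Im (of_int n)" by (simp only:)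
    then have "Im (\<nu> + of_int p * \<tau>) = 0" by simp
    then have "Im \<nu> / Im \<tau> = of_int (- p)" using assms(1) by (simp add: field_simps)
    then show False using assms(2) by (metis Ints_of_int)
  qed
  then show ?thesis
    by (simp add: Theta_eq[OF assms(1)] qpoch_1_nonzero theta_prod_nonzero norm_nome[OF assms(1)])
qed

lemma Theta_lattice:
  assumes "Im \<tau> > 0"
  shows "Theta (of_int l * \<tau> + of_int k) \<tau> = 0"
proof -
  have "e1 (of_int l * \<tau> + of_int k) = e1 \<tau> powi l" by (simp add: e1_add e1_of_int_mult)
  then show ?thesis
    by (simp add: Theta_eq[OF assms] theta_prod_eq_0[OF norm_nome[OF assms] e1_nonzero])
qed

lemma Theta_uminus:
  assumes "Im \<tau> > 0"
  shows "Theta (- \<nu>) \<tau> = - Theta \<nu> \<tau>"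
proof -
  have "theta_prod q (inverse x) = - inverse x * theta_prod q x" if "x \<noteq> 0" for q x
    using that by (simp add: theta_prod_def field_simps)
  then have "theta_prod (e1 \<tau>) (e1 (- \<nu>)) = - inverse (e1 \<nu>) * theta_prod (e1 \<tau>) (e1 \<nu>)"
    by (simp add: e1_minus)
  moreover have "exp (\<i> * of_real pi * \<nu>) * inverse (e1 \<nu>) = exp (- (\<i> * of_real pi * \<nu>))"
    by (simp add: e1_def flip: exp_minus exp_add) (simp add: algebra_simps)
  ultimately have "exp (- (\<i> * of_real pi * (- \<nu>))) * theta_prod (e1 \<tau>) (e1 (- \<nu>)) =
    - (exp (- (\<i> * of_real pi * \<nu>)) * theta_prod (e1 \<tau>) (e1 \<nu>))"
    by (metis (no_types, lifting) minus_mult_left mult.assoc mult_minus_left mult_minus_right minus_minus)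
  then show ?thesis by (simp only: Theta_eq[OF assms] mult_minus_right)
qed

text \<open>Equal to 2 pi / (i Theta'(0)), with the derivative in the first argument: the
  normalising constant of the Kronecker function.\<close>

definition theta_const :: "complex \<Rightarrow> complex" where
  "theta_const \<tau> = inverse (\<i> * e1 (\<tau> / 8) * qpoch (e1 \<tau>) 1 ^ 3)"

lemma theta_const_nonzero: "Im \<tau> > 0 \<Longrightarrow> theta_const \<tau> \<noteq> 0"
  by (simp add: theta_const_def qpoch_1_nonzero norm_nome)

lemma lattice_avoid:
  assumes "Im \<tau> > 0" "Im u / Im \<tau> \<notin> \<int>"
  shows "e1 u * e1 \<tau> powi p \<noteq> 1" "Im (u + of_int p * \<tau>) \<noteq> 0"
proof -
  show *: "Im (u + of_int p * \<tau>) \<noteq> 0"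
  proof
    assume "Im (u + of_int p * \<tau>) = 0"
    then have "Im u / Im \<tau> = of_int (- p)" using assms(1) by (simp add: field_simps)
    then show False using assms(2) by (metis Ints_of_int)
  qed
  have "norm (e1 (u + of_int p * \<tau>)) \<noteq> 1" unfolding norm_e1 using * by auto
  then show "e1 u * e1 \<tau> powi p \<noteq> 1" unfolding e1_add e1_of_int_mult by (metis norm_one)
qed

text \<open>\<open>theta_prod_quotient\<close> with b = \<open>e1 (- a)\<close> and x =
  \<open>e1 u\<close>. The strip for a is the preimage of the annulus |q| < |b| < 1. That expansion
  has u - a in the numerator, and oddness of \<open>Theta\<close> turns it into a - u.\<close>

lemma Theta_quotient:
  assumes \<tau>: "Im \<tau> > 0" and a: "Im a < 0" "- Im a < Im \<tau>" and u: "Im u / Im \<tau> \<notin> \<int>"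
  shows "Theta (a - u) \<tau> / Theta u \<tau> = theta_const \<tau> * Theta a \<tau> *
     (\<Sum>\<^sub>\<infinity>p::int. e1 (- a * of_int p) / (1 - e1 (u + of_int p * \<tau>)))"
proof -
  define K where "K = \<i> * e1 (\<tau> / 8) * qpoch (e1 \<tau>) 1"
  define S where "S = (\<Sum>\<^sub>\<infinity>p::int. e1 (- a * of_int p) / (1 - e1 (u + of_int p * \<tau>)))"
  have K0: "K \<noteq> 0" by (simp add: K_def qpoch_1_nonzero norm_nome \<tau>)
  have S: "S = (\<Sum>\<^sub>\<infinity>p::int. e1 (- a) powi p / (1 - e1 u * e1 \<tau> powi p))"
    unfolding S_def e1_add by (simp only: mult.commute[of "- a"] e1_of_int_mult)
  have n: "norm (e1 \<tau>) < norm (e1 (- a))" "norm (e1 (- a)) < 1"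
    using a mult_strict_left_mono[of "- Im a" "Im \<tau>" pi] by (auto simp: norm_e1 mult_less_0_iff)
  have q: "theta_prod (e1 \<tau>) (e1 (- a) * e1 u) / theta_prod (e1 \<tau>) (e1 u) =
     theta_prod (e1 \<tau>) (e1 (- a)) / qpoch (e1 \<tau>) 1 ^ 2 * S"
    unfolding S by (rule theta_prod_quotient[OF e1_nonzero n e1_nonzero lattice_avoid(1)[OF \<tau> u]])
  have "Theta (u - a) \<tau> / Theta u \<tau> =
     exp (- (\<i> * of_real pi * (u - a))) / exp (- (\<i> * of_real pi * u)) *
       (theta_prod (e1 \<tau>) (e1 (- a) * e1 u) / theta_prod (e1 \<tau>) (e1 u))"
  proof -
    have "e1 (u - a) = e1 (- a) * e1 u" by (simp flip: e1_add)
    then show ?thesis unfolding Theta_eq[OF \<tau>] K_def[symmetric] using K0 by simp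
  qed
  also have "exp (- (\<i> * of_real pi * (u - a))) / exp (- (\<i> * of_real pi * u)) = exp (\<i> * of_real pi * a)"
    by (simp flip: exp_diff add: algebra_simps)
  also have "exp (\<i> * of_real pi * a) * (theta_prod (e1 \<tau>) (e1 (- a) * e1 u) / theta_prod (e1 \<tau>) (e1 u)) =
     (K * (exp (- (\<i> * of_real pi * (- a))) * theta_prod (e1 \<tau>) (e1 (- a)))) / (K * qpoch (e1 \<tau>) 1 ^ 2) * S"
    unfolding q using K0 by simp
  also have "K * (exp (- (\<i> * of_real pi * (- a))) * theta_prod (e1 \<tau>) (e1 (- a))) = Theta (- a) \<tau>"
    by (simp only: Theta_eq[OF \<tau>] K_def)
  also have "Theta (- a) \<tau> / (K * qpoch (e1 \<tau>) 1 ^ 2) * S = - (theta_const \<tau> * Theta a \<tau> * S)"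
    by (simp add: Theta_uminus[OF \<tau>] theta_const_def K_def power3_eq_cube power2_eq_square field_simps)
  finally have "Theta (u - a) \<tau> / Theta u \<tau> = - (theta_const \<tau> * Theta a \<tau> * S)" .
  moreover have "Theta (a - u) \<tau> = - Theta (u - a) \<tau>" using Theta_uminus[OF \<tau>, of "u - a"] by simp
  ultimately show ?thesis by (simp add: S_def)
qed

text \<open>The shift c in (0, 1) separates k >= 0 from k < 0. For Im w > 0 the first half
  contributes with sign +1, for Im w < 0 the second half with sign -1, and both geometric series
  have the same closed form. The version with norms prepares the summation over a second
  index.\<close>

lemma geometric_signed:
  fixes w :: complex
  assumes "Im w \<noteq> 0" "0 < c" "c < 1" "T > 0"
  shows "((\<lambda>k::int. of_real (sg (of_int k + c) (Im w / T)) * e1 (of_int k * w)) has_sum 1 / (1 - e1 w)) UNIV"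
    and "((\<lambda>k::int. norm (of_real (sg (of_int k + c) (Im w / T)) * e1 (of_int k * w))) has_sum \<bar>1 / (1 - norm (e1 w))\<bar>) UNIV"
proof -
  have U: "UNIV = range int \<union> range (\<lambda>n. - int (Suc n))"
  proof -
    have "k \<in> range int \<or> k \<in> range (\<lambda>n. - int (Suc n))" for k
    proof (cases "k \<ge> 0")
      case True then have "k = int (nat k)" by simp then show ?thesis by blast
    next
      case False then have "k = - int (Suc (nat (-k) - 1))" by auto then show ?thesis by blast
    qed
    then show ?thesis by auto
  qed
  have inj: "inj (\<lambda>n. - int (Suc n))" by (auto simp: inj_on_def)
  have split: "(f has_sum s1) UNIV" if "((\<lambda>n. f (int n)) has_sum s1) UNIV" "\<And>n. f (- int (Suc n)) = 0" for f :: "int \<Rightarrow> 'b::banach" and s1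
  proof -
    have "(f has_sum s1) (range int)" using that(1) by (subst has_sum_reindex) (auto simp: o_def)
    then show ?thesis using that(2) by (rule_tac has_sum_cong_neutral[THEN iffD1, rotated -1]) (use U in auto)
  qed
  have split': "(f has_sum s1) UNIV" if "((\<lambda>n. f (- int (Suc n))) has_sum s1) UNIV" "\<And>n. f (int n) = 0" for f :: "int \<Rightarrow> 'b::banach" and s1
  proof -
    have "(f has_sum s1) (range (\<lambda>n. - int (Suc n)))" using that(1) by (subst has_sum_reindex[OF inj]) (auto simp: o_def)
    moreover have "f x = 0" if "x \<notin> range (\<lambda>n. - int (Suc n))" for x
    proof -
      have "x \<in> range int" using U that by blast
      then show ?thesis using \<open>\<And>n. f (int n) = 0\<close> by auto
    qed
    ultimately show ?thesis by (rule_tac has_sum_cong_neutral[THEN iffD1, rotated -1]) auto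
  qed
  have geo: "((\<lambda>n. x ^ n) has_sum 1 / (1 - x)) UNIV" if "norm x < 1" for x :: "'b::{real_normed_field,banach}"
  proof (rule norm_summable_imp_has_sum)
    show "(\<lambda>n. x ^ n) sums (1 / (1 - x))" by (rule geometric_sums[OF that])
    show "summable (\<lambda>n. norm (x ^ n))" using that by (simp add: norm_power summable_geometric)
  qed
  define x where "x = e1 w"
  have x0: "x \<noteq> 0" by (simp add: x_def)
  have sgk: "sgn (of_int (int n) + c) = 1" "sgn (of_int (- int (Suc n)) + c) = -1" for n
    using assms by (auto simp: sgn_if)
  show "((\<lambda>k::int. of_real (sg (of_int k + c) (Im w / T)) * e1 (of_int k * w)) has_sum 1 / (1 - e1 w)) UNIV"
   and "((\<lambda>k::int. norm (of_real (sg (of_int k + c) (Im w / T)) * e1 (of_int k * w))) has_sum \<bar>1 / (1 - norm (e1 w))\<bar>) UNIV"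
  proof (atomize (full), cases "Im w > 0")
    case True
    then have n1: "norm x < 1" by (simp add: x_def norm_e1)
    have s: "sgn (Im w / T) = 1" using True assms by simp
    have v: "of_real (sg (of_int (int n) + c) (Im w / T)) * e1 (of_int (int n) * w) = x ^ n"
        "of_real (sg (of_int (- int (Suc n)) + c) (Im w / T)) * e1 (of_int (- int (Suc n)) * w) = 0" for n
      unfolding sg_def s sgk using e1_of_nat_mult[of n w] by (simp_all add: x_def)
    have v': "norm (of_real (sg (of_int (int n) + c) (Im w / T)) * e1 (of_int (int n) * w)) = norm x ^ n" for n
      unfolding v by (simp add: norm_power)
    show "((\<lambda>k::int. of_real (sg (of_int k + c) (Im w / T)) * e1 (of_int k * w)) has_sum 1 / (1 - e1 w)) UNIV \<and>
      ((\<lambda>k::int. norm (of_real (sg (of_int k + c) (Im w / T)) * e1 (of_int k * w))) has_sum \<bar>1 / (1 - norm (e1 w))\<bar>) UNIV"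
    proof
      show "((\<lambda>k::int. of_real (sg (of_int k + c) (Im w / T)) * e1 (of_int k * w)) has_sum 1 / (1 - e1 w)) UNIV"
        by (rule split) (use geo[OF n1] v in \<open>simp_all only: x_def\<close>)
      have "\<bar>1 / (1 - norm (e1 w))\<bar> = 1 / (1 - norm x)" using n1 by (simp add: x_def)
      then show "((\<lambda>k::int. norm (of_real (sg (of_int k + c) (Im w / T)) * e1 (of_int k * w))) has_sum \<bar>1 / (1 - norm (e1 w))\<bar>) UNIV"
        using geo[of "norm x"] n1 by (intro split) (simp_all only: v' v norm_zero norm_power real_norm_def abs_norm_cancel)
    qed
  next
    case False
    then have neg: "Im w < 0" using assms by simp
    then have n1: "norm x > 1" by (simp add: x_def norm_e1 mult_less_0_iff)
    then have n2: "norm (inverse x) < 1" unfolding norm_inverse inverse_less_1_iff by simp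
    have s: "sgn (Im w / T) = -1" using divide_neg_pos[OF neg assms(4)] by (rule sgn_neg)
    have v: "of_real (sg (of_int (int n) + c) (Im w / T)) * e1 (of_int (int n) * w) = 0"
        "of_real (sg (of_int (- int (Suc n)) + c) (Im w / T)) * e1 (of_int (- int (Suc n)) * w) = - (inverse x * inverse x ^ n)" for n
      unfolding sg_def s sgk e1_of_int_mult power_int_minus power_int_of_nat by (simp_all add: x_def power_inverse del: of_nat_Suc)
    have v': "norm (of_real (sg (of_int (- int (Suc n)) + c) (Im w / T)) * e1 (of_int (- int (Suc n)) * w)) = norm (inverse x) * norm (inverse x) ^ n" for n
      unfolding v by (simp add: norm_mult norm_power)
    show "((\<lambda>k::int. of_real (sg (of_int k + c) (Im w / T)) * e1 (of_int k * w)) has_sum 1 / (1 - e1 w)) UNIV \<and>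
      ((\<lambda>k::int. norm (of_real (sg (of_int k + c) (Im w / T)) * e1 (of_int k * w))) has_sum \<bar>1 / (1 - norm (e1 w))\<bar>) UNIV"
    proof
      have "x \<noteq> 1" using n1 by auto
      then have "1 / (1 - e1 w) = - (inverse x * (1 / (1 - inverse x)))" using x0 by (simp add: x_def field_simps)
      moreover have "((\<lambda>n. - (inverse x * inverse x ^ n)) has_sum - (inverse x * (1 / (1 - inverse x)))) UNIV"
        using has_sum_cmult_right[OF geo[OF n2], of "- inverse x"] by (simp only: mult_minus_left)
      ultimately show "((\<lambda>k::int. of_real (sg (of_int k + c) (Im w / T)) * e1 (of_int k * w)) has_sum 1 / (1 - e1 w)) UNIV"
        by (intro split') (simp_all only: v)
      have "\<bar>1 / (1 - norm (e1 w))\<bar> = norm (inverse x) * (1 / (1 - norm (inverse x)))"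
        unfolding norm_inverse x_def[symmetric] using n1 x0 by (simp add: field_simps)
      moreover have "((\<lambda>n. norm (inverse x) * norm (inverse x) ^ n) has_sum norm (inverse x) * (1 / (1 - norm (inverse x)))) UNIV"
        by (intro has_sum_cmult_right geo) (use n2 in simp)
      ultimately show "((\<lambda>k::int. norm (of_real (sg (of_int k + c) (Im w / T)) * e1 (of_int k * w))) has_sum \<bar>1 / (1 - norm (e1 w))\<bar>) UNIV"
        by (intro split') (simp_all only: v' v norm_zero norm_minus_cancel norm_mult norm_power)
    qed
  qed
qed

section \<open>Double series and sums over finite groups\<close>

lemma complex_of_rat_eq: "complex_of_rat r = complex_of_real (of_rat r)"
  by (cases r) (simp add: of_rat_rat)

lemma Im_of_rat [simp]: "Im (of_rat r) = 0" and Re_of_rat [simp]: "Re (of_rat r) = of_rat r"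
  by (simp_all add: complex_of_rat_eq)

text \<open>Kronecker's series with every denominator expanded. The shift c = - Im a / Im \<tau> is
  chosen because the norm of the exponential is then, up to a constant factor, exp (- 2 pi Im \<tau>
  (k + c) (l + Im u / Im \<tau>)): the two sign arguments reappear in the exponent.\<close>

lemma Theta_quotient_pairs:
  fixes a u \<tau> :: complex
  assumes \<tau>: "Im \<tau> > 0" and a: "Im a < 0" "- Im a < Im \<tau>" and u: "Im u / Im \<tau> \<notin> \<int>"
  defines "t \<equiv> \<lambda>(l::int, k::int). of_real (sg (of_int k - Im a / Im \<tau>) (of_int l + Im u / Im \<tau>)) *
    e1 (- a * of_int l + of_int k * (u + of_int l * \<tau>))"
  shows "(\<lambda>x. norm (t x)) summable_on UNIV"
    and "Theta (a - u) \<tau> / Theta u \<tau> = theta_const \<tau> * Theta a \<tau> * infsum t UNIV"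
proof -
  define c where "c = - Im a / Im \<tau>"
  have c: "0 < c" "c < 1" using \<tau> a by (auto simp: c_def field_simps)
  define w where "w l = u + of_int l * \<tau>" for l :: int
  have Imw: "Im (w l) \<noteq> 0" for l unfolding w_def by (rule lattice_avoid(2)[OF \<tau> u])
  have t: "t (l, k) = e1 (- a * of_int l) * (of_real (sg (of_int k + c) (Im (w l) / Im \<tau>)) * e1 (of_int k * w l))" for l k
  proof -
    have "Im (w l) / Im \<tau> = of_int l + Im u / Im \<tau>" using \<tau> by (simp add: w_def field_simps)
    moreover have "e1 (- a * of_int l + of_int k * w l) = e1 (- a * of_int l) * e1 (of_int k * w l)" by (rule e1_add)
    ultimately show ?thesis by (simp add: t_def c_def w_def)
  qed
  have s1: "((\<lambda>k. t (l, k)) has_sum e1 (- a * of_int l) * (1 / (1 - e1 (w l)))) UNIV" for l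
    unfolding t by (intro has_sum_cmult_right geometric_signed Imw c \<tau>)
  have s2: "((\<lambda>k. norm (t (l, k))) has_sum norm (e1 (- a * of_int l)) * \<bar>1 / (1 - norm (e1 (w l)))\<bar>) UNIV" for l
    unfolding t norm_mult[of "e1 (- a * of_int l)"] by (intro has_sum_cmult_right geometric_signed Imw c \<tau>)
  \<comment> \<open>The sums over k of the norms form a Lerch series again, with the parameters
    replaced by their absolute values.\<close>
  have "(\<lambda>l::int. norm ((of_real (norm (e1 (- a)))::complex) powi l / (1 - of_real (norm (e1 u)) * of_real (norm (e1 \<tau>)) powi l))) summable_on UNIV"
  proof (rule lerch_abs_summable)
    fix p :: int
    have "norm (e1 (w p)) \<noteq> 1" using Imw[of p] by (simp add: norm_e1)
    moreover have "e1 (w p) = e1 u * e1 \<tau> powi p" by (simp add: w_def e1_add e1_of_int_mult)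
    ultimately have "norm (e1 u) * norm (e1 \<tau>) powi p \<noteq> 1" by (simp add: norm_mult norm_power_int)
    then show "complex_of_real (norm (e1 u)) * of_real (norm (e1 \<tau>)) powi p \<noteq> 1"
      by (metis of_real_eq_1_iff of_real_mult of_real_power_int)
  qed (use a \<tau> mult_strict_left_mono[of "- Im a" "Im \<tau>" pi] in \<open>auto simp: norm_e1 mult_less_0_iff\<close>)
  moreover have "norm ((of_real (norm (e1 (- a)))::complex) powi l / (1 - of_real (norm (e1 u)) * of_real (norm (e1 \<tau>)) powi l))
     = norm (e1 (- a * of_int l)) * \<bar>1 / (1 - norm (e1 (w l)))\<bar>" for l :: int
  proof -
    have "norm (e1 (w l)) = norm (e1 u) * norm (e1 \<tau>) powi l"
      by (simp add: w_def e1_add e1_of_int_mult norm_mult norm_power_int)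
    moreover have "norm (1 - complex_of_real (norm (e1 u)) * of_real (norm (e1 \<tau>)) powi l) = \<bar>1 - norm (e1 u) * norm (e1 \<tau>) powi l\<bar>"
      by (metis norm_of_real of_real_1 of_real_diff of_real_mult of_real_power_int)
    moreover have "norm (e1 (- a * of_int l)) = norm (e1 (- a)) powi l"
      by (metis e1_of_int_mult mult.commute norm_power_int)
    ultimately show ?thesis by (simp add: norm_divide norm_power_int)
  qed
  ultimately have s3: "(\<lambda>l. norm (e1 (- a * of_int l)) * \<bar>1 / (1 - norm (e1 (w l)))\<bar>) summable_on UNIV" by simp
  have abs: "Infinite_Sum.abs_summable_on t (UNIV \<times> UNIV)"
  proof (rule Infinite_Sum.abs_summable_on_Sigma_iff[THEN iffD2, OF conjI], intro ballI)
    show "(\<lambda>k. norm (t (l, k))) summable_on UNIV" for l using s2 has_sum_imp_summable by blast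
    have "infsum (\<lambda>k. norm (t (l, k))) UNIV = norm (e1 (- a * of_int l)) * \<bar>1 / (1 - norm (e1 (w l)))\<bar>" for l
      by (rule infsumI[OF s2])
    then show "(\<lambda>l. norm (infsum (\<lambda>k. norm (t (l, k))) UNIV)) summable_on UNIV" using s3 by simp
  qed
  then show "(\<lambda>x. norm (t x)) summable_on UNIV" by simp
  have "infsum t UNIV = infsum (\<lambda>l. infsum (\<lambda>k. t (l, k)) UNIV) UNIV"
    using infsum_Sigma_banach[OF Infinite_Sum.abs_summable_summable[OF abs]] by simp
  also have "\<dots> = (\<Sum>\<^sub>\<infinity>l. e1 (- a * of_int l) / (1 - e1 (u + of_int l * \<tau>)))"
    by (intro infsum_cong) (use infsumI[OF s1] in \<open>simp add: w_def\<close>)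
  finally show "Theta (a - u) \<tau> / Theta u \<tau> = theta_const \<tau> * Theta a \<tau> * infsum t UNIV"
    using Theta_quotient[OF \<tau> a u] by simp
qed

text \<open>
  A finite subgroup of the torus is given by a set P of rational representatives; only the
  coordinates in J matter.
\<close>

definition reps_group :: "('j \<Rightarrow> rat) set \<Rightarrow> 'j set \<Rightarrow> bool" where
  "reps_group P J \<longleftrightarrow> finite P \<and> P \<noteq> {} \<and>
     (\<forall>p\<in>P. \<forall>p'\<in>P. \<exists>p''\<in>P. \<forall>j\<in>J. p'' j - (p j + p' j) \<in> \<int>) \<and>
     (\<forall>p\<in>P. \<forall>p'\<in>P. (\<forall>j\<in>J. p j - p' j \<in> \<int>) \<longrightarrow> p = p')"

definition lat :: "('j \<Rightarrow> rat) set \<Rightarrow> 'j set \<Rightarrow> ('j \<Rightarrow> rat) set" where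
  "lat P J = {n. (\<forall>j. j \<notin> J \<longrightarrow> n j = 0) \<and> (\<exists>p\<in>P. \<forall>j\<in>J. n j - p j \<in> \<int>)}"

text \<open>The dual of \<open>lat P J\<close>: integrality of k is the condition imposed by the
  integral vectors in that lattice, and the remaining conditions come from P.\<close>

definition annihilator :: "('j \<Rightarrow> rat) set \<Rightarrow> 'j set \<Rightarrow> ('j \<Rightarrow> rat) set" where
  "annihilator P J = {k. (\<forall>j. j \<notin> J \<longrightarrow> k j = 0) \<and> (\<forall>j. k j \<in> \<int>) \<and> (\<forall>p\<in>P. (\<Sum>j\<in>J. k j * p j) \<in> \<int>)}"

lemma e1_of_rat_eq_1_iff: "e1 (of_rat r) = 1 \<longleftrightarrow> r \<in> \<int>"
proof
  assume "e1 (of_rat r) = 1"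
  then obtain n :: int where "(of_rat r :: complex) = of_int n" unfolding e1_eq_1_iff by (elim Ints_cases)
  then have "(of_rat r :: complex) = of_rat (of_int n)" by simp
  then have "r = of_int n" by (simp only: of_rat_eq_iff)
  then show "r \<in> \<int>" by simp
next
  assume "r \<in> \<int>" then show "e1 (of_rat r) = 1" by (auto elim: Ints_cases)
qed

text \<open>Orthogonality of characters. Since k is integral on J, the character depends on p only
  modulo integers; translation by a p0 with nontrivial value permutes P and multiplies the sum by
  that value.\<close>

lemma character_sum:
  assumes P: "reps_group P J" and J: "finite J" and k: "\<And>j. j \<in> J \<Longrightarrow> k j \<in> \<int>"
  shows "(\<Sum>p\<in>P. e1 (of_rat (\<Sum>j\<in>J. k j * p j))) =
    (if \<forall>p\<in>P. (\<Sum>j\<in>J. k j * p j) \<in> \<int> then of_nat (card P) else 0)"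
proof (cases "\<forall>p\<in>P. (\<Sum>j\<in>J. k j * p j) \<in> \<int>")
  case True
  then have "(\<Sum>p\<in>P. e1 (of_rat (\<Sum>j\<in>J. k j * p j))) = (\<Sum>p\<in>P. 1)"
    by (intro sum.cong refl) (simp add: e1_of_rat_eq_1_iff)
  then show ?thesis using True by simp
next
  case False
  then obtain p0 where p0: "p0 \<in> P" "(\<Sum>j\<in>J. k j * p0 j) \<notin> \<int>" by blast
  define ch where "ch p = e1 (of_rat (\<Sum>j\<in>J. k j * p j))" for p
  have "\<exists>f. \<forall>p\<in>P. f p \<in> P \<and> (\<forall>j\<in>J. f p j - (p j + p0 j) \<in> \<int>)"
  proof (intro bchoice ballI)
    fix p assume "p \<in> P"
    then have "\<exists>p''\<in>P. \<forall>j\<in>J. p'' j - (p j + p0 j) \<in> \<int>"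
      using P p0(1) by (simp add: reps_group_def)
    then show "\<exists>y. y \<in> P \<and> (\<forall>j\<in>J. y j - (p j + p0 j) \<in> \<int>)" by blast
  qed
  then obtain f where f: "\<And>p. p \<in> P \<Longrightarrow> f p \<in> P" "\<And>p j. p \<in> P \<Longrightarrow> j \<in> J \<Longrightarrow> f p j - (p j + p0 j) \<in> \<int>" by blast
  have inj: "inj_on f P"
  proof (rule inj_onI)
    fix p p' assume p: "p \<in> P" "p' \<in> P" "f p = f p'"
    have "p j - p' j \<in> \<int>" if "j \<in> J" for j
    proof -
      have "(f p' j - (p' j + p0 j)) - (f p j - (p j + p0 j)) \<in> \<int>" by (rule Ints_diff[OF f(2)[OF p(2) that] f(2)[OF p(1) that]])
      then show ?thesis using p(3) by simp
    qed
    then show "p = p'" using P p(1,2) unfolding reps_group_def by blast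
  qed
  have "f ` P = P" using P f(1) inj unfolding reps_group_def by (intro endo_inj_surj) auto
  then have bij: "bij_betw f P P" using inj by (auto simp: bij_betw_def)
  have ff: "ch (f p) = ch p * ch p0" if "p \<in> P" for p
  proof -
    have "(\<Sum>j\<in>J. k j * f p j) - ((\<Sum>j\<in>J. k j * p j) + (\<Sum>j\<in>J. k j * p0 j)) = (\<Sum>j\<in>J. k j * (f p j - (p j + p0 j)))"
      by (simp add: sum.distrib sum_subtractf algebra_simps)
    also have "\<dots> \<in> \<int>" using k f(2)[OF that] by (intro Ints_sum Ints_mult) auto
    finally have "e1 (of_rat ((\<Sum>j\<in>J. k j * f p j) - ((\<Sum>j\<in>J. k j * p j) + (\<Sum>j\<in>J. k j * p0 j)))) = 1"
      by (simp only: e1_of_rat_eq_1_iff)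
    then show ?thesis unfolding ch_def diff_conv_add_uminus of_rat_add of_rat_minus e1_add e1_minus
      by (simp add: field_simps)
  qed
  have "(\<Sum>p\<in>P. ch p) = (\<Sum>p\<in>P. ch (f p))" by (rule sum.reindex_bij_betw[OF bij, symmetric])
  also have "\<dots> = (\<Sum>p\<in>P. ch p) * ch p0" by (simp add: ff sum_distrib_right)
  finally have "(\<Sum>p\<in>P. ch p) * (1 - ch p0) = 0" by (simp add: algebra_simps)
  moreover have "ch p0 \<noteq> 1" unfolding ch_def e1_of_rat_eq_1_iff by (rule p0(2))
  ultimately have "(\<Sum>p\<in>P. ch p) = 0" by simp
  then show ?thesis using False by (simp only: ch_def if_False)
qed

text \<open>The exponent is unchanged when (k, n, B, z) becomes (-n, -k, z, B), while every sign
  factor is reversed. This symmetry is what the duality exploits.\<close>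

definition theta_term ::
    "'j set \<Rightarrow> ('j \<Rightarrow> complex) \<Rightarrow> ('j \<Rightarrow> complex) \<Rightarrow> complex \<Rightarrow> ('j \<Rightarrow> rat) \<times> ('j \<Rightarrow> rat) \<Rightarrow> complex" where
  "theta_term J z B \<tau> = (\<lambda>(k, n). of_real (\<Prod>j\<in>J. sg (of_rat (k j) - Im (z j) / Im \<tau>) (of_rat (n j) + Im (B j) / Im \<tau>)) *
     e1 (\<Sum>j\<in>J. of_rat (k j) * B j - z j * of_rat (n j) + of_rat (k j * n j) * \<tau>))"

text \<open>The sum over p unites the cosets of the integral vectors to the whole lattice. The sum
  over p1 is a character sum in k, which leaves \<open>card P\<close> times the terms with k in the
  annihilator. Each variable has its own \<open>z j\<close>, and B is independent of z, as the
  generic perturbation requires.\<close>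

lemma Theta_sum_expansion:
  fixes P :: "('j \<Rightarrow> rat) set" and z B :: "'j \<Rightarrow> complex"
  assumes \<tau>: "Im \<tau> > 0" and J: "finite J" and P: "reps_group P J"
    and z: "\<And>j. j \<in> J \<Longrightarrow> Im (z j) < 0" "\<And>j. j \<in> J \<Longrightarrow> - Im (z j) < Im \<tau>"
    and B: "\<And>p j. p \<in> P \<Longrightarrow> j \<in> J \<Longrightarrow> of_rat (p j) + Im (B j) / Im \<tau> \<notin> \<int>"
  shows "(\<Sum>p\<in>P. \<Sum>p1\<in>P. \<Prod>j\<in>J. e1 (- z j * of_rat (p j)) *
      (Theta (z j - (B j + of_rat (p j) * \<tau> + of_rat (p1 j))) \<tau> / Theta (B j + of_rat (p j) * \<tau> + of_rat (p1 j)) \<tau>)) =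
    of_nat (card P) * (\<Prod>j\<in>J. theta_const \<tau> * Theta (z j) \<tau>) * infsum (theta_term J z B \<tau>) (annihilator P J \<times> lat P J)"
proof -
  let ?PE = "Pi\<^sub>E J (\<lambda>_. UNIV :: (int \<times> int) set)"
  define C where "C = (\<Prod>j\<in>J. theta_const \<tau> * Theta (z j) \<tau>)"
  define u where "u p p1 j = B j + of_rat (p j) * \<tau> + of_rat (p1 j)" for p p1 :: "'j \<Rightarrow> rat" and j
  define r where "r p j = (\<lambda>(l::int, k::int). of_real (sg (of_int k - Im (z j) / Im \<tau>) (of_rat (p j) + of_int l + Im (B j) / Im \<tau>)) *
     e1 (of_int k * B j - z j * (of_rat (p j) + of_int l) + of_int k * (of_rat (p j) + of_int l) * \<tau>))" for p :: "'j \<Rightarrow> rat" and j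
  define s where "s p p1 j = (\<lambda>(l::int, k::int). r p j (l, k) * e1 (of_int k * of_rat (p1 j)))" for p p1 :: "'j \<Rightarrow> rat" and j
  define kk where "kk g = (\<lambda>j. if j \<in> J then of_int (snd (g j)) else 0 :: rat)" for g :: "'j \<Rightarrow> int \<times> int"
  define nn where "nn p g = (\<lambda>j. if j \<in> J then p j + of_int (fst (g j)) else 0 :: rat)" for p and g :: "'j \<Rightarrow> int \<times> int"
  have Imu: "Im (u p p1 j) / Im \<tau> = of_rat (p j) + Im (B j) / Im \<tau>" for p p1 j
    using \<tau> by (simp add: u_def field_simps)
  have one: "Infinite_Sum.abs_summable_on (s p p1 j) UNIV \<and>
     e1 (- z j * of_rat (p j)) * (Theta (z j - u p p1 j) \<tau> / Theta (u p p1 j) \<tau>) = theta_const \<tau> * Theta (z j) \<tau> * infsum (s p p1 j) UNIV"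
    if "p \<in> P" "j \<in> J" for p p1 j
  proof -
    have ui: "Im (u p p1 j) / Im \<tau> \<notin> \<int>" unfolding Imu by (rule B[OF that])
    define t where "t = (\<lambda>(l::int, k::int). of_real (sg (of_int k - Im (z j) / Im \<tau>) (of_int l + Im (u p p1 j) / Im \<tau>)) *
      e1 (- z j * of_int l + of_int k * (u p p1 j + of_int l * \<tau>)))"
    have st: "s p p1 j = (\<lambda>x. e1 (- z j * of_rat (p j)) * t x)"
    proof
      fix x :: "int \<times> int" obtain l k where x: "x = (l, k)" by force
      have e: "e1 (of_int k * B j - z j * (of_rat (p j) + of_int l) + of_int k * (of_rat (p j) + of_int l) * \<tau>) * e1 (of_int k * of_rat (p1 j)) =
        e1 (- z j * of_rat (p j)) * e1 (- z j * of_int l + of_int k * (u p p1 j + of_int l * \<tau>))"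
        unfolding e1_add[symmetric] u_def by (rule arg_cong[where f = e1]) (simp add: algebra_simps)
      have gen: "a * X * Y = Z * (a * W)" if "X * Y = Z * W" for a X Y Z W :: complex
        using that by (simp add: mult.assoc mult.left_commute)
      have i: "of_rat (p j) + of_int l + Im (B j) / Im \<tau> = of_int l + Im (u p p1 j) / Im \<tau>" unfolding Imu by simp
      show "s p p1 j x = e1 (- z j * of_rat (p j)) * t x"
        unfolding x s_def r_def t_def prod.case i by (rule gen[OF e])
    qed
    have abs: "(\<lambda>x. norm (t x)) summable_on UNIV"
      unfolding t_def by (rule Theta_quotient_pairs(1)[OF \<tau> z(1)[OF that(2)] z(2)[OF that(2)] ui])
    have "(\<lambda>x. norm (e1 (- z j * of_rat (p j))) * norm (t x)) summable_on UNIV"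
      by (intro summable_on_cmult_right abs)
    then have 1: "Infinite_Sum.abs_summable_on (s p p1 j) UNIV" unfolding st norm_mult .
    have "Theta (z j - u p p1 j) \<tau> / Theta (u p p1 j) \<tau> = theta_const \<tau> * Theta (z j) \<tau> * infsum t UNIV"
      unfolding t_def by (rule Theta_quotient_pairs(2)[OF \<tau> z(1)[OF that(2)] z(2)[OF that(2)] ui])
    moreover have "infsum (s p p1 j) UNIV = e1 (- z j * of_rat (p j)) * infsum t UNIV"
      unfolding st by (rule infsum_cmult_right) (rule Infinite_Sum.abs_summable_summable[OF abs])
    ultimately show ?thesis using 1 by (simp only: mult_ac simp_thms)
  qed
  define R where "R p g = (\<Prod>j\<in>J. r p j (g j))" for p and g :: "'j \<Rightarrow> int \<times> int"
  have s_prod: "(\<Prod>j\<in>J. s p p1 j (g j)) = R p g * e1 (of_rat (\<Sum>j\<in>J. kk g j * p1 j))" for p p1 g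
  proof -
    have "(\<Prod>j\<in>J. s p p1 j (g j)) = R p g * (\<Prod>j\<in>J. e1 (of_int (snd (g j)) * of_rat (p1 j)))"
      by (simp add: s_def R_def prod.distrib case_prod_beta)
    also have "(\<Prod>j\<in>J. e1 (of_int (snd (g j)) * of_rat (p1 j))) = e1 (\<Sum>j\<in>J. of_rat (kk g j * p1 j))"
      unfolding e1_sum[OF J] by (intro prod.cong refl) (simp add: kk_def of_rat_mult)
    finally show ?thesis by (simp add: of_rat_sum)
  qed
  have sumPE: "((\<lambda>g. R p g * e1 (of_rat (\<Sum>j\<in>J. kk g j * p1 j))) has_sum (\<Prod>j\<in>J. infsum (s p p1 j) UNIV)) ?PE" if "p \<in> P" for p p1
  proof -
    have "Infinite_Set_Sum.abs_summable_on (\<lambda>g. \<Prod>j\<in>J. s p p1 j (g j)) ?PE"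
      by (intro Infinite_Set_Sum.abs_summable_on_prod_PiE J) (use one[OF that] abs_summable_equivalent in auto)
    then have "Infinite_Sum.abs_summable_on (\<lambda>g. \<Prod>j\<in>J. s p p1 j (g j)) ?PE"
      unfolding abs_summable_equivalent .
    then have "((\<lambda>g. \<Prod>j\<in>J. s p p1 j (g j)) has_sum (\<Sum>\<^sub>\<infinity>g\<in>?PE. \<Prod>j\<in>J. s p p1 j (g j))) ?PE"
      by (rule has_sum_infsum[OF Infinite_Sum.abs_summable_summable])
    moreover have "(\<Sum>\<^sub>\<infinity>g\<in>?PE. \<Prod>j\<in>J. s p p1 j (g j)) = (\<Prod>j\<in>J. infsum (s p p1 j) UNIV)"
      by (intro infsum_prod_PiE_abs J) (use one[OF that] in auto)
    ultimately show ?thesis by (simp only: s_prod)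
  qed
  have kint: "kk g j \<in> \<int>" for g j by (simp add: kk_def)
  have term_eq: "theta_term J z B \<tau> (kk g, nn p g) = R p g" for p g
  proof -
    have "theta_term J z B \<tau> (kk g, nn p g) = (\<Prod>j\<in>J. of_real (sg (of_rat (kk g j) - Im (z j) / Im \<tau>) (of_rat (nn p g j) + Im (B j) / Im \<tau>)) *
       e1 (of_rat (kk g j) * B j - z j * of_rat (nn p g j) + of_rat (kk g j * nn p g j) * \<tau>))"
      unfolding theta_term_def prod.case prod.distrib of_real_prod e1_sum[OF J] ..
    also have "\<dots> = R p g"
      unfolding R_def by (intro prod.cong refl) (simp add: kk_def nn_def r_def case_prod_beta of_rat_add of_rat_mult)
    finally show ?thesis .
  qed
  define K where "K = annihilator P J"
  define Bp where "Bp p = {(k, n). k \<in> K \<and> n \<in> lat P J \<and> (\<forall>j\<in>J. n j - p j \<in> \<int>)}" for p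
  have each: "(theta_term J z B \<tau> has_sum (\<Sum>p1\<in>P. \<Prod>j\<in>J. infsum (s p p1 j) UNIV) / of_nat (card P)) (Bp p)" if p: "p \<in> P" for p
  proof -
    have cP: "of_nat (card P) \<noteq> (0::complex)" using P by (auto simp: reps_group_def)
    have "((\<lambda>g. \<Sum>p1\<in>P. R p g * e1 (of_rat (\<Sum>j\<in>J. kk g j * p1 j))) has_sum (\<Sum>p1\<in>P. \<Prod>j\<in>J. infsum (s p p1 j) UNIV)) ?PE"
      using P by (intro has_sum_finite_sum sumPE[OF p]) (simp add: reps_group_def)
    also have "(\<lambda>g. \<Sum>p1\<in>P. R p g * e1 (of_rat (\<Sum>j\<in>J. kk g j * p1 j))) =
       (\<lambda>g. R p g * (if kk g \<in> K then of_nat (card P) else 0))"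
    proof
      fix g
      have "(\<forall>p\<in>P. (\<Sum>j\<in>J. kk g j * p j) \<in> \<int>) \<longleftrightarrow> kk g \<in> K"
        using kint by (auto simp: K_def annihilator_def kk_def)
      then show "(\<Sum>p1\<in>P. R p g * e1 (of_rat (\<Sum>j\<in>J. kk g j * p1 j))) = R p g * (if kk g \<in> K then of_nat (card P) else 0)"
        using character_sum[OF P J, of "kk g"] kint by (simp add: sum_distrib_left[symmetric])
    qed
    finally have "((\<lambda>g. R p g * (if kk g \<in> K then of_nat (card P) else 0)) has_sum (\<Sum>p1\<in>P. \<Prod>j\<in>J. infsum (s p p1 j) UNIV)) ?PE" .
    note h = has_sum_cmult_left[OF this, of "1 / of_nat (card P)"]
    have "((\<lambda>g. if kk g \<in> K then R p g else 0) has_sum (\<Sum>p1\<in>P. \<Prod>j\<in>J. infsum (s p p1 j) UNIV) / of_nat (card P)) ?PE"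
    proof -
      have "R p g * (if kk g \<in> K then of_nat (card P) else 0) * (1 / of_nat (card P)) = (if kk g \<in> K then R p g else 0)" for g
        using cP by (cases "kk g \<in> K") simp_all
      moreover have "x * (1 / of_nat (card P)) = x / of_nat (card P)" for x :: complex by simp
      ultimately show ?thesis using h by (simp only:)
    qed
    then have "(R p has_sum (\<Sum>p1\<in>P. \<Prod>j\<in>J. infsum (s p p1 j) UNIV) / of_nat (card P)) {g \<in> ?PE. kk g \<in> K}"
      by (rule has_sum_cong_neutral[THEN iffD1, rotated -1]) auto
    moreover have "bij_betw (\<lambda>g. (kk g, nn p g)) {g \<in> ?PE. kk g \<in> K} (Bp p)"
    proof (rule bij_betw_imageI)
      show "inj_on (\<lambda>g. (kk g, nn p g)) {g \<in> ?PE. kk g \<in> K}"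
      proof (rule inj_onI)
        fix g g' assume g: "g \<in> {g \<in> ?PE. kk g \<in> K}" "g' \<in> {g \<in> ?PE. kk g \<in> K}" and eq: "(kk g, nn p g) = (kk g', nn p g')"
        have "g j = g' j" if "j \<in> J" for j
        proof -
          have "kk g j = kk g' j" "nn p g j = nn p g' j" using eq by auto
          then show ?thesis using that by (simp add: kk_def nn_def prod_eq_iff)
        qed
        moreover have "g \<in> ?PE" "g' \<in> ?PE" using g by blast+
        ultimately show "g = g'" using PiE_ext by blast
      qed
      show "(\<lambda>g. (kk g, nn p g)) ` {g \<in> ?PE. kk g \<in> K} = Bp p"
      proof (intro equalityI subsetI)
        fix x assume "x \<in> (\<lambda>g. (kk g, nn p g)) ` {g \<in> ?PE. kk g \<in> K}"
        then show "x \<in> Bp p" using p by (auto simp: Bp_def lat_def nn_def intro!: bexI[of _ p])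
      next
        fix x assume "x \<in> Bp p"
        then obtain k n where x: "x = (k, n)" "k \<in> K" "n \<in> lat P J" "\<And>j. j \<in> J \<Longrightarrow> n j - p j \<in> \<int>" by (auto simp: Bp_def)
        define g where "g = restrict (\<lambda>j. (\<lfloor>n j - p j\<rfloor>, \<lfloor>k j\<rfloor>)) J"
        have "kk g = k" using x(2) by (auto simp: fun_eq_iff g_def kk_def K_def annihilator_def)
        moreover have "nn p g = n" using x(3,4) by (auto simp: fun_eq_iff g_def nn_def lat_def)
        ultimately show "x \<in> (\<lambda>g. (kk g, nn p g)) ` {g \<in> ?PE. kk g \<in> K}"
          using x(1,2) by (intro image_eqI[of _ _ g]) (auto simp: g_def)
      qed
    qed
    ultimately show ?thesis
      using has_sum_reindex_bij_betw[of "\<lambda>g. (kk g, nn p g)" _ _ "theta_term J z B \<tau>"] by (simp only: term_eq)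
  qed
  have "(theta_term J z B \<tau> has_sum (\<Sum>p\<in>P. (\<Sum>p1\<in>P. \<Prod>j\<in>J. infsum (s p p1 j) UNIV) / of_nat (card P))) (\<Union>p\<in>P. Bp p)"
  proof (rule sum_has_sum[OF _ each])
    show "finite P" using P by (simp add: reps_group_def)
    fix p p' assume pp: "p \<in> P" "p' \<in> P" "p \<noteq> p'"
    show "Bp p \<inter> Bp p' = {}"
    proof (rule ccontr)
      assume "Bp p \<inter> Bp p' \<noteq> {}"
      then obtain n where n: "\<forall>j\<in>J. n j - p j \<in> \<int>" "\<forall>j\<in>J. n j - p' j \<in> \<int>" by (auto simp: Bp_def)
      have "\<forall>j\<in>J. p j - p' j \<in> \<int>"
      proof
        fix j assume "j \<in> J"
        then have "(n j - p' j) - (n j - p j) \<in> \<int>" using n by (intro Ints_diff[of "n j - p' j"]) blast+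
        then show "p j - p' j \<in> \<int>" by simp
      qed
      then show False using P pp unfolding reps_group_def by blast
    qed
  qed
  also have "(\<Union>p\<in>P. Bp p) = annihilator P J \<times> lat P J" by (auto simp: Bp_def K_def lat_def)
  finally have "infsum (theta_term J z B \<tau>) (annihilator P J \<times> lat P J) = (\<Sum>p\<in>P. (\<Sum>p1\<in>P. \<Prod>j\<in>J. infsum (s p p1 j) UNIV) / of_nat (card P))"
    by (rule infsumI)
  also have "\<dots> = (\<Sum>p\<in>P. \<Sum>p1\<in>P. \<Prod>j\<in>J. infsum (s p p1 j) UNIV) / of_nat (card P)"
    by (rule sum_divide_distrib[symmetric])
  finally have fin: "of_nat (card P) * infsum (theta_term J z B \<tau>) (annihilator P J \<times> lat P J) = (\<Sum>p\<in>P. \<Sum>p1\<in>P. \<Prod>j\<in>J. infsum (s p p1 j) UNIV)"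
    using P by (simp add: reps_group_def)
  have "(\<Sum>p\<in>P. \<Sum>p1\<in>P. \<Prod>j\<in>J. e1 (- z j * of_rat (p j)) * (Theta (z j - u p p1 j) \<tau> / Theta (u p p1 j) \<tau>)) =
    (\<Sum>p\<in>P. \<Sum>p1\<in>P. \<Prod>j\<in>J. theta_const \<tau> * Theta (z j) \<tau> * infsum (s p p1 j) UNIV)"
    by (intro sum.cong prod.cong refl) (use one in blast)
  also have "\<dots> = C * (\<Sum>p\<in>P. \<Sum>p1\<in>P. \<Prod>j\<in>J. infsum (s p p1 j) UNIV)"
    by (simp add: prod.distrib C_def sum_distrib_left)
  finally show ?thesis unfolding fin[symmetric] u_def C_def by (simp only: mult_ac)
qed

section \<open>Nondegenerate exponent matrices\<close>

text \<open>This is what remains of the Kreuzer--Skarke conditions for the nondegeneracy of a potential.\<close>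

definition comb_nondegenerate :: "'i set \<Rightarrow> 'j set \<Rightarrow> ('i \<Rightarrow> 'j \<Rightarrow> nat) \<Rightarrow> bool" where
  "comb_nondegenerate I J a \<longleftrightarrow> (\<forall>Y. Y \<subseteq> J \<and> Y \<noteq> {} \<longrightarrow> (\<exists>i\<in>I. \<forall>j\<in>J. j \<notin> Y \<longrightarrow> a i j = 0) \<or>
     (\<exists>k\<in>J - Y. \<exists>!i. i \<in> I \<and> a i k = 1 \<and> (\<forall>j\<in>J. j \<notin> Y \<longrightarrow> j \<noteq> k \<longrightarrow> a i j = 0)))"

lemma disj_bexE:
  assumes "(\<exists>i\<in>I. P i) \<or> (\<exists>k\<in>K. Q k)" "\<And>i. i \<in> I \<Longrightarrow> P i \<Longrightarrow> R" "\<And>k. k \<in> K \<Longrightarrow> Q k \<Longrightarrow> R"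
  shows R
  using assms by blast

lemma ex1_conjE:
  assumes "\<exists>!i. i \<in> I \<and> P i \<and> Q i"
    and "\<And>i. i \<in> I \<Longrightarrow> P i \<Longrightarrow> Q i \<Longrightarrow> (\<And>i'. i' \<in> I \<Longrightarrow> P i' \<Longrightarrow> Q i' \<Longrightarrow> i' = i) \<Longrightarrow> R"
  shows R
  using assms by blast

text \<open>
  By induction on Z: removing a suitable variable decreases the right-hand side. If there is no
  such variable, a minimal subset of Z without unique pointers is removed as a whole.
\<close>

lemma counting_lemma:
  fixes V :: "'j set" and H :: "'i set" and Good :: "'t \<Rightarrow> 'i set" and a :: "'i \<Rightarrow> 'j \<Rightarrow> nat"
  defines "gz \<equiv> \<lambda>t Z. {i \<in> Good t. \<forall>j\<in>V - Z. a i j = 0}"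
  defines "f \<equiv> \<lambda>g::nat. if g \<ge> 2 then g - 1 else g"
  defines "hz \<equiv> \<lambda>Z. {i \<in> H. (\<Sum>j\<in>V - Z. a i j) \<le> 1}"
  assumes fin: "finite V" "finite H" "finite T" "\<And>t. t \<in> T \<Longrightarrow> finite (Good t)"
    and H: "\<And>i. i \<in> H \<Longrightarrow> (\<exists>j\<in>V. a i j \<ge> 2) \<or> (\<Sum>j\<in>V. a i j) \<ge> 3"
    and Good: "\<And>t i. t \<in> T \<Longrightarrow> i \<in> Good t \<Longrightarrow> \<exists>j\<in>V. a i j \<noteq> 0"
    and CN: "\<And>Y. Y \<subseteq> V \<Longrightarrow> Y \<noteq> {} \<Longrightarrow> (\<exists>i\<in>H. (\<Sum>j\<in>V - Y. a i j) \<le> 1) \<or> (\<exists>t\<in>T. card (gz t Y) = 1)"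
    and Z: "Z \<subseteq> V"
  shows "card Z \<le> card (hz Z) + (\<Sum>t\<in>T. f (card (gz t Z)))"
  using Z
proof (induction "card Z" arbitrary: Z rule: less_induct)
  case less
  define \<Gamma> where "\<Gamma> Z = (\<Sum>t\<in>T. f (card (gz t Z)))" for Z
  have finZ: "finite Z" using less.prems fin(1) finite_subset by blast
  have fg: "finite (gz t Z)" if "t \<in> T" for t Z using fin(4)[OF that] by (simp add: gz_def)
  have fh: "finite (hz Z)" for Z using fin(2) by (simp add: hz_def)
  have f_mono: "f x \<le> f y" if "x \<le> y" for x y using that by (auto simp: f_def)
  have gz_mono: "gz t Y \<subseteq> gz t Z" if "Y \<subseteq> Z" for t Y Z using that by (auto simp: gz_def)
  have hz_mono: "hz Y \<subseteq> hz Z" if "Y \<subseteq> Z" "Z \<subseteq> V" for Y Z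
  proof
    fix i assume i: "i \<in> hz Y"
    have "(\<Sum>j\<in>V - Z. a i j) \<le> (\<Sum>j\<in>V - Y. a i j)" using that fin(1) by (intro sum_mono2) auto
    then show "i \<in> hz Z" using i by (simp add: hz_def)
  qed
  have fgz_mono: "f (card (gz t Y)) \<le> f (card (gz t Z))" if "Y \<subseteq> Z" "t \<in> T" for t Y Z
    using that by (intro f_mono card_mono fg gz_mono)
  have \<Gamma>_mono: "\<Gamma> Y \<le> \<Gamma> Z" if "Y \<subseteq> Z" for Y Z
    unfolding \<Gamma>_def using that by (intro sum_mono fgz_mono)
  have \<Gamma>_strict: "\<Gamma> Y + 1 \<le> \<Gamma> Z" if "Y \<subseteq> Z" "t \<in> T" "f (card (gz t Y)) < f (card (gz t Z))" for Y Z t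
  proof -
    have "\<Gamma> Y < \<Gamma> Z" unfolding \<Gamma>_def using that fin(3) by (intro sum_strict_mono_ex1) (auto intro: fgz_mono)
    then show ?thesis by simp
  qed
  show ?case
  proof (cases "Z = {}")
    case True then show ?thesis by simp
  next
    case Zne: False
    show ?thesis
    proof (cases "\<exists>y\<in>Z. card (hz (Z - {y})) + \<Gamma> (Z - {y}) + 1 \<le> card (hz Z) + \<Gamma> Z")
      case True
      then obtain y where y: "y \<in> Z" "card (hz (Z - {y})) + \<Gamma> (Z - {y}) + 1 \<le> card (hz Z) + \<Gamma> Z" by blast
      have "card (Z - {y}) \<le> card (hz (Z - {y})) + \<Gamma> (Z - {y})"
        unfolding \<Gamma>_def using less.prems y(1) finZ by (intro less.hyps card_Diff1_less) auto
      then show ?thesis using y card_Suc_Diff1[OF finZ y(1)] by (simp add: \<Gamma>_def)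
    next
      case False
      \<comment> \<open>No removal of a single variable lowers either part of the right-hand
        side.\<close>
      have bad: "hz (Z - {y}) = hz Z \<and> (\<forall>t\<in>T. f (card (gz t (Z - {y}))) = f (card (gz t Z)))" if y: "y \<in> Z" for y
      proof -
        have sub: "Z - {y} \<subseteq> Z" by auto
        have n: "\<not> card (hz (Z - {y})) + \<Gamma> (Z - {y}) + 1 \<le> card (hz Z) + \<Gamma> Z" using False y by blast
        have c: "card (hz (Z - {y})) \<le> card (hz Z)" using less.prems by (intro card_mono fh hz_mono) auto
        have "hz (Z - {y}) = hz Z"
        proof (rule card_subset_eq[OF fh hz_mono[OF sub less.prems]])
          show "card (hz (Z - {y})) = card (hz Z)" using n c \<Gamma>_mono[OF sub] by linarith
        qed
        moreover have "f (card (gz t (Z - {y}))) = f (card (gz t Z))" if t: "t \<in> T" for t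
        proof (rule ccontr)
          assume "f (card (gz t (Z - {y}))) \<noteq> f (card (gz t Z))"
          then have "f (card (gz t (Z - {y}))) < f (card (gz t Z))" using fgz_mono[OF sub t] by linarith
          then show False using \<Gamma>_strict[OF sub t] n c by linarith
        qed
        ultimately show ?thesis by blast
      qed
      have meets: "\<exists>y\<in>Y. a i y \<noteq> 0" if t: "t \<in> T" and i: "i \<in> gz t Y" for i t Y
      proof -
        have "i \<in> Good t" "\<forall>j\<in>V - Y. a i j = 0" using i by (auto simp: gz_def)
        moreover obtain j where j: "j \<in> V" "a i j \<noteq> 0" using Good[OF t] \<open>i \<in> Good t\<close> by blast
        ultimately have "j \<in> Y" by (cases "j \<in> Y") auto
        then show ?thesis using j by blast
      qed
      have drop: "i \<notin> gz t (Y - {y})" if "a i y \<noteq> 0" "y \<in> V" for i t Y y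
        using that by (auto simp: gz_def)
      \<comment> \<open>Removing a variable of a counted row lowers the cardinality, and f detects
        this except in the step from 2 to 1, where both values are 1.\<close>
      have g02: "card (gz t Z) = 0 \<or> card (gz t Z) = 2" if t: "t \<in> T" for t
      proof (rule ccontr)
        assume n: "\<not> ?thesis"
        then have "gz t Z \<noteq> {}" by auto
        then obtain i where i: "i \<in> gz t Z" by blast
        obtain y where y: "y \<in> Z" "a i y \<noteq> 0" using meets[OF t i] by blast
        have sub1: "gz t (Z - {y}) \<subseteq> gz t Z - {i}" using gz_mono[of "Z - {y}" Z t] drop[of i y t Z] y less.prems by auto
        then have "card (gz t (Z - {y})) \<le> card (gz t Z) - 1"
          using card_mono[OF _ sub1] fg[OF t, of Z] i by (simp add: card_Diff_singleton)
        moreover have "card (gz t Z) \<ge> 1" using i fg[OF t, of Z] card_gt_0_iff[of "gz t Z"] by fastforce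
        ultimately have "f (card (gz t (Z - {y}))) < f (card (gz t Z))" using n by (auto simp: f_def)
        then show False using bad[OF y(1)] t by simp
      qed
      \<comment> \<open>A row that stays counted after the removal of any one variable of Z has
        exponents at most 1 in Z and none outside. The assumption on H then makes its degree at
        least 3.\<close>
      have alive: "(\<forall>j\<in>V - Z. a i j = 0) \<and> (\<Sum>j\<in>V. a i j) \<ge> 3" if i: "i \<in> hz Z" for i
      proof -
        have iH: "i \<in> H" and le1: "(\<Sum>j\<in>V - Z. a i j) \<le> 1" using i by (auto simp: hz_def)
        have out: "(\<Sum>j\<in>V - (Z - {y}). a i j) = a i y + (\<Sum>j\<in>V - Z. a i j)" if y: "y \<in> Z" for y
        proof -
          have "V - (Z - {y}) = insert y (V - Z)" using y less.prems by auto
          then show ?thesis using y fin(1) by simp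
        qed
        have keep: "a i y + (\<Sum>j\<in>V - Z. a i j) \<le> 1" if y: "y \<in> Z" for y
        proof -
          have "i \<in> hz (Z - {y})" using bad[OF y] i by blast
          then show ?thesis using out[OF y] by (simp add: hz_def)
        qed
        have split: "(\<Sum>j\<in>V. a i j) = (\<Sum>j\<in>V - Z. a i j) + (\<Sum>j\<in>Z. a i j)"
          using sum.subset_diff[OF less.prems fin(1), of "a i"] by simp
        have tot: "(\<Sum>j\<in>V. a i j) \<ge> 2"
        proof (cases "\<exists>j\<in>V. a i j \<ge> 2")
          case True
          then obtain j where j: "j \<in> V" "a i j \<ge> 2" by blast
          then show ?thesis using member_le_sum[of j V "a i"] fin(1) by simp
        qed (use H[OF iH] in auto)
        have "\<exists>y\<in>Z. a i y \<noteq> 0"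
        proof (rule ccontr)
          assume "\<not> (\<exists>y\<in>Z. a i y \<noteq> 0)"
          then have "(\<Sum>j\<in>Z. a i j) = 0" by simp
          then show False using split le1 tot by linarith
        qed
        then obtain y where y: "y \<in> Z" "a i y \<noteq> 0" by blast
        have z: "(\<Sum>j\<in>V - Z. a i j) = 0" using keep[OF y(1)] y(2) by simp
        then have zero: "\<forall>j\<in>V - Z. a i j = 0" using fin(1) by simp
        have "\<not> (\<exists>j\<in>V. a i j \<ge> 2)"
        proof
          assume "\<exists>j\<in>V. a i j \<ge> 2"
          then obtain j where j: "j \<in> V" "a i j \<ge> 2" by blast
          then have "j \<in> Z" using zero by (cases "j \<in> Z") auto
          then show False using keep[of j] j by simp
        qed
        then show ?thesis using zero H[OF iH] by blast
      qed
      \<comment> \<open>For a minimal such set the condition \<open>CN\<close> has to supply a row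
        of H, whereas every smaller nonempty subset has some t with exactly one counted row.\<close>
      define ok where "ok Y \<longleftrightarrow> Y \<subseteq> Z \<and> Y \<noteq> {} \<and> (\<forall>t\<in>T. card (gz t Y) \<noteq> 1)" for Y
      have okZ: "ok Z" using Zne g02 unfolding ok_def by force
      obtain Z0 where okZ0: "ok Z0" and okmin: "\<And>Y. ok Y \<Longrightarrow> card Z0 \<le> card Y"
        using ex_has_least_nat[of ok Z card, OF okZ] by blast
      note Z0 = okZ0[unfolded ok_def, THEN conjunct1] okZ0[unfolded ok_def, THEN conjunct2, THEN conjunct1]
        okZ0[unfolded ok_def, THEN conjunct2, THEN conjunct2]
      note min = okmin[unfolded ok_def]
      have finZ0: "finite Z0" using Z0(1) finZ finite_subset by blast
      obtain R where R: "R \<in> H" "(\<Sum>j\<in>V - Z0. a R j) \<le> 1"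
        using CN[of Z0] Z0 less.prems by (meson subset_trans)
      have "R \<in> hz Z" using R hz_mono[OF Z0(1) less.prems] by (auto simp: hz_def)
      then have R3: "(\<Sum>j\<in>V. a R j) \<ge> 3" and R0: "\<forall>j\<in>V - Z. a R j = 0" using alive by blast+
      \<comment> \<open>R has degree at least 3, and at most 1 of it outside Z0; so at least 2 lies
        in Z0, and R is lost when Z0 is removed.\<close>
      have "R \<notin> hz (Z - Z0)"
      proof
        assume "R \<in> hz (Z - Z0)"
        then have "(\<Sum>j\<in>V - (Z - Z0). a R j) \<le> 1" by (simp add: hz_def)
        moreover have "(\<Sum>j\<in>Z0. a R j) \<le> (\<Sum>j\<in>V - (Z - Z0). a R j)"
          using Z0(1) less.prems fin(1) by (intro sum_mono2) auto
        moreover have "(\<Sum>j\<in>V. a R j) = (\<Sum>j\<in>V - Z0. a R j) + (\<Sum>j\<in>Z0. a R j)"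
          using sum.subset_diff[of Z0 V "a R"] Z0(1) less.prems fin(1) by auto
        ultimately show False using R(2) R3 by linarith
      qed
      then have "hz (Z - Z0) \<subset> hz Z" using \<open>R \<in> hz Z\<close> hz_mono[of "Z - Z0" Z] less.prems by blast
      then have h1: "card (hz (Z - Z0)) + 1 \<le> card (hz Z)" using psubset_card_mono[OF fh] by (metis Suc_eq_plus1 Suc_leI)
      \<comment> \<open>The variables of W are put back one at a time. By minimality of Z0 some t
        has exactly one counted row for W, and deleting a variable of that row lowers f from 1 to
        0.\<close>
      have chain: "\<Gamma> (Z - Z0) + card W \<le> \<Gamma> ((Z - Z0) \<union> W)" if "W \<subset> Z0" for W
        using that
      proof (induction "card W" arbitrary: W rule: less_induct)
        case (less W)
        show ?case
        proof (cases "W = {}")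
          case True then show ?thesis by simp
        next
          case False
          have finW: "finite W" using less.prems finZ0 finite_subset by blast
          have "card W < card Z0" using less.prems finZ0 by (rule psubset_card_mono[rotated])
          then obtain t where t: "t \<in> T" "card (gz t W) = 1"
            using min[of W] False less.prems Z0(1) by (meson not_le psubset_imp_subset subset_trans)
          have "card (gz t W) \<le> card (gz t Z0)" "card (gz t Z0) \<le> card (gz t Z)"
            using less.prems Z0(1) t(1) by (auto intro!: card_mono fg gz_mono)
          moreover have "card (gz t Z0) \<noteq> 1" using Z0(3) t(1) by blast
          ultimately have "card (gz t Z0) = card (gz t Z)" using t(2) g02[OF t(1)] by presburger
          then have eqZ: "gz t Z0 = gz t Z" by (intro card_subset_eq fg t gz_mono Z0)
          let ?S = "(Z - Z0) \<union> W"
          have SW: "gz t ?S = gz t W"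
          proof
            show "gz t W \<subseteq> gz t ?S" by (intro gz_mono) auto
            show "gz t ?S \<subseteq> gz t W"
            proof
              fix i assume i: "i \<in> gz t ?S"
              have "gz t ?S \<subseteq> gz t Z" using less.prems Z0(1) by (intro gz_mono) auto
              then have "i \<in> gz t Z0" using i eqZ by auto
              then show "i \<in> gz t W" using i less.prems by (auto simp: gz_def)
            qed
          qed
          obtain i where i: "gz t W = {i}" using t(2) card_1_singletonE by blast
          obtain z where z: "z \<in> W" "a i z \<noteq> 0" using meets[OF t(1), of i W] i by auto
          have zV: "z \<in> V" using z(1) less.prems Z0(1) \<open>Z \<subseteq> V\<close> by auto
          have "gz t (?S - {z}) \<subseteq> gz t ?S" by (intro gz_mono) auto
          then have "gz t (?S - {z}) = {}" using drop[OF z(2) zV, of t ?S] unfolding SW i by auto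
          then have "f (card (gz t (?S - {z}))) < f (card (gz t ?S))" unfolding SW i by (simp add: f_def)
          then have "\<Gamma> (?S - {z}) + 1 \<le> \<Gamma> ?S" using t(1) by (intro \<Gamma>_strict[of _ _ t]) auto
          moreover have "?S - {z} = (Z - Z0) \<union> (W - {z})" using z(1) less.prems by auto
          moreover have "\<Gamma> (Z - Z0) + card (W - {z}) \<le> \<Gamma> ((Z - Z0) \<union> (W - {z}))"
            using z(1) finW less.prems by (intro less.hyps card_Diff1_less) auto
          ultimately show ?thesis using card_Suc_Diff1[OF finW z(1)] by simp
        qed
      qed
      \<comment> \<open>The proper subset Z0 - {x} accounts for all variables of Z0 but one, and the
        row R accounts for the last.\<close>
      obtain x where x: "x \<in> Z0" using Z0(2) by blast
      have "\<Gamma> (Z - Z0) + card (Z0 - {x}) \<le> \<Gamma> ((Z - Z0) \<union> (Z0 - {x}))" using x by (intro chain) auto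
      also have "\<dots> \<le> \<Gamma> Z" using Z0(1) by (intro \<Gamma>_mono) auto
      finally have g1: "\<Gamma> (Z - Z0) + card Z0 \<le> \<Gamma> Z + 1" using card_Suc_Diff1[OF finZ0 x] by simp
      have "card (Z - Z0) < card Z" using Z0 finZ by (intro psubset_card_mono) auto
      then have "card (Z - Z0) \<le> card (hz (Z - Z0)) + \<Gamma> (Z - Z0)"
        unfolding \<Gamma>_def using less.prems by (intro less.hyps) auto
      moreover have "card Z = card (Z - Z0) + card Z0"
        using card_Diff_subset[OF finZ0 Z0(1)] card_mono[OF finZ Z0(1)] by simp
      ultimately show ?thesis using h1 g1 unfolding \<Gamma>_def[symmetric] by linarith
    qed
  qed
qed

text \<open>What the induction retains of the potential: I indexes the monomials and J the
  variables. Invertibility takes the form of injectivity on both sides, and the degrees of W and of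
  its dual are fixed functions, because elimination only restricts them.\<close>

locale qsystem =
  fixes I :: "'i set" and J :: "'j set" and a :: "'i \<Rightarrow> 'j \<Rightarrow> nat" and q :: "'j \<Rightarrow> rat" and qd :: "'i \<Rightarrow> rat"
  assumes finI: "finite I" and finJ: "finite J" and cardIJ: "card I = card J"
    and CN: "comb_nondegenerate I J a"
    and q_pos: "j \<in> J \<Longrightarrow> 0 < q j" and qd_pos: "i \<in> I \<Longrightarrow> 0 < qd i"
    and deg: "i \<in> I \<Longrightarrow> (\<Sum>j\<in>J. of_nat (a i j) * q j) = 1"
    and ddeg: "j \<in> J \<Longrightarrow> (\<Sum>i\<in>I. qd i * of_nat (a i j)) = 1"
    and col_inj: "(\<And>i. i \<in> I \<Longrightarrow> (\<Sum>j\<in>J. of_nat (a i j) * x j) = (0::rat)) \<Longrightarrow> j \<in> J \<Longrightarrow> x j = 0"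
    and row_inj: "(\<And>j. j \<in> J \<Longrightarrow> (\<Sum>i\<in>I. y i * of_nat (a i j)) = (0::rat)) \<Longrightarrow> i \<in> I \<Longrightarrow> y i = 0"
begin

definition linear_row :: "'i \<Rightarrow> 'j \<Rightarrow> bool" where
  "linear_row i k \<longleftrightarrow> i \<in> I \<and> k \<in> J \<and> a i k = 1 \<and> (\<forall>j\<in>J - {k}. a i j = 0)"

definition edge :: "'i \<Rightarrow> 'j \<Rightarrow> 'j \<Rightarrow> bool" where
  "edge i c t \<longleftrightarrow> i \<in> I \<and> c \<in> J \<and> t \<in> J \<and> c \<noteq> t \<and> a i c = 1 \<and> a i t = 1 \<and> (\<forall>j\<in>J. j \<noteq> c \<longrightarrow> j \<noteq> t \<longrightarrow> a i j = 0)"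

lemma edge_sym: "edge i c t \<Longrightarrow> edge i t c" unfolding edge_def by auto

lemma edge_deg:
  assumes "edge i c t" shows "q c + q t = 1"
proof -
  have "(\<Sum>j\<in>J. of_nat (a i j) * q j) = (\<Sum>j\<in>{c, t}. of_nat (a i j) * q j)"
    using assms finJ by (intro sum.mono_neutral_right) (auto simp: edge_def)
  then show ?thesis using assms deg[of i] by (auto simp: edge_def)
qed

lemma entry_le_deg: "i \<in> I \<Longrightarrow> S \<subseteq> J \<Longrightarrow> (\<Sum>j\<in>S. of_nat (a i j) * q j) \<le> 1"
  using deg[of i] sum_mono2[OF finJ, of S "\<lambda>j. of_nat (a i j) * q j"] q_pos by (force simp: less_imp_le)

text \<open>
  In a maximal matching E of quadratic monomials, counting monomials bounds the number of those
  that meet the matched variables T in another way. If no pivot existed, comparing degrees would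
  force both sets to have the same sum of exponent vectors, contradicting invertibility.
\<close>

lemma pivot_exists:
  assumes edge: "\<exists>i c t. edge i c t" and nolin: "\<And>i k. \<not> linear_row i k"
  shows "\<exists>i0 i1 c t. edge i0 c t \<and> i1 \<in> I \<and> i1 \<noteq> i0 \<and> a i1 c = 1 \<and> (\<forall>i\<in>I - {i0, i1}. a i c = 0)"
proof (rule ccontr)
  assume nopiv: "\<not> ?thesis"
  define supp where "supp i = {j\<in>J. a i j \<noteq> 0}" for i
  have supp_edge: "supp i = {c, t}" if "edge i c t" for i c t using that by (auto simp: supp_def edge_def)
  define matching where "matching E \<longleftrightarrow> E \<subseteq> I \<and> (\<forall>i\<in>E. \<exists>c t. edge i c t) \<and>
    (\<forall>i\<in>E. \<forall>i'\<in>E. i \<noteq> i' \<longrightarrow> supp i \<inter> supp i' = {})" for E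
  have cardle: "\<forall>E. matching E \<longrightarrow> card E < Suc (card I)"
    using card_mono[OF finI] by (auto simp: matching_def less_Suc_eq_le)
  obtain i0 c0 t0 where e0: "edge i0 c0 t0" using edge by blast
  have m0: "matching {i0}" using e0 by (auto simp: matching_def edge_def)
  obtain E where E: "matching E" and Emax: "\<forall>E'. matching E' \<longrightarrow> card E' \<le> card E"
    using ex_has_greatest_nat[of matching "{i0}" card, OF m0 cardle] by blast
  have Epos: "card E \<ge> 1" using Emax m0 by force
  have EI: "E \<subseteq> I" and finE: "finite E" using E finI finite_subset unfolding matching_def by auto
  have Eedge: "\<exists>c t. edge i c t" if "i \<in> E" for i using E that unfolding matching_def by blast
  define T where "T = (\<Union>i\<in>E. supp i)"
  define V where "V = J - T"
  have TJ: "T \<subseteq> J" by (auto simp: T_def supp_def)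
  have fin: "finite T" "finite V" using TJ finJ finite_subset by (auto simp: V_def)
  have suppcard: "card (supp i) = 2" "finite (supp i)" "(\<Sum>t\<in>supp i. q t) = 1" if i: "i \<in> E" for i
  proof -
    obtain c t where "edge i c t" using Eedge[OF i] by blast
    then show "card (supp i) = 2" "finite (supp i)" "(\<Sum>t\<in>supp i. q t) = 1"
      using supp_edge edge_deg by (auto simp: edge_def)
  qed
  have disj: "\<forall>i\<in>E. \<forall>i'\<in>E. i \<noteq> i' \<longrightarrow> supp i \<inter> supp i' = {}" using E unfolding matching_def by blast
  have "card T = (\<Sum>i\<in>E. card (supp i))"
    unfolding T_def using finE suppcard disj by (intro card_UN_disjoint) auto
  then have cardT: "card T = 2 * card E" using suppcard by simp
  have qT: "(\<Sum>t\<in>T. q t) = of_nat (card E)"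
  proof -
    have "(\<Sum>t\<in>T. q t) = (\<Sum>i\<in>E. \<Sum>t\<in>supp i. q t)"
      unfolding T_def using finE suppcard disj by (intro sum.UNION_disjoint) auto
    then show ?thesis using suppcard by simp
  qed
  have noV: "\<not> (edge i c t \<and> supp i \<subseteq> V)" for i c t
  proof
    assume h: "edge i c t \<and> supp i \<subseteq> V"
    then have disjT: "supp i \<inter> T = {}" by (auto simp: V_def)
    have ne: "supp i \<noteq> {}" using h supp_edge by blast
    then have "i \<notin> E" using disjT by (auto simp: T_def)
    moreover have "matching (insert i E)"
      unfolding matching_def
    proof (intro conjI ballI impI)
      show "insert i E \<subseteq> I" using EI h by (auto simp: edge_def)
      show "\<exists>c t. edge i' c t" if "i' \<in> insert i E" for i' using that h Eedge by blast
      show "supp i1 \<inter> supp i2 = {}" if "i1 \<in> insert i E" "i2 \<in> insert i E" "i1 \<noteq> i2" for i1 i2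
        using that disj disjT unfolding T_def by blast
    qed
    ultimately show False using Emax finE by force
  qed
  \<comment> \<open>The rows outside E are sorted by how they meet T: not at all, in a single
    variable with exponent 1, or more heavily.\<close>
  define H where "H = {i\<in>I. supp i \<subseteq> V}"
  define Good where "Good t = {i\<in>I - E. a i t = 1 \<and> (\<forall>j\<in>T - {t}. a i j = 0)}" for t
  define Bad where "Bad = I - E - H - (\<Union>t\<in>T. Good t)"
  have finH: "finite H" using finI by (simp add: H_def)
  have finG: "finite (Good t)" for t using finI by (simp add: Good_def)
  have EH: "E \<inter> H = {}"
  proof -
    have "i \<notin> H" if i: "i \<in> E" for i
    proof
      assume "i \<in> H"
      then have "supp i \<subseteq> V" by (simp add: H_def)
      moreover have "supp i \<subseteq> T" using i by (auto simp: T_def)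
      ultimately have "supp i = {}" by (auto simp: V_def)
      then show False using suppcard(1)[OF i] by simp
    qed
    then show ?thesis by blast
  qed
  have Hdef: "i \<in> H \<longleftrightarrow> i \<in> I \<and> (\<forall>j\<in>T. a i j = 0)" for i
    using TJ by (auto simp: H_def supp_def V_def)
  have JV: "J = V \<union> T" "V \<inter> T = {}" using TJ by (auto simp: V_def)
  have Eother: "\<exists>t'\<in>T - {t}. a i t' = 1" if i: "i \<in> E" and t: "t \<in> T" for i t
  proof -
    obtain c t' where ct: "edge i c t'" using Eedge[OF i] by blast
    have "c \<in> T" "t' \<in> T" using i supp_edge[OF ct] by (auto simp: T_def)
    then show ?thesis using ct by (cases "t = c") (auto simp: edge_def)
  qed
  \<comment> \<open>\<open>counting_lemma\<close> for Z = V. Maximality of E and the absence of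
    linear rows exclude short rows in H, and the unique pointer of \<open>comb_nondegenerate\<close>
    becomes a unique row of some \<open>Good t\<close>.\<close>
  have count: "card V \<le> card H + (\<Sum>t\<in>T. (let g = card (Good t) in if g \<ge> 2 then g - 1 else g))"
  proof -
    have "card V \<le> card {i \<in> H. (\<Sum>j\<in>V - V. a i j) \<le> 1} +
       (\<Sum>t\<in>T. (\<lambda>g. if g \<ge> 2 then g - 1 else g) (card {i \<in> Good t. \<forall>j\<in>V - V. a i j = 0}))"
    proof (rule counting_lemma[OF fin(2) finH fin(1) finG])
      fix i assume i: "i \<in> H"
      then have iI: "i \<in> I" and iT: "\<forall>j\<in>T. a i j = 0" using Hdef by auto
      show "(\<exists>j\<in>V. a i j \<ge> 2) \<or> (\<Sum>j\<in>V. a i j) \<ge> 3"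
      proof (rule ccontr)
        assume n: "\<not> ?thesis"
        then have le1: "a i j \<le> 1" if "j \<in> V" for j using that by force
        have sV: "supp i = {j\<in>V. a i j \<noteq> 0}" using iT JV by (auto simp: supp_def)
        have "(\<Sum>j\<in>V. a i j) = (\<Sum>j\<in>supp i. a i j)" using fin(2) sV by (intro sum.mono_neutral_right) auto
        also have "\<dots> = (\<Sum>j\<in>supp i. 1)" using le1 sV by (intro sum.cong refl) (force simp: le_Suc_eq)
        finally have "card (supp i) \<le> 2" using n by simp
        then consider "card (supp i) = 0" | "card (supp i) = 1" | "card (supp i) = 2" by linarith
        then show False
        proof cases
          case 1
          then have "supp i = {}" using fin(2) sV by simp
          then have "(\<Sum>j\<in>J. of_nat (a i j) * q j) = 0" by (intro sum.neutral) (auto simp: supp_def)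
          then show False using deg[OF iI] by simp
        next
          case 2
          then obtain k where k: "supp i = {k}" using card_1_singletonE by blast
          have "k \<in> {j\<in>V. a i j \<noteq> 0}" using k sV by simp
          then have "k \<in> V" "a i k = 1" using le1[of k] by auto
          then have "linear_row i k" unfolding linear_row_def using k iI JV by (auto simp: supp_def)
          then show False using nolin by blast
        next
          case 3
          then obtain c t where ct: "supp i = {c, t}" "c \<noteq> t" by (auto simp: card_2_iff)
          have ct': "c \<in> {j\<in>V. a i j \<noteq> 0}" "t \<in> {j\<in>V. a i j \<noteq> 0}" using ct sV by auto
          then have "c \<in> V" "t \<in> V" "a i c = 1" "a i t = 1" using le1[of c] le1[of t] ct' by auto
          then have "edge i c t" unfolding edge_def using ct iI JV by (auto simp: supp_def)
          then show False using noV i by (auto simp: H_def)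
        qed
      qed
    next
      fix t i assume t: "t \<in> T" and i: "i \<in> Good t"
      show "\<exists>j\<in>V. a i j \<noteq> 0"
      proof (rule ccontr)
        assume "\<not> ?thesis"
        then have "linear_row i t" unfolding linear_row_def using t i TJ JV by (auto simp: Good_def)
        then show False using nolin by blast
      qed
    next
      fix Y assume Y: "Y \<subseteq> V" "Y \<noteq> {}"
      have "Y \<subseteq> J" using Y by (auto simp: V_def)
      consider i where "i \<in> I" "\<forall>j\<in>J. j \<notin> Y \<longrightarrow> a i j = 0"
        | k where "k \<in> J - Y" "\<exists>!i. i \<in> I \<and> a i k = 1 \<and> (\<forall>j\<in>J. j \<notin> Y \<longrightarrow> j \<noteq> k \<longrightarrow> a i j = 0)"
        by (rule disj_bexE[OF CN[unfolded comb_nondegenerate_def, rule_format, of Y] that]) (use Y(2) \<open>Y \<subseteq> J\<close> in auto)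
      then show "(\<exists>i\<in>H. (\<Sum>j\<in>V - Y. a i j) \<le> 1) \<or> (\<exists>t\<in>T. card {i \<in> Good t. \<forall>j\<in>V - Y. a i j = 0} = 1)"
      proof cases
        case 1
        have "i \<in> H" unfolding Hdef using 1 Y JV by blast
        moreover have "(\<Sum>j\<in>V - Y. a i j) = 0" using 1 JV by (intro sum.neutral) auto
        ultimately show ?thesis by force
      next
        case 2
        then obtain i where i: "i \<in> I" "a i k = 1" "\<forall>j\<in>J. j \<notin> Y \<longrightarrow> j \<noteq> k \<longrightarrow> a i j = 0"
          and uniq: "\<And>i'. i' \<in> I \<Longrightarrow> a i' k = 1 \<Longrightarrow> \<forall>j\<in>J. j \<notin> Y \<longrightarrow> j \<noteq> k \<longrightarrow> a i' j = 0 \<Longrightarrow> i' = i" by (metis (no_types, lifting))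
        show ?thesis
        proof (cases "k \<in> T")
          case False
          then have kV: "k \<in> V - Y" using 2(1) JV by auto
          have "i \<in> H" unfolding Hdef using i False Y JV by (metis (no_types, lifting) Diff_iff IntI UnI2 empty_iff singletonD subset_iff)
          moreover have "(\<Sum>j\<in>V - Y. a i j) = a i k + (\<Sum>j\<in>V - Y - {k}. a i j)"
            using fin(2) kV by (simp add: sum.remove)
          moreover have "(\<Sum>j\<in>V - Y - {k}. a i j) = 0" using i JV by (intro sum.neutral) auto
          ultimately show ?thesis using i(2) by force
        next
          case True
          have TY: "T - {k} \<subseteq> J - Y - {k}" using Y JV by auto
          have "i \<notin> E"
          proof
            assume "i \<in> E"
            then obtain t' where "t' \<in> T - {k}" "a i t' = 1" using Eother True by blast
            then show False using i(3) TY by auto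
          qed
          then have iG: "i \<in> Good k" unfolding Good_def using i TY by auto
          have VY: "V - Y \<subseteq> J - Y - {k}" using True JV by auto
          have "{i \<in> Good k. \<forall>j\<in>V - Y. a i j = 0} = {i}"
          proof (intro equalityI subsetI)
            fix i' assume i': "i' \<in> {i \<in> Good k. \<forall>j\<in>V - Y. a i j = 0}"
            have "\<forall>j\<in>J. j \<notin> Y \<longrightarrow> j \<noteq> k \<longrightarrow> a i' j = 0" using i' JV by (auto simp: Good_def)
            then show "i' \<in> {i}" using uniq[of i'] i' by (auto simp: Good_def)
          next
            fix i' assume "i' \<in> {i}"
            then show "i' \<in> {i \<in> Good k. \<forall>j\<in>V - Y. a i j = 0}" using iG i(3) VY by auto
          qed
          then show ?thesis using True by (intro disjI2 bexI[of _ k]) auto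
        qed
      qed
    qed simp
    moreover have "{i \<in> H. (\<Sum>j\<in>V - V. a i j) \<le> 1} = H" "{i \<in> Good t. \<forall>j\<in>V - V. a i j = 0} = Good t" for t by auto
    ultimately show ?thesis by (simp only: Let_def)
  qed
  define T2 where "T2 = {t\<in>T. card (Good t) \<ge> 2}"
  have sumf: "(\<Sum>t\<in>T. (let g = card (Good t) in if g \<ge> 2 then g - 1 else g)) + card T2 = (\<Sum>t\<in>T. card (Good t))"
  proof -
    have "card T2 = (\<Sum>t\<in>T. if card (Good t) \<ge> 2 then 1 else 0)"
      using fin(1) by (simp add: T2_def sum.If_cases Int_def)
    then show ?thesis by (simp add: sum.distrib[symmetric] Let_def) (intro sum.cong refl, auto)
  qed
  have cardI: "card I = card E + card H + (\<Sum>t\<in>T. card (Good t)) + card Bad"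
  proof -
    let ?G = "\<Union>t\<in>T. Good t"
    have Gdisj: "Good t \<inter> Good t' = {}" if "t \<in> T" "t' \<in> T" "t \<noteq> t'" for t t'
      using that by (fastforce simp: Good_def)
    have cG: "card ?G = (\<Sum>t\<in>T. card (Good t))" using fin(1) finG Gdisj by (intro card_UN_disjoint) auto
    have GH: "?G \<inter> H = {}" by (auto simp: Good_def Hdef)
    have GE: "?G \<inter> E = {}" "?G \<subseteq> I" "H \<subseteq> I" by (auto simp: Good_def Hdef)
    have finGu: "finite ?G" using fin(1) finG by auto
    have "I = (E \<union> H) \<union> ?G \<union> Bad" using EI GE by (auto simp: Bad_def)
    then have "card I = card ((E \<union> H) \<union> ?G \<union> Bad)" by simp
    also have "\<dots> = card ((E \<union> H) \<union> ?G) + card Bad"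
      using finE finH finGu finI by (intro card_Un_disjoint) (auto simp: Bad_def)
    also have "card ((E \<union> H) \<union> ?G) = card (E \<union> H) + card ?G"
      using finE finH finGu GE GH by (intro card_Un_disjoint) auto
    also have "card (E \<union> H) = card E + card H" using finE finH EH by (intro card_Un_disjoint) auto
    finally show ?thesis by (simp add: cG)
  qed
  have cardJ: "card J = card V + 2 * card E" using JV fin cardT by (simp add: card_Un_disjoint)
  \<comment> \<open>There are as many rows as variables; comparing both counts with
    \<open>count\<close> leaves this bound by the number of matched pairs.\<close>
  have beta: "card Bad + card T2 \<le> card E" using count sumf cardI cardJ cardIJ by linarith
  have finBad: "finite Bad" using finI by (simp add: Bad_def)
  have BadI: "Bad \<subseteq> I" by (auto simp: Bad_def)
  \<comment> \<open>A matched variable t without a bad row occurs only in its edge and in at most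
    one good row. With one such row it would be a pivot. With none the dual degree of the edge is 1,
    so its other variable c occurs nowhere else either, and the columns of t and c coincide.\<close>
  have covered: "\<exists>i\<in>Bad. a i t \<noteq> 0" if t: "t \<in> T - T2" for t
  proof (rule ccontr)
    assume nb: "\<not> (\<exists>i\<in>Bad. a i t \<noteq> 0)"
    obtain e where e: "e \<in> E" "t \<in> supp e" using t by (auto simp: T_def)
    obtain c t' where ct': "edge e c t'" using Eedge[OF e(1)] by blast
    obtain c where ct: "edge e t c"
    proof (cases "t = c")
      case True then show ?thesis using ct' that by blast
    next
      case False then have "t = t'" using e(2) supp_edge[OF ct'] by auto
      then show ?thesis using edge_sym[OF ct'] that by blast
    qed
    have others: "a i t = 0" if i: "i \<in> I" "i \<noteq> e" "i \<notin> Good t" for i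
    proof -
      consider "i \<in> E" | "i \<in> H" | s where "s \<in> T" "i \<in> Good s" | "i \<in> Bad" using i(1) by (auto simp: Bad_def)
      then show ?thesis
      proof cases
        case 1 then have "t \<notin> supp i" using disj e i(2) by blast
        then show ?thesis using t TJ by (auto simp: supp_def)
      next
        case 2 then show ?thesis using t by (auto simp: Hdef)
      next
        case 3 then have "s \<noteq> t" using i(3) by auto
        then show ?thesis using 3 t by (auto simp: Good_def)
      next
        case 4 then show ?thesis using nb by blast
      qed
    qed
    have "card (Good t) \<le> 1" using t by (auto simp: T2_def)
    then consider "Good t = {}" | i1 where "Good t = {i1}"
      using finG[of t] by (metis One_nat_def card_0_eq card_1_singletonE le_Suc_eq le_zero_eq)
    then show False
    proof cases
      case 2
      then have "i1 \<in> I" "i1 \<noteq> e" "a i1 t = 1" using e(1) by (auto simp: Good_def)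
      then show False using nopiv ct others 2 by blast
    next
      case 1
      have eI: "e \<in> I" using e EI by auto
      have col: "(\<Sum>i\<in>I. qd i * of_nat (a i t)) = qd e"
        using finI eI others 1 ct by (subst sum.remove[of _ e]) (auto simp: edge_def intro!: sum.neutral)
      then have qde: "qd e = 1" using ddeg[of t] t TJ by auto
      have cJ: "c \<in> J" using ct by (simp add: edge_def)
      have "(\<Sum>i\<in>I - {e}. qd i * of_nat (a i c)) = 0"
        using ddeg[OF cJ] qde ct finI eI by (subst (asm) sum.remove[of _ e]) (auto simp: edge_def)
      then have z: "a i c = 0" if "i \<in> I" "i \<noteq> e" for i
      proof -
        have "\<forall>i\<in>I - {e}. qd i * of_nat (a i c) = 0"
          using \<open>(\<Sum>i\<in>I - {e}. qd i * of_nat (a i c)) = 0\<close> finI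
          by (subst (asm) sum_nonneg_eq_0_iff) (simp_all add: less_imp_le qd_pos)
        from bspec[OF this, of i] show ?thesis using that qd_pos[of i] by simp
      qed
      define x where "x j = (if j = t then 1 else if j = c then -1 else 0 :: rat)" for j
      have "(\<Sum>j\<in>J. of_nat (a i j) * x j) = 0" if i: "i \<in> I" for i
      proof -
        have "(\<Sum>j\<in>J. of_nat (a i j) * x j) = (\<Sum>j\<in>{t, c}. of_nat (a i j) * x j)"
          using finJ ct by (intro sum.mono_neutral_right) (auto simp: x_def edge_def)
        also have "\<dots> = of_nat (a i t) - of_nat (a i c)" using ct by (auto simp: x_def edge_def)
        also have "\<dots> = 0" using ct others[OF i] z[OF i] 1 by (cases "i = e") (auto simp: edge_def)
        finally show ?thesis .
      qed
      from col_inj[OF this, of t] show False using t TJ by (auto simp: x_def)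
    qed
  qed
  define d where "d t = (\<Sum>i\<in>Bad. a i t)" for t
  have d1: "d t \<ge> 1" if t: "t \<in> T - T2" for t
  proof -
    obtain i where "i \<in> Bad" "a i t \<noteq> 0" using covered[OF t] by blast
    then show ?thesis using member_le_sum[of i Bad "\<lambda>i. a i t"] finBad by (simp add: d_def)
  qed
  have qT0: "0 < q t" "q t < 1" if t: "t \<in> T" for t
  proof -
    show "0 < q t" using q_pos t TJ by auto
    obtain e where e: "e \<in> E" "t \<in> supp e" using t by (auto simp: T_def)
    obtain c t' where ct': "edge e c t'" using Eedge[OF e(1)] by blast
    then have "q c + q t' = 1" "0 < q c" "0 < q t'" "t = c \<or> t = t'"
      using edge_deg q_pos e(2) supp_edge by (auto simp: edge_def)
    then show "q t < 1" by auto
  qed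
  \<comment> \<open>By its degree equation a single bad row carries weight at most 1 on T.\<close>
  have up: "(\<Sum>t\<in>T. q t * of_nat (d t)) \<le> of_nat (card Bad)"
  proof -
    have "(\<Sum>t\<in>T. q t * of_nat (d t)) = (\<Sum>t\<in>T. \<Sum>i\<in>Bad. of_nat (a i t) * q t)"
      by (simp add: d_def sum_distrib_left mult.commute)
    also have "\<dots> = (\<Sum>i\<in>Bad. \<Sum>t\<in>T. of_nat (a i t) * q t)" by (rule sum.swap)
    also have "\<dots> \<le> (\<Sum>i\<in>Bad. 1)" using BadI TJ by (intro sum_mono entry_le_deg) auto
    finally show ?thesis by simp
  qed
  have T2T: "T2 \<subseteq> T" "finite T2" using fin(1) by (auto simp: T2_def)
  have low: "(\<Sum>t\<in>T - T2. q t) \<le> (\<Sum>t\<in>T. q t * of_nat (d t))"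
  proof -
    have "(\<Sum>t\<in>T - T2. q t) \<le> (\<Sum>t\<in>T - T2. q t * of_nat (d t))"
    proof (rule sum_mono)
      fix t assume t: "t \<in> T - T2"
      have "(1::rat) \<le> of_nat (d t)" using d1[OF t] by simp
      then show "q t \<le> q t * of_nat (d t)" using mult_left_mono[of 1 "of_nat (d t)" "q t"] qT0(1)[of t] t by auto
    qed
    also have "\<dots> \<le> (\<Sum>t\<in>T. q t * of_nat (d t))" using fin(1) qT0 by (intro sum_mono2) (auto simp: less_imp_le)
    finally show ?thesis .
  qed
  have splitT: "(\<Sum>t\<in>T. q t) = (\<Sum>t\<in>T - T2. q t) + (\<Sum>t\<in>T2. q t)"
    using sum.subset_diff[OF T2T(1) fin(1)] by simp
  have betaq: "of_nat (card Bad) + of_nat (card T2) \<le> (of_nat (card E) :: rat)"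
    using beta by (metis of_nat_add of_nat_le_iff)
  \<comment> \<open>Each \<open>q t\<close> is below 1, so a nonempty T2 would have weight below its
    cardinality. With T2 empty, the upper and lower estimates are forced to be equalities.\<close>
  have "of_nat (card T2) \<le> (\<Sum>t\<in>T2. q t)" using qT splitT low up betaq by linarith
  moreover have "(\<Sum>t\<in>T2. q t) < (\<Sum>t\<in>T2. 1)" if "T2 \<noteq> {}"
    using that T2T qT0(2) by (intro sum_strict_mono) auto
  ultimately have T2e: "T2 = {}" by force
  have eq: "(\<Sum>t\<in>T. q t * of_nat (d t)) = (\<Sum>t\<in>T. q t)" "card Bad = card E"
  proof -
    have "(\<Sum>t\<in>T. q t) \<le> (\<Sum>t\<in>T. q t * of_nat (d t))" using low T2e by simp
    moreover have "(of_nat (card Bad) :: rat) \<le> of_nat (card E)" using betaq T2e by simp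
    ultimately show "(\<Sum>t\<in>T. q t * of_nat (d t)) = (\<Sum>t\<in>T. q t)" using up qT by linarith
    then have "(of_nat (card E)::rat) \<le> of_nat (card Bad)" using up qT by linarith
    then show "card Bad = card E" using beta T2e by simp
  qed
  have "(\<Sum>t\<in>T. q t * (of_nat (d t) - 1)) = 0" using eq(1) by (simp add: sum_subtractf algebra_simps)
  then have "\<forall>t\<in>T. q t * (of_nat (d t) - 1) = 0"
    using d1 T2e qT0 fin(1) by (subst (asm) sum_nonneg_eq_0_iff) (auto simp: less_imp_le)
  then have dT: "of_nat (d t) = (1::rat)" if "t \<in> T" for t using that qT0(1)[OF that] by auto
  have badV: "a i j = 0" if i: "i \<in> Bad" and j: "j \<in> V" for i j
  proof -
    have "(\<Sum>i\<in>Bad. \<Sum>t\<in>T. of_nat (a i t) * q t) = (\<Sum>i\<in>Bad. 1)"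
    proof -
      have "(\<Sum>i\<in>Bad. \<Sum>t\<in>T. of_nat (a i t) * q t) = (\<Sum>t\<in>T. q t * of_nat (d t))"
        by (subst sum.swap) (simp add: d_def sum_distrib_left mult.commute)
      then show ?thesis using eq qT by simp
    qed
    then have "(\<Sum>i\<in>Bad. 1 - (\<Sum>t\<in>T. of_nat (a i t) * q t)) = 0" by (simp add: sum_subtractf)
    moreover have "0 \<le> 1 - (\<Sum>t\<in>T. of_nat (a i t) * q t)" if "i \<in> Bad" for i
      using entry_le_deg[of i T] that BadI TJ by auto
    ultimately have "\<forall>i\<in>Bad. 1 - (\<Sum>t\<in>T. of_nat (a i t) * q t) = 0"
      using finBad by (subst (asm) sum_nonneg_eq_0_iff) auto
    then have one: "(\<Sum>t\<in>T. of_nat (a i t) * q t) = 1" using i by simp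
    have "(\<Sum>j\<in>J. of_nat (a i j) * q j) = (\<Sum>j\<in>V. of_nat (a i j) * q j) + (\<Sum>t\<in>T. of_nat (a i t) * q t)"
      using JV fin by (simp add: sum.union_disjoint)
    then have "(\<Sum>j\<in>V. of_nat (a i j) * q j) = 0" using one deg[of i] i BadI by auto
    then have "of_nat (a i j) * q j = 0"
      using fin(2) j q_pos JV by (subst (asm) sum_nonneg_eq_0_iff) (auto simp: less_imp_le)
    then show ?thesis using q_pos[of j] j JV by auto
  qed
  \<comment> \<open>The bad rows and the matched rows both sum to the indicator of T, so their
    difference is a nontrivial relation between the rows.\<close>
  define y where "y i = (if i \<in> Bad then 1 else if i \<in> E then -1 else 0 :: rat)" for i
  have BE: "Bad \<inter> E = {}" by (auto simp: Bad_def)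
  have "(\<Sum>i\<in>I. y i * of_nat (a i j)) = 0" if j: "j \<in> J" for j
  proof -
    have "(\<Sum>i\<in>I. y i * of_nat (a i j)) = (\<Sum>i\<in>Bad \<union> E. y i * of_nat (a i j))"
      using finI BadI EI by (intro sum.mono_neutral_right) (auto simp: y_def)
    also have "\<dots> = (\<Sum>i\<in>Bad. y i * of_nat (a i j)) + (\<Sum>i\<in>E. y i * of_nat (a i j))"
      using finBad finE BE by (intro sum.union_disjoint)
    also have "(\<Sum>i\<in>Bad. y i * of_nat (a i j)) = of_nat (d j)" by (simp add: y_def d_def)
    also have "(\<Sum>i\<in>E. y i * of_nat (a i j)) = - (\<Sum>i\<in>E. of_nat (a i j))"
      unfolding sum_negf[symmetric] using BE by (intro sum.cong refl) (auto simp: y_def)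
    also have "of_nat (d j) + - (\<Sum>i\<in>E. of_nat (a i j)) = (0::rat)"
    proof (cases "j \<in> T")
      case True
      then obtain e where e: "e \<in> E" "j \<in> supp e" by (auto simp: T_def)
      obtain c t' where ct': "edge e c t'" using Eedge[OF e(1)] by blast
      have "a e j = 1" using ct' e(2) supp_edge[OF ct'] by (auto simp: edge_def)
      moreover have "a i j = 0" if "i \<in> E" "i \<noteq> e" for i
      proof -
        have "j \<notin> supp i" using disj e that by blast
        then show ?thesis using j by (simp add: supp_def)
      qed
      ultimately have "(\<Sum>i\<in>E. of_nat (a i j)) = (1::rat)" using finE e(1) by (subst sum.remove[of _ e]) (auto intro!: sum.neutral)
      then show ?thesis using dT[OF True] by simp
    next
      case False
      then have jV: "j \<in> V" using j JV by auto
      have "d j = 0" unfolding d_def using badV[OF _ jV] by simp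
      moreover have "a i j = 0" if "i \<in> E" for i
      proof -
        have "j \<notin> supp i" using that False by (auto simp: T_def)
        then show ?thesis using j by (simp add: supp_def)
      qed
      ultimately show ?thesis by simp
    qed
    finally show ?thesis .
  qed
  note y0 = row_inj[OF this]
  obtain e where e: "e \<in> E" using Epos by fastforce
  have "y e = 0" using y0 e EI by blast
  then show False using e BE by (auto simp: y_def split: if_splits)
qed

text \<open>The decomposition into chains and loops: p j is the variable that j points to.\<close>

lemma atomic_structure:
  assumes noedge: "\<And>i c t. \<not> edge i c t" and nolin: "\<And>i k. \<not> linear_row i k"
  shows "\<exists>\<pi> b p. bij_betw \<pi> J I \<and> (\<forall>j\<in>J. b j \<ge> 2 \<and> p j \<noteq> Some j \<and> (\<forall>k. p j = Some k \<longrightarrow> k \<in> J) \<and>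
     (\<forall>k\<in>J. a (\<pi> j) k = (if k = j then b j else if p j = Some k then 1 else 0))) \<and>
     (\<forall>j\<in>J. \<forall>l\<in>J. \<forall>k. p j = Some k \<and> p l = Some k \<longrightarrow> j = l)"
proof -
  \<comment> \<open>The condition for the set {v} yields a monomial v^b or v^b x_k; b >= 2 because
    linear rows and edges are excluded.\<close>
  have ex: "\<exists>i m. i \<in> I \<and> a i v \<ge> 2 \<and> m \<noteq> Some v \<and> (\<forall>k. m = Some k \<longrightarrow> k \<in> J) \<and>
      (\<forall>k\<in>J. k \<noteq> v \<longrightarrow> a i k = (if m = Some k then 1 else 0))" if v: "v \<in> J" for v
  proof -
    have c: "(\<exists>i\<in>I. \<forall>j\<in>J. j \<noteq> v \<longrightarrow> a i j = 0) \<or>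
        (\<exists>k\<in>J - {v}. \<exists>!i. i \<in> I \<and> a i k = 1 \<and> (\<forall>j\<in>J. j \<noteq> v \<longrightarrow> j \<noteq> k \<longrightarrow> a i j = 0))"
      using CN[unfolded comb_nondegenerate_def, rule_format, of "{v}"] v by simp
    consider i where "i \<in> I" "\<forall>j\<in>J. j \<noteq> v \<longrightarrow> a i j = 0"
      | k where "k \<in> J - {v}" "\<exists>!i. i \<in> I \<and> a i k = 1 \<and> (\<forall>j\<in>J. j \<noteq> v \<longrightarrow> j \<noteq> k \<longrightarrow> a i j = 0)"
      by (rule disj_bexE[OF c that])
    then show ?thesis
    proof cases
      case 1
      have "a i v \<noteq> 0"
      proof
        assume "a i v = 0"
        then have "(\<Sum>j\<in>J. of_nat (a i j) * q j) = 0" using 1 by (intro sum.neutral) force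
        then show False using deg[OF 1(1)] by simp
      qed
      moreover have "a i v \<noteq> 1" using nolin[of i v] 1 v by (auto simp: linear_row_def)
      ultimately show ?thesis using 1 by (intro exI[of _ i] exI[of _ None]) auto
    next
      case 2
      then obtain i where i: "i \<in> I" "a i k = 1" "\<forall>j\<in>J. j \<noteq> v \<longrightarrow> j \<noteq> k \<longrightarrow> a i j = 0" by blast
      have "a i v \<noteq> 0" using nolin[of i k] i 2(1) by (auto simp: linear_row_def)
      moreover have "a i v \<noteq> 1" using noedge[of i v k] i 2(1) v by (auto simp: edge_def)
      ultimately show ?thesis using i 2(1) by (intro exI[of _ i] exI[of _ "Some k"]) auto
    qed
  qed
  have "\<exists>f. \<forall>v\<in>J. fst (f v) \<in> I \<and> a (fst (f v)) v \<ge> 2 \<and> snd (f v) \<noteq> Some v \<and> (\<forall>k. snd (f v) = Some k \<longrightarrow> k \<in> J) \<and>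
      (\<forall>k\<in>J. k \<noteq> v \<longrightarrow> a (fst (f v)) k = (if snd (f v) = Some k then 1 else 0))"
    using ex by (intro bchoice) force
  then obtain f where f: "\<And>v. v \<in> J \<Longrightarrow> fst (f v) \<in> I \<and> a (fst (f v)) v \<ge> 2 \<and> snd (f v) \<noteq> Some v \<and> (\<forall>k. snd (f v) = Some k \<longrightarrow> k \<in> J) \<and>
      (\<forall>k\<in>J. k \<noteq> v \<longrightarrow> a (fst (f v)) k = (if snd (f v) = Some k then 1 else 0))" by blast
  define \<pi> where "\<pi> v = fst (f v)" for v
  define p where "p v = snd (f v)" for v
  define b where "b v = a (\<pi> v) v" for v
  have F: "\<pi> v \<in> I" "b v \<ge> 2" "p v \<noteq> Some v" "\<And>k. p v = Some k \<Longrightarrow> k \<in> J"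
    "\<And>k. k \<in> J \<Longrightarrow> k \<noteq> v \<Longrightarrow> a (\<pi> v) k = (if p v = Some k then 1 else 0)" if "v \<in> J" for v
    using f[OF that] by (auto simp: \<pi>_def p_def b_def)
  \<comment> \<open>In the row \<open>\<pi> v\<close> only v has an exponent of 2 or more.\<close>
  have inj: "inj_on \<pi> J"
  proof (rule inj_onI, rule ccontr)
    fix v w assume vw: "v \<in> J" "w \<in> J" "\<pi> v = \<pi> w" "v \<noteq> w"
    have "a (\<pi> v) w \<ge> 2" using F(2)[OF vw(2)] vw(3) by (simp add: b_def)
    then show False using F(5)[OF vw(1,2)] vw(4) by (auto split: if_splits)
  qed
  have "\<pi> ` J = I" using F(1) inj finI cardIJ by (intro card_subset_eq) (auto simp: card_image)
  then have bij: "bij_betw \<pi> J I" using inj by (simp add: bij_betw_def)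
  \<comment> \<open>If j and l both pointed to k, the condition for {j, l} would fail: the rows
    available to it all involve k, and the pointer to k is not unique.\<close>
  have pinj: "j = l" if jl: "j \<in> J" "l \<in> J" "p j = Some k" "p l = Some k" for j l k
  proof (rule ccontr)
    assume ne: "j \<noteq> l"
    have kJ: "k \<in> J" and kj: "k \<noteq> j" "k \<noteq> l" using F(3,4) jl by auto
    have row: "\<exists>s\<in>J. i = \<pi> s" if "i \<in> I" for i using that \<open>\<pi> ` J = I\<close> by auto
    have c: "(\<exists>i\<in>I. \<forall>m\<in>J. m \<noteq> j \<longrightarrow> m \<noteq> l \<longrightarrow> a i m = 0) \<or>
        (\<exists>k\<in>J - {j, l}. \<exists>!i. i \<in> I \<and> a i k = 1 \<and> (\<forall>m\<in>J. m \<noteq> j \<longrightarrow> m \<noteq> l \<longrightarrow> m \<noteq> k \<longrightarrow> a i m = 0))"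
      using CN[unfolded comb_nondegenerate_def, rule_format, of "{j, l}"] jl(1,2) by (simp add: imp_conjL)
    consider i where "i \<in> I" "\<forall>m\<in>J. m \<noteq> j \<longrightarrow> m \<noteq> l \<longrightarrow> a i m = 0"
      | k' where "k' \<in> J - {j, l}" "\<exists>!i. i \<in> I \<and> a i k' = 1 \<and> (\<forall>m\<in>J. m \<noteq> j \<longrightarrow> m \<noteq> l \<longrightarrow> m \<noteq> k' \<longrightarrow> a i m = 0)"
      by (rule disj_bexE[OF c that])
    then show False
    proof cases
      case 1
      obtain s where s: "s \<in> J" "i = \<pi> s" using row 1 by blast
      have "s \<in> {j, l}" using 1(2) s F(2)[OF s(1)] by (force simp: b_def)
      then have "p s = Some k" using jl by auto
      then have "a i k = 1" using F(5)[OF s(1) kJ] s kj \<open>s \<in> {j, l}\<close> by auto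
      then show False using 1(2) kJ kj by auto
    next
      case 2
      from 2(2) obtain i where i: "i \<in> I" "a i k' = 1" "\<forall>m\<in>J. m \<noteq> j \<longrightarrow> m \<noteq> l \<longrightarrow> m \<noteq> k' \<longrightarrow> a i m = 0"
        and uniq: "\<And>i'. i' \<in> I \<Longrightarrow> a i' k' = 1 \<Longrightarrow> \<forall>m\<in>J. m \<noteq> j \<longrightarrow> m \<noteq> l \<longrightarrow> m \<noteq> k' \<longrightarrow> a i' m = 0 \<Longrightarrow> i' = i"
        by (rule ex1_conjE[OF _ that])
      obtain s where s: "s \<in> J" "i = \<pi> s" using row i by blast
      have sjl: "s \<in> {j, l}"
      proof (rule ccontr)
        assume n: "s \<notin> {j, l}"
        have "a i s \<ge> 2" using F(2)[OF s(1)] s by (simp add: b_def)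
        then show False using i n s(1) by (cases "s = k'") auto
      qed
      have kk: "k' = k"
      proof -
        have "p s = Some k" using sjl jl by auto
        moreover have kJ': "k' \<in> J" "k' \<noteq> s" using 2(1) sjl by blast+
        have "p s = Some k'" using F(5)[OF s(1) kJ'] i(2) unfolding s(2) by (cases "p s = Some k'") simp_all
        ultimately show ?thesis by simp
      qed
      have "a (\<pi> j) k = 1" "a (\<pi> l) k = 1" "\<forall>m\<in>J. m \<noteq> j \<longrightarrow> m \<noteq> l \<longrightarrow> m \<noteq> k \<longrightarrow> a (\<pi> j) m = 0" "\<forall>m\<in>J. m \<noteq> j \<longrightarrow> m \<noteq> l \<longrightarrow> m \<noteq> k \<longrightarrow> a (\<pi> l) m = 0"
        using F(5)[OF jl(1)] F(5)[OF jl(2)] jl kJ kj by auto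
      then have "\<pi> j = i" "\<pi> l = i" using uniq[unfolded kk] F(1) jl(1,2) by blast+
      then have "\<pi> j = \<pi> l" by simp
      then show False using inj jl(1,2) ne by (auto dest: inj_onD)
    qed
  qed
  show ?thesis
  proof (intro exI[of _ \<pi>] exI[of _ b] exI[of _ p] conjI ballI allI impI)
    show "bij_betw \<pi> J I" by (rule bij)
    show "2 \<le> b j" "p j \<noteq> Some j" if "j \<in> J" for j using F(2,3) that by auto
    show "k \<in> J" if "j \<in> J" "p j = Some k" for j k using F(4) that by blast
    show "a (\<pi> j) k = (if k = j then b j else if p j = Some k then 1 else 0)" if "j \<in> J" "k \<in> J" for j k
      using F(5)[OF that] by (simp add: b_def)
    show "j = l" if "j \<in> J" "l \<in> J" "p j = Some k \<and> p l = Some k" for j l k using pinj that by blast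
  qed
qed

end

section \<open>Chains and loops\<close>

lemma countable_rdot:
  assumes "finite J"
  shows "countable (range (rdot J c))"
  using assms
proof (induction J rule: finite_induct)
  case empty
  then show ?case by (simp add: rdot_def image_def)
next
  case (insert x J)
  have "range (rdot (insert x J) c) \<subseteq> (\<lambda>(r::rat, s). c x * of_rat r + s) ` (UNIV \<times> range (rdot J c))"
  proof
    fix y assume "y \<in> range (rdot (insert x J) c)"
    then obtain g where "y = rdot (insert x J) c g" by blast
    then have "y = (\<lambda>(r::rat, s). c x * of_rat r + s) (g x, rdot J c g)" using insert.hyps by (simp add: rdot_def)
    then show "y \<in> (\<lambda>(r::rat, s). c x * of_rat r + s) ` (UNIV \<times> range (rdot J c))" by blast
  qed
  moreover have "countable ((\<lambda>(r::rat, s). c x * of_rat r + s) ` (UNIV \<times> range (rdot J c)))"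
    by (rule countable_image[OF countable_SIGMA[OF countableI_type insert.IH]])
  ultimately show ?case by (rule countable_subset)
qed

text \<open>The coordinates are chosen one after the other: a rational pairing that involves the new
  coordinate confines it to a countable set.\<close>

lemma generic_point:
  fixes C \<delta> :: real
  assumes "finite J" "\<delta> > 0"
  shows "\<exists>c. (\<forall>j\<in>J. \<bar>c j - C\<bar> < \<delta>) \<and> (\<forall>g. (\<exists>j\<in>J. g j \<noteq> 0) \<longrightarrow> rdot J c g \<notin> \<rat>)"
  using assms(1)
proof (induction J rule: finite_induct)
  case empty
  then show ?case by simp
next
  case (insert x J)
  from insert.IH obtain c where c: "\<forall>j\<in>J. \<bar>c j - C\<bar> < \<delta>" "\<forall>g. (\<exists>j\<in>J. g j \<noteq> 0) \<longrightarrow> rdot J c g \<notin> \<rat>" by (elim exE conjE)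
  define S where "S = (\<lambda>(r::rat, s, t::rat). (of_rat r - s) / of_rat t) ` (UNIV \<times> range (rdot J c) \<times> UNIV)"
  have "countable S" unfolding S_def 
    by (rule countable_image[OF countable_SIGMA[OF countableI_type countable_SIGMA[OF countable_rdot[OF insert.hyps(1)] countableI_type]]])
  moreover have "uncountable {C<..<C + \<delta>}" using assms(2) by (simp add: uncountable_open_interval)
  ultimately obtain y where y: "y \<in> {C<..<C + \<delta>}" "y \<notin> S" by (meson countable_subset subsetI)
  have r: "rdot (insert x J) (c(x := y)) g = y * of_rat (g x) + rdot J c g" for g
  proof -
    have "(\<Sum>j\<in>J. (c(x := y)) j * of_rat (g j)) = (\<Sum>j\<in>J. c j * of_rat (g j))"
      using insert.hyps by (intro sum.cong) auto
    then show ?thesis using insert.hyps by (simp add: rdot_def)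
  qed
  have "rdot (insert x J) (c(x := y)) g \<notin> \<rat>" if g: "\<exists>j\<in>insert x J. g j \<noteq> 0" for g
  proof (cases "g x = 0")
    case True
    then show ?thesis using g c(2) by (auto simp: r)
  next
    case False
    show ?thesis
    proof
      assume "rdot (insert x J) (c(x := y)) g \<in> \<rat>"
      then obtain t where t: "y * of_rat (g x) + rdot J c g = of_rat t" unfolding r by (elim Rats_cases)
      have "y = (of_rat t - rdot J c g) / of_rat (g x)" using t False by (simp add: field_simps)
      then have "y = (\<lambda>(r::rat, s, t::rat). (of_rat r - s) / of_rat t) (t, rdot J c g, g x)" by simp
      then have "y \<in> S" unfolding S_def by blast
      then show False using y by blast
    qed
  qed
  moreover have "\<forall>j\<in>insert x J. \<bar>(c(x := y)) j - C\<bar> < \<delta>" using c(1) y insert.hyps by auto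
  ultimately show ?case by (intro exI[of _ "c(x := y)"]) blast
qed

lemma unit_interval_not_Ints: "0 < x \<Longrightarrow> x < 1 \<Longrightarrow> (x::real) \<notin> \<int>"
  by (auto elim!: Ints_cases)

lemma sum_shift_Ints:
  fixes b n p :: "'j \<Rightarrow> rat"
  assumes "\<And>j. j \<in> J \<Longrightarrow> n j - p j \<in> \<int>" "\<And>j. j \<in> J \<Longrightarrow> b j \<in> \<int>" "(\<Sum>j\<in>J. b j * p j) \<in> \<int>"
  shows "(\<Sum>j\<in>J. b j * n j) \<in> \<int>"
proof -
  have "(\<Sum>j\<in>J. b j * n j) = (\<Sum>j\<in>J. b j * p j) + (\<Sum>j\<in>J. b j * (n j - p j))"
    by (simp add: sum.distrib[symmetric] algebra_simps)
  moreover have "(\<Sum>j\<in>J. b j * (n j - p j)) \<in> \<int>" by (rule Ints_sum) (rule Ints_mult[OF assms(2,1)])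
  ultimately show ?thesis using assms(3) by simp
qed

lemma Im_mult_of_rat [simp]: "Im (x * of_rat r) = Im x * of_rat r"
  by (simp add: complex_of_rat_eq)

lemma Im_of_rat_mult [simp]: "Im (of_rat r * x) = of_rat r * Im x"
  by (simp add: complex_of_rat_eq)

lemma rdot_unit: "finite J \<Longrightarrow> s \<in> J \<Longrightarrow> rdot J x (\<lambda>j. if j = s then 1 else 0) = x s"
  by (simp add: rdot_def if_distrib[of of_rat] if_distrib[of "\<lambda>y. x _ * y"] sum.delta cong: if_cong)

text \<open>
  The groups of the two sides enter through finite sets P and Pd of representatives modulo the
  lattices spanned by the unit vectors. The lattices N and M are lat P J and lat Pd I.
\<close>

locale mirror = qsystem I J a q qd
  for I :: "'i set" and J :: "'j set" and a :: "'i \<Rightarrow> 'j \<Rightarrow> nat" and q :: "'j \<Rightarrow> rat" and qd :: "'i \<Rightarrow> rat" +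
  fixes P :: "('j \<Rightarrow> rat) set" and Pd :: "('i \<Rightarrow> rat) set"
  assumes reps: "reps_group P J" and dreps: "reps_group Pd I"
    and int: "p \<in> P \<Longrightarrow> i \<in> I \<Longrightarrow> (\<Sum>j\<in>J. of_nat (a i j) * p j) \<in> \<int>"
    and dint: "r \<in> Pd \<Longrightarrow> j \<in> J \<Longrightarrow> (\<Sum>i\<in>I. r i * of_nat (a i j)) \<in> \<int>"
    and pair: "r \<in> Pd \<Longrightarrow> p \<in> P \<Longrightarrow> (\<Sum>i\<in>I. r i * (\<Sum>j\<in>J. of_nat (a i j) * p j)) \<in> \<int>"
    and dual: "k \<in> annihilator P J \<Longrightarrow> \<exists>m\<in>lat Pd I. \<forall>j\<in>J. (\<Sum>i\<in>I. m i * of_nat (a i j)) = k j"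
    and ddual: "l \<in> annihilator Pd I \<Longrightarrow> \<exists>n\<in>lat P J. \<forall>i\<in>I. (\<Sum>j\<in>J. of_nat (a i j) * n j) = l i"
begin

lemma int_lat:
  assumes "n \<in> lat P J" "i \<in> I"
  shows "(\<Sum>j\<in>J. of_nat (a i j) * n j) \<in> \<int>"
proof -
  obtain p where p: "p \<in> P" "\<And>j. j \<in> J \<Longrightarrow> n j - p j \<in> \<int>" using assms(1) by (auto simp: lat_def)
  show ?thesis by (rule sum_shift_Ints[OF p(2) _ int[OF p(1) assms(2)]]) auto
qed

lemma pair_swap: "(\<Sum>i\<in>I. r i * (\<Sum>j\<in>J. of_nat (a i j) * p j)) = (\<Sum>j\<in>J. (\<Sum>i\<in>I. r i * of_nat (a i j)) * p j)"
  unfolding sum_distrib_left sum_distrib_right mult.assoc by (rule sum.swap)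

lemma pair_lat:
  assumes "r \<in> Pd" "n \<in> lat P J"
  shows "(\<Sum>i\<in>I. r i * (\<Sum>j\<in>J. of_nat (a i j) * n j)) \<in> \<int>"
proof -
  obtain p where p: "p \<in> P" "\<And>j. j \<in> J \<Longrightarrow> n j - p j \<in> \<int>" using assms(2) by (auto simp: lat_def)
  have h: "(\<Sum>j\<in>J. (\<Sum>i\<in>I. r i * of_nat (a i j)) * p j) \<in> \<int>" using pair[OF assms(1) p(1)] by (simp only: pair_swap)
  show ?thesis unfolding pair_swap by (rule sum_shift_Ints[OF p(2) dint[OF assms(1)] h])
qed

lemma dint_lat:
  assumes "m \<in> lat Pd I" "j \<in> J"
  shows "(\<Sum>i\<in>I. m i * of_nat (a i j)) \<in> \<int>"
proof -
  obtain r where r: "r \<in> Pd" "\<And>i. i \<in> I \<Longrightarrow> m i - r i \<in> \<int>" using assms(1) by (auto simp: lat_def)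
  have h: "(\<Sum>i\<in>I. of_nat (a i j) * r i) \<in> \<int>" using dint[OF r(1) assms(2)] by (simp add: mult.commute)
  have "(\<Sum>i\<in>I. of_nat (a i j) * m i) \<in> \<int>" by (rule sum_shift_Ints[OF r(2) Ints_of_nat h])
  then show ?thesis by (simp add: mult.commute)
qed

lemma lat_pair:
  assumes "m \<in> lat Pd I" "p \<in> P"
  shows "(\<Sum>i\<in>I. m i * (\<Sum>j\<in>J. of_nat (a i j) * p j)) \<in> \<int>"
proof -
  obtain r where r: "r \<in> Pd" "\<And>i. i \<in> I \<Longrightarrow> m i - r i \<in> \<int>" using assms(1) by (auto simp: lat_def)
  have h: "(\<Sum>i\<in>I. (\<Sum>j\<in>J. of_nat (a i j) * p j) * r i) \<in> \<int>" using pair[OF r(1) assms(2)] by (simp add: mult.commute)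
  have "(\<Sum>i\<in>I. (\<Sum>j\<in>J. of_nat (a i j) * p j) * m i) \<in> \<int>"
    by (rule sum_shift_Ints[OF r(2) int[OF assms(2)] h])
  then show ?thesis by (simp add: mult.commute)
qed

end

locale atomic = mirror I J a q qd P Pd
  for I :: "'i set" and J :: "'j set" and a q qd P Pd +
  fixes \<pi> :: "'j \<Rightarrow> 'i" and b :: "'j \<Rightarrow> nat" and pt :: "'j \<Rightarrow> 'j option" and D :: nat
  assumes bij: "bij_betw \<pi> J I" and b2: "j \<in> J \<Longrightarrow> b j \<ge> 2" and pt_ne: "j \<in> J \<Longrightarrow> pt j \<noteq> Some j"
    and pt_in: "j \<in> J \<Longrightarrow> pt j = Some k \<Longrightarrow> k \<in> J"
    and pt_inj: "j \<in> J \<Longrightarrow> l \<in> J \<Longrightarrow> pt j = Some k \<Longrightarrow> pt l = Some k \<Longrightarrow> j = l"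
    and a_eq: "j \<in> J \<Longrightarrow> k \<in> J \<Longrightarrow> a (\<pi> j) k = (if k = j then b j else if pt j = Some k then 1 else 0)"
    and D0: "D > 0" and D_P: "p \<in> P \<Longrightarrow> j \<in> J \<Longrightarrow> of_nat D * p j \<in> \<int>"
    and D_Pd: "r \<in> Pd \<Longrightarrow> i \<in> I \<Longrightarrow> of_nat D * r i \<in> \<int>"
begin

definition u :: "'j \<Rightarrow> 'j \<Rightarrow> rat" where
  "u l j = (if j = l then of_nat (b l) else if pt l = Some j then 1 else 0)"

abbreviation "\<pi>' \<equiv> inv_into J \<pi>"

lemma \<pi>'_\<pi> [simp]: "s \<in> J \<Longrightarrow> \<pi>' (\<pi> s) = s"
  using bij by (simp add: bij_betw_inv_into_left)

lemma \<pi>_in [simp]: "s \<in> J \<Longrightarrow> \<pi> s \<in> I"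
  using bij by (auto simp: bij_betw_def)

lemma \<pi>'_in [simp]: "i \<in> I \<Longrightarrow> \<pi>' i \<in> J" and \<pi>_\<pi>' [simp]: "i \<in> I \<Longrightarrow> \<pi> (\<pi>' i) = i"
  using bij by (auto simp: bij_betw_def inv_into_into f_inv_into_f)

lemma sum_I: "sum f I = (\<Sum>s\<in>J. f (\<pi> s))"
  by (rule sum.reindex_bij_betw[OF bij, symmetric])

lemma prod_I: "prod f I = (\<Prod>s\<in>J. f (\<pi> s))"
  by (rule prod.reindex_bij_betw[OF bij, symmetric])

lemma u_a: "l \<in> J \<Longrightarrow> j \<in> J \<Longrightarrow> rat_of_nat (a (\<pi> l) j) = u l j"
  by (auto simp: u_def a_eq)

lemma u_int: "u l j \<in> \<int>"
  by (simp add: u_def)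

lemma sum_u: "l \<in> J \<Longrightarrow> (\<Sum>j\<in>J. of_nat (a (\<pi> l) j) * n j) = dot J (u l) n"
  unfolding dot_def by (intro sum.cong refl) (simp add: u_a)

lemma sum_m: "j \<in> J \<Longrightarrow> (\<Sum>i\<in>I. m i * of_nat (a i j)) = (\<Sum>s\<in>J. m (\<pi> s) * u s j)"
  unfolding sum_I by (intro sum.cong refl) (simp add: u_a)

text \<open>D times a unit vector pairs integrally with P, so it lies in the annihilator, and the
  assumption \<open>dual\<close> writes it as a combination of rows. Division by D gives the inverse
  matrix.\<close>

lemma dual_basis_exists: "\<exists>G. \<forall>i\<in>J. \<forall>j\<in>J. (\<Sum>s\<in>J. G s i * u s j) = (if i = j then 1 else 0)"
proof -
  have "\<exists>m. \<forall>j\<in>J. (\<Sum>i'\<in>I. m i' * rat_of_nat (a i' j)) = (if j = i then rat_of_nat D else 0)" if i: "i \<in> J" for i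
  proof -
    have "(\<Sum>j\<in>J. (if j = i then rat_of_nat D else 0) * p j) \<in> \<int>" if "p \<in> P" for p
      using i D_P[OF that i] finJ by (simp add: if_distrib[of "\<lambda>y. y * _"] sum.delta cong: if_cong)
    then have "(\<lambda>j. if j = i then rat_of_nat D else 0) \<in> annihilator P J" using i by (auto simp: annihilator_def)
    from dual[OF this] show ?thesis by blast
  qed
  then obtain f where f: "\<And>i j. i \<in> J \<Longrightarrow> j \<in> J \<Longrightarrow> (\<Sum>i'\<in>I. f i i' * rat_of_nat (a i' j)) = (if j = i then rat_of_nat D else 0)"
    using bchoice[of J "\<lambda>i m. \<forall>j\<in>J. (\<Sum>i'\<in>I. m i' * rat_of_nat (a i' j)) = (if j = i then rat_of_nat D else 0)"] by blast
  have "(\<Sum>s\<in>J. f i (\<pi> s) / rat_of_nat D * u s j) = (if i = j then 1 else 0)" if ij: "i \<in> J" "j \<in> J" for i j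
  proof -
    have "(\<Sum>s\<in>J. f i (\<pi> s) / rat_of_nat D * u s j) = (\<Sum>s\<in>J. f i (\<pi> s) * u s j) / rat_of_nat D"
      by (simp add: sum_divide_distrib)
    also have "\<dots> = (if i = j then 1 else 0)"
      using f[OF ij] D0 unfolding sum_m[OF ij(2)] by auto
    finally show ?thesis .
  qed
  then show ?thesis by (intro exI[of _ "\<lambda>s i. f i (\<pi> s) / rat_of_nat D"]) blast
qed

definition G where "G = (SOME G. \<forall>i\<in>J. \<forall>j\<in>J. (\<Sum>s\<in>J. G s i * u s j) = (if i = j then 1 else 0))"

lemma G_u: "i \<in> J \<Longrightarrow> j \<in> J \<Longrightarrow> (\<Sum>s\<in>J. G s i * u s j) = (if i = j then 1 else 0)"
  using someI_ex[OF dual_basis_exists] unfolding G_def[symmetric] by blast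

lemma G_expand: 
  assumes "j \<in> J" shows "(\<Sum>s\<in>J. G s j * dot J (u s) n) = n j"
proof -
  have "(\<Sum>s\<in>J. G s j * dot J (u s) n) = (\<Sum>i\<in>J. (\<Sum>s\<in>J. G s j * u s i) * n i)"
    unfolding dot_def by (simp add: sum_distrib_left sum_distrib_right mult.assoc) (rule sum.swap)
  also have "\<dots> = (\<Sum>i\<in>J. if j = i then n i else 0)" by (intro sum.cong refl) (simp add: G_u[OF assms])
  finally show ?thesis using assms finJ by (simp add: sum.delta)
qed

lemma u_expand: 
  assumes "j \<in> J" shows "(\<Sum>s\<in>J. dot J k (G s) * u s j) = k j"
proof -
  have "(\<Sum>s\<in>J. dot J k (G s) * u s j) = (\<Sum>i\<in>J. k i * (\<Sum>s\<in>J. G s i * u s j))"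
    unfolding dot_def by (simp add: sum_distrib_left sum_distrib_right mult.assoc) (rule sum.swap)
  also have "\<dots> = (\<Sum>i\<in>J. if i = j then k i else 0)" by (intro sum.cong refl) (simp add: G_u[OF _ assms])
  finally show ?thesis using assms finJ by (simp add: sum.delta)
qed

text \<open>G is chosen as a one-sided inverse of the matrix of rows; \<open>row_inj\<close> makes
  it two-sided.\<close>

lemma dot_u_G:
  assumes "s \<in> J" "t \<in> J"
  shows "dot J (u s) (G t) = (if s = t then 1 else 0)"
proof -
  define y where "y i = dot J (u s) (G (\<pi>' i)) - (if s = \<pi>' i then 1 else 0)" for i
  have "(\<Sum>i\<in>I. y i * of_nat (a i j)) = 0" if j: "j \<in> J" for j
  proof -
    have "(\<Sum>i\<in>I. y i * of_nat (a i j)) = (\<Sum>t\<in>J. dot J (u s) (G t) * u t j - (if s = t then u t j else 0))"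
      unfolding sum_m[OF j] by (intro sum.cong refl) (simp add: y_def algebra_simps)
    also have "\<dots> = 0" using assms finJ by (simp add: sum_subtractf u_expand[OF j] sum.delta)
    finally show ?thesis .
  qed
  from row_inj[OF this, of "\<pi> t"] show ?thesis using assms by (simp add: y_def)
qed

lemma dot_sum_u:
  assumes "s \<in> J" shows "dot J (\<lambda>j. \<Sum>t\<in>J. x t * u t j) (G s) = x s"
proof -
  have "dot J (\<lambda>j. \<Sum>t\<in>J. x t * u t j) (G s) = (\<Sum>t\<in>J. x t * dot J (u t) (G s))"
    unfolding dot_def by (simp add: sum_distrib_left sum_distrib_right mult.assoc) (rule sum.swap)
  also have "\<dots> = (\<Sum>t\<in>J. if t = s then x t else 0)" by (intro sum.cong refl) (simp add: dot_u_G assms)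
  finally show ?thesis using assms finJ by (simp add: sum.delta)
qed

lemma dot_sum_G:
  assumes "s \<in> J" shows "dot J (u s) (\<lambda>j. \<Sum>t\<in>J. x t * G t j) = x s"
proof -
  have "dot J (u s) (\<lambda>j. \<Sum>t\<in>J. x t * G t j) = (\<Sum>t\<in>J. x t * dot J (u s) (G t))"
    unfolding dot_def by (simp add: sum_distrib_left sum_distrib_right mult_ac) (rule sum.swap)
  also have "\<dots> = (\<Sum>t\<in>J. if t = s then x t else 0)" by (intro sum.cong refl) (auto simp: dot_u_G assms)
  finally show ?thesis using assms finJ by (simp add: sum.delta)
qed

text \<open>Every row of the exponent matrix pairs with q to 1, so the inverse matrix sends the
  vector of ones to q; \<open>G_qd\<close> is the transposed statement.\<close>

lemma G_q: "j \<in> J \<Longrightarrow> (\<Sum>s\<in>J. G s j) = q j"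
proof -
  assume j: "j \<in> J"
  have "dot J (u s) q = 1" if "s \<in> J" for s using deg[of "\<pi> s"] that by (simp add: sum_u)
  then show ?thesis using G_expand[OF j, of q] by simp
qed

lemma G_qd:
  assumes "s \<in> J" shows "(\<Sum>j\<in>J. G s j) = qd (\<pi> s)"
proof -
  have "dot J (\<lambda>j. \<Sum>t\<in>J. qd (\<pi> t) * u t j) (G s) = (\<Sum>j\<in>J. G s j)"
    unfolding dot_def using ddeg sum_m[of _ qd] by (intro sum.cong refl) simp
  then show ?thesis using dot_sum_u[OF assms, of "\<lambda>t. qd (\<pi> t)"] by simp
qed

lemma uminus_annihilator: "k \<in> annihilator R S \<Longrightarrow> (\<lambda>j. - k j) \<in> annihilator R S"
  by (auto simp: annihilator_def sum_negf)

text \<open>The two components change places; this matches the summation sets of the two expansions.\<close>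

definition flip :: "('j \<Rightarrow> rat) \<times> ('j \<Rightarrow> rat) \<Rightarrow> ('i \<Rightarrow> rat) \<times> ('i \<Rightarrow> rat)" where
  "flip = (\<lambda>(k, n). (\<lambda>i. if i \<in> I then - dot J (u (\<pi>' i)) n else 0, \<lambda>i. if i \<in> I then - dot J k (G (\<pi>' i)) else 0))"

text \<open>The substitution k = - m a, l = - a n in coordinates. The assumptions
  \<open>dual\<close> and \<open>ddual\<close> provide an m and an n in the right lattices, and
  invertibility identifies them with the explicit formulas in terms of G.\<close>

lemma bij_flip: "bij_betw flip (annihilator P J \<times> lat P J) (annihilator Pd I \<times> lat Pd I)"
proof -
  define unflip :: "('i \<Rightarrow> rat) \<times> ('i \<Rightarrow> rat) \<Rightarrow> ('j \<Rightarrow> rat) \<times> ('j \<Rightarrow> rat)" where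
    "unflip = (\<lambda>(l, m). (\<lambda>j. if j \<in> J then - (\<Sum>s\<in>J. m (\<pi> s) * u s j) else 0, \<lambda>j. if j \<in> J then - (\<Sum>s\<in>J. l (\<pi> s) * G s j) else 0))"
  have into: "flip (k, n) \<in> annihilator Pd I \<times> lat Pd I" if k: "k \<in> annihilator P J" and n: "n \<in> lat P J" for k n
  proof -
    have l: "(\<Sum>j\<in>J. of_nat (a i j) * n j) = dot J (u (\<pi>' i)) n" if "i \<in> I" for i
      using sum_u[of "\<pi>' i" n] that by simp
    have "dot J (u (\<pi>' i)) n \<in> \<int>" if "i \<in> I" for i using int_lat[OF n that] l[OF that] by simp
    moreover have "(\<Sum>i\<in>I. (if i \<in> I then - dot J (u (\<pi>' i)) n else 0) * r i) \<in> \<int>" if "r \<in> Pd" for r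
    proof -
      have "(\<Sum>i\<in>I. (if i \<in> I then - dot J (u (\<pi>' i)) n else 0) * r i) = - (\<Sum>i\<in>I. r i * (\<Sum>j\<in>J. of_nat (a i j) * n j))"
        unfolding sum_negf[symmetric] by (intro sum.cong refl) (simp add: l)
      then show ?thesis using pair_lat[OF that n] by simp
    qed
    ultimately have 1: "fst (flip (k, n)) \<in> annihilator Pd I" by (auto simp: annihilator_def flip_def)
    obtain m where m: "m \<in> lat Pd I" "\<And>j. j \<in> J \<Longrightarrow> (\<Sum>s\<in>J. m (\<pi> s) * u s j) = - k j"
      using dual[OF uminus_annihilator[OF k]] by (auto simp: sum_m)
    have "m i = (if i \<in> I then - dot J k (G (\<pi>' i)) else 0)" for i
    proof (cases "i \<in> I")
      case True
      have "m i = dot J (\<lambda>j. \<Sum>s\<in>J. m (\<pi> s) * u s j) (G (\<pi>' i))"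
        using dot_sum_u[of "\<pi>' i" "\<lambda>s. m (\<pi> s)"] True by simp
      also have "\<dots> = - dot J k (G (\<pi>' i))" unfolding dot_def sum_negf[symmetric] using m(2) by (intro sum.cong refl) simp
      finally show ?thesis using True by simp
    qed (use m(1) in \<open>auto simp: lat_def\<close>)
    then have "m = snd (flip (k, n))" by (auto simp: flip_def)
    then show ?thesis using 1 m(1) by (metis mem_Times_iff)
  qed
  have unflip_in: "unflip (l, m) \<in> annihilator P J \<times> lat P J" if l: "l \<in> annihilator Pd I" and m: "m \<in> lat Pd I" for l m
  proof -
    have c: "(\<Sum>s\<in>J. m (\<pi> s) * u s j) = (\<Sum>i\<in>I. m i * of_nat (a i j))" if "j \<in> J" for j using sum_m[OF that] by simp
    have "(\<Sum>s\<in>J. m (\<pi> s) * u s j) \<in> \<int>" if "j \<in> J" for j using dint_lat[OF m that] c[OF that] by simp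
    moreover have "(\<Sum>j\<in>J. (if j \<in> J then - (\<Sum>s\<in>J. m (\<pi> s) * u s j) else 0) * p j) \<in> \<int>" if "p \<in> P" for p
    proof -
      have "(\<Sum>j\<in>J. (if j \<in> J then - (\<Sum>s\<in>J. m (\<pi> s) * u s j) else 0) * p j) = - (\<Sum>i\<in>I. m i * (\<Sum>j\<in>J. of_nat (a i j) * p j))"
        unfolding pair_swap sum_negf[symmetric] by (intro sum.cong refl) (simp add: c[symmetric] sum_negf)
      then show ?thesis using lat_pair[OF m that] by simp
    qed
    ultimately have 1: "fst (unflip (l, m)) \<in> annihilator P J" by (auto simp: annihilator_def unflip_def)
    obtain n where n: "n \<in> lat P J" "\<And>i. i \<in> I \<Longrightarrow> (\<Sum>j\<in>J. of_nat (a i j) * n j) = - l i"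
      using ddual[OF uminus_annihilator[OF l]] by auto
    have "n j = (if j \<in> J then - (\<Sum>s\<in>J. l (\<pi> s) * G s j) else 0)" for j
    proof (cases "j \<in> J")
      case True
      have "dot J (u s) n = - l (\<pi> s)" if "s \<in> J" for s using n(2)[of "\<pi> s"] that by (simp add: sum_u)
      then have "n j = (\<Sum>s\<in>J. - (l (\<pi> s) * G s j))"
        unfolding G_expand[OF True, of n, symmetric] by (intro sum.cong refl) simp
      then show ?thesis using True by (simp add: sum_negf)
    qed (use n(1) in \<open>auto simp: lat_def\<close>)
    then have "n = snd (unflip (l, m))" by (auto simp: unflip_def)
    then show ?thesis using 1 n(1) by (metis mem_Times_iff)
  qed
  show ?thesis
  proof (rule bij_betw_byWitness[where f' = unflip])
    show "\<forall>x\<in>annihilator P J \<times> lat P J. unflip (flip x) = x"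
    proof safe
      fix k n assume k: "k \<in> annihilator P J" and n: "n \<in> lat P J"
      have "(if j \<in> J then - (\<Sum>s\<in>J. snd (flip (k, n)) (\<pi> s) * u s j) else 0) = k j" for j
        using u_expand[of j k] k by (auto simp: flip_def annihilator_def sum_negf)
      moreover have "(if j \<in> J then - (\<Sum>s\<in>J. fst (flip (k, n)) (\<pi> s) * G s j) else 0) = n j" for j
        using G_expand[of j n] n by (auto simp: flip_def lat_def sum_negf mult.commute)
      ultimately show "unflip (flip (k, n)) = (k, n)" by (auto simp: unflip_def case_prod_beta)
    qed
    show "\<forall>x\<in>annihilator Pd I \<times> lat Pd I. flip (unflip x) = x"
    proof safe
      fix l m assume l: "l \<in> annihilator Pd I" and m: "m \<in> lat Pd I"
      have "dot J (u s) (\<lambda>j. if j \<in> J then - (\<Sum>s\<in>J. l (\<pi> s) * G s j) else 0) = - l (\<pi> s)" if "s \<in> J" for s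
        using dot_sum_G[OF that, of "\<lambda>s. l (\<pi> s)"] by (simp add: dot_def sum_negf)
      moreover have "dot J (\<lambda>j. if j \<in> J then - (\<Sum>s\<in>J. m (\<pi> s) * u s j) else 0) (G s) = - m (\<pi> s)" if "s \<in> J" for s
        using dot_sum_u[OF that, of "\<lambda>s. m (\<pi> s)"] by (simp add: dot_def sum_negf)
      ultimately show "flip (unflip (l, m)) = (l, m)" using l m
        by (auto simp: unflip_def flip_def annihilator_def lat_def fun_eq_iff)
    qed
    show "flip ` (annihilator P J \<times> lat P J) \<subseteq> annihilator Pd I \<times> lat Pd I" using into by blast
    show "unflip ` (annihilator Pd I \<times> lat Pd I) \<subseteq> annihilator P J \<times> lat P J" using unflip_in by blast
  qed
qed

text \<open>W is the family of values on the dual side. A row receives the value at the variable to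
  which it points, as \<open>u_c\<close> of \<open>core\<close> demands, and keeps z if it points to
  none. B solves the linear system of the rows with right-hand side W, and Bd applies the inverse
  matrix to Z; thus the terms with B and Z on one side become those with W and Bd on the
  other.\<close>

lemma mirror_series:
  fixes Z :: "'j \<Rightarrow> complex" and z \<tau> :: complex
  defines "W \<equiv> \<lambda>s. case pt s of Some k \<Rightarrow> Z k | None \<Rightarrow> z"
  defines "B \<equiv> \<lambda>j. \<Sum>s\<in>J. W s * of_rat (G s j)"
  defines "Bd \<equiv> \<lambda>s. \<Sum>j\<in>J. Z j * of_rat (G s j)"
  assumes \<tau>: "Im \<tau> > 0" and gen: "\<And>g j. j \<in> J \<Longrightarrow> g j \<noteq> 0 \<Longrightarrow> rdot J (\<lambda>j. - Im (Z j) / Im \<tau>) g \<notin> \<rat>"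
    and Zs: "\<And>j. j \<in> J \<Longrightarrow> 0 < - Im (Z j) / Im \<tau> \<and> - Im (Z j) / Im \<tau> < 1"
    and zs: "0 < - Im z / Im \<tau>" "- Im z / Im \<tau> < 1"
    and nu: "\<And>j. j \<in> J \<Longrightarrow> 0 < of_nat D * (- Im (B j) / Im \<tau>) \<and> of_nat D * (- Im (B j) / Im \<tau>) < 1"
  shows "infsum (theta_term J Z B \<tau>) (annihilator P J \<times> lat P J) = (-1) ^ card J *
     infsum (theta_term I (\<lambda>i. W (\<pi>' i)) (\<lambda>i. Bd (\<pi>' i)) \<tau>) (annihilator Pd I \<times> lat Pd I)"
proof -
  define K where "K = annihilator P J"
  define N where "N = lat P J"
  define c where "c j = - Im (Z j) / Im \<tau>" for j
  have c_eq: "c = (\<lambda>j. - Im (Z j) / Im \<tau>)" by (simp add: c_def fun_eq_iff)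
  define \<nu> where "\<nu> j = - Im (B j) / Im \<tau>" for j
  define w where "w = (\<lambda>(k, n). e1 (\<Sum>j\<in>J. of_rat (k j) * B j - Z j * of_rat (n j) + of_rat (k j * n j) * \<tau>))"
  have Bu: "(\<Sum>j\<in>J. B j * of_rat (u l j)) = W l" if l: "l \<in> J" for l
  proof -
    have "(\<Sum>j\<in>J. B j * of_rat (u l j)) = (\<Sum>s\<in>J. W s * of_rat (dot J (u l) (G s)))"
      unfolding B_def dot_def by (simp add: sum_distrib_left sum_distrib_right of_rat_sum of_rat_mult mult_ac) (rule sum.swap)
    also have "\<dots> = (\<Sum>s\<in>J. if s = l then W s else 0)" by (intro sum.cong refl) (auto simp: dot_u_G l)
    finally show ?thesis using l finJ by (simp add: sum.delta)
  qed
  have nu_u: "rdot J \<nu> (u l) = - Im (W l) / Im \<tau>" if "l \<in> J" for l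
  proof -
    have "rdot J \<nu> (u l) = - (\<Sum>j\<in>J. Im (B j * of_rat (u l j))) / Im \<tau>"
      by (simp add: rdot_def \<nu>_def sum_negf sum_divide_distrib)
    then show ?thesis by (simp only: Im_sum[symmetric] Bu[OF that])
  qed
  have Ws: "0 < - Im (W s) / Im \<tau> \<and> - Im (W s) / Im \<tau> < 1" if "s \<in> J" for s
    using Zs pt_in[OF that] zs by (auto simp: W_def split: option.splits)
  have exponent: "(\<Sum>j\<in>J. of_rat (k j) * B j - Z j * of_rat (n j) + of_rat (k j * n j) * \<tau>) =
     (\<Sum>j\<in>J. of_rat (k j) * B j) - (\<Sum>j\<in>J. Z j * of_rat (n j)) + of_rat (\<Sum>j\<in>J. k j * n j) * \<tau>" for k n
    by (simp add: sum.distrib sum_subtractf of_rat_sum sum_distrib_right)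
  \<comment> \<open>The imaginary part of the exponent is Im \<tau> times the pairing of k + c and n
    - \<nu>, up to the pairing of the shifts themselves; that pairing gives the constant in the
    bound.\<close>
  interpret core J K N c \<nu> w b pt u D "2 * pi * Im \<tau>" "exp (- (2 * pi * Im \<tau>) * (\<Sum>j\<in>J. c j * \<nu> j))"
  proof
    show "finite J" by (rule finJ)
    show "0 < D" by (rule D0)
    show "k j = 0" if "k \<in> K" "j \<notin> J" for k j using that by (auto simp: K_def annihilator_def)
    show "k j \<in> \<int>" if "k \<in> K" for k j using that by (auto simp: K_def annihilator_def)
    show "n j = 0" if "n \<in> N" "j \<notin> J" for n j using that by (auto simp: N_def lat_def)
    show "of_nat D * n j \<in> \<int>" if n: "n \<in> N" and j: "j \<in> J" for n j
    proof -
      obtain p where p: "p \<in> P" "n j - p j \<in> \<int>" using n j by (auto simp: N_def lat_def)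
      have "of_nat D * n j = of_nat D * p j + of_nat D * (n j - p j)" by (simp add: algebra_simps)
      then show ?thesis using D_P[OF p(1) j] Ints_mult[OF Ints_of_nat p(2)] by simp
    qed
    show "(\<lambda>j. k j - t * u l j) \<in> K" if k: "k \<in> K" and l: "l \<in> J" and t: "t \<in> \<int>" for k l t
    proof -
      have 1: "u l j = 0" if "j \<notin> J" for j using that l pt_in[OF l] by (auto simp: u_def)
      have "(\<Sum>j\<in>J. (k j - t * u l j) * p j) \<in> \<int>" if p: "p \<in> P" for p
      proof -
        have "(\<Sum>j\<in>J. (k j - t * u l j) * p j) = (\<Sum>j\<in>J. k j * p j) - t * dot J (u l) p"
          by (simp add: dot_def sum_subtractf sum_distrib_left algebra_simps)
        moreover have "dot J (u l) p \<in> \<int>" using int[OF p \<pi>_in[OF l]] by (simp add: sum_u[OF l])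
        moreover have "(\<Sum>j\<in>J. k j * p j) \<in> \<int>" using k p by (auto simp: K_def annihilator_def)
        ultimately show ?thesis using Ints_mult[OF t] by simp
      qed
      moreover have "k j - t * u l j \<in> \<int>" for j
        using k Ints_mult[OF t u_int] by (auto simp: K_def annihilator_def)
      ultimately show ?thesis using k 1 by (auto simp: K_def annihilator_def)
    qed
    show "n(i := n i - t) \<in> N" if n: "n \<in> N" and i: "i \<in> J" and t: "t \<in> \<int>" for n i t
    proof -
      obtain p where p: "p \<in> P" "\<And>j. j \<in> J \<Longrightarrow> n j - p j \<in> \<int>" using n by (auto simp: N_def lat_def)
      have "(n(i := n i - t)) j - p j \<in> \<int>" if "j \<in> J" for j
        using p(2)[OF that] Ints_diff[OF p(2)[OF that] t] by (auto simp: algebra_simps)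
      moreover have "(n(i := n i - t)) j = 0" if "j \<notin> J" for j using n i that by (auto simp: N_def lat_def)
      ultimately show ?thesis unfolding N_def lat_def using p(1) by blast
    qed
    show "dot J (u l) n \<in> \<int>" if "n \<in> N" "l \<in> J" for n l
      using int_lat[of n "\<pi> l"] that by (simp add: N_def sum_u)
    show "rdot J c g \<notin> \<rat>" if "j \<in> J" "g j \<noteq> 0" for j g using gen[of j g, OF that] unfolding c_eq[symmetric] .
    show "of_nat D * \<nu> j \<notin> \<int>" if "j \<in> J" for j
      using nu[OF that] unfolding \<nu>_def by (intro unit_interval_not_Ints) auto
    show "rdot J \<nu> (u l) \<notin> \<int>" if "l \<in> J" for l
      using Ws[OF that] unfolding nu_u[OF that] by (intro unit_interval_not_Ints) auto
    show "rdot J \<nu> (u l) = c i" if "l \<in> J" "pt l = Some i" for l i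
      using that by (simp add: nu_u c_def W_def)
    show "u l = (\<lambda>j. if j = l then of_nat (b l) else if pt l = Some j then 1 else 0)" for l by (simp add: u_def fun_eq_iff)
    show "2 \<le> b l" "pt l \<noteq> Some l" if "l \<in> J" for l using b2[OF that] pt_ne[OF that] by auto
    show "i \<in> J" if "l \<in> J" "pt l = Some i" for l i using pt_in that by blast
    show "l = l'" if "l \<in> J" "l' \<in> J" "pt l = Some i" "pt l' = Some i" for l l' i using pt_inj that by blast
    show "0 < 2 * pi * Im \<tau>" using \<tau> by simp
    show "norm (w (k, n)) \<le> exp (- (2 * pi * Im \<tau>) * (\<Sum>j\<in>J. c j * \<nu> j)) *
        exp (- (2 * pi * Im \<tau>) * (\<Sum>j\<in>J. (of_rat (k j) + c j) * (of_rat (n j) - \<nu> j)))" for k n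
    proof -
      have *: "Im (of_rat (k j) * B j - Z j * of_rat (n j) + of_rat (k j * n j) * \<tau>) =
          Im \<tau> * (c j * \<nu> j + (of_rat (k j) + c j) * (of_rat (n j) - \<nu> j))" for j
      proof -
        have "Im (of_rat (k j) * B j - Z j * of_rat (n j) + of_rat (k j * n j) * \<tau>) =
            of_rat (k j) * Im (B j) - Im (Z j) * of_rat (n j) + of_rat (k j) * of_rat (n j) * Im \<tau>"
          by (simp add: of_rat_mult)
        moreover have "Im (B j) = - Im \<tau> * \<nu> j" "Im (Z j) = - Im \<tau> * c j" using \<tau> by (simp_all add: \<nu>_def c_def)
        ultimately show ?thesis by (simp add: algebra_simps)
      qed
      have "Im (\<Sum>j\<in>J. of_rat (k j) * B j - Z j * of_rat (n j) + of_rat (k j * n j) * \<tau>) =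
          Im \<tau> * ((\<Sum>j\<in>J. c j * \<nu> j) + (\<Sum>j\<in>J. (of_rat (k j) + c j) * (of_rat (n j) - \<nu> j)))"
        unfolding Im_sum * by (simp only: sum_distrib_left[symmetric] sum.distrib)
      then show ?thesis unfolding w_def case_prod_conv norm_e1 by (simp add: exp_add[symmetric] algebra_simps)
    qed
    \<comment> \<open>The two linear terms change by the same multiple of \<open>Z i\<close>, which
      cancels, and the pairing of k and n is the quadratic form that the reflection
      preserves.\<close>
    show "w (\<lambda>j. k j - t * u l j, n(i := n i - t)) = w (k, n)"
      if l: "l \<in> J" and i: "pt l = Some i" and t: "t = k i + dot J (u l) n" for k n l i t
    proof -
      have iJ: "i \<in> J" using pt_in[OF l i] .
      have il: "i \<noteq> l" using pt_ne[OF l] i by auto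
      have ui: "u l i = 1" using i il by (simp add: u_def)
      have upd: "(n(i := n i - t)) j = n j - (if j = i then t else 0)" for j by simp
      have 1: "(\<Sum>j\<in>J. of_rat (k j - t * u l j) * B j) = (\<Sum>j\<in>J. of_rat (k j) * B j) - of_rat t * Z i"
      proof -
        have "(\<Sum>j\<in>J. of_rat (k j - t * u l j) * B j) = (\<Sum>j\<in>J. of_rat (k j) * B j) - of_rat t * (\<Sum>j\<in>J. B j * of_rat (u l j))"
          by (simp add: of_rat_diff of_rat_mult sum_subtractf sum_distrib_left algebra_simps)
        then show ?thesis using Bu[OF l] i by (simp add: W_def)
      qed
      have 2: "(\<Sum>j\<in>J. Z j * of_rat ((n(i := n i - t)) j)) = (\<Sum>j\<in>J. Z j * of_rat (n j)) - of_rat t * Z i"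
      proof -
        have "(\<Sum>j\<in>J. Z j * of_rat ((n(i := n i - t)) j)) = (\<Sum>j\<in>J. Z j * of_rat (n j) - (if j = i then of_rat t * Z i else 0))"
          unfolding upd by (intro sum.cong refl) (auto simp: of_rat_diff algebra_simps)
        then show ?thesis using iJ finJ by (simp add: sum_subtractf sum.delta)
      qed
      have 3: "(\<Sum>j\<in>J. (k j - t * u l j) * (n(i := n i - t)) j) = (\<Sum>j\<in>J. k j * n j)"
      proof -
        have "(\<Sum>j\<in>J. (k j - t * u l j) * (n(i := n i - t)) j) =
            (\<Sum>j\<in>J. k j * n j - t * (u l j * n j) - (if j = i then (k i - t) * t else 0))"
          unfolding upd by (intro sum.cong refl) (auto simp: ui algebra_simps)
        also have "\<dots> = (\<Sum>j\<in>J. k j * n j) - t * dot J (u l) n - (k i - t) * t"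
          using iJ finJ by (simp add: sum_subtractf sum.delta sum_distrib_left dot_def)
        also have "\<dots> = (\<Sum>j\<in>J. k j * n j)" unfolding t by (simp add: algebra_simps)
        finally show ?thesis .
      qed
      show ?thesis unfolding w_def case_prod_conv exponent 1 2 3 by simp
    qed
  qed
  obtain G' where G': "dual_bases J (forms J) G'"
    and path: "infsum (st (forms {}) (\<lambda>s j. if j = s then 1 else 0)) (K \<times> N) = infsum (st (forms J) G') (K \<times> N)"
    using path[OF finJ order_refl] by blast
  have G'G: "G' t j = G t j" if t: "t \<in> J" and j: "j \<in> J" for t j
  proof -
    have "dot J (u s) (G' t) = (if s = t then 1 else 0)" if "s \<in> J" for s
      using G' t that by (auto simp: dual_bases_def forms_def)
    then have "(\<Sum>s\<in>J. G s j * dot J (u s) (G' t)) = (\<Sum>s\<in>J. if s = t then G s j else 0)" by (intro sum.cong refl) auto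
    then show ?thesis using G_expand[OF j, of "G' t"] t finJ by (simp add: sum.delta)
  qed
  have first: "infsum (theta_term J Z B \<tau>) (K \<times> N) = infsum (st (forms {}) (\<lambda>s j. if j = s then 1 else 0)) (K \<times> N)"
  proof (rule infsum_cong)
    fix x assume "x \<in> K \<times> N"
    obtain k n where x: "x = (k, n)" by force
    have "sg (of_rat (k s) - Im (Z s) / Im \<tau>) (of_rat (n s) + Im (B s) / Im \<tau>) =
       sg (cf k (\<lambda>j. if j = s then 1 else 0)) (xf n (forms {} s))" if "s \<in> J" for s
      by (simp add: cf_def xf_def forms_def rdot_unit[OF finJ that] c_def \<nu>_def)
    then show "theta_term J Z B \<tau> x = st (forms {}) (\<lambda>s j. if j = s then 1 else 0) x"
      unfolding x st_def theta_term_def case_prod_conv unfolding w_def case_prod_conv by (simp cong: prod.cong)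
  qed
  \<comment> \<open>In the basis of rows the sign arguments are those of the dual series with the
    two components exchanged. The shift of k comes with one sign and that of n with the other, so
    both components are negated, and each slot contributes a factor -1.\<close>
  have last: "st (forms J) G' x = (-1) ^ card J * theta_term I (\<lambda>i. W (\<pi>' i)) (\<lambda>i. Bd (\<pi>' i)) \<tau> (flip x)" for x
  proof -
    obtain k n where x: "x = (k, n)" by force
    have cG: "cf k (G' s) = of_rat (dot J k (G s)) - Im (Bd s) / Im \<tau>" if "s \<in> J" for s
    proof -
      have "cf k (G' s) = cf k (G s)" unfolding cf_def rdot_def using G'G that by (intro sum.cong refl) simp
      moreover have "rdot J c (G s) = - Im (Bd s) / Im \<tau>"
        by (simp add: Bd_def rdot_def c_def sum_negf sum_divide_distrib)
      ultimately show ?thesis by (simp add: cf_eq)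
    qed
    have xu: "xf n (forms J s) = of_rat (dot J (u s) n) + Im (W s) / Im \<tau>" if "s \<in> J" for s
      using nu_u[OF that] that by (simp add: xf_eq forms_def)
    have sg: "(\<Prod>i\<in>I. sg (of_rat (fst (flip x) i) - Im (W (\<pi>' i)) / Im \<tau>) (of_rat (snd (flip x) i) + Im (Bd (\<pi>' i)) / Im \<tau>)) =
        (-1) ^ card J * (\<Prod>s\<in>J. sg (cf k (G' s)) (xf n (forms J s)))"
    proof -
      have "sg (of_rat (fst (flip x) (\<pi> s)) - Im (W (\<pi>' (\<pi> s))) / Im \<tau>) (of_rat (snd (flip x) (\<pi> s)) + Im (Bd (\<pi>' (\<pi> s))) / Im \<tau>) =
          - sg (cf k (G' s)) (xf n (forms J s))" if s: "s \<in> J" for s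
      proof -
        have "of_rat (fst (flip x) (\<pi> s)) - Im (W (\<pi>' (\<pi> s))) / Im \<tau> = - xf n (forms J s)"
          "of_rat (snd (flip x) (\<pi> s)) + Im (Bd (\<pi>' (\<pi> s))) / Im \<tau> = - cf k (G' s)"
          using s by (simp_all add: x flip_def xu cG of_rat_minus)
        then show ?thesis by (simp only: sg_uminus sg_commute)
      qed
      then show ?thesis unfolding prod_I by (simp add: prod_uminus cong: prod.cong)
    qed
    have i: "(\<Sum>s\<in>J. of_rat (dot J (u s) n) * Bd s) = (\<Sum>j\<in>J. Z j * of_rat (n j))"
    proof -
      have "(\<Sum>s\<in>J. of_rat (dot J (u s) n) * Bd s) = (\<Sum>j\<in>J. Z j * of_rat (\<Sum>s\<in>J. G s j * dot J (u s) n))"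
        unfolding Bd_def by (simp add: sum_distrib_left of_rat_sum of_rat_mult mult_ac) (rule sum.swap)
      then show ?thesis using G_expand by (simp cong: sum.cong)
    qed
    have ii: "(\<Sum>s\<in>J. W s * of_rat (dot J k (G s))) = (\<Sum>j\<in>J. of_rat (k j) * B j)"
      unfolding B_def dot_def by (simp add: sum_distrib_left of_rat_sum of_rat_mult mult_ac) (rule sum.swap)
    have iii: "(\<Sum>s\<in>J. dot J (u s) n * dot J k (G s)) = (\<Sum>j\<in>J. k j * n j)"
    proof -
      have "(\<Sum>s\<in>J. dot J (u s) n * dot J k (G s)) = (\<Sum>j\<in>J. k j * (\<Sum>s\<in>J. G s j * dot J (u s) n))"
        unfolding dot_def[of J k] by (simp add: sum_distrib_left mult_ac) (rule sum.swap)
      then show ?thesis using G_expand by (simp cong: sum.cong)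
    qed
    have "(\<Sum>i\<in>I. of_rat (fst (flip x) i) * Bd (\<pi>' i) - W (\<pi>' i) * of_rat (snd (flip x) i) + of_rat (fst (flip x) i * snd (flip x) i) * \<tau>) =
       (\<Sum>s\<in>J. W s * of_rat (dot J k (G s)) - of_rat (dot J (u s) n) * Bd s + of_rat (dot J (u s) n * dot J k (G s)) * \<tau>)"
      unfolding sum_I by (intro sum.cong refl) (simp add: x flip_def of_rat_minus)
    also have "\<dots> = (\<Sum>j\<in>J. of_rat (k j) * B j - Z j * of_rat (n j) + of_rat (k j * n j) * \<tau>)"
      unfolding sum.distrib sum_subtractf i ii sum_distrib_right[symmetric] of_rat_sum[symmetric] iii ..
    finally have ex: "(\<Sum>i\<in>I. of_rat (fst (flip x) i) * Bd (\<pi>' i) - W (\<pi>' i) * of_rat (snd (flip x) i) + of_rat (fst (flip x) i * snd (flip x) i) * \<tau>) =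
       (\<Sum>j\<in>J. of_rat (k j) * B j - Z j * of_rat (n j) + of_rat (k j * n j) * \<tau>)" .
    have "theta_term I (\<lambda>i. W (\<pi>' i)) (\<lambda>i. Bd (\<pi>' i)) \<tau> (fst (flip x), snd (flip x)) = (-1) ^ card J * st (forms J) G' (k, n)"
      unfolding theta_term_def case_prod_conv sg ex st_def unfolding w_def case_prod_conv by simp
    then have "(-1) ^ card J * theta_term I (\<lambda>i. W (\<pi>' i)) (\<lambda>i. Bd (\<pi>' i)) \<tau> (flip x) = ((-1) ^ card J * (-1) ^ card J) * st (forms J) G' (k, n)"
      by simp
    then show ?thesis by (simp add: x power_mult_distrib[symmetric])
  qed
  show ?thesis
    unfolding K_def[symmetric] N_def[symmetric] first path last infsum_cmult_right'
    unfolding K_def N_def infsum_reindex_bij_betw[OF bij_flip, of "theta_term I (\<lambda>i. W (\<pi>' i)) (\<lambda>i. Bd (\<pi>' i)) \<tau>"] ..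
qed

end

section \<open>Passage to equal values of z\<close>

definition phi :: "complex \<Rightarrow> complex \<Rightarrow> rat \<Rightarrow> rat \<Rightarrow> rat \<Rightarrow> complex" where
  "phi \<tau> z x \<theta> \<theta>1 = e1 (- z * of_rat \<theta>) *
     (Theta (z - (z * of_rat x + of_rat \<theta> * \<tau> + of_rat \<theta>1)) \<tau> / Theta (z * of_rat x + of_rat \<theta> * \<tau> + of_rat \<theta>1) \<tau>)"

definition orbifold_sum :: "'j set \<Rightarrow> ('j \<Rightarrow> rat) set \<Rightarrow> ('j \<Rightarrow> rat) \<Rightarrow> complex \<Rightarrow> complex \<Rightarrow> complex" where
  "orbifold_sum J P q z \<tau> = 1 / of_nat (card P) * (\<Sum>p\<in>P. \<Sum>p1\<in>P. \<Prod>j\<in>J. phi \<tau> z (q j) (p j) (p1 j))"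

lemma not_Ints_shift:
  fixes x :: real and r :: rat
  assumes "of_nat D * r \<in> \<int>" "0 < of_nat D * x" "of_nat D * x < 1"
  shows "of_rat r - x \<notin> \<int>"
proof
  assume h: "of_rat r - x \<in> \<int>"
  obtain k :: int where "of_nat D * r = of_int k" using assms(1) by (elim Ints_cases)
  then have "(of_rat (of_nat D * r) :: real) = of_int k" by simp
  then have "(of_nat D * of_rat r :: real) \<in> \<int>" by (simp add: of_rat_mult)
  moreover have "of_nat D * (of_rat r - x) \<in> \<int>" by (rule Ints_mult[OF Ints_of_nat h])
  ultimately have "of_nat D * of_rat r - of_nat D * (of_rat r - x) \<in> \<int>" by (rule Ints_diff)
  then have "of_nat D * x \<in> \<int>" by (simp add: algebra_simps)
  then show False using unit_interval_not_Ints[OF assms(2,3)] by blast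
qed

lemma Theta_tendsto:
  assumes "Im \<tau> > 0" "(f \<longlongrightarrow> l) F"
  shows "((\<lambda>x. Theta (f x) \<tau>) \<longlongrightarrow> Theta l \<tau>) F"
proof -
  have "continuous_on UNIV (\<lambda>x. Theta x \<tau>)"
    using Theta_holomorphic[OF assms(1) holomorphic_on_ident] by (rule holomorphic_on_imp_continuous_on)
  then have "isCont (\<lambda>x. Theta x \<tau>) l" by (simp add: continuous_on_eq_continuous_at)
  then show ?thesis using assms(2) by (rule isCont_tendsto_compose)
qed

lemma e1_tendsto: "(f \<longlongrightarrow> l) F \<Longrightarrow> ((\<lambda>x. e1 (f x)) \<longlongrightarrow> e1 l) F"
  unfolding e1_def by (intro tendsto_intros)

lemma phi_limit:
  fixes Z B :: "nat \<Rightarrow> 'j \<Rightarrow> complex"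
  assumes \<tau>: "Im \<tau> > 0" and Z: "\<And>j. j \<in> J \<Longrightarrow> (\<lambda>m. Z m j) \<longlonglongrightarrow> z"
    and B: "\<And>j. j \<in> J \<Longrightarrow> (\<lambda>m. B m j) \<longlonglongrightarrow> z * of_rat (q j)"
    and nz: "\<And>p j. p \<in> P \<Longrightarrow> j \<in> J \<Longrightarrow> of_rat (p j) + Im z * of_rat (q j) / Im \<tau> \<notin> \<int>"
  shows "(\<lambda>m. \<Sum>p\<in>P. \<Sum>p1\<in>P. \<Prod>j\<in>J. e1 (- Z m j * of_rat (p j)) *
      (Theta (Z m j - (B m j + of_rat (p j) * \<tau> + of_rat (p1 j))) \<tau> / Theta (B m j + of_rat (p j) * \<tau> + of_rat (p1 j)) \<tau>))
    \<longlonglongrightarrow> (\<Sum>p\<in>P. \<Sum>p1\<in>P. \<Prod>j\<in>J. phi \<tau> z (q j) (p j) (p1 j))"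
  unfolding phi_def
proof (intro tendsto_sum tendsto_prod)
  fix p p1 j assume h: "p \<in> P" "p1 \<in> P" "j \<in> J"
  have "Im (z * of_rat (q j) + of_rat (p j) * \<tau> + of_rat (p1 j)) / Im \<tau> = of_rat (p j) + Im z * of_rat (q j) / Im \<tau>"
    using \<tau> by (simp add: field_simps)
  then have "Theta (z * of_rat (q j) + of_rat (p j) * \<tau> + of_rat (p1 j)) \<tau> \<noteq> 0"
    using nz[OF h(1,3)] by (intro Theta_nonzero[OF \<tau>]) simp
  then show "(\<lambda>m. e1 (- Z m j * of_rat (p j)) *
      (Theta (Z m j - (B m j + of_rat (p j) * \<tau> + of_rat (p1 j))) \<tau> / Theta (B m j + of_rat (p j) * \<tau> + of_rat (p1 j)) \<tau>))
    \<longlonglongrightarrow> e1 (- z * of_rat (p j)) * (Theta (z - (z * of_rat (q j) + of_rat (p j) * \<tau> + of_rat (p1 j))) \<tau> /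
       Theta (z * of_rat (q j) + of_rat (p j) * \<tau> + of_rat (p1 j)) \<tau>)"
    by (intro tendsto_mult tendsto_divide Theta_tendsto[OF \<tau>] e1_tendsto tendsto_diff tendsto_add tendsto_minus tendsto_const Z B h)
qed

context atomic
begin

text \<open>With these bounds D C \<open>q j\<close> and its dual analogue stay in (0, 1) for C = -
  Im z / Im \<tau> in the thin strip below.\<close>

lemma degrees_le_1:
  assumes "j \<in> J" shows "q j \<le> 1" "qd (\<pi> j) \<le> 1"
proof -
  have b: "(1::rat) \<le> of_nat (b j)" using b2[OF assms] by simp
  have "q j \<le> of_nat (b j) * q j" using mult_right_mono[OF b, of "q j"] q_pos[OF assms] by simp
  also have "\<dots> = (\<Sum>k\<in>{j}. of_nat (a (\<pi> j) k) * q k)" using a_eq[OF assms assms] by simp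
  also have "\<dots> \<le> 1" using assms by (intro entry_le_deg) auto
  finally show "q j \<le> 1" .
  have "qd (\<pi> j) \<le> qd (\<pi> j) * of_nat (b j)" using mult_left_mono[OF b, of "qd (\<pi> j)"] qd_pos[of "\<pi> j"] assms by simp
  also have "\<dots> = (\<Sum>i\<in>{\<pi> j}. qd i * of_nat (a i j))" using a_eq[OF assms assms] by simp
  also have "\<dots> \<le> (\<Sum>i\<in>I. qd i * of_nat (a i j))"
    using finI assms qd_pos by (intro sum_mono2) (auto simp: less_imp_le)
  also have "\<dots> = 1" by (rule ddeg[OF assms])
  finally show "qd (\<pi> j) \<le> 1" .
qed

text \<open>The strip is D times thinner than that of Kronecker's expansion. The group elements have
  coordinates in (1/D) Z, so in this strip no theta function in a denominator vanishes, and this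
  persists for nearby generic values. The identity of series then passes to the limit as an identity
  of continuous functions.\<close>

lemma atomic_duality:
  assumes \<tau>: "Im \<tau> > 0" and z: "Im z < 0" "- Im z * of_nat D < Im \<tau>"
  shows "orbifold_sum J P q z \<tau> = (-1) ^ card J * orbifold_sum I Pd qd z \<tau>"
proof -
  define C where "C = - Im z / Im \<tau>"
  have C0: "C > 0" using \<tau> z by (simp add: C_def divide_neg_pos)
  have C1: "of_nat D * C < 1" using \<tau> z by (simp add: C_def field_simps)
  have "C * 1 \<le> C * of_nat D" using C0 D0 by (intro mult_left_mono) auto
  then have C2: "C < 1" using C1 by (simp add: mult.commute)
  have Cq: "0 < of_nat D * (C * of_rat x) \<and> of_nat D * (C * of_rat x) < 1" if "0 < x" "x \<le> 1" for x :: rat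
  proof
    show "0 < of_nat D * (C * of_rat x)" using C0 D0 that by simp
    have "(of_rat x :: real) \<le> 1" using that by simp
    then have "of_nat D * C * of_rat x \<le> of_nat D * C * 1" using C0 by (intro mult_left_mono) auto
    then show "of_nat D * (C * of_rat x) < 1" using C1 by simp
  qed
  have "\<forall>m. \<exists>c. (\<forall>j\<in>J. \<bar>c j - C\<bar> < inverse (real (Suc m))) \<and> (\<forall>g. (\<exists>j\<in>J. g j \<noteq> 0) \<longrightarrow> rdot J c g \<notin> \<rat>)"
    by (intro allI generic_point finJ) simp
  then obtain c where c: "\<And>m j. j \<in> J \<Longrightarrow> \<bar>c m j - C\<bar> < inverse (real (Suc m))"
    and cgen: "\<And>m g. (\<exists>j\<in>J. g j \<noteq> 0) \<Longrightarrow> rdot J (c m) g \<notin> \<rat>" by metis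
  have clim: "(\<lambda>m. c m j) \<longlonglongrightarrow> C" if "j \<in> J" for j
  proof (rule LIM_zero_cancel, rule Lim_null_comparison)
    show "\<forall>\<^sub>F m in sequentially. norm (c m j - C) \<le> inverse (real (Suc m))"
      using c[OF that] by (intro always_eventually allI) (simp add: less_imp_le)
  qed (rule LIMSEQ_inverse_real_of_nat)
  \<comment> \<open>Only imaginary parts are perturbed, since only they enter the sign
    arguments.\<close>
  define Z where "Z m j = z - \<i> * of_real (Im \<tau> * (c m j - C))" for m j
  have ImZ: "- Im (Z m j) / Im \<tau> = c m j" for m j using \<tau> by (simp add: Z_def C_def field_simps)
  define W where "W m s = (case pt s of Some k \<Rightarrow> Z m k | None \<Rightarrow> z)" for m s
  define B where "B m j = (\<Sum>s\<in>J. W m s * of_rat (G s j))" for m j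
  define Bd where "Bd m s = (\<Sum>j\<in>J. Z m j * of_rat (G s j))" for m s
  have Zlim: "(\<lambda>m. Z m j) \<longlonglongrightarrow> z" if "j \<in> J" for j
  proof -
    have "(\<lambda>m. Z m j) \<longlonglongrightarrow> z - \<i> * of_real (Im \<tau> * (C - C))"
      unfolding Z_def by (intro tendsto_intros clim that)
    then show ?thesis by simp
  qed
  have Wlim: "(\<lambda>m. W m s) \<longlonglongrightarrow> z" if "s \<in> J" for s
    unfolding W_def using Zlim pt_in[OF that] by (cases "pt s") auto
  have Blim: "(\<lambda>m. B m j) \<longlonglongrightarrow> z * of_rat (q j)" if "j \<in> J" for j
  proof -
    have "(\<lambda>m. B m j) \<longlonglongrightarrow> (\<Sum>s\<in>J. z * of_rat (G s j))" unfolding B_def by (intro tendsto_intros Wlim)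
    then show ?thesis by (simp add: sum_distrib_left[symmetric] of_rat_sum[symmetric] G_q[OF that])
  qed
  have Bdlim: "(\<lambda>m. Bd m s) \<longlonglongrightarrow> z * of_rat (qd (\<pi> s))" if "s \<in> J" for s
  proof -
    have "(\<lambda>m. Bd m s) \<longlonglongrightarrow> (\<Sum>j\<in>J. z * of_rat (G s j))" unfolding Bd_def by (intro tendsto_intros Zlim)
    then show ?thesis by (simp add: sum_distrib_left[symmetric] of_rat_sum[symmetric] G_qd[OF that])
  qed
  have ev: "\<forall>\<^sub>F m in sequentially. \<forall>j\<in>J. x < f m j \<and> f m j < y"
    if "\<And>j. j \<in> J \<Longrightarrow> (\<lambda>m. f m j) \<longlonglongrightarrow> l j" "\<And>j. j \<in> J \<Longrightarrow> x < l j \<and> l j < y" for f l and x y :: real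
    by (rule eventually_ball_finite[OF finJ])
       (use that in \<open>auto intro!: eventually_conj order_tendstoD(1)[of _ _ _ x] order_tendstoD(2)[of _ _ _ y]\<close>)
  have D_lim: "(\<lambda>m. of_nat D * (- Im (X m) / Im \<tau>)) \<longlonglongrightarrow> of_nat D * (C * of_rat x)" if "X \<longlonglongrightarrow> z * of_rat x" for X x
  proof -
    have "(\<lambda>m. of_nat D * (- Im (X m) / Im \<tau>)) \<longlonglongrightarrow> of_nat D * (- Im (z * of_rat x) / Im \<tau>)"
      using \<tau> by (intro tendsto_intros that) auto
    then show ?thesis by (simp add: C_def)
  qed
  have ev1: "\<forall>\<^sub>F m in sequentially. \<forall>j\<in>J. 0 < c m j \<and> c m j < 1"
    using C0 C2 by (intro ev[of c "\<lambda>_. C"] clim) auto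
  have ev2: "\<forall>\<^sub>F m in sequentially. \<forall>j\<in>J. 0 < of_nat D * (- Im (B m j) / Im \<tau>) \<and> of_nat D * (- Im (B m j) / Im \<tau>) < 1"
    by (rule ev[of "\<lambda>m j. of_nat D * (- Im (B m j) / Im \<tau>)" "\<lambda>j. of_nat D * (C * of_rat (q j))"])
       (intro D_lim Blim Cq q_pos degrees_le_1; assumption)+
  have ev3: "\<forall>\<^sub>F m in sequentially. \<forall>j\<in>J. 0 < of_nat D * (- Im (Bd m j) / Im \<tau>) \<and> of_nat D * (- Im (Bd m j) / Im \<tau>) < 1"
    by (rule ev[of "\<lambda>m j. of_nat D * (- Im (Bd m j) / Im \<tau>)" "\<lambda>j. of_nat D * (C * of_rat (qd (\<pi> j)))"])
       (intro D_lim Bdlim Cq qd_pos degrees_le_1 \<pi>_in; assumption)+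
  define L where "L m = (\<Sum>p\<in>P. \<Sum>p1\<in>P. \<Prod>j\<in>J. e1 (- Z m j * of_rat (p j)) *
      (Theta (Z m j - (B m j + of_rat (p j) * \<tau> + of_rat (p1 j))) \<tau> / Theta (B m j + of_rat (p j) * \<tau> + of_rat (p1 j)) \<tau>))" for m
  define R where "R m = (\<Sum>p\<in>Pd. \<Sum>p1\<in>Pd. \<Prod>i\<in>I. e1 (- W m (\<pi>' i) * of_rat (p i)) *
      (Theta (W m (\<pi>' i) - (Bd m (\<pi>' i) + of_rat (p i) * \<tau> + of_rat (p1 i))) \<tau> / Theta (Bd m (\<pi>' i) + of_rat (p i) * \<tau> + of_rat (p1 i)) \<tau>))" for m
  define X where "X m = (\<Prod>j\<in>J. theta_const \<tau> * Theta (Z m j) \<tau>)" for m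
  define Y where "Y m = (\<Prod>i\<in>I. theta_const \<tau> * Theta (W m (\<pi>' i)) \<tau>)" for m
  \<comment> \<open>The prefactors X and Y may differ before the limit, so the identity is stated
    without division; both tend to \<open>t ^ card J\<close>.\<close>
  have eq: "\<forall>\<^sub>F m in sequentially. L m * (of_nat (card Pd) * Y m) = (-1) ^ card J * R m * (of_nat (card P) * X m)"
    using ev1 ev2 ev3
  proof eventually_elim
    case (elim m)
    have ImZ': "Im (Z m j) = - (Im \<tau> * c m j)" for j using ImZ[of m j] \<tau> by (simp add: field_simps)
    have Ws: "Im (W m s) < 0 \<and> - Im (W m s) < Im \<tau>" if "s \<in> J" for s
    proof (cases "pt s")
      case None
      then show ?thesis using C0 C2 \<tau> by (simp add: W_def C_def field_simps)
    next
      case (Some k)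
      then have "k \<in> J" using pt_in that by blast
      then show ?thesis using Some elim(1) \<tau> by (simp add: W_def ImZ')
    qed
    have "L m = of_nat (card P) * X m * infsum (theta_term J (Z m) (B m) \<tau>) (annihilator P J \<times> lat P J)"
      unfolding L_def X_def
    proof (rule Theta_sum_expansion[OF \<tau> finJ reps])
      show "Im (Z m j) < 0" "- Im (Z m j) < Im \<tau>" if "j \<in> J" for j using elim(1) \<tau> that by (simp_all add: ImZ')
      show "of_rat (p j) + Im (B m j) / Im \<tau> \<notin> \<int>" if "p \<in> P" "j \<in> J" for p j
        using not_Ints_shift[OF D_P[OF that], of "- Im (B m j) / Im \<tau>"] elim(2) that by simp
    qed
    moreover have "R m = of_nat (card Pd) * Y m * infsum (theta_term I (\<lambda>i. W m (\<pi>' i)) (\<lambda>i. Bd m (\<pi>' i)) \<tau>) (annihilator Pd I \<times> lat Pd I)"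
      unfolding R_def Y_def
    proof (rule Theta_sum_expansion[OF \<tau> finI dreps])
      show "Im (W m (\<pi>' i)) < 0" "- Im (W m (\<pi>' i)) < Im \<tau>" if "i \<in> I" for i using Ws[of "\<pi>' i"] that by simp_all
      show "of_rat (r i) + Im (Bd m (\<pi>' i)) / Im \<tau> \<notin> \<int>" if "r \<in> Pd" "i \<in> I" for r i
        using not_Ints_shift[OF D_Pd[OF that], of "- Im (Bd m (\<pi>' i)) / Im \<tau>"] bspec[OF elim(3) \<pi>'_in[OF that(2)]] by simp
    qed
    moreover have "infsum (theta_term J (Z m) (B m) \<tau>) (annihilator P J \<times> lat P J) = (-1) ^ card J *
        infsum (theta_term I (\<lambda>i. W m (\<pi>' i)) (\<lambda>i. Bd m (\<pi>' i)) \<tau>) (annihilator Pd I \<times> lat Pd I)"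
      unfolding W_def[abs_def] B_def[abs_def] Bd_def[abs_def]
    proof (rule mirror_series[OF \<tau>])
      show "rdot J (\<lambda>j. - Im (Z m j) / Im \<tau>) g \<notin> \<rat>" if "j \<in> J" "g j \<noteq> 0" for g j
        unfolding ImZ using cgen[of g m] that by blast
      show "0 < - Im (Z m j) / Im \<tau> \<and> - Im (Z m j) / Im \<tau> < 1" if "j \<in> J" for j
        unfolding ImZ using elim(1) that by blast
      show "0 < - Im z / Im \<tau>" "- Im z / Im \<tau> < 1" using C0 C2 by (simp_all only: C_def)
      show "0 < of_nat D * (- Im (\<Sum>s\<in>J. (case pt s of None \<Rightarrow> z | Some k \<Rightarrow> Z m k) * of_rat (G s j)) / Im \<tau>) \<and>
         of_nat D * (- Im (\<Sum>s\<in>J. (case pt s of None \<Rightarrow> z | Some k \<Rightarrow> Z m k) * of_rat (G s j)) / Im \<tau>) < 1" if "j \<in> J" for j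
        using bspec[OF elim(2) that] unfolding B_def W_def .
    qed
    ultimately show ?case by (simp add: algebra_simps)
  qed
  have Llim: "L \<longlonglongrightarrow> (\<Sum>p\<in>P. \<Sum>p1\<in>P. \<Prod>j\<in>J. phi \<tau> z (q j) (p j) (p1 j))"
    unfolding L_def[abs_def]
  proof (rule phi_limit[OF \<tau> Zlim Blim])
    show "of_rat (p j) + Im z * of_rat (q j) / Im \<tau> \<notin> \<int>" if "p \<in> P" "j \<in> J" for p j
      using not_Ints_shift[OF D_P[OF that], of "C * of_rat (q j)"] Cq[OF q_pos degrees_le_1(1), OF that(2) that(2)]
      by (simp add: C_def)
  qed
  have Rlim: "R \<longlonglongrightarrow> (\<Sum>p\<in>Pd. \<Sum>p1\<in>Pd. \<Prod>i\<in>I. phi \<tau> z (qd i) (p i) (p1 i))"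
    unfolding R_def[abs_def]
  proof (rule phi_limit[OF \<tau>])
    show "(\<lambda>m. W m (\<pi>' i)) \<longlonglongrightarrow> z" if "i \<in> I" for i using Wlim that by simp
    show "(\<lambda>m. Bd m (\<pi>' i)) \<longlonglongrightarrow> z * of_rat (qd i)" if "i \<in> I" for i using Bdlim[of "\<pi>' i"] that by simp
    show "of_rat (r i) + Im z * of_rat (qd i) / Im \<tau> \<notin> \<int>" if "r \<in> Pd" "i \<in> I" for r i
      using not_Ints_shift[OF D_Pd[OF that], of "C * of_rat (qd i)"] Cq[OF qd_pos[OF that(2)]] degrees_le_1(2)[of "\<pi>' i"] that
      by (simp add: C_def)
  qed
  define t where "t = theta_const \<tau> * Theta z \<tau>"
  have Xlim: "X \<longlonglongrightarrow> t ^ card J"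
  proof -
    have "X \<longlonglongrightarrow> (\<Prod>j\<in>J. t)" unfolding X_def[abs_def] t_def
      by (intro tendsto_prod tendsto_mult tendsto_const Theta_tendsto[OF \<tau>] Zlim)
    then show ?thesis by simp
  qed
  have Ylim: "Y \<longlonglongrightarrow> t ^ card J"
  proof -
    have "Y \<longlonglongrightarrow> (\<Prod>i\<in>I. t)" unfolding Y_def[abs_def] t_def
      by (intro tendsto_prod tendsto_mult tendsto_const Theta_tendsto[OF \<tau>] Wlim \<pi>'_in)
    then show ?thesis by (simp add: cardIJ)
  qed
  have t0: "t \<noteq> 0"
  proof -
    have "Im z / Im \<tau> \<notin> \<int>" using unit_interval_not_Ints[OF C0 C2] by (simp add: C_def)
    then show ?thesis using Theta_nonzero[OF \<tau>] theta_const_nonzero[OF \<tau>] by (simp add: t_def)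
  qed
  have "(\<lambda>m. L m * (of_nat (card Pd) * Y m)) \<longlonglongrightarrow>
      (\<Sum>p\<in>P. \<Sum>p1\<in>P. \<Prod>j\<in>J. phi \<tau> z (q j) (p j) (p1 j)) * (of_nat (card Pd) * t ^ card J)"
    by (intro tendsto_mult tendsto_const Llim Ylim)
  moreover have "(\<lambda>m. (-1) ^ card J * R m * (of_nat (card P) * X m)) \<longlonglongrightarrow>
      (-1) ^ card J * (\<Sum>p\<in>Pd. \<Sum>p1\<in>Pd. \<Prod>i\<in>I. phi \<tau> z (qd i) (p i) (p1 i)) * (of_nat (card P) * t ^ card J)"
    by (intro tendsto_mult tendsto_const Rlim Xlim)
  ultimately have "(\<Sum>p\<in>P. \<Sum>p1\<in>P. \<Prod>j\<in>J. phi \<tau> z (q j) (p j) (p1 j)) * (of_nat (card Pd) * t ^ card J) =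
      (-1) ^ card J * (\<Sum>p\<in>Pd. \<Sum>p1\<in>Pd. \<Prod>i\<in>I. phi \<tau> z (qd i) (p i) (p1 i)) * (of_nat (card P) * t ^ card J)"
    using LIMSEQ_unique Lim_transform_eventually[OF _ eq] by blast
  moreover have "card P \<noteq> 0" "card Pd \<noteq> 0" using reps dreps by (auto simp: reps_group_def)
  ultimately show ?thesis unfolding orbifold_sum_def using t0 by (simp add: field_simps)
qed

end

section \<open>Elimination of quadratic monomials\<close>

text \<open>The potential has the form x_c (x_t + M) + R, where M is the monomial i1 without x_c and
  R is free of x_c. Eliminating x_c substitutes -M for x_t in R, which yields the exponents
  \<open>a i k + a i t * a i1 k\<close>. The condition for Y is drawn from the original one for Y,
  for Y with t added, or for Y with c added, according to how M and the monomials pointing to t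
  interfere.\<close>

lemma pivot_nondegenerate:
  fixes a :: "'i \<Rightarrow> 'j \<Rightarrow> nat"
  assumes CN: "comb_nondegenerate I J a" and mem: "c \<in> J" "t \<in> J" "c \<noteq> t" "i0 \<in> I" "i1 \<in> I" "i0 \<noteq> i1"
    and r0: "a i0 c = 1" "a i0 t = 1" "\<And>j. j \<in> J \<Longrightarrow> j \<noteq> c \<Longrightarrow> j \<noteq> t \<Longrightarrow> a i0 j = 0"
    and r1: "a i1 c = 1" "a i1 t = 0" and colc: "\<And>i. i \<in> I \<Longrightarrow> i \<noteq> i0 \<Longrightarrow> i \<noteq> i1 \<Longrightarrow> a i c = 0"
  shows "comb_nondegenerate (I - {i0, i1}) (J - {c, t}) (\<lambda>i k. a i k + a i t * a i1 k)"
  unfolding comb_nondegenerate_def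
proof (intro allI impI)
  fix Y assume Y: "Y \<subseteq> J - {c, t} \<and> Y \<noteq> {}"
  define b where "b i k = a i k + a i t * a i1 k" for i k
  define I' where "I' = I - {i0, i1}"
  define W where "W = J - {c, t} - Y"
  define row where "row X k i \<longleftrightarrow> i \<in> I \<and> a i k = 1 \<and> (\<forall>j\<in>J. j \<notin> X \<longrightarrow> j \<noteq> k \<longrightarrow> a i j = 0)" for X k i
  let ?goal = "(\<exists>i\<in>I - {i0, i1}. \<forall>j\<in>J - {c, t}. j \<notin> Y \<longrightarrow> a i j + a i t * a i1 j = 0) \<or>
     (\<exists>k\<in>J - {c, t} - Y. \<exists>!i. i \<in> I - {i0, i1} \<and> a i k + a i t * a i1 k = 1 \<and>
        (\<forall>j\<in>J - {c, t}. j \<notin> Y \<longrightarrow> j \<noteq> k \<longrightarrow> a i j + a i t * a i1 j = 0))"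
  have WJ: "j \<in> J" "j \<noteq> c" "j \<noteq> t" "j \<notin> Y" if "j \<in> W" for j using that by (auto simp: W_def)
  have WI: "j \<in> W" if "j \<in> J" "j \<noteq> c" "j \<noteq> t" "j \<notin> Y" for j using that by (simp add: W_def)
  have I'c: "a i c = 0" "i \<in> I" "i \<noteq> i1" "i \<noteq> i0" if "i \<in> I'" for i using that colc by (auto simp: I'_def)
  have I'I: "i \<in> I'" if "i \<in> I" "a i c = 0" for i using that r0(1) r1(1) by (auto simp: I'_def)
  have out1: ?goal if "i \<in> I'" "\<And>j. j \<in> W \<Longrightarrow> b i j = 0" for i
  proof (rule disjI1, rule bexI[of _ i])
    show "\<forall>j\<in>J - {c, t}. j \<notin> Y \<longrightarrow> a i j + a i t * a i1 j = 0"
      using that(2) by (auto simp: W_def b_def)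
  qed (use that in \<open>simp add: I'_def\<close>)
  have out2: ?goal if k: "k \<in> W" and i: "i \<in> I'" "b i k = 1" "\<And>j. j \<in> W \<Longrightarrow> j \<noteq> k \<Longrightarrow> b i j = 0"
      and u: "\<And>i'. i' \<in> I' \<Longrightarrow> b i' k = 1 \<Longrightarrow> (\<And>j. j \<in> W \<Longrightarrow> j \<noteq> k \<Longrightarrow> b i' j = 0) \<Longrightarrow> i' = i" for k i
  proof (rule disjI2, rule bexI[of _ k], rule ex1I[of _ i])
    show "i \<in> I - {i0, i1} \<and> a i k + a i t * a i1 k = 1 \<and>
        (\<forall>j\<in>J - {c, t}. j \<notin> Y \<longrightarrow> j \<noteq> k \<longrightarrow> a i j + a i t * a i1 j = 0)"
      using i unfolding I'_def W_def b_def by simp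
  next
    fix i' assume h: "i' \<in> I - {i0, i1} \<and> a i' k + a i' t * a i1 k = 1 \<and>
        (\<forall>j\<in>J - {c, t}. j \<notin> Y \<longrightarrow> j \<noteq> k \<longrightarrow> a i' j + a i' t * a i1 j = 0)"
    show "i' = i"
    proof (rule u)
      show "i' \<in> I'" "b i' k = 1" using h by (simp_all add: I'_def b_def)
      show "b i' j = 0" if "j \<in> W" "j \<noteq> k" for j
        using h that unfolding W_def b_def by (metis DiffE)
    qed
  qed (use k in \<open>simp add: W_def\<close>)
  have cn: thesis if X: "X \<subseteq> J" "X \<noteq> {}" and 1: "\<And>i. i \<in> I \<Longrightarrow> (\<And>j. j \<in> J \<Longrightarrow> j \<notin> X \<Longrightarrow> a i j = 0) \<Longrightarrow> thesis"
    and 2: "\<And>k i. k \<in> J \<Longrightarrow> k \<notin> X \<Longrightarrow> row X k i \<Longrightarrow> (\<And>i'. row X k i' \<Longrightarrow> i' = i) \<Longrightarrow> thesis" for X thesis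
  proof (rule disj_bexE[OF CN[unfolded comb_nondegenerate_def, rule_format, of X]])
    show "X \<subseteq> J \<and> X \<noteq> {}" using X by simp
    show thesis if "i \<in> I" "\<forall>j\<in>J. j \<notin> X \<longrightarrow> a i j = 0" for i using 1[of i] that by simp
    show thesis if k: "k \<in> J - X" "\<exists>!i. i \<in> I \<and> a i k = 1 \<and> (\<forall>j\<in>J. j \<notin> X \<longrightarrow> j \<noteq> k \<longrightarrow> a i j = 0)" for k
    proof -
      have "\<exists>!i. row X k i" using k(2) by (simp only: row_def)
      then obtain i where i: "row X k i" and u: "\<forall>i'. row X k i' \<longrightarrow> i' = i" by (elim ex1E) (rule that)
      show thesis by (rule 2[OF _ _ i]) (use k(1) u in auto)
    qed
  qed
  have YJ: "Y \<subseteq> J" "Y \<noteq> {}" "c \<notin> Y" "t \<notin> Y" using Y by auto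
  have rowD: "i \<in> I" "a i k = 1" "\<And>j. j \<in> J \<Longrightarrow> j \<notin> X \<Longrightarrow> j \<noteq> k \<Longrightarrow> a i j = 0" if "row X k i" for X k i
    using that by (auto simp: row_def)
  have rowI: "row X k i" if "i \<in> I" "a i k = 1" "\<And>j. j \<in> J \<Longrightarrow> j \<notin> X \<Longrightarrow> j \<noteq> k \<Longrightarrow> a i j = 0" for X k i
    using that by (auto simp: row_def)
  have cover: "j = c \<or> j = t \<or> j \<in> W" if "j \<in> J" "j \<notin> Y" for j using that WI by blast
  show ?goal
  proof (cases "\<forall>j\<in>W. a i1 j = 0")
    \<comment> \<open>M has only variables in Y, so t is added to Y. The condition cannot point to c
      there, because both i0 and i1 do.\<close>
    case True
    have R0: "a i1 j = 0" if "j \<in> W" for j using True that by blast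
    have ba: "b i j = a i j" if "j \<in> W" for i j using R0[OF that] by (simp add: b_def)
    show ?thesis
    proof (rule cn[of "insert t Y"])
      show "insert t Y \<subseteq> J" "insert t Y \<noteq> {}" using YJ mem by auto
    next
      fix i assume i: "i \<in> I" and z: "\<And>j. j \<in> J \<Longrightarrow> j \<notin> insert t Y \<Longrightarrow> a i j = 0"
      have "a i c = 0" using z[OF mem(1)] YJ mem by simp
      then show ?goal
      proof (intro out1[of i] I'I i)
        show "b i j = 0" if "j \<in> W" for j using z[of j] WJ[OF that] ba[OF that] by simp
      qed
    next
      fix k i assume k: "k \<in> J" "k \<notin> insert t Y" and i: "row (insert t Y) k i" and u: "\<And>i'. row (insert t Y) k i' \<Longrightarrow> i' = i"
      have kc: "k \<noteq> c"
      proof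
        assume kc: "k = c"
        have "row (insert t Y) c i0" using r0 mem by (intro rowI) auto
        moreover have "row (insert t Y) c i1" using r1 mem R0 WI by (intro rowI) auto
        ultimately show False using u[unfolded kc] mem(6) by metis
      qed
      have kW: "k \<in> W" using k kc WI by simp
      have "a i c = 0" using rowD(3)[OF i mem(1)] YJ mem kc by simp
      then have iI: "i \<in> I'" using I'I rowD(1)[OF i] by simp
      show ?goal
      proof (rule out2[OF kW iI])
        show "b i k = 1" using rowD(2)[OF i] ba[OF kW] by simp
        show "b i j = 0" if "j \<in> W" "j \<noteq> k" for j using rowD(3)[OF i, of j] WJ[OF that(1)] that ba[OF that(1)] by simp
        fix i' assume i': "i' \<in> I'" "b i' k = 1" "\<And>j. j \<in> W \<Longrightarrow> j \<noteq> k \<Longrightarrow> b i' j = 0"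
        show "i' = i"
        proof (rule u, rule rowI)
          show "i' \<in> I" "a i' k = 1" using I'c[OF i'(1)] i'(2) ba[OF kW] by simp_all
          show "a i' j = 0" if j: "j \<in> J" "j \<notin> insert t Y" "j \<noteq> k" for j
          proof (cases "j = c")
            case True then show ?thesis using I'c[OF i'(1)] by simp
          next
            case False
            then have "j \<in> W" using j WI by simp
            then show ?thesis using i'(3) j ba by simp
          qed
        qed
      qed
    qed
  next
    case False
    then obtain j1 where j1: "j1 \<in> W" "a i1 j1 \<noteq> 0" by blast
    \<comment> \<open>A reduced row that points to k although it contains x_t is x_t times a
      monomial in Y, and M itself points to k.\<close>
    have bad: "i \<in> I'" "a i t = 1" "\<And>j. j \<in> W \<Longrightarrow> a i j = 0" "a i1 k = 1" "\<And>j. j \<in> W \<Longrightarrow> j \<noteq> k \<Longrightarrow> a i1 j = 0"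
      if i: "i \<in> I'" "b i k = 1" "\<And>j. j \<in> W \<Longrightarrow> j \<noteq> k \<Longrightarrow> b i j = 0" and t0: "a i t \<noteq> 0" for i k
    proof -
      show "i \<in> I'" by (rule i)
      show z: "a i1 j = 0" if "j \<in> W" "j \<noteq> k" for j using i(3)[OF that] t0 by (simp add: b_def)
      have "j1 = k" using z[OF j1(1)] j1(2) by blast
      then have "a i1 k \<noteq> 0" using j1 by simp
      then have "a i t * a i1 k \<ge> 1" using t0 by simp
      then have "a i t * a i1 k = 1" "a i k = 0" using i(2) unfolding b_def by linarith+
      then show "a i t = 1" "a i1 k = 1" by simp_all
      show "a i j = 0" if "j \<in> W" for j using i(3)[OF that] \<open>a i k = 0\<close> by (cases "j = k") (auto simp: b_def)
    qed
    have good: "b i j = a i j" if "a i t = 0" for i j using that by (simp add: b_def)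
    have inner: ?goal if i: "i \<in> I" and z: "\<And>j. j \<in> J \<Longrightarrow> j \<notin> Y \<Longrightarrow> a i j = 0" for i
    proof (rule out1[of i])
      show "i \<in> I'" using I'I[OF i] z[OF mem(1)] YJ by simp
      show "b i j = 0" if "j \<in> W" for j using z[OF mem(2)] z[of j] WJ[OF that] YJ by (simp add: b_def)
    qed
    have rowW: "row Y k i" if "i \<in> I'" "a i t = 0" "a i k = 1" "\<And>j. j \<in> W \<Longrightarrow> j \<noteq> k \<Longrightarrow> a i j = 0" for k i
    proof (rule rowI)
      show "i \<in> I" "a i k = 1" using that I'c by auto
      show "a i j = 0" if "j \<in> J" "j \<notin> Y" "j \<noteq> k" for j
        using cover[OF that(1,2)] \<open>\<And>j. j \<in> W \<Longrightarrow> j \<noteq> k \<Longrightarrow> a i j = 0\<close>[OF _ that(3)] \<open>a i t = 0\<close> I'c[OF \<open>i \<in> I'\<close>] by auto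
    qed
    have row_weaken: "row (insert c Y) k i" if "row Y k i" for k i using that by (auto simp: row_def)
    \<comment> \<open>These are the rows that point from Y to t, the only ones whose substitution
      can create a new pointer.\<close>
    define Q where "Q i \<longleftrightarrow> i \<in> I' \<and> a i t = 1 \<and> (\<forall>j\<in>W. a i j = 0)" for i
    have Qrow: "row Y t i" if "Q i" for i
    proof (rule rowI)
      show "i \<in> I" "a i t = 1" using that I'c by (auto simp: Q_def)
      show "a i j = 0" if "j \<in> J" "j \<notin> Y" "j \<noteq> t" for j
        using cover[OF that(1,2)] that(3) \<open>Q i\<close> I'c[of i] by (auto simp: Q_def)
    qed
    have rowQ: "Q i" if "row Y t i" for i
    proof -
      have "a i c = 0" using rowD(3)[OF that mem(1)] YJ mem by simp
      then show ?thesis unfolding Q_def using rowD[OF that] I'I WJ by simp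
    qed
    have kc: "k \<noteq> c" if "row Y k i" for k i
    proof
      assume k: "k = c"
      have "a i t = 0" "a i j1 = 0" "a i c = 1" using rowD[OF that] mem YJ WJ[OF j1(1)] k by auto
      then show False using colc[OF rowD(1)[OF that]] r0(2) j1(2) by (metis zero_neq_one)
    qed
    have use: ?goal if k: "k \<in> J" "k \<notin> Y" "row Y k i" and u: "\<And>i'. row Y k i' \<Longrightarrow> i' = i" and kt: "k \<noteq> t"
      and nb: "\<And>i'. i' \<in> I' \<Longrightarrow> b i' k = 1 \<Longrightarrow> (\<And>j. j \<in> W \<Longrightarrow> j \<noteq> k \<Longrightarrow> b i' j = 0) \<Longrightarrow> a i' t = 0" for k i
    proof -
      have kW: "k \<in> W" using WI[OF k(1) kc[OF k(3)] kt k(2)] .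
      have at: "a i t = 0" "a i c = 0" using rowD(3)[OF k(3)] mem YJ kt kc[OF k(3)] by auto
      show ?thesis
      proof (rule out2[OF kW I'I[OF rowD(1)[OF k(3)] at(2)]])
        show "b i k = 1" using rowD(2)[OF k(3)] good at by simp
        show "b i j = 0" if "j \<in> W" "j \<noteq> k" for j using rowD(3)[OF k(3), of j] WJ[OF that(1)] that good[OF at(1)] by simp
        fix i' assume i': "i' \<in> I'" "b i' k = 1" "\<And>j. j \<in> W \<Longrightarrow> j \<noteq> k \<Longrightarrow> b i' j = 0"
        have "a i' t = 0" using nb[OF i'] .
        then show "i' = i" using i' by (intro u rowW) (simp_all add: good)
      qed
    qed
    show ?thesis
    proof (rule cn[OF YJ(1,2)])
      fix k i assume k: "k \<in> J" "k \<notin> Y" and i: "row Y k i" and u: "\<And>i'. row Y k i' \<Longrightarrow> i' = i"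
      show ?goal
      proof (cases "\<exists>i'. Q i'")
        case False
        have kt: "k \<noteq> t" using rowQ i False by blast
        show ?goal
        proof (rule use[OF k i u kt])
          fix i' assume i': "i' \<in> I'" "b i' k = 1" "\<And>j. j \<in> W \<Longrightarrow> j \<noteq> k \<Longrightarrow> b i' j = 0"
          show "a i' t = 0"
          proof (rule ccontr)
            assume n: "a i' t \<noteq> 0"
            then have "Q i'" unfolding Q_def using bad[OF i' n] by simp
            then show False using False by blast
          qed
        qed
      next
        case True
        \<comment> \<open>With c added to Y, both i0 and i' point to t, so the condition there
          cannot point to t and leads to another variable k2.\<close>
        then obtain i' where Qi': "Q i'" by blast
        show ?goal
        proof (rule cn[of "insert c Y"])
          show "insert c Y \<subseteq> J" "insert c Y \<noteq> {}" using YJ mem by auto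
        next
          fix i2 assume i2: "i2 \<in> I" and z: "\<And>j. j \<in> J \<Longrightarrow> j \<notin> insert c Y \<Longrightarrow> a i2 j = 0"
          have "a i2 t = 0" "a i2 j1 = 0" using z mem YJ WJ[OF j1(1)] by auto
          then have "i2 \<noteq> i0" "i2 \<noteq> i1" using r0(2) j1(2) by auto
          then have "a i2 c = 0" using colc i2 by simp
          then show ?goal using z by (intro inner[OF i2]) (metis insert_iff)
        next
          fix k2 i2 assume k2: "k2 \<in> J" "k2 \<notin> insert c Y" and i2: "row (insert c Y) k2 i2"
            and u2: "\<And>i'. row (insert c Y) k2 i' \<Longrightarrow> i' = i2"
          have k2t: "k2 \<noteq> t"
          proof
            assume kt: "k2 = t"
            have "row (insert c Y) t i0" using r0 mem by (intro rowI) auto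
            moreover have "row (insert c Y) t i'" by (rule row_weaken[OF Qrow[OF Qi']])
            ultimately have "i0 = i'" using u2[unfolded kt] by metis
            then show False using Qi' I'c by (auto simp: Q_def)
          qed
          have k2W: "k2 \<in> W" using WI k2 k2t by simp
          have i2t: "a i2 t = 0" using rowD(3)[OF i2 mem(2)] mem YJ k2t by simp
          have i2n0: "i2 \<noteq> i0" using i2t r0(2) by auto
          show ?goal
          proof (cases "i2 = i1")
            case False
            have "a i2 c = 0" using colc rowD(1)[OF i2] False i2n0 by simp
            then have I2: "i2 \<in> I'" using I'I rowD(1)[OF i2] by simp
            have r2: "row Y k2 i2"
            proof (rule rowI[OF rowD(1,2)[OF i2]])
              show "a i2 j = 0" if "j \<in> J" "j \<notin> Y" "j \<noteq> k2" for j
                using rowD(3)[OF i2, of j] that \<open>a i2 c = 0\<close> by (cases "j = c") auto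
            qed
            show ?goal
            proof (rule use[OF k2(1) _ r2 _ k2t])
              show "k2 \<notin> Y" using k2 by simp
              show "i'' = i2" if "row Y k2 i''" for i'' using u2 row_weaken[OF that] by simp
              fix i'' assume i'': "i'' \<in> I'" "b i'' k2 = 1" "\<And>j. j \<in> W \<Longrightarrow> j \<noteq> k2 \<Longrightarrow> b i'' j = 0"
              show "a i'' t = 0"
              proof (rule ccontr)
                assume n: "a i'' t \<noteq> 0"
                have "row (insert c Y) k2 i1"
                proof (rule rowI[OF mem(5) bad(4)[OF i'' n]])
                  show "a i1 j = 0" if "j \<in> J" "j \<notin> insert c Y" "j \<noteq> k2" for j
                    using cover[of j] that bad(5)[OF i'' n] r1(2) by auto
                qed
                then show False using u2 False by metis
              qed
            qed
          next
            \<comment> \<open>Here M points to k2. If the first condition pointed to t, its unique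
              row points to k2 after the substitution; otherwise the first pointer remains
              valid.\<close>
            case i21: True
            have R: "a i1 k2 = 1" "\<And>j. j \<in> W \<Longrightarrow> j \<noteq> k2 \<Longrightarrow> a i1 j = 0"
              using rowD(2)[OF i2] rowD(3)[OF i2] WJ unfolding i21 by auto
            show ?goal
            proof (cases "k = t")
              case kt: True
              have Qi: "Q i" using rowQ i kt by simp
              show ?goal
              proof (rule out2[OF k2W])
                show "i \<in> I'" using Qi by (simp add: Q_def)
                show "b i k2 = 1" using Qi R k2W by (simp add: Q_def b_def)
                show "b i j = 0" if "j \<in> W" "j \<noteq> k2" for j using Qi R(2)[OF that] that by (simp add: Q_def b_def)
                fix i'' assume i'': "i'' \<in> I'" "b i'' k2 = 1" "\<And>j. j \<in> W \<Longrightarrow> j \<noteq> k2 \<Longrightarrow> b i'' j = 0"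
                show "i'' = i"
                proof (cases "a i'' t = 0")
                  case True
                  have "row Y k2 i''" using i'' True by (intro rowW) (simp_all add: good)
                  then have "i'' = i1" using u2[OF row_weaken] i21 by simp
                  then show ?thesis using I'c[OF i''(1)] by simp
                next
                  case False
                  have "Q i''" unfolding Q_def using bad[OF i'' False] by simp
                  then show ?thesis using u Qrow kt by simp
                qed
              qed
            next
              case kt: False
              have at: "a i t = 0" "a i c = 0" using rowD(3)[OF i] mem YJ kt kc[OF i] by auto
              have kk: "k \<noteq> k2"
              proof
                assume "k = k2"
                then have "i = i1" using u2[OF row_weaken] i i21 by simp
                then show False using at r1(1) by simp
              qed
              show ?goal
              proof (rule use[OF k i u kt])
                fix i'' assume i'': "i'' \<in> I'" "b i'' k = 1" "\<And>j. j \<in> W \<Longrightarrow> j \<noteq> k \<Longrightarrow> b i'' j = 0"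
                show "a i'' t = 0" using i''(3)[OF k2W] kk R(1) by (simp add: b_def)
              qed
            qed
          qed
        qed
      qed
    qed (rule inner)
  qed
qed

context mirror
begin

text \<open>Groups and degrees are only restricted to fewer indices. On these the reduced row i
  equals row i plus \<open>a i t\<close> times the difference of rows i1 and i0, and dually for the
  columns t and c. The differences vanish on the degrees and are integral on the groups, so
  equations and integrality pass to the reduced system.\<close>

lemma pivot_mirror:
  assumes edge: "edge i0 c t" and i1: "i1 \<in> I" "i1 \<noteq> i0" "a i1 c = 1" and colc: "\<And>i. i \<in> I \<Longrightarrow> i \<noteq> i0 \<Longrightarrow> i \<noteq> i1 \<Longrightarrow> a i c = 0"
  shows "mirror (I - {i0, i1}) (J - {c, t}) (\<lambda>i k. a i k + a i t * a i1 k) q qd P Pd"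
proof -
  define I' where "I' = I - {i0, i1}"
  define J' where "J' = J - {c, t}"
  define b where "b i k = a i k + a i t * a i1 k" for i k
  have mem: "i0 \<in> I" "c \<in> J" "t \<in> J" "c \<noteq> t" and r0: "a i0 c = 1" "a i0 t = 1" "\<And>j. j \<in> J \<Longrightarrow> j \<noteq> c \<Longrightarrow> j \<noteq> t \<Longrightarrow> a i0 j = 0"
    using edge by (auto simp: edge_def)
  have JI: "J' \<subseteq> J" "I' \<subseteq> I" "finite J'" "finite I'" using finI finJ by (auto simp: J'_def I'_def)
  have splitJ: "sum f J = f c + f t + sum f J'" for f :: "'j \<Rightarrow> rat"
  proof -
    have J: "J = insert c (insert t J')" using mem by (auto simp: J'_def)
    have "c \<notin> insert t J'" "t \<notin> J'" using mem by (auto simp: J'_def)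
    then show ?thesis using JI(3) by (subst J) (simp add: add.assoc)
  qed
  have splitI: "sum f I = f i0 + f i1 + sum f I'" for f :: "'i \<Rightarrow> rat"
  proof -
    have I: "I = insert i0 (insert i1 I')" using mem i1 by (auto simp: I'_def)
    have "i0 \<notin> insert i1 I'" "i1 \<notin> I'" using i1 by (auto simp: I'_def)
    then show ?thesis using JI(4) by (subst I) (simp add: add.assoc)
  qed
  \<comment> \<open>Since \<open>q c + q t = 1\<close>, a row containing both x_c and x_t is x_c x_t
    itself and would repeat row i0.\<close>
  have t1: "a i1 t = 0"
  proof (rule ccontr)
    assume n: "a i1 t \<noteq> 0"
    have "q c + q t + (of_nat (a i1 t - 1) * q t + (\<Sum>j\<in>J'. of_nat (a i1 j) * q j)) = 1"
      using deg[OF i1(1)] i1 n unfolding splitJ by (simp add: of_nat_diff algebra_simps)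
    then have z: "of_nat (a i1 t - 1) * q t + (\<Sum>j\<in>J'. of_nat (a i1 j) * q j) = 0" using edge_deg[OF edge] by simp
    have nn: "0 \<le> of_nat (a i1 t - 1) * q t" "0 \<le> (\<Sum>j\<in>J'. of_nat (a i1 j) * q j)"
      using q_pos mem JI by (auto simp: less_imp_le intro!: sum_nonneg)
    have "of_nat (a i1 t - 1) * q t = 0" and z2: "(\<Sum>j\<in>J'. of_nat (a i1 j) * q j) = 0" using z nn by linarith+
    then have at: "a i1 t = 1" using q_pos[OF mem(3)] n by simp
    have "\<forall>j\<in>J'. of_nat (a i1 j) * q j = 0"
      using z2 JI q_pos by (subst (asm) sum_nonneg_eq_0_iff) (auto simp: less_imp_le subset_iff)
    then have aj: "a i1 j = 0" if "j \<in> J'" for j using q_pos[of j] that JI by force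
    define y where "y i = (if i = i0 then 1 else if i = i1 then -1 else 0 :: rat)" for i
    have "(\<Sum>i\<in>I. y i * of_nat (a i j)) = 0" if j: "j \<in> J" for j
    proof -
      have "(\<Sum>i\<in>I. y i * of_nat (a i j)) = of_nat (a i0 j) - of_nat (a i1 j)"
        unfolding splitI using i1 by (simp add: y_def I'_def)
      moreover have "a i0 j = a i1 j"
        using r0 i1 at aj[of j] j by (cases "j = c"; cases "j = t") (auto simp: J'_def)
      ultimately show ?thesis by simp
    qed
    from row_inj[OF this mem(1)] show False by (simp add: y_def)
  qed
  have key1: "(\<Sum>k\<in>J'. of_nat (b i k) * x k) = (\<Sum>j\<in>J. of_nat (a i j) * x j) +
      of_nat (a i t) * ((\<Sum>j\<in>J. of_nat (a i1 j) * x j) - (\<Sum>j\<in>J. of_nat (a i0 j) * x j))" if i: "i \<in> I'" for i and x :: "'j \<Rightarrow> rat"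
  proof -
    have "(\<Sum>k\<in>J'. of_nat (a i0 k) * x k) = 0" using r0 by (intro sum.neutral) (auto simp: J'_def)
    moreover have "a i c = 0" using colc i by (auto simp: I'_def)
    moreover have "(\<Sum>k\<in>J'. of_nat (b i k) * x k) = (\<Sum>k\<in>J'. of_nat (a i k) * x k) + of_nat (a i t) * (\<Sum>k\<in>J'. of_nat (a i1 k) * x k)"
      by (simp add: b_def sum.distrib sum_distrib_left algebra_simps)
    ultimately show ?thesis unfolding splitJ using r0 i1 t1 by (simp add: algebra_simps)
  qed
  have key2: "(\<Sum>i\<in>I'. y i * of_nat (b i k)) = (\<Sum>i\<in>I. y i * of_nat (a i k)) +
      of_nat (a i1 k) * ((\<Sum>i\<in>I. y i * of_nat (a i t)) - (\<Sum>i\<in>I. y i * of_nat (a i c)))" if k: "k \<in> J'" for k and y :: "'i \<Rightarrow> rat"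
  proof -
    have "(\<Sum>i\<in>I'. y i * of_nat (a i c)) = 0" using colc by (intro sum.neutral) (auto simp: I'_def)
    moreover have "a i0 k = 0" using r0 k by (auto simp: J'_def)
    moreover have "(\<Sum>i\<in>I'. y i * of_nat (b i k)) = (\<Sum>i\<in>I'. y i * of_nat (a i k)) + of_nat (a i1 k) * (\<Sum>i\<in>I'. y i * of_nat (a i t))"
      by (simp add: b_def sum.distrib sum_distrib_left algebra_simps)
    ultimately show ?thesis unfolding splitI using r0 i1 t1 by (simp add: algebra_simps)
  qed
  have nat_int: "of_nat m \<in> (\<int> :: rat set)" for m by simp
  have shift_int: "x + of_nat m * (y - y') \<in> \<int>" if "x \<in> \<int>" "y \<in> \<int>" "y' \<in> \<int>" for x y y' :: rat and m
    using that by (intro Ints_add Ints_mult Ints_diff) auto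
  have sumJ_int: "(\<Sum>j\<in>J'. of_nat (a i j) * x j) \<in> \<int>" if "\<And>j. j \<in> J' \<Longrightarrow> x j \<in> \<int>" for i and x :: "'j \<Rightarrow> rat"
    by (rule Ints_sum) (rule Ints_mult[OF nat_int that])
  have sumI_int: "(\<Sum>i\<in>I'. y i * of_nat (a i j)) \<in> \<int>" if "\<And>i. i \<in> I' \<Longrightarrow> y i \<in> \<int>" for j and y :: "'i \<Rightarrow> rat"
    by (rule Ints_sum) (rule Ints_mult[OF that nat_int])
  have "mirror I' J' b q qd P Pd"
  proof
    show "finite I'" "finite J'" by (fact JI)+
    have "card I' = card I - 2" unfolding I'_def using finI mem i1 by (subst card_Diff_subset) auto
    moreover have "card J' = card J - 2" unfolding J'_def using finJ mem by (subst card_Diff_subset) auto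
    ultimately show "card I' = card J'" using cardIJ by simp
    show "comb_nondegenerate I' J' b"
      unfolding I'_def J'_def b_def[abs_def]
      by (rule pivot_nondegenerate[OF CN mem(2,3,4,1) i1(1) i1(2)[symmetric] r0 i1(3) t1 colc])
    show "0 < q j" if "j \<in> J'" for j using q_pos that JI by blast
    show "0 < qd i" if "i \<in> I'" for i using qd_pos that JI by blast
    show "(\<Sum>j\<in>J'. of_nat (b i j) * q j) = 1" if "i \<in> I'" for i
      using key1[OF that, of q] deg[of i] deg[OF mem(1)] deg[OF i1(1)] that JI by auto
    show "(\<Sum>i\<in>I'. qd i * of_nat (b i j)) = 1" if "j \<in> J'" for j
      using key2[OF that, of qd] ddeg[of j] ddeg[OF mem(2)] ddeg[OF mem(3)] that JI by auto
    show "x j = 0" if x: "\<And>i. i \<in> I' \<Longrightarrow> (\<Sum>j\<in>J'. of_nat (b i j) * x j) = 0" and j: "j \<in> J'" for x :: "'j \<Rightarrow> rat" and j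
    proof -
      define s where "s = (\<Sum>k\<in>J'. of_nat (a i1 k) * x k)"
      \<comment> \<open>The values at c and t are forced: row i1 requires - s at c, and then row i0
        requires s at t.\<close>
      define x' where "x' k = (if k = c then - s else if k = t then s else x k)" for k
      have x'J: "x' k = x k" if "k \<in> J'" for k using that by (simp add: x'_def J'_def)
      have sx: "(\<Sum>k\<in>J'. of_nat (e k) * x' k) = (\<Sum>k\<in>J'. of_nat (e k) * x k)" for e :: "'j \<Rightarrow> nat"
        by (intro sum.cong refl) (simp add: x'J)
      have z1: "(\<Sum>k\<in>J. of_nat (a i1 k) * x' k) = 0"
        unfolding splitJ sx using i1 t1 by (simp add: x'_def s_def)
      have "(\<Sum>k\<in>J'. of_nat (a i0 k) * x k) = 0" using r0 by (intro sum.neutral) (auto simp: J'_def)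
      then have z0: "(\<Sum>k\<in>J. of_nat (a i0 k) * x' k) = 0"
        unfolding splitJ sx using r0 mem by (simp add: x'_def)
      have "(\<Sum>k\<in>J. of_nat (a i k) * x' k) = 0" if iI: "i \<in> I" for i
      proof -
        consider "i = i0" | "i = i1" | "i \<in> I'" using iI by (auto simp: I'_def)
        then show ?thesis
        proof cases
          case 3
          then show ?thesis using key1[OF 3, of x'] x[OF 3] sx[of "b i"] z0 z1 by simp
        qed (use z0 z1 in auto)
      qed
      from col_inj[OF this, of j] show ?thesis using j JI x'J by auto
    qed
    show "y i = 0" if y: "\<And>j. j \<in> J' \<Longrightarrow> (\<Sum>i\<in>I'. y i * of_nat (b i j)) = 0" and i: "i \<in> I'" for y :: "'i \<Rightarrow> rat" and i
    proof -
      define s where "s = (\<Sum>i\<in>I'. y i * of_nat (a i t))"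
      \<comment> \<open>Column t forces the value - s at i0, and column c then forces s at
        i1.\<close>
      define y' where "y' k = (if k = i0 then - s else if k = i1 then s else y k)" for k
      have y'I: "y' k = y k" if "k \<in> I'" for k using that by (simp add: y'_def I'_def)
      have sy: "(\<Sum>k\<in>I'. y' k * of_nat (e k)) = (\<Sum>k\<in>I'. y k * of_nat (e k))" for e :: "'i \<Rightarrow> nat"
        by (intro sum.cong refl) (simp add: y'I)
      have zt: "(\<Sum>k\<in>I. y' k * of_nat (a k t)) = 0"
        unfolding splitI sy using i1 t1 r0 by (simp add: y'_def s_def)
      have "(\<Sum>k\<in>I'. y k * of_nat (a k c)) = 0" using colc by (intro sum.neutral) (auto simp: I'_def)
      then have zc: "(\<Sum>k\<in>I. y' k * of_nat (a k c)) = 0"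
        unfolding splitI sy using r0 i1 by (simp add: y'_def)
      have "(\<Sum>k\<in>I. y' k * of_nat (a k j)) = 0" if jJ: "j \<in> J" for j
      proof -
        consider "j = c" | "j = t" | "j \<in> J'" using jJ by (auto simp: J'_def)
        then show ?thesis
        proof cases
          case 3
          then show ?thesis using key2[OF 3, of y'] y[OF 3] sy[of "\<lambda>i. b i j"] zt zc by simp
        qed (use zt zc in auto)
      qed
      from row_inj[OF this, of i] show ?thesis using i JI y'I by auto
    qed
    \<comment> \<open>Representatives stay inequivalent: if a difference is integral on the
      remaining variables, row i1 makes it integral at c, and row i0 then at t.\<close>
    show "reps_group P J'"
    proof -
      have "p = p'" if p: "p \<in> P" "p' \<in> P" and h: "\<forall>j\<in>J'. p j - p' j \<in> \<int>" for p p'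
      proof -
        define x where "x j = p j - p' j" for j
        have row: "(\<Sum>j\<in>J. of_nat (a i j) * x j) \<in> \<int>" if "i \<in> I" for i
        proof -
          have "(\<Sum>j\<in>J. of_nat (a i j) * x j) = (\<Sum>j\<in>J. of_nat (a i j) * p j) - (\<Sum>j\<in>J. of_nat (a i j) * p' j)"
            by (simp add: x_def sum_subtractf algebra_simps)
          then show ?thesis using int[OF p(1) that] int[OF p(2) that] by simp
        qed
        have R: "(\<Sum>j\<in>J'. of_nat (a i j) * x j) \<in> \<int>" for i by (rule sumJ_int) (use h in \<open>simp add: x_def\<close>)
        have "x c = (\<Sum>j\<in>J. of_nat (a i1 j) * x j) - (\<Sum>j\<in>J'. of_nat (a i1 j) * x j)"
          unfolding splitJ using i1 t1 by simp
        then have xc: "x c \<in> \<int>" using row[OF i1(1)] R[of i1] by simp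
        have "x t = (\<Sum>j\<in>J. of_nat (a i0 j) * x j) - (\<Sum>j\<in>J'. of_nat (a i0 j) * x j) - x c"
          unfolding splitJ using r0 by simp
        then have xt: "x t \<in> \<int>" using row[OF mem(1)] R[of i0] xc by simp
        have "\<forall>j\<in>J. p j - p' j \<in> \<int>"
        proof
          fix j assume "j \<in> J"
          then consider "j = c" | "j = t" | "j \<in> J'" by (auto simp: J'_def)
          then show "p j - p' j \<in> \<int>" using xc xt h by cases (auto simp: x_def)
        qed
        then show ?thesis using reps p unfolding reps_group_def by blast
      qed
      then show ?thesis using reps JI(1) unfolding reps_group_def by (meson subsetD)
    qed
    show "reps_group Pd I'"
    proof -
      have "p = p'" if p: "p \<in> Pd" "p' \<in> Pd" and h: "\<forall>i\<in>I'. p i - p' i \<in> \<int>" for p p'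
      proof -
        define y where "y i = p i - p' i" for i
        have col: "(\<Sum>i\<in>I. y i * of_nat (a i j)) \<in> \<int>" if "j \<in> J" for j
        proof -
          have "(\<Sum>i\<in>I. y i * of_nat (a i j)) = (\<Sum>i\<in>I. p i * of_nat (a i j)) - (\<Sum>i\<in>I. p' i * of_nat (a i j))"
            by (simp add: y_def sum_subtractf algebra_simps)
          then show ?thesis using dint[OF p(1) that] dint[OF p(2) that] by simp
        qed
        have R: "(\<Sum>i\<in>I'. y i * of_nat (a i j)) \<in> \<int>" for j by (rule sumI_int) (use h in \<open>simp add: y_def\<close>)
        have "y i0 = (\<Sum>i\<in>I. y i * of_nat (a i t)) - (\<Sum>i\<in>I'. y i * of_nat (a i t))"
          unfolding splitI using r0 t1 by simp
        then have y0: "y i0 \<in> \<int>" using col[OF mem(3)] R[of t] by simp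
        have "y i1 = (\<Sum>i\<in>I. y i * of_nat (a i c)) - (\<Sum>i\<in>I'. y i * of_nat (a i c)) - y i0"
          unfolding splitI using r0 i1 by simp
        then have y1: "y i1 \<in> \<int>" using col[OF mem(2)] R[of c] y0 by simp
        have "\<forall>i\<in>I. p i - p' i \<in> \<int>"
        proof
          fix i assume "i \<in> I"
          then consider "i = i0" | "i = i1" | "i \<in> I'" by (auto simp: I'_def)
          then show "p i - p' i \<in> \<int>" using y0 y1 h by cases (auto simp: y_def)
        qed
        then show ?thesis using dreps p unfolding reps_group_def by blast
      qed
      then show ?thesis using dreps JI(2) unfolding reps_group_def by (meson subsetD)
    qed
    show "(\<Sum>j\<in>J'. of_nat (b i j) * p j) \<in> \<int>" if "p \<in> P" "i \<in> I'" for p i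
      unfolding key1[OF that(2)] using that JI mem i1 by (intro shift_int int) auto
    show "(\<Sum>i\<in>I'. r i * of_nat (b i j)) \<in> \<int>" if "r \<in> Pd" "j \<in> J'" for r j
      unfolding key2[OF that(2)] using that JI mem by (intro shift_int dint) auto
    show "(\<Sum>i\<in>I'. r i * (\<Sum>j\<in>J'. of_nat (b i j) * p j)) \<in> \<int>" if r: "r \<in> Pd" and p: "p \<in> P" for r p
    proof -
      define L where "L i = (\<Sum>j\<in>J. of_nat (a i j) * p j)" for i
      define sc where "sc = (\<Sum>i\<in>I. r i * of_nat (a i c))"
      define st where "st = (\<Sum>i\<in>I. r i * of_nat (a i t))"
      have ints: "L i0 \<in> \<int>" "L i1 \<in> \<int>" "sc \<in> \<int>" "st \<in> \<int>" "(\<Sum>i\<in>I. r i * L i) \<in> \<int>"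
        using int[OF p] dint[OF r] pair[OF r p] mem i1 by (simp_all add: L_def sc_def st_def)
      have kL: "(\<Sum>j\<in>J'. of_nat (b i j) * p j) = L i + of_nat (a i t) * (L i1 - L i0)" if "i \<in> I'" for i
        using key1[OF that, of p] by (simp only: L_def)
      have "(\<Sum>i\<in>I'. r i * (\<Sum>j\<in>J'. of_nat (b i j) * p j)) = (\<Sum>i\<in>I'. r i * L i) + (\<Sum>i\<in>I'. r i * of_nat (a i t)) * (L i1 - L i0)"
        unfolding sum_distrib_right sum.distrib[symmetric]
        by (intro sum.cong refl) (simp only: kL, simp only: algebra_simps)
      moreover have "(\<Sum>i\<in>I'. r i * L i) = (\<Sum>i\<in>I. r i * L i) - r i0 * L i0 - r i1 * L i1" unfolding splitI by simp
      moreover have "(\<Sum>i\<in>I'. r i * of_nat (a i t)) = st - r i0" unfolding st_def splitI using r0 t1 by simp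
      moreover have "sc = r i0 + r i1"
      proof -
        have "(\<Sum>i\<in>I'. r i * of_nat (a i c)) = 0" using colc by (intro sum.neutral) (auto simp: I'_def)
        then show ?thesis unfolding sc_def splitI using r0 i1 by simp
      qed
      ultimately have "(\<Sum>i\<in>I'. r i * (\<Sum>j\<in>J'. of_nat (b i j) * p j)) = (\<Sum>i\<in>I. r i * L i) + st * (L i1 - L i0) - sc * L i1"
        by (simp add: algebra_simps)
      moreover have "st * (L i1 - L i0) \<in> \<int>" "sc * L i1 \<in> \<int>" using ints by (auto intro: Ints_mult Ints_diff)
      ultimately show ?thesis using ints(5) by simp
    qed
    show "\<exists>m\<in>lat Pd I'. \<forall>j\<in>J'. (\<Sum>i\<in>I'. m i * of_nat (b i j)) = k j" if k: "k \<in> annihilator P J'" for k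
    proof -
      have k0: "k j = 0" if "j \<notin> J'" for j using k that by (auto simp: annihilator_def)
      have "(\<Sum>j\<in>J. k j * p j) = (\<Sum>j\<in>J'. k j * p j)" for p unfolding splitJ using k0 by (simp add: J'_def)
      then have "k \<in> annihilator P J" using k JI by (auto simp: annihilator_def)
      from dual[OF this] obtain m where m: "m \<in> lat Pd I" "\<And>j. j \<in> J \<Longrightarrow> (\<Sum>i\<in>I. m i * of_nat (a i j)) = k j" by blast
      define m' where "m' i = (if i \<in> I' then m i else 0)" for i
      obtain r where "r \<in> Pd" "\<And>i. i \<in> I \<Longrightarrow> m i - r i \<in> \<int>" using m(1) by (auto simp: lat_def)
      then have "m' \<in> lat Pd I'" unfolding lat_def using JI(2) by (auto simp: m'_def intro!: bexI[of _ r])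
      moreover have "(\<Sum>i\<in>I'. m' i * of_nat (b i j)) = k j" if j: "j \<in> J'" for j
      proof -
        have "(\<Sum>i\<in>I'. m' i * of_nat (b i j)) = (\<Sum>i\<in>I'. m i * of_nat (b i j))" by (intro sum.cong refl) (simp add: m'_def)
        then show ?thesis unfolding key2[OF j] using m(2) j mem k0[of c] k0[of t] JI by (auto simp: J'_def)
      qed
      ultimately show ?thesis by blast
    qed
    show "\<exists>n\<in>lat P J'. \<forall>i\<in>I'. (\<Sum>j\<in>J'. of_nat (b i j) * n j) = l i" if l: "l \<in> annihilator Pd I'" for l
    proof -
      have l0: "l i = 0" if "i \<notin> I'" for i using l that by (auto simp: annihilator_def)
      have "(\<Sum>i\<in>I. l i * p i) = (\<Sum>i\<in>I'. l i * p i)" for p unfolding splitI using l0 by (simp add: I'_def)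
      then have "l \<in> annihilator Pd I" using l JI by (auto simp: annihilator_def)
      from ddual[OF this] obtain n where n: "n \<in> lat P J" "\<And>i. i \<in> I \<Longrightarrow> (\<Sum>j\<in>J. of_nat (a i j) * n j) = l i" by blast
      define n' where "n' j = (if j \<in> J' then n j else 0)" for j
      obtain p where "p \<in> P" "\<And>j. j \<in> J \<Longrightarrow> n j - p j \<in> \<int>" using n(1) by (auto simp: lat_def)
      then have "n' \<in> lat P J'" unfolding lat_def using JI(1) by (auto simp: n'_def intro!: bexI[of _ p])
      moreover have "(\<Sum>j\<in>J'. of_nat (b i j) * n' j) = l i" if i: "i \<in> I'" for i
      proof -
        have "(\<Sum>j\<in>J'. of_nat (b i j) * n' j) = (\<Sum>j\<in>J'. of_nat (b i j) * n j)" by (intro sum.cong refl) (simp add: n'_def)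
        then show ?thesis unfolding key1[OF i] using n(2) i mem i1 l0[of i0] l0[of i1] JI by (auto simp: I'_def)
      qed
      ultimately show ?thesis by blast
    qed
  qed
  then show ?thesis by (simp add: I'_def J'_def b_def[abs_def])
qed

end

text \<open>Read off from Kronecker's series: a shift of u by n \<tau> is a shift of the summation
  index, and a shift by an integer is invisible to \<open>e1\<close>.\<close>

lemma kronecker_shift:
  assumes \<tau>: "Im \<tau> > 0" and z: "Im z < 0" "- Im z < Im \<tau>" and u: "Im u / Im \<tau> \<notin> \<int>"
  shows "Theta (z - (u + of_int n * \<tau> + of_int m)) \<tau> / Theta (u + of_int n * \<tau> + of_int m) \<tau> =
    e1 (z * of_int n) * (Theta (z - u) \<tau> / Theta u \<tau>)"
proof -
  have "Im (u + of_int n * \<tau> + of_int m) / Im \<tau> = Im u / Im \<tau> + of_int n" using \<tau> by (simp add: field_simps)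
  moreover have "Im u / Im \<tau> + of_int n \<notin> \<int>"
  proof
    assume "Im u / Im \<tau> + of_int n \<in> \<int>"
    then have "Im u / Im \<tau> + of_int n - of_int n \<in> \<int>" by (rule Ints_diff) simp
    then show False using u by simp
  qed
  ultimately have u': "Im (u + of_int n * \<tau> + of_int m) / Im \<tau> \<notin> \<int>" by simp
  define g where "g p = e1 (- z * of_int p) / (1 - e1 (u + of_int p * \<tau>))" for p :: int
  have "(\<Sum>\<^sub>\<infinity>p::int. e1 (- z * of_int p) / (1 - e1 (u + of_int n * \<tau> + of_int m + of_int p * \<tau>))) =
      (\<Sum>\<^sub>\<infinity>p::int. e1 (z * of_int n) * g (p + n))"
  proof (rule infsum_cong)
    fix p :: int
    have "e1 (u + of_int n * \<tau> + of_int m + of_int p * \<tau>) = e1 (u + of_int (p + n) * \<tau>) * e1 (of_int m)"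
      unfolding e1_add[symmetric] by (simp add: algebra_simps)
    moreover have "e1 (- z * of_int p) = e1 (z * of_int n) * e1 (- z * of_int (p + n))"
      unfolding e1_add[symmetric] by (simp add: algebra_simps)
    ultimately show "e1 (- z * of_int p) / (1 - e1 (u + of_int n * \<tau> + of_int m + of_int p * \<tau>)) = e1 (z * of_int n) * g (p + n)"
      by (simp add: g_def)
  qed
  also have "\<dots> = e1 (z * of_int n) * (\<Sum>\<^sub>\<infinity>p::int. g p)"
  proof -
    have "bij_betw (\<lambda>p::int. p + n) UNIV UNIV" by (rule bij_betwI[where g = "\<lambda>p. p - n"]) auto
    then show ?thesis unfolding infsum_cmult_right' by (simp add: infsum_reindex_bij_betw[where f = g])
  qed
  finally show ?thesis
    unfolding Theta_quotient[OF \<tau> z u'] Theta_quotient[OF \<tau> z u] by (simp add: g_def)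
qed

text \<open>By quasi-periodicity the second quotient is the inverse of the first.\<close>

lemma phi_pair:
  assumes \<tau>: "Im \<tau> > 0" and z: "Im z < 0" "- Im z * of_nat D < Im \<tau>" and D: "D > 0" "of_nat D * \<theta> \<in> \<int>"
    and x: "x + x' = 1" "0 < x" "0 < x'" and \<theta>: "\<theta> + \<theta>' \<in> \<int>" "\<theta>1 + \<theta>1' \<in> \<int>"
  shows "phi \<tau> z x \<theta> \<theta>1 * phi \<tau> z x' \<theta>' \<theta>1' = 1"
proof -
  define C where "C = - Im z / Im \<tau>"
  have C0: "C > 0" using \<tau> z by (simp add: C_def divide_neg_pos)
  have C1: "of_nat D * C < 1" using \<tau> z by (simp add: C_def field_simps)
  have Cq: "0 < of_nat D * (C * of_rat x) \<and> of_nat D * (C * of_rat x) < 1" if "0 < x" "x < 1" for x :: rat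
  proof
    show "0 < of_nat D * (C * of_rat x)" using C0 D that by simp
    have "(of_rat x :: real) \<le> 1" using that by simp
    then have "of_nat D * C * of_rat x \<le> of_nat D * C * 1" using C0 by (intro mult_left_mono) auto
    then show "of_nat D * (C * of_rat x) < 1" using C1 by simp
  qed
  have z': "- Im z < Im \<tau>"
  proof -
    have "- Im z * 1 \<le> - Im z * of_nat D" using z D by (intro mult_left_mono) auto
    then have "- Im z \<le> - Im z * of_nat D" by (simp only: mult_1_right)
    then show ?thesis using z(2) by linarith
  qed
  obtain n where n: "\<theta> + \<theta>' = of_int n" using \<theta>(1) by (elim Ints_cases)
  obtain m where m: "\<theta>1 + \<theta>1' = of_int m" using \<theta>(2) by (elim Ints_cases)
  have eqs: "\<theta>' = of_int n - \<theta>" "\<theta>1' = of_int m - \<theta>1" "x' = 1 - x" using n m x(1) by (simp_all add: algebra_simps)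
  define U where "U = z * of_rat x + of_rat \<theta> * \<tau> + of_rat \<theta>1"
  have U': "z * of_rat x' + of_rat \<theta>' * \<tau> + of_rat \<theta>1' = (z - U) + of_int n * \<tau> + of_int m"
    unfolding U_def eqs by (simp add: of_rat_diff algebra_simps)
  have "Im U / Im \<tau> = of_rat \<theta> - C * of_rat x" using \<tau> by (simp add: U_def C_def field_simps)
  then have nU: "Im U / Im \<tau> \<notin> \<int>" using not_Ints_shift[OF D(2)] Cq[of x] x by simp
  have "Im (z - U) / Im \<tau> = of_rat (- \<theta>) - C * of_rat x'" using \<tau> by (simp add: U_def C_def eqs of_rat_minus of_rat_diff field_simps)
  moreover have "of_nat D * (- \<theta>) \<in> \<int>" using D(2) by simp
  ultimately have nU': "Im (z - U) / Im \<tau> \<notin> \<int>" using not_Ints_shift[of D "- \<theta>"] Cq[of x'] x by simp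
  have "phi \<tau> z x' \<theta>' \<theta>1' = e1 (- z * of_rat \<theta>') * (e1 (z * of_int n) * (Theta (z - (z - U)) \<tau> / Theta (z - U) \<tau>))"
    unfolding phi_def U' kronecker_shift[OF \<tau> z(1) z' nU'] ..
  moreover have "phi \<tau> z x \<theta> \<theta>1 = e1 (- z * of_rat \<theta>) * (Theta (z - U) \<tau> / Theta U \<tau>)"
    by (simp add: phi_def U_def)
  ultimately have "phi \<tau> z x \<theta> \<theta>1 * phi \<tau> z x' \<theta>' \<theta>1' = e1 (- z * of_rat \<theta>) * e1 (- z * of_rat \<theta>') * e1 (z * of_int n)"
    using Theta_nonzero[OF \<tau> nU] Theta_nonzero[OF \<tau> nU'] by simp
  also have "\<dots> = e1 (- z * of_rat \<theta> + - z * of_rat \<theta>' + z * of_int n)" by (simp only: e1_add)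
  also have "- z * of_rat \<theta> + - z * of_rat \<theta>' + z * of_int n = 0" unfolding eqs by (simp add: of_rat_diff algebra_simps)
  finally show ?thesis by simp
qed

lemma orbifold_sum_remove_pair:
  assumes "finite J" "c \<in> J" "t \<in> J" "c \<noteq> t"
    and "\<And>p p1. p \<in> P \<Longrightarrow> p1 \<in> P \<Longrightarrow> phi \<tau> z (q c) (p c) (p1 c) * phi \<tau> z (q t) (p t) (p1 t) = 1"
  shows "orbifold_sum J P q z \<tau> = orbifold_sum (J - {c, t}) P q z \<tau>"
proof -
  have J: "J = insert c (insert t (J - {c, t}))" using assms by auto
  have "(\<Prod>j\<in>J. phi \<tau> z (q j) (p j) (p1 j)) = (\<Prod>j\<in>J - {c, t}. phi \<tau> z (q j) (p j) (p1 j))" if "p \<in> P" "p1 \<in> P" for p p1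
    using assms(1,4) assms(5)[OF that] by (subst J) (simp add: mult.assoc[symmetric])
  then show ?thesis by (simp add: orbifold_sum_def cong: sum.cong)
qed

text \<open>With \<open>q k = 1\<close> and integral coordinates at k, the numerator is
  \<open>Theta\<close> at a point of the period lattice.\<close>

lemma orbifold_sum_eq_0:
  assumes \<tau>: "Im \<tau> > 0" and J: "finite J" "k \<in> J" "q k = 1" and P: "\<And>p. p \<in> P \<Longrightarrow> p k \<in> \<int>"
  shows "orbifold_sum J P q z \<tau> = 0"
proof -
  have "phi \<tau> z (q k) (p k) (p1 k) = 0" if p: "p \<in> P" "p1 \<in> P" for p p1
  proof -
    obtain l m where "p k = of_int l" "p1 k = of_int m" using P[OF p(1)] P[OF p(2)] by (elim Ints_cases)
    moreover have "z - (z + of_int l * \<tau> + of_int m) = of_int (- l) * \<tau> + of_int (- m)" by simp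
    ultimately show ?thesis using Theta_lattice[OF \<tau>, of "- l" "- m"] J(3) by (simp add: phi_def)
  qed
  then have "(\<Prod>j\<in>J. phi \<tau> z (q j) (p j) (p1 j)) = 0" if "p \<in> P" "p1 \<in> P" for p p1
    using that J by (intro prod_zero bexI[of _ k]) auto
  then show ?thesis by (simp add: orbifold_sum_def cong: sum.cong)
qed

context mirror
begin

lemma edge_sum:
  fixes f :: "'j \<Rightarrow> rat"
  assumes "edge i c t" shows "(\<Sum>j\<in>J. of_nat (a i j) * f j) = f c + f t"
proof -
  have "(\<Sum>j\<in>J. of_nat (a i j) * f j) = (\<Sum>j\<in>{c, t}. of_nat (a i j) * f j)"
    using assms finJ by (intro sum.mono_neutral_right) (auto simp: edge_def)
  then show ?thesis using assms by (auto simp: edge_def)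
qed

text \<open>The monomial x_k gives \<open>q k = 1\<close>, so another monomial containing x_k has no
  room for further variables and would repeat the row.\<close>

lemma linear_row_column:
  assumes lin: "linear_row i k" and i': "i' \<in> I" "i' \<noteq> i"
  shows "a i' k = 0"
proof (rule ccontr)
  assume n: "a i' k \<noteq> 0"
  have l: "i \<in> I" "k \<in> J" "a i k = 1" "\<And>j. j \<in> J \<Longrightarrow> j \<noteq> k \<Longrightarrow> a i j = 0" using lin by (auto simp: linear_row_def)
  have "(\<Sum>j\<in>J. of_nat (a i j) * q j) = (\<Sum>j\<in>{k}. of_nat (a i j) * q j)"
    using l finJ by (intro sum.mono_neutral_right) auto
  then have qk: "q k = 1" using deg[OF l(1)] l by simp
  have s: "of_nat (a i' k) + (\<Sum>j\<in>J - {k}. of_nat (a i' j) * q j) = 1"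
    using deg[OF i'(1)] qk finJ l(2) by (simp add: sum.remove)
  have nn: "0 \<le> (\<Sum>j\<in>J - {k}. of_nat (a i' j) * q j)" using q_pos by (auto simp: less_imp_le intro!: sum_nonneg)
  have ge: "(1::rat) \<le> of_nat (a i' k)" using n by simp
  have "of_nat (a i' k) = (1::rat)" and z: "(\<Sum>j\<in>J - {k}. of_nat (a i' j) * q j) = 0" using s nn ge by linarith+
  then have a1: "a i' k = 1" by simp
  have z': "\<forall>j\<in>J - {k}. of_nat (a i' j) * q j = 0"
    using z finJ q_pos by (subst (asm) sum_nonneg_eq_0_iff) (auto simp: less_imp_le)
  have a0: "a i' j = 0" if "j \<in> J" "j \<noteq> k" for j
    using bspec[OF z', of j] q_pos[OF that(1)] that by simp
  define y where "y h = (if h = i then 1 else if h = i' then -1 else 0 :: rat)" for h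
  have "(\<Sum>h\<in>I. y h * of_nat (a h j)) = 0" if "j \<in> J" for j
  proof -
    have "(\<Sum>h\<in>I. y h * of_nat (a h j)) = (\<Sum>h\<in>{i, i'}. y h * of_nat (a h j))"
      using l(1) i' finI by (intro sum.mono_neutral_right) (auto simp: y_def)
    also have "\<dots> = of_nat (a i j) - of_nat (a i' j)" using i' by (auto simp: y_def)
    also have "\<dots> = 0" using l a1 a0 that by (cases "j = k") auto
    finally show ?thesis .
  qed
  from row_inj[OF this l(1)] show False by (simp add: y_def)
qed

end

text \<open>P, Pd and D stay fixed while the index sets and the matrix vary in the induction. A
  monomial that is a single variable makes both sides 0. A pivot removes two variables, so the sign
  is preserved. What remains are sums of chains and loops.\<close>

theorem mirror_duality:
  assumes "mirror I J a q qd P Pd"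
    and \<tau>: "Im \<tau> > 0" and z: "Im z < 0" "- Im z * of_nat D < Im \<tau>" and D0: "D > 0"
    and D: "\<And>p j. p \<in> P \<Longrightarrow> j \<in> J \<Longrightarrow> of_nat D * p j \<in> \<int>" "\<And>r i. r \<in> Pd \<Longrightarrow> i \<in> I \<Longrightarrow> of_nat D * r i \<in> \<int>"
  shows "orbifold_sum J P q z \<tau> = (-1) ^ card J * orbifold_sum I Pd qd z \<tau>"
  using assms(1) D
proof (induction "card J" arbitrary: I J a rule: less_induct)
  case less
  interpret mirror I J a q qd P Pd by (rule less.prems(1))
  consider (lin) i k where "linear_row i k" | (edge) "\<And>i k. \<not> linear_row i k" "\<exists>i c t. edge i c t"
    | (atomic) "\<And>i k. \<not> linear_row i k" "\<And>i c t. \<not> edge i c t" by blast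
  then show ?case
  proof cases
    case lin
    then have l: "i \<in> I" "k \<in> J" "a i k = 1" "\<And>j. j \<in> J \<Longrightarrow> j \<noteq> k \<Longrightarrow> a i j = 0" by (auto simp: linear_row_def)
    have row: "(\<Sum>j\<in>J. of_nat (a i j) * f j) = f k" for f :: "'b \<Rightarrow> rat"
    proof -
      have "(\<Sum>j\<in>J. of_nat (a i j) * f j) = (\<Sum>j\<in>{k}. of_nat (a i j) * f j)"
        using l finJ by (intro sum.mono_neutral_right) auto
      then show ?thesis using l by simp
    qed
    have col: "(\<Sum>h\<in>I. f h * of_nat (a h k)) = f i" for f :: "'a \<Rightarrow> rat"
    proof -
      have "(\<Sum>h\<in>I. f h * of_nat (a h k)) = (\<Sum>h\<in>{i}. f h * of_nat (a h k))"
        using l finI linear_row_column[OF lin] by (intro sum.mono_neutral_right) auto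
      then show ?thesis using l by simp
    qed
    have "orbifold_sum J P q z \<tau> = 0"
      using deg[OF l(1)] int[OF _ l(1)] unfolding row by (intro orbifold_sum_eq_0[OF \<tau> finJ l(2)])
    moreover have "orbifold_sum I Pd qd z \<tau> = 0"
      using ddeg[OF l(2)] dint[OF _ l(2)] unfolding col by (intro orbifold_sum_eq_0[OF \<tau> finI l(1)])
    ultimately show ?thesis by simp
  next
    case edge
    obtain i0 i1 c t where e: "edge i0 c t" "i1 \<in> I" "i1 \<noteq> i0" "a i1 c = 1" "\<forall>i\<in>I - {i0, i1}. a i c = 0"
      using pivot_exists[OF edge(2,1)] by blast
    have colc: "a i c = 0" if "i \<in> I" "i \<noteq> i0" "i \<noteq> i1" for i using bspec[OF e(5), of i] that by simp
    have m: "i0 \<in> I" "c \<in> J" "t \<in> J" "c \<noteq> t" "a i0 c = 1" using e(1) by (auto simp: edge_def)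
    have col: "(\<Sum>h\<in>I. f h * of_nat (a h c)) = f i0 + f i1" for f :: "'a \<Rightarrow> rat"
    proof -
      have "(\<Sum>h\<in>I. f h * of_nat (a h c)) = (\<Sum>h\<in>{i0, i1}. f h * of_nat (a h c))"
        using m e colc finI by (intro sum.mono_neutral_right) auto
      then show ?thesis using m e by auto
    qed
    have card: "card J = card (J - {c, t}) + 2"
    proof -
      have "card {c, t} \<le> card J" using m finJ by (intro card_mono) auto
      then show ?thesis using m finJ by (subst card_Diff_subset) auto
    qed
    have "orbifold_sum (J - {c, t}) P q z \<tau> = (-1) ^ card (J - {c, t}) * orbifold_sum (I - {i0, i1}) Pd qd z \<tau>"
      using less.prems(2,3) card
      by (intro less.hyps[OF _ pivot_mirror[OF e(1-4) colc]]) auto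
    moreover have "orbifold_sum J P q z \<tau> = orbifold_sum (J - {c, t}) P q z \<tau>"
    proof (rule orbifold_sum_remove_pair[OF finJ m(2-4)])
      fix p p1 assume p: "p \<in> P" "p1 \<in> P"
      have "p c + p t \<in> \<int>" "p1 c + p1 t \<in> \<int>" "q c + q t = 1"
        using int[OF p(1) m(1)] int[OF p(2) m(1)] deg[OF m(1)] unfolding edge_sum[OF e(1)] by auto
      then show "phi \<tau> z (q c) (p c) (p1 c) * phi \<tau> z (q t) (p t) (p1 t) = 1"
        using q_pos m p less.prems(2) by (intro phi_pair[OF \<tau> z D0]) auto
    qed
    moreover have "orbifold_sum I Pd qd z \<tau> = orbifold_sum (I - {i0, i1}) Pd qd z \<tau>"
    proof (rule orbifold_sum_remove_pair[OF finI m(1) e(2) e(3)[symmetric]])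
      fix p p1 assume p: "p \<in> Pd" "p1 \<in> Pd"
      have "p i0 + p i1 \<in> \<int>" "p1 i0 + p1 i1 \<in> \<int>" "qd i0 + qd i1 = 1"
        using dint[OF p(1) m(2)] dint[OF p(2) m(2)] ddeg[OF m(2)] unfolding col by auto
      then show "phi \<tau> z (qd i0) (p i0) (p1 i0) * phi \<tau> z (qd i1) (p i1) (p1 i1) = 1"
        using qd_pos m e(2) p less.prems(3) by (intro phi_pair[OF \<tau> z D0]) auto
    qed
    ultimately show ?thesis by (simp add: card)
  next
    case atomic
    from atomic_structure[OF atomic(2,1)] obtain \<pi> b pt where S: "bij_betw \<pi> J I \<and> (\<forall>j\<in>J. b j \<ge> 2 \<and> pt j \<noteq> Some j \<and> (\<forall>k. pt j = Some k \<longrightarrow> k \<in> J) \<and>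
        (\<forall>k\<in>J. a (\<pi> j) k = (if k = j then b j else if pt j = Some k then 1 else 0))) \<and>
        (\<forall>j\<in>J. \<forall>l\<in>J. \<forall>k. pt j = Some k \<and> pt l = Some k \<longrightarrow> j = l)"
      by (elim exE)
    note s = S[THEN conjunct1] S[THEN conjunct2, THEN conjunct1]
    note inj = S[THEN conjunct2, THEN conjunct2]
    interpret atomic I J a q qd P Pd \<pi> b pt D
    proof
      show "bij_betw \<pi> J I" by (rule s)
      show "2 \<le> b j" "pt j \<noteq> Some j" if "j \<in> J" for j using s(2) that by auto
      show "k \<in> J" if "j \<in> J" "pt j = Some k" for j k using bspec[OF s(2) that(1)] that(2) by blast
      show "j = l" if "j \<in> J" "l \<in> J" "pt j = Some k" "pt l = Some k" for j l k using inj that by blast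
      show "a (\<pi> j) k = (if k = j then b j else if pt j = Some k then 1 else 0)" if "j \<in> J" "k \<in> J" for j k
        using bspec[OF s(2) that(1)] that(2) by blast
      show "0 < D" by (rule D0)
      show "of_nat D * p j \<in> \<int>" if "p \<in> P" "j \<in> J" for p j using less.prems(2) that .
      show "of_nat D * r i \<in> \<int>" if "r \<in> Pd" "i \<in> I" for r i using less.prems(3) that .
    qed
    show ?thesis by (rule atomic_duality[OF \<tau> z])
  qed
qed

section \<open>The lattices of a pair of potential and group\<close>

text \<open>A single summand is the only obstruction to cancellation, which is why
  \<open>comb_nondegenerate\<close> asks for exactly one pointing monomial.\<close>

lemma nonzero_sum_0:
  assumes "finite S" "card S \<noteq> 1"
  shows "\<exists>c. (\<forall>i\<in>S. c i \<noteq> (0::complex)) \<and> sum c S = 0"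
proof (cases "S = {}")
  case False
  then obtain x where x: "x \<in> S" by blast
  then have "card S \<ge> 2" using assms card_gt_0_iff[of S] by fastforce
  then have c: "card (S - {x}) \<ge> 1" using x assms by simp
  define c where "c i = (if i = x then - of_nat (card (S - {x})) else 1 :: complex)" for i
  have "sum c S = c x + (\<Sum>i\<in>S - {x}. c i)" using assms x by (simp add: sum.remove)
  also have "(\<Sum>i\<in>S - {x}. c i) = (\<Sum>i\<in>S - {x}. 1)" by (intro sum.cong) (auto simp: c_def)
  finally have "sum c S = 0" by (simp add: c_def)
  moreover have "c i \<noteq> 0" for i using c by (simp add: c_def del: card_Diff_insert card_Diff_singleton)
  ultimately show ?thesis by blast
qed simp

text \<open>
  If the combinatorial condition failed for Y, a suitable point of the torus of Y would be a
  singular point: all its monomials vanish, and the partial derivatives are sums over groups of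
  monomials whose values can be prescribed, as the exponent matrix is invertible.
\<close>

lemma nondegenerate_comb:
  fixes A :: "nat^'d^'d"
  assumes inv: "invertible (map_matrix rat_of_nat A)" and nd: "nondegenerate A"
  shows "comb_nondegenerate UNIV UNIV (\<lambda>i j. A $ i $ j)"
proof (rule ccontr)
  assume "\<not> ?thesis"
  then obtain Y :: "'d set" where Y: "Y \<noteq> {}" and n: "\<not> ((\<exists>i\<in>UNIV. \<forall>j\<in>UNIV. j \<notin> Y \<longrightarrow> A $ i $ j = 0) \<or>
     (\<exists>k\<in>UNIV - Y. \<exists>!i. i \<in> UNIV \<and> A $ i $ k = 1 \<and> (\<forall>j\<in>UNIV. j \<notin> Y \<longrightarrow> j \<noteq> k \<longrightarrow> A $ i $ j = 0)))"
    unfolding comb_nondegenerate_def not_all not_imp by (elim exE conjE)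
  have n1: "\<not> (\<exists>i. \<forall>j. j \<notin> Y \<longrightarrow> A $ i $ j = 0)"
    and n2: "\<not> (\<exists>k. k \<notin> Y \<and> (\<exists>!i. A $ i $ k = 1 \<and> (\<forall>j. j \<notin> Y \<longrightarrow> j \<noteq> k \<longrightarrow> A $ i $ j = 0)))"
    using n by (simp_all add: Bex_def)
  \<comment> \<open>At a point supported on Y, only x_k times monomials in Y contribute to the
    partial derivative in x_k.\<close>
  define grp where "grp k = {i. A $ i $ k = 1 \<and> (\<forall>j. j \<notin> Y \<longrightarrow> j \<noteq> k \<longrightarrow> A $ i $ j = 0)}" for k
  have grp1: "card (grp k) \<noteq> 1" if k: "k \<notin> Y" for k
  proof
    assume "card (grp k) = 1"
    then obtain i where i: "grp k = {i}" using card_1_singletonE by blast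
    have "\<exists>!i. i \<in> grp k" unfolding i by simp
    then show False using n2 k unfolding grp_def by blast
  qed
  have grp_eq: "k = k'" if "i \<in> grp k" "i \<in> grp k'" "k \<notin> Y" "k' \<notin> Y" for i k k'
  proof (rule ccontr)
    assume "k \<noteq> k'"
    then have "A $ i $ k' = 0" using that by (auto simp: grp_def)
    then show False using that by (auto simp: grp_def)
  qed
  have "\<forall>k. \<exists>c. k \<notin> Y \<longrightarrow> (\<forall>i\<in>grp k. c i \<noteq> (0::complex)) \<and> sum c (grp k) = 0"
    using nonzero_sum_0[OF _ grp1] by (metis finite)
  then obtain f where f: "\<And>k i. k \<notin> Y \<Longrightarrow> i \<in> grp k \<Longrightarrow> f k i \<noteq> (0::complex)" "\<And>k. k \<notin> Y \<Longrightarrow> sum (f k) (grp k) = 0" by metis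
  define c where "c i = (if \<exists>k. k \<notin> Y \<and> i \<in> grp k then f (SOME k. k \<notin> Y \<and> i \<in> grp k) i else 1)" for i
  have cf: "c i = f k i" if "k \<notin> Y" "i \<in> grp k" for i k
  proof -
    have "(SOME k. k \<notin> Y \<and> i \<in> grp k) = k"
      using that grp_eq by (intro some_equality) auto
    then show ?thesis using that by (auto simp: c_def)
  qed
  have c0: "c i \<noteq> 0" for i
  proof (cases "\<exists>k. k \<notin> Y \<and> i \<in> grp k")
    case True
    then obtain k where "k \<notin> Y" "i \<in> grp k" by blast
    then show ?thesis using cf f(1) by metis
  qed (auto simp: c_def)
  have csum: "sum c (grp k) = 0" if "k \<notin> Y" for k
    using f(2)[OF that] cf[OF that] by (metis (no_types, lifting) sum.cong)
  obtain B where B: "map_matrix rat_of_nat A ** B = mat 1" using inv by (auto simp: invertible_def)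
  have AB: "(\<Sum>j\<in>UNIV. of_nat (A $ i $ j) * B $ j $ i') = (if i = i' then 1 else 0)" for i i'
    using arg_cong[OF B, of "\<lambda>M. M $ i $ i'"] by (simp add: matrix_matrix_mult_def mat_def)
  \<comment> \<open>The exponent matrix is inverted on logarithms, so that the i-th monomial takes
    the value \<open>c i\<close> at the point with coordinates \<open>exp (l j)\<close>.\<close>
  define l where "l j = (\<Sum>i\<in>UNIV. of_rat (B $ j $ i) * Ln (c i))" for j
  have Al: "(\<Sum>j\<in>UNIV. of_nat (A $ i $ j) * l j) = Ln (c i)" for i
  proof -
    have "(\<Sum>j\<in>UNIV. of_nat (A $ i $ j) * l j) = (\<Sum>i'\<in>UNIV. of_rat (\<Sum>j\<in>UNIV. of_nat (A $ i $ j) * B $ j $ i') * Ln (c i'))"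
      unfolding l_def of_rat_sum of_rat_mult of_rat_of_nat_eq sum_distrib_left sum_distrib_right mult.assoc by (rule sum.swap)
    also have "\<dots> = (\<Sum>i'\<in>UNIV. if i = i' then Ln (c i') else 0)" unfolding AB by (intro sum.cong) auto
    finally show ?thesis by simp
  qed
  have mono: "(\<Prod>j\<in>UNIV. exp (l j) ^ (A $ i $ j)) = c i" for i
    using c0[of i] by (simp add: exp_of_nat_mult[symmetric] exp_sum[symmetric] Al)
  define x :: "complex^'d" where "x = (\<chi> j. if j \<in> Y then exp (l j) else 0)"
  have "x \<noteq> 0"
  proof -
    obtain j where "j \<in> Y" using Y by blast
    then have "x $ j \<noteq> 0" by (simp add: x_def)
    then show ?thesis by auto
  qed
  have term0: "(\<Prod>j\<in>S. (x $ j) ^ (A $ i $ j)) = 0" if "j \<in> S" "j \<notin> Y" "A $ i $ j \<noteq> 0" for i j S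
    using that by (intro prod_zero bexI[of _ j]) (auto simp: x_def)
  have "potential A x = 0"
    unfolding potential_def
  proof (rule sum.neutral, rule ballI)
    fix i
    obtain j where "j \<notin> Y" "A $ i $ j \<noteq> 0" using n1 by blast
    then show "(\<Prod>j\<in>UNIV. (x $ j) ^ (A $ i $ j)) = 0" using term0[of j UNIV i] by simp
  qed
  moreover have "partial_deriv k (potential A) x = 0" for k
  proof -
    define w where "w i = (\<Prod>j\<in>UNIV - {k}. (x $ j) ^ (A $ i $ j))" for i
    have pot: "potential A (\<chi> j. if j = k then t else x $ j) = (\<Sum>i\<in>UNIV. t ^ (A $ i $ k) * w i)" for t
      unfolding potential_def
    proof (intro sum.cong refl)
      fix i
      have "(\<Prod>j\<in>UNIV. ((\<chi> j. if j = k then t else x $ j) $ j) ^ (A $ i $ j)) =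
          t ^ (A $ i $ k) * (\<Prod>j\<in>UNIV - {k}. ((\<chi> j. if j = k then t else x $ j) $ j) ^ (A $ i $ j))"
        by (subst prod.remove[of _ k]) auto
      also have "(\<Prod>j\<in>UNIV - {k}. ((\<chi> j. if j = k then t else x $ j) $ j) ^ (A $ i $ j)) = w i"
        unfolding w_def by (intro prod.cong) auto
      finally show "(\<Prod>j\<in>UNIV. ((\<chi> j. if j = k then t else x $ j) $ j) ^ (A $ i $ j)) = t ^ (A $ i $ k) * w i" .
    qed
    have "((\<lambda>t. \<Sum>i\<in>UNIV. t ^ (A $ i $ k) * w i) has_field_derivative
        (\<Sum>i\<in>UNIV. of_nat (A $ i $ k) * (x $ k) ^ (A $ i $ k - 1) * w i)) (at (x $ k))"
      by (intro DERIV_sum DERIV_cmult_right) (auto intro!: derivative_eq_intros)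
    then have d: "partial_deriv k (potential A) x = (\<Sum>i\<in>UNIV. of_nat (A $ i $ k) * (x $ k) ^ (A $ i $ k - 1) * w i)"
      unfolding partial_deriv_def pot by (rule DERIV_imp_deriv)
    show ?thesis
    proof (cases "k \<in> Y")
      case True
      have "w i = 0" for i
      proof -
        obtain j where "j \<notin> Y" "A $ i $ j \<noteq> 0" using n1 by blast
        then show ?thesis unfolding w_def using True by (intro term0[of j]) auto
      qed
      then show ?thesis unfolding d by simp
    next
      case False
      have out: "of_nat (A $ i $ k) * (x $ k) ^ (A $ i $ k - 1) * w i = 0" if i: "i \<notin> grp k" for i
      proof (cases "A $ i $ k = 1")
        case True
        then obtain j where "j \<notin> Y" "j \<noteq> k" "A $ i $ j \<noteq> 0" using i by (auto simp: grp_def)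
        then have "w i = 0" unfolding w_def by (intro term0[of j]) auto
        then show ?thesis by simp
      next
        case n: False
        show ?thesis using n False by (cases "A $ i $ k = 0") (auto simp: x_def)
      qed
      have inn: "of_nat (A $ i $ k) * (x $ k) ^ (A $ i $ k - 1) * w i = c i / exp (l k)" if i: "i \<in> grp k" for i
      proof -
        have "w i = (\<Prod>j\<in>UNIV - {k}. exp (l j) ^ (A $ i $ j))"
          unfolding w_def using i by (intro prod.cong refl) (auto simp: grp_def x_def)
        moreover have "c i = exp (l k) ^ (A $ i $ k) * (\<Prod>j\<in>UNIV - {k}. exp (l j) ^ (A $ i $ j))"
          unfolding mono[symmetric] by (subst prod.remove[of _ k]) auto
        ultimately show ?thesis using i by (simp add: grp_def)
      qed
      have "partial_deriv k (potential A) x = (\<Sum>i\<in>grp k. of_nat (A $ i $ k) * (x $ k) ^ (A $ i $ k - 1) * w i)"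
        unfolding d using out by (intro sum.mono_neutral_right) auto
      also have "\<dots> = (\<Sum>i\<in>grp k. c i) / exp (l k)" unfolding sum_divide_distrib by (intro sum.cong refl inn)
      finally show ?thesis using csum[OF False] by simp
    qed
  qed
  ultimately show False using nd \<open>x \<noteq> 0\<close> unfolding nondegenerate_def by blast
qed

section \<open>Exponentials of rational vectors and their representatives\<close>

lemma expvec_nth: "expvec p $ j = e1 (of_rat (p $ j))"
  by (simp add: expvec_def e1_def)

lemma expvec_eq_iff: "expvec p = expvec p' \<longleftrightarrow> (\<forall>j. p $ j - p' $ j \<in> \<int>)"
proof -
  have "e1 (of_rat r) = e1 (of_rat s) \<longleftrightarrow> r - s \<in> \<int>" for r s
  proof -
    have "e1 (of_rat (r - s)) = e1 (of_rat r) / e1 (of_rat s)"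
      by (simp add: of_rat_diff e1_add[of "of_rat r" "- of_rat s", simplified] e1_minus divide_inverse)
    then show ?thesis using e1_of_rat_eq_1_iff[of "r - s"] by (auto simp: divide_eq_eq)
  qed
  then show ?thesis by (simp add: vec_eq_iff expvec_nth)
qed

lemma expvec_add: "expvec (p + p') = expvec p * expvec p'"
  by (simp add: vec_eq_iff expvec_nth of_rat_add e1_add)

lemma finite_expvec:
  assumes "D > 0" and H: "\<And>\<gamma>. \<gamma> \<in> H \<Longrightarrow> \<exists>p. \<gamma> = expvec p \<and> (\<forall>j. of_nat D * p $ j \<in> \<int>)"
  shows "finite (H :: (complex^'d) set)"
proof (rule finite_subset)
  show "H \<subseteq> (\<lambda>f. \<chi> j. f j) ` (PiE UNIV (\<lambda>_. {x. x ^ D = 1}))"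
  proof
    fix \<gamma> assume "\<gamma> \<in> H"
    then obtain p :: "rat^'d" where p: "\<gamma> = expvec p" "\<And>j. of_nat D * p $ j \<in> \<int>" using H by blast
    have "(\<gamma> $ j) ^ D = 1" for j
    proof -
      have "(\<gamma> $ j) ^ D = e1 (of_rat (of_nat D * p $ j))" by (simp add: p(1) expvec_nth e1_of_nat_mult of_rat_mult)
      then show ?thesis using p(2) by (simp add: e1_of_rat_eq_1_iff)
    qed
    then show "\<gamma> \<in> (\<lambda>f. \<chi> j. f j) ` (PiE UNIV (\<lambda>_. {x. x ^ D = 1}))"
      by (intro image_eqI[of _ _ "\<lambda>j. \<gamma> $ j"]) (auto simp: vec_eq_iff)
  qed
  have "finite {x::complex. x ^ D = 1}" using assms(1) by (rule finite_nth_roots)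
  then show "finite ((\<lambda>f. \<chi> j. f j) ` (PiE UNIV (\<lambda>_. {x::complex. x ^ D = 1})) :: (complex^'d) set)"
    by (intro finite_imageI finite_PiE) auto
qed

text \<open>Representatives as functions, the form used by \<open>orbifold_sum\<close>; taking
  \<open>theta_rep\<close> makes the summands those of \<open>Ell_raw\<close>.\<close>

definition reps :: "(complex^'d) set \<Rightarrow> ('d \<Rightarrow> rat) set" where
  "reps H = (\<lambda>\<gamma> j. theta_rep \<gamma> $ j) ` H"

locale exp_group =
  fixes H :: "(complex^'d) set"
  assumes fin: "finite H" and ne: "H \<noteq> {}" and range: "\<gamma> \<in> H \<Longrightarrow> \<exists>p. \<gamma> = expvec p"
    and closed: "\<gamma> \<in> H \<Longrightarrow> \<gamma>' \<in> H \<Longrightarrow> \<gamma> * \<gamma>' \<in> H"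
begin

lemma expvec_rep: "\<gamma> \<in> H \<Longrightarrow> expvec (theta_rep \<gamma>) = \<gamma>"
  unfolding theta_rep_def by (rule someI_ex) (metis range)

lemma inj_rep: "inj_on (\<lambda>\<gamma> j. theta_rep \<gamma> $ j) H"
proof (rule inj_onI)
  fix \<gamma> \<gamma>' assume "\<gamma> \<in> H" "\<gamma>' \<in> H" "(\<lambda>j. theta_rep \<gamma> $ j) = (\<lambda>j. theta_rep \<gamma>' $ j)"
  then show "\<gamma> = \<gamma>'" using expvec_rep by (metis vec_eq_iff)
qed

lemma expvec_reps: "p \<in> reps H \<Longrightarrow> expvec (\<chi> j. p j) \<in> H"
  by (auto simp: reps_def expvec_rep)

lemma reps_exists:
  assumes "expvec n \<in> H" shows "\<exists>p\<in>reps H. \<forall>j. n $ j - p j \<in> \<int>"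
proof -
  have "expvec n = expvec (theta_rep (expvec n))" using expvec_rep[OF assms] by simp
  then have "\<forall>j. n $ j - theta_rep (expvec n) $ j \<in> \<int>" by (simp add: expvec_eq_iff)
  then show ?thesis unfolding reps_def using assms by blast
qed

lemma reps_group_reps: "reps_group (reps H) UNIV"
  unfolding reps_group_def
proof (intro conjI ballI impI)
  show "finite (reps H)" "reps H \<noteq> {}" using fin ne by (auto simp: reps_def)
  fix p p' assume p: "p \<in> reps H" "p' \<in> reps H"
  have "expvec ((\<chi> j. p j) + (\<chi> j. p' j)) \<in> H" unfolding expvec_add using p by (intro closed expvec_reps)
  from reps_exists[OF this] obtain p'' where p'': "p'' \<in> reps H" "\<And>j. p j + p' j - p'' j \<in> \<int>" by auto
  have "p'' j - (p j + p' j) \<in> \<int>" for j using Ints_minus[OF p''(2)[of j]] by (simp add: algebra_simps)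
  then show "\<exists>p''\<in>reps H. \<forall>j\<in>UNIV. p'' j - (p j + p' j) \<in> \<int>" using p''(1) by blast
next
  fix p p' assume p: "p \<in> reps H" "p' \<in> reps H" "\<forall>j\<in>UNIV. p j - p' j \<in> \<int>"
  obtain \<gamma> \<gamma>' where g: "\<gamma> \<in> H" "\<gamma>' \<in> H" "p = (\<lambda>j. theta_rep \<gamma> $ j)" "p' = (\<lambda>j. theta_rep \<gamma>' $ j)"
    using p(1,2) by (auto simp: reps_def)
  have "expvec (theta_rep \<gamma>) = expvec (theta_rep \<gamma>')" using p(3) by (simp add: expvec_eq_iff g)
  then show "p = p'" using g expvec_rep by simp
qed

end

lemma geometric_roots:
  assumes "of_nat D * r \<in> \<int>" "r \<notin> \<int>"
  shows "(\<Sum>g<D. e1 (of_rat (of_nat g * r))) = 0"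
proof -
  have "(\<Sum>g<D. e1 (of_rat (of_nat g * r))) = (\<Sum>g<D. e1 (of_rat r) ^ g)"
    by (simp add: of_rat_mult e1_of_nat_mult)
  also have "\<dots> = (1 - e1 (of_rat r) ^ D) / (1 - e1 (of_rat r))"
    using assms(2) e1_of_rat_eq_1_iff[of r] by (intro sum_gp_strict[THEN trans]) simp
  also have "e1 (of_rat r) ^ D = e1 (of_rat (of_nat D * r))" by (simp add: of_rat_mult e1_of_nat_mult)
  also have "\<dots> = 1" using assms(1) by (simp add: e1_of_rat_eq_1_iff)
  finally show ?thesis by simp
qed

text \<open>Finite Pontryagin duality, by summing a character over a box.\<close>

lemma double_annihilator:
  fixes P :: "('j \<Rightarrow> rat) set"
  assumes P: "reps_group P J" and J: "finite J" and D: "D > 0"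
    and DP: "\<And>p j. p \<in> P \<Longrightarrow> j \<in> J \<Longrightarrow> of_nat D * p j \<in> \<int>" and Dn: "\<And>j. j \<in> J \<Longrightarrow> of_nat D * n j \<in> \<int>"
    and ann: "\<And>k. k \<in> annihilator P J \<Longrightarrow> (\<Sum>j\<in>J. k j * n j) \<in> \<int>"
  shows "\<exists>p\<in>P. \<forall>j\<in>J. n j - p j \<in> \<int>"
proof (rule ccontr)
  assume no: "\<not> ?thesis"
  define Bx where "Bx = PiE J (\<lambda>_. {..<D})"
  have finBx: "finite Bx" unfolding Bx_def using J by (intro finite_PiE) auto
  \<comment> \<open>T is evaluated twice. Summed over the box first, it factors into sums of roots
    of unity, one of which vanishes. Summed over P first, it counts the characters in the box that
    annihilate P, among them the trivial one.\<close>
  define T where "T = (\<Sum>g\<in>Bx. \<Sum>p\<in>P. e1 (of_rat (\<Sum>j\<in>J. of_nat (g j) * (p j - n j))))"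
  have "T = (\<Sum>p\<in>P. \<Sum>g\<in>Bx. \<Prod>j\<in>J. e1 (of_rat (of_nat (g j) * (p j - n j))))"
    unfolding T_def using J by (subst sum.swap) (simp add: of_rat_sum e1_sum)
  also have "\<dots> = (\<Sum>p\<in>P. \<Prod>j\<in>J. \<Sum>g<D. e1 (of_rat (of_nat g * (p j - n j))))"
    unfolding Bx_def using J by (subst prod_sum_PiE) auto
  also have "\<dots> = 0"
  proof (rule sum.neutral, rule ballI)
    fix p assume p: "p \<in> P"
    then obtain j where j: "j \<in> J" "n j - p j \<notin> \<int>" using no by blast
    have "p j - n j \<notin> \<int>" using j(2) Ints_minus[of "p j - n j"] by auto
    moreover have "of_nat D * (p j - n j) \<in> \<int>"
      using Ints_diff[OF DP[OF p j(1)] Dn[OF j(1)]] by (simp add: algebra_simps)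
    ultimately have "(\<Sum>g<D. e1 (of_rat (of_nat g * (p j - n j)))) = 0" by (intro geometric_roots)
    then show "(\<Prod>j\<in>J. \<Sum>g<D. e1 (of_rat (of_nat g * (p j - n j)))) = 0"
      using j(1) J by (intro prod_zero bexI[of _ j]) auto
  qed
  finally have T0: "T = 0" .
  define ok where "ok g \<longleftrightarrow> (\<forall>p\<in>P. (\<Sum>j\<in>J. of_nat (g j) * p j) \<in> \<int>)" for g :: "'j \<Rightarrow> nat"
  have "T = (\<Sum>g\<in>Bx. if ok g then of_nat (card P) else 0)"
    unfolding T_def
  proof (intro sum.cong refl)
    fix g assume "g \<in> Bx"
    have s: "(\<Sum>j\<in>J. of_nat (g j) * (p j - n j)) = (\<Sum>j\<in>J. of_nat (g j) * p j) + - (\<Sum>j\<in>J. of_nat (g j) * n j)" for p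
      by (simp add: sum_subtractf algebra_simps)
    have "(\<Sum>p\<in>P. e1 (of_rat (\<Sum>j\<in>J. of_nat (g j) * (p j - n j)))) =
        (\<Sum>p\<in>P. e1 (of_rat (\<Sum>j\<in>J. of_nat (g j) * p j))) * e1 (of_rat (- (\<Sum>j\<in>J. of_nat (g j) * n j)))"
      unfolding s of_rat_add e1_add sum_distrib_right ..
    also have "(\<Sum>p\<in>P. e1 (of_rat (\<Sum>j\<in>J. of_nat (g j) * p j))) = (if ok g then of_nat (card P) else 0)"
      unfolding ok_def by (rule character_sum[OF P J]) simp
    also have "\<dots> * e1 (of_rat (- (\<Sum>j\<in>J. of_nat (g j) * n j))) = (if ok g then of_nat (card P) else 0)"
    proof (cases "ok g")
      case True
      define k where "k j = (if j \<in> J then rat_of_nat (g j) else 0)" for j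
      have kk: "(\<Sum>j\<in>J. k j * f j) = (\<Sum>j\<in>J. of_nat (g j) * f j)" for f :: "'j \<Rightarrow> rat" by (intro sum.cong) (auto simp: k_def)
      have "k \<in> annihilator P J" using True unfolding annihilator_def ok_def kk[symmetric] by (auto simp: k_def)
      from ann[OF this] have "- (\<Sum>j\<in>J. of_nat (g j) * n j) \<in> \<int>" unfolding kk by simp
      then have "e1 (of_rat (- (\<Sum>j\<in>J. of_nat (g j) * n j))) = 1" by (rule iffD2[OF e1_of_rat_eq_1_iff])
      then show ?thesis by (simp only: mult_1_right)
    qed simp
    finally show "(\<Sum>p\<in>P. e1 (of_rat (\<Sum>j\<in>J. of_nat (g j) * (p j - n j)))) = (if ok g then of_nat (card P) else 0)" .
  qed
  also have "\<dots> = of_nat (card P) * of_nat (card {g\<in>Bx. ok g})"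
    using finBx by (simp add: sum.If_cases Int_def)
  finally have "card P = 0 \<or> card {g\<in>Bx. ok g} = 0" using T0 by simp
  moreover have "card P \<noteq> 0" using P by (auto simp: reps_group_def)
  moreover have "(\<lambda>j\<in>J. 0) \<in> {g\<in>Bx. ok g}" using D by (auto simp: Bx_def ok_def)
  then have "card {g\<in>Bx. ok g} \<noteq> 0" using finBx card_0_eq[of "{g\<in>Bx. ok g}"] by (metis empty_iff finite_Collect_conjI Collect_mem_eq)
  ultimately show False by blast
qed

section \<open>The inverse matrix and the dual group\<close>

lemma e1_Ln: "x \<noteq> 0 \<Longrightarrow> e1 (Ln x / (2 * of_real pi * \<i>)) = x"
  by (simp add: e1_def)

lemma pairing_eq: "pairing A m n = (\<Sum>i\<in>UNIV. m $ i * (\<Sum>j\<in>UNIV. of_nat (A $ i $ j) * n $ j))"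
  by (simp add: pairing_def sum_distrib_left mult.assoc)

lemma pairing_eq': "pairing A m n = (\<Sum>j\<in>UNIV. (\<Sum>i\<in>UNIV. m $ i * of_nat (A $ i $ j)) * n $ j)"
  unfolding pairing_def sum_distrib_right by (rule sum.swap)

lemma pairing_add: "pairing A (m + m') n = pairing A m n + pairing A m' n"
  by (simp add: pairing_eq sum.distrib algebra_simps)

lemma sum_Ints_mult:
  fixes f g :: "'k \<Rightarrow> rat"
  assumes "\<And>i. i \<in> S \<Longrightarrow> f i \<in> \<int>" "\<And>i. i \<in> S \<Longrightarrow> g i \<in> \<int>" shows "(\<Sum>i\<in>S. f i * g i) \<in> \<int>"
  by (rule Ints_sum) (rule Ints_mult[OF assms])

text \<open>B is the inverse of A over the rationals. A common denominator D of its entries also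
  serves as one for representatives of both groups.\<close>

locale dual_pair =
  fixes A :: "nat^'d^'d" and q q_dual :: "rat^'d" and G :: "(complex^'d) set" and B :: "rat^'d^'d" and D :: nat
  assumes AB: "(\<Sum>j\<in>UNIV. of_nat (A $ i $ j) * B $ j $ i') = (if i = i' then 1 else 0)"
    and BA: "(\<Sum>i\<in>UNIV. B $ j $ i * of_nat (A $ i $ j')) = (if j = j' then 1 else 0)"
    and D0: "D > 0" and DB: "of_nat D * B $ j $ i \<in> \<int>"
    and CN: "comb_nondegenerate UNIV UNIV (\<lambda>i j. A $ i $ j)"
    and degrees: "is_degrees A q" and dual_degrees: "is_degrees (transpose A) q_dual"
    and subgroup: "subgroup G (Aut A)"
begin

lemma A_B: "(\<Sum>j\<in>UNIV. of_nat (A $ i $ j) * (\<Sum>i'\<in>UNIV. B $ j $ i' * y i')) = y i" for y :: "'d \<Rightarrow> rat"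
proof -
  have "(\<Sum>j\<in>UNIV. of_nat (A $ i $ j) * (\<Sum>i'\<in>UNIV. B $ j $ i' * y i')) =
      (\<Sum>i'\<in>UNIV. (\<Sum>j\<in>UNIV. of_nat (A $ i $ j) * B $ j $ i') * y i')"
    unfolding sum_distrib_left sum_distrib_right mult.assoc by (rule sum.swap)
  also have "\<dots> = (\<Sum>i'\<in>UNIV. if i = i' then y i' else 0)" unfolding AB by (intro sum.cong) auto
  finally show ?thesis by simp
qed

lemma B_A: "(\<Sum>i\<in>UNIV. B $ j $ i * (\<Sum>j'\<in>UNIV. of_nat (A $ i $ j') * x j')) = x j" for x :: "'d \<Rightarrow> rat"
proof -
  have "(\<Sum>i\<in>UNIV. B $ j $ i * (\<Sum>j'\<in>UNIV. of_nat (A $ i $ j') * x j')) =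
      (\<Sum>j'\<in>UNIV. (\<Sum>i\<in>UNIV. B $ j $ i * of_nat (A $ i $ j')) * x j')"
    unfolding sum_distrib_left sum_distrib_right mult.assoc by (rule sum.swap)
  also have "\<dots> = (\<Sum>j'\<in>UNIV. if j = j' then x j' else 0)" unfolding BA by (intro sum.cong) auto
  finally show ?thesis by simp
qed

lemma mB_A: "(\<Sum>i\<in>UNIV. (\<Sum>j\<in>UNIV. k j * B $ j $ i) * of_nat (A $ i $ j')) = k j'" for k :: "'d \<Rightarrow> rat"
proof -
  have "(\<Sum>i\<in>UNIV. (\<Sum>j\<in>UNIV. k j * B $ j $ i) * of_nat (A $ i $ j')) =
      (\<Sum>j\<in>UNIV. k j * (\<Sum>i\<in>UNIV. B $ j $ i * of_nat (A $ i $ j')))"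
    unfolding sum_distrib_left sum_distrib_right mult.assoc by (rule sum.swap)
  also have "\<dots> = (\<Sum>j\<in>UNIV. if j = j' then k j else 0)" unfolding BA by (intro sum.cong) auto
  finally show ?thesis by simp
qed

lemma mA_B: "(\<Sum>j\<in>UNIV. (\<Sum>i\<in>UNIV. m i * of_nat (A $ i $ j)) * B $ j $ i') = m i'" for m :: "'d \<Rightarrow> rat"
proof -
  have "(\<Sum>j\<in>UNIV. (\<Sum>i\<in>UNIV. m i * of_nat (A $ i $ j)) * B $ j $ i') =
      (\<Sum>i\<in>UNIV. m i * (\<Sum>j\<in>UNIV. of_nat (A $ i $ j) * B $ j $ i'))"
    unfolding sum_distrib_left sum_distrib_right mult.assoc by (rule sum.swap)
  also have "\<dots> = (\<Sum>i\<in>UNIV. if i = i' then m i else 0)" unfolding AB by (intro sum.cong) auto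
  finally show ?thesis by simp
qed

lemma D_mult_left: "(\<And>i. y i \<in> \<int>) \<Longrightarrow> of_nat D * (\<Sum>i\<in>UNIV. B $ j $ i * y i) \<in> \<int>"
  unfolding sum_distrib_left mult.assoc[symmetric] by (rule sum_Ints_mult[OF DB])

lemma D_mult_right:
  assumes "\<And>j. y j \<in> \<int>" shows "of_nat D * (\<Sum>j\<in>UNIV. y j * B $ j $ i) \<in> \<int>"
proof -
  have eq: "of_nat D * (\<Sum>j\<in>UNIV. y j * B $ j $ i) = (\<Sum>j\<in>UNIV. y j * (of_nat D * B $ j $ i))"
    unfolding sum_distrib_left by (intro sum.cong refl) (simp only: mult.left_commute)
  show ?thesis unfolding eq by (rule sum_Ints_mult[OF assms DB])
qed

lemma Aut_int:
  assumes "expvec n \<in> carrier (Aut A)"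
  shows "(\<Sum>j\<in>UNIV. of_nat (A $ i $ j) * n $ j) \<in> \<int>"
proof -
  have "(\<Prod>j\<in>UNIV. (expvec n $ j) ^ (A $ i $ j)) = 1" using assms by (simp add: Aut_def)
  moreover have "(\<Prod>j\<in>UNIV. (expvec n $ j) ^ (A $ i $ j)) = e1 (of_rat (\<Sum>j\<in>UNIV. of_nat (A $ i $ j) * n $ j))"
    by (simp add: of_rat_sum of_rat_mult e1_sum e1_of_nat_mult expvec_nth)
  ultimately show ?thesis by (simp add: e1_of_rat_eq_1_iff)
qed

text \<open>The normalised logarithms of the entries are sent to integers by A, so they form the
  image of an integral vector under B.\<close>

lemma Aut_exp:
  assumes "\<gamma> \<in> carrier (Aut A)"
  shows "\<exists>p. \<gamma> = expvec p \<and> (\<forall>j. of_nat D * p $ j \<in> \<int>)"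
proof -
  have g: "\<And>j. \<gamma> $ j \<noteq> 0" "\<And>i. (\<Prod>j\<in>UNIV. (\<gamma> $ j) ^ (A $ i $ j)) = 1" using assms by (auto simp: Aut_def)
  define L where "L j = Ln (\<gamma> $ j) / (2 * of_real pi * \<i>)" for j
  have eL: "e1 (L j) = \<gamma> $ j" for j unfolding L_def by (rule e1_Ln[OF g(1)])
  have "(\<Sum>j\<in>UNIV. of_nat (A $ i $ j) * L j) \<in> \<int>" for i
    using g(2)[of i] unfolding e1_eq_1_iff[symmetric] by (simp add: e1_sum e1_of_nat_mult eL)
  then have "\<forall>i. \<exists>m::int. (\<Sum>j\<in>UNIV. of_nat (A $ i $ j) * L j) = of_int m" by (metis Ints_cases)
  then obtain m :: "'d \<Rightarrow> int" where m: "\<And>i. (\<Sum>j\<in>UNIV. of_nat (A $ i $ j) * L j) = of_int (m i)" by metis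
  define p :: "rat^'d" where "p = (\<chi> j. \<Sum>i\<in>UNIV. B $ j $ i * of_int (m i))"
  have "L j = of_rat (p $ j)" for j
  proof -
    have "of_rat (p $ j) = (\<Sum>i\<in>UNIV. of_rat (B $ j $ i) * (\<Sum>j'\<in>UNIV. of_nat (A $ i $ j') * L j'))"
      by (simp add: p_def m of_rat_sum of_rat_mult)
    also have "\<dots> = (\<Sum>j'\<in>UNIV. of_rat (\<Sum>i\<in>UNIV. B $ j $ i * of_nat (A $ i $ j')) * L j')"
      unfolding of_rat_sum of_rat_mult of_rat_of_nat_eq sum_distrib_left sum_distrib_right mult.assoc by (rule sum.swap)
    also have "\<dots> = (\<Sum>j'\<in>UNIV. if j = j' then L j' else 0)" unfolding BA by (intro sum.cong) auto
    finally show ?thesis by simp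
  qed
  then have "\<gamma> = expvec p" using eL by (simp add: vec_eq_iff expvec_nth)
  moreover have "of_nat D * p $ j \<in> \<int>" for j unfolding p_def by (simp add: D_mult_left)
  ultimately show ?thesis by blast
qed

lemma G_Aut: "\<gamma> \<in> G \<Longrightarrow> \<gamma> \<in> carrier (Aut A)"
  using subgroup.subset[OF subgroup] by blast

lemma one_G: "1 \<in> G"
  using subgroup.one_closed[OF subgroup] by (simp add: Aut_def)

sublocale exp_group G
proof
  show "finite G" by (rule finite_expvec[OF D0 Aut_exp[OF G_Aut]])
  show "G \<noteq> {}" using one_G by blast
  show "\<exists>p. \<gamma> = expvec p" if "\<gamma> \<in> G" for \<gamma> using Aut_exp[OF G_Aut[OF that]] by blast
  show "\<gamma> * \<gamma>' \<in> G" if "\<gamma> \<in> G" "\<gamma>' \<in> G" for \<gamma> \<gamma>'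
    using subgroup.m_closed[OF subgroup that] by (simp add: Aut_def)
qed

abbreviation "M \<equiv> dual_lattice A (cover_lattice G)"
abbreviation "Gd \<equiv> dual_group A G"

lemma cover_int: "n \<in> cover_lattice G \<Longrightarrow> (\<Sum>j\<in>UNIV. of_nat (A $ i $ j) * n $ j) \<in> \<int>"
  unfolding cover_lattice_def using Aut_int G_Aut by blast

lemma integral_cover:
  fixes n :: "rat^'d"
  assumes "\<And>j. n $ j \<in> \<int>" shows "n \<in> cover_lattice G"
proof -
  have "expvec n = expvec 0" using assms by (simp add: expvec_eq_iff)
  also have "expvec 0 = 1" by (simp add: vec_eq_iff expvec_nth)
  finally show ?thesis using one_G by (simp add: cover_lattice_def)
qed

lemma M_int:
  assumes "m \<in> M" shows "(\<Sum>i\<in>UNIV. m $ i * of_nat (A $ i $ j)) \<in> \<int>"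
proof -
  define n :: "rat^'d" where "n = (\<chi> l. if l = j then 1 else 0)"
  have "n \<in> cover_lattice G" by (rule integral_cover) (simp add: n_def)
  then have "pairing A m n \<in> \<int>" using assms by (simp add: dual_lattice_def)
  moreover have "pairing A m n = (\<Sum>l\<in>UNIV. if l = j then (\<Sum>i\<in>UNIV. m $ i * of_nat (A $ i $ l)) else 0)"
    unfolding pairing_eq' n_def by (intro sum.cong) auto
  ultimately show ?thesis by simp
qed

lemma integral_pairing:
  fixes m :: "rat^'d"
  assumes "\<And>i. m $ i \<in> \<int>" "n \<in> cover_lattice G" shows "pairing A m n \<in> \<int>"
  unfolding pairing_eq by (rule sum_Ints_mult[OF assms(1) cover_int[OF assms(2)]])

text \<open>Membership does not depend on the representative, as integral vectors pair integrally
  with the lattice of G.\<close>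

lemma dual_group_iff: "expvec m \<in> Gd \<longleftrightarrow> m \<in> M"
proof
  assume "expvec m \<in> Gd"
  then obtain m' where m': "m' \<in> M" "expvec m = expvec m'" by (auto simp: dual_group_def)
  have d: "(m - m') $ i \<in> \<int>" for i using m'(2) by (simp add: expvec_eq_iff)
  have "pairing A m n \<in> \<int>" if "n \<in> cover_lattice G" for n
  proof -
    have "pairing A (m' + (m - m')) n = pairing A m' n + pairing A (m - m') n" by (rule pairing_add)
    moreover have "pairing A m' n \<in> \<int>" using m'(1) that by (simp add: dual_lattice_def)
    ultimately show ?thesis using integral_pairing[OF d that] by simp
  qed
  then show "m \<in> M" by (simp add: dual_lattice_def)
qed (auto simp: dual_group_def)

lemma D_M:
  fixes m :: "rat^'d"
  assumes "m \<in> M" shows "of_nat D * m $ i \<in> \<int>"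
proof -
  have "of_nat D * (\<Sum>j\<in>UNIV. (\<Sum>i\<in>UNIV. m $ i * of_nat (A $ i $ j)) * B $ j $ i) \<in> \<int>"
    by (rule D_mult_right[OF M_int[OF assms]])
  then show ?thesis by (simp only: mA_B)
qed

sublocale dual: exp_group Gd
proof
  show "finite Gd"
  proof (rule finite_expvec[OF D0])
    fix \<gamma> assume "\<gamma> \<in> Gd"
    then show "\<exists>p. \<gamma> = expvec p \<and> (\<forall>j. of_nat D * p $ j \<in> \<int>)" unfolding dual_group_def using D_M by blast
  qed
  have "0 \<in> M" by (simp add: dual_lattice_def pairing_eq)
  then show "Gd \<noteq> {}" by (auto simp: dual_group_def)
  show "\<exists>p. \<gamma> = expvec p" if "\<gamma> \<in> Gd" for \<gamma> using that by (auto simp: dual_group_def)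
  show "\<gamma> * \<gamma>' \<in> Gd" if h: "\<gamma> \<in> Gd" "\<gamma>' \<in> Gd" for \<gamma> \<gamma>'
  proof -
    obtain m m' where m: "m \<in> M" "m' \<in> M" "\<gamma> = expvec m" "\<gamma>' = expvec m'" using h by (auto simp: dual_group_def)
    have "m + m' \<in> M" using m(1,2) by (simp add: dual_lattice_def pairing_add)
    then show ?thesis unfolding m expvec_add[symmetric] by (simp add: dual_group_iff)
  qed
qed

lemma reps_G: "p \<in> reps G \<Longrightarrow> (\<chi> j. p j) \<in> cover_lattice G"
  using expvec_reps by (simp add: cover_lattice_def)

lemma reps_Gd: "r \<in> reps Gd \<Longrightarrow> (\<chi> j. r j) \<in> M"
  using dual.expvec_reps by (simp add: dual_group_iff)

lemma D_G:
  assumes "p \<in> reps G" shows "of_nat D * p j \<in> \<int>"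
proof -
  have "of_nat D * (\<Sum>i\<in>UNIV. B $ j $ i * (\<Sum>j'\<in>UNIV. of_nat (A $ i $ j') * (\<chi> j. p j) $ j')) \<in> \<int>"
    by (rule D_mult_left[OF cover_int[OF reps_G[OF assms]]])
  then show ?thesis by (simp only: B_A) simp
qed

lemma D_Gd: "r \<in> reps Gd \<Longrightarrow> of_nat D * r i \<in> \<int>"
  using D_M[OF reps_Gd, of r i] by simp

text \<open>For \<open>dual\<close> the inverse matrix suffices: m = k B lies in the dual lattice
  because k annihilates the representatives of G. The assumption \<open>ddual\<close> amounts to
  recovering G from its dual group and rests on \<open>double_annihilator\<close>.\<close>

lemma mirror: "mirror UNIV UNIV (\<lambda>i j. A $ i $ j) (\<lambda>j. q $ j) (\<lambda>i. q_dual $ i) (reps G) (reps Gd)"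
proof
  show "comb_nondegenerate UNIV UNIV (\<lambda>i j. A $ i $ j)" by (rule CN)
  show "0 < q $ j" "0 < q_dual $ i" for i j using degrees dual_degrees by (auto simp: is_degrees_def)
  show "(\<Sum>j\<in>UNIV. of_nat (A $ i $ j) * q $ j) = 1" for i using degrees by (simp add: is_degrees_def)
  show "(\<Sum>i\<in>UNIV. q_dual $ i * of_nat (A $ i $ j)) = 1" for j
    using dual_degrees by (simp add: is_degrees_def transpose_def mult.commute)
  show "x j = 0" if "\<And>i. i \<in> UNIV \<Longrightarrow> (\<Sum>j\<in>UNIV. of_nat (A $ i $ j) * x j) = 0" for x :: "'d \<Rightarrow> rat" and j
    using B_A[of j x] that by simp
  show "y i = 0" if "\<And>j. j \<in> UNIV \<Longrightarrow> (\<Sum>i\<in>UNIV. y i * of_nat (A $ i $ j)) = 0" for y :: "'d \<Rightarrow> rat" and i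
    using mA_B[of y i] that by simp
  show "reps_group (reps G) UNIV" by (rule reps_group_reps)
  show "reps_group (reps Gd) UNIV" by (rule dual.reps_group_reps)
  show "(\<Sum>j\<in>UNIV. of_nat (A $ i $ j) * p j) \<in> \<int>" if "p \<in> reps G" for p i
    using cover_int[OF reps_G[OF that], of i] by simp
  show "(\<Sum>i\<in>UNIV. r i * of_nat (A $ i $ j)) \<in> \<int>" if "r \<in> reps Gd" for r j
    using M_int[OF reps_Gd[OF that], of j] by simp
  show "(\<Sum>i\<in>UNIV. r i * (\<Sum>j\<in>UNIV. of_nat (A $ i $ j) * p j)) \<in> \<int>" if "r \<in> reps Gd" "p \<in> reps G" for r p
    using reps_Gd[OF that(1)] reps_G[OF that(2)] unfolding dual_lattice_def pairing_eq by fastforce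
  show "\<exists>m\<in>lat (reps Gd) UNIV. \<forall>j\<in>UNIV. (\<Sum>i\<in>UNIV. m i * of_nat (A $ i $ j)) = k j"
    if k: "k \<in> annihilator (reps G) UNIV" for k
  proof -
    define m where "m i = (\<Sum>j\<in>UNIV. k j * B $ j $ i)" for i
    have mA: "(\<Sum>i\<in>UNIV. m i * of_nat (A $ i $ j)) = k j" for j unfolding m_def by (rule mB_A)
    have "pairing A (\<chi> i. m i) n \<in> \<int>" if n: "n \<in> cover_lattice G" for n
    proof -
      obtain p where p: "p \<in> reps G" "\<forall>j. n $ j - p j \<in> \<int>" using reps_exists n unfolding cover_lattice_def by blast
      have "(\<Sum>j\<in>UNIV. k j * n $ j) \<in> \<int>"
        by (rule sum_shift_Ints[where p = p]) (use p k in \<open>auto simp: annihilator_def\<close>)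
      then show ?thesis unfolding pairing_eq' by (simp add: mA)
    qed
    then have "expvec (\<chi> i. m i) \<in> Gd" by (simp add: dual_group_iff dual_lattice_def)
    from dual.reps_exists[OF this] have "m \<in> lat (reps Gd) UNIV" by (simp add: lat_def)
    then show ?thesis using mA by blast
  qed
  show "\<exists>n\<in>lat (reps G) UNIV. \<forall>i\<in>UNIV. (\<Sum>j\<in>UNIV. of_nat (A $ i $ j) * n j) = l i"
    if l: "l \<in> annihilator (reps Gd) UNIV" for l
  proof -
    define n where "n j = (\<Sum>i\<in>UNIV. B $ j $ i * l i)" for j
    have An: "(\<Sum>j\<in>UNIV. of_nat (A $ i $ j) * n j) = l i" for i unfolding n_def by (rule A_B)
    have l_int: "l i \<in> \<int>" for i using l by (simp add: annihilator_def)
    have "\<exists>p\<in>reps G. \<forall>j\<in>UNIV. n j - p j \<in> \<int>"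
    proof (rule double_annihilator[OF reps_group_reps finite D0])
      show "of_nat D * p j \<in> \<int>" if "p \<in> reps G" for p j by (rule D_G[OF that])
      show "of_nat D * n j \<in> \<int>" for j unfolding n_def by (rule D_mult_left[OF l_int])
      fix k assume k: "k \<in> annihilator (reps G) UNIV"
      \<comment> \<open>The vector m = k B lies in the dual lattice, so the pairing of k and n = B l
        becomes the pairing of l and m, which is integral by assumption on l.\<close>
      define m where "m i = (\<Sum>j\<in>UNIV. k j * B $ j $ i)" for i
      have mA: "(\<Sum>i\<in>UNIV. m i * of_nat (A $ i $ j)) = k j" for j unfolding m_def by (rule mB_A)
      have "pairing A (\<chi> i. m i) n' \<in> \<int>" if n': "n' \<in> cover_lattice G" for n'
      proof -
        obtain p where p: "p \<in> reps G" "\<forall>j. n' $ j - p j \<in> \<int>" using reps_exists n' unfolding cover_lattice_def by blast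
        have "(\<Sum>j\<in>UNIV. k j * n' $ j) \<in> \<int>"
          by (rule sum_shift_Ints[where p = p]) (use p k in \<open>auto simp: annihilator_def\<close>)
        then show ?thesis unfolding pairing_eq' by (simp add: mA)
      qed
      then have "expvec (\<chi> i. m i) \<in> Gd" by (simp add: dual_group_iff dual_lattice_def)
      from dual.reps_exists[OF this] obtain r where r: "r \<in> reps Gd" "\<And>i. m i - r i \<in> \<int>" by auto
      have "(\<Sum>i\<in>UNIV. l i * m i) \<in> \<int>"
        by (rule sum_shift_Ints[where p = r]) (use r l in \<open>auto simp: annihilator_def\<close>)
      moreover have "(\<Sum>j\<in>UNIV. k j * n j) = (\<Sum>i\<in>UNIV. l i * m i)"
      proof -
        have "(\<Sum>j\<in>UNIV. k j * n j) = pairing A (\<chi> i. m i) (\<chi> j. n j)" unfolding pairing_eq' by (simp add: mA)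
        also have "\<dots> = (\<Sum>i\<in>UNIV. l i * m i)" unfolding pairing_eq by (simp add: An) (simp add: mult.commute)
        finally show ?thesis .
      qed
      ultimately show "(\<Sum>j\<in>UNIV. k j * n j) \<in> \<int>" by simp
    qed
    then have "n \<in> lat (reps G) UNIV" by (simp add: lat_def)
    then show ?thesis using An by blast
  qed
qed simp_all

end

lemma (in exp_group) Ell_raw_orbifold_sum: "Ell_raw q H z \<tau> = orbifold_sum UNIV (reps H) (\<lambda>j. q $ j) z \<tau>"
proof -
  have "exp (- 2 * of_real pi * \<i> * z * of_rat t) * (Theta ((1 - of_rat x) * z - of_rat t * \<tau> - of_rat s) \<tau> /
      Theta (of_rat x * z + of_rat t * \<tau> + of_rat s) \<tau>) = phi \<tau> z x t s" for x t s
    by (simp add: phi_def e1_def algebra_simps)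
  then show ?thesis
    by (simp add: Ell_raw_def orbifold_sum_def reps_def sum.reindex[OF inj_rep] card_image[OF inj_rep])
qed

lemma (in dual_pair) Ell_raw_strip:
  assumes "Im \<tau> > 0" "Im z < 0" "- Im z * of_nat D < Im \<tau>"
  shows "Ell_raw q G z \<tau> = (-1) ^ CARD('d) * Ell_raw q_dual Gd z \<tau>"
  unfolding Ell_raw_orbifold_sum dual.Ell_raw_orbifold_sum
  by (rule mirror_duality[OF mirror assms D0]) (auto intro: D_G D_Gd)

section \<open>Analytic continuation\<close>

lemma holomorphic_imp_meromorphic_UNIV: "f holomorphic_on UNIV \<Longrightarrow> f meromorphic_on UNIV"
  by (intro analytic_on_imp_meromorphic_on) (simp add: analytic_on_open)

lemma Ell_raw_meromorphic:
  assumes "Im \<tau> > 0"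
  shows "(\<lambda>z. Ell_raw q H z \<tau>) meromorphic_on UNIV"
  unfolding Ell_raw_def
  by (intro meromorphic_on_mult meromorphic_on_sum meromorphic_on_prod meromorphic_on_divide meromorphic_on_const;
      rule holomorphic_imp_meromorphic_UNIV; intro holomorphic_intros Theta_holomorphic[OF assms])

text \<open>\<open>remove_sings\<close> takes a default value where no limit exists, so the
  existence of the two limits has to be compared as well.\<close>

lemma remove_sings_cmult:
  fixes c :: complex
  assumes "c \<noteq> 0"
  shows "remove_sings (\<lambda>w. c * f w) z = c * remove_sings f z"
proof (cases "\<exists>l. f \<midarrow>z\<rightarrow> l")
  case True
  then obtain l where l: "f \<midarrow>z\<rightarrow> l" by blast
  then have "(\<lambda>w. c * f w) \<midarrow>z\<rightarrow> c * l" by (intro tendsto_intros)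
  then show ?thesis using remove_sings_eqI l by metis
next
  case False
  have "\<not> (\<exists>l. (\<lambda>w. c * f w) \<midarrow>z\<rightarrow> l)"
  proof
    assume "\<exists>l. (\<lambda>w. c * f w) \<midarrow>z\<rightarrow> l"
    then obtain l where "(\<lambda>w. c * f w) \<midarrow>z\<rightarrow> l" by blast
    then have "(\<lambda>w. inverse c * (c * f w)) \<midarrow>z\<rightarrow> inverse c * l" by (intro tendsto_intros)
    then show False using False assms by (auto simp: mult.assoc[symmetric])
  qed
  then show ?thesis using False by (simp add: remove_sings_def)
qed

text \<open>The difference is meromorphic on the connected plane and vanishes on an open set, so it
  cannot be nonzero outside a sparse set.\<close>

lemma meromorphic_eq_remove_sings:
  assumes "f meromorphic_on UNIV" "g meromorphic_on UNIV" and U: "open U" "z0 \<in> U" "\<And>w. w \<in> U \<Longrightarrow> f w = g w"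
  shows "remove_sings f z = remove_sings g z"
proof (rule remove_sings_cong)
  define h where "h w = f w - g w" for w
  have "h meromorphic_on UNIV" unfolding h_def[abs_def] using assms(1,2) by (rule meromorphic_on_diff)
  then consider "eventually (\<lambda>w. h w = 0) (cosparse UNIV)" | "eventually (\<lambda>w. h w \<noteq> 0) (cosparse UNIV)"
    using meromorphic_imp_constant_or_avoid[OF _ open_UNIV connected_UNIV] by blast
  then show "\<forall>\<^sub>F w in at z. f w = g w"
  proof cases
    case 1
    then have "\<forall>\<^sub>F w in at z. h w = 0" by (rule eventually_cosparse_imp_eventually_at) simp
    then show ?thesis by (simp add: h_def)
  next
    case 2
    then have "\<forall>\<^sub>F w in at z0. h w \<noteq> 0" by (rule eventually_cosparse_imp_eventually_at) simp
    moreover have "\<forall>\<^sub>F w in at z0. w \<in> U" using U(1,2) by (rule eventually_at_in_open')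
    ultimately have "\<forall>\<^sub>F w in at z0. False"
    proof eventually_elim
      case (elim w)
      then show ?case using U(3)[of w] by (simp add: h_def)
    qed
    then show ?thesis by simp
  qed
qed simp

theorem theorem4p5:
  fixes A :: "nat^'d^'d"
    and q q_dual :: "rat^'d"
    and G :: "(complex^'d) set"
    and c_hat :: int
    and z \<tau> :: complex
  assumes "invertible (map_matrix rat_of_nat A)"
    and "is_degrees A q"
    and "nondegenerate A"
    and "(\<Sum>j\<in>UNIV. q $ j) \<in> \<int>"
    and "0 < (\<Sum>j\<in>UNIV. q $ j)"
    and "subgroup G (Aut A)"
    and "generate (Aut A) {expvec q} \<subseteq> G"
    and "G \<subseteq> SL A"
    and "is_degrees (transpose A) q_dual"
    and "of_int c_hat = of_nat CARD('d) - 2 * (\<Sum>j\<in>UNIV. q $ j)"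
    and "Im \<tau> > 0"
  shows "Ell q G z \<tau> = (-1) powi c_hat * Ell q_dual (dual_group A G) z \<tau>"
proof -
  obtain B where B: "map_matrix rat_of_nat A ** B = mat 1" "B ** map_matrix rat_of_nat A = mat 1"
    using assms(1) by (auto simp: invertible_def)
  obtain D where D: "D > 0" "\<forall>x\<in>(\<lambda>(j, i). B $ j $ i) ` UNIV. of_nat D * x \<in> \<int>"
    using common_denominator[of "(\<lambda>(j, i). B $ j $ i) ` UNIV"] by auto
  interpret dual_pair A q q_dual G B D
  proof (rule dual_pair.intro)
    show "(\<Sum>j\<in>UNIV. of_nat (A $ i $ j) * B $ j $ i') = (if i = i' then 1 else 0)" for i i'
      using arg_cong[OF B(1), of "\<lambda>M. M $ i $ i'"] by (simp add: matrix_matrix_mult_def mat_def)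
    show "(\<Sum>i\<in>UNIV. B $ j $ i * of_nat (A $ i $ j')) = (if j = j' then 1 else 0)" for j j'
      using arg_cong[OF B(2), of "\<lambda>M. M $ j $ j'"] by (simp add: matrix_matrix_mult_def mat_def)
    show "of_nat D * B $ j $ i \<in> \<int>" for j i using D(2) by force
    show "comb_nondegenerate UNIV UNIV (\<lambda>i j. A $ i $ j)" by (rule nondegenerate_comb[OF assms(1,3)])
  qed (fact D(1) assms)+
  define U where "U = {w. Im w < 0} \<inter> {w. - Im w * of_nat D < Im \<tau>}"
  have "open U" unfolding U_def by (intro open_Int open_Collect_less continuous_intros)
  \<comment> \<open>A point halfway across the strip.\<close>
  moreover have "- \<i> * of_real (Im \<tau> / (2 * of_nat D)) \<in> U"
    using assms(11) D(1) by (simp add: U_def field_simps)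
  ultimately have "remove_sings (\<lambda>w. Ell_raw q G w \<tau>) z = remove_sings (\<lambda>w. (-1) ^ CARD('d) * Ell_raw q_dual Gd w \<tau>) z"
    using assms(11)
    by (intro meromorphic_eq_remove_sings[of _ _ U "- \<i> * of_real (Im \<tau> / (2 * of_nat D))"]
        meromorphic_on_mult meromorphic_on_const Ell_raw_meromorphic) (auto simp: U_def intro: Ell_raw_strip)
  then have "Ell q G z \<tau> = (-1) ^ CARD('d) * Ell q_dual Gd z \<tau>"
    unfolding Ell_def by (simp add: remove_sings_cmult)
  \<comment> \<open>The sum of the degrees is an integer, so \<open>c_hat\<close> and the number of
    variables have the same parity.\<close>
  moreover have "(-1) powi c_hat = ((-1) ^ CARD('d) :: complex)"
  proof -
    obtain s where s: "(\<Sum>j\<in>UNIV. q $ j) = of_int s" using assms(4) by (elim Ints_cases)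
    have "rat_of_int c_hat = of_int (int CARD('d) - 2 * s)" using assms(10) by (simp add: s)
    then have c: "c_hat = int CARD('d) - 2 * s" by (simp only: of_int_eq_iff)
    have "(-1) powi c_hat = ((-1) powi int CARD('d) / (-1) powi (2 * s) :: complex)"
      unfolding c by (rule power_int_diff) simp
    also have "(-1) powi (2 * s) = (1 :: complex)" by (simp add: power_int_mult)
    finally show ?thesis by simp
  qed
  ultimately show ?thesis by simp
qed

end
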